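(* Let $N\ge1$, $p$ a prime with $p\nmid N$, $k\ge 2$ even, and $f\in S_k(\Gamma_0(Np))$ a normalized eigenform new at $p$. For $n\ge 1$ define $$L_n=\sum_{\substack{a=1\\ p\nmid a}}^{p^n-1}\mu_f\bigl(\mathrm{TS}_a(x^{\frac{k}{2}-1}\log_p\langle x\rangle),a,p^n\bigr).$$ Then $L_n$ is a linear combination of period integrals of $f$, and for every $n\ge1$, $$v_p\bigl(L_p'(f,k/2)-L_n\bigr)\ \ge\ \frac{nk}{2}-\left\lfloor\frac{\log(k-1)}{\log p}\right\rfloor.$$
   Context: Fix $\mathbb{C}\simeq\overline{\mathbb{Q}}_p$ and $v_p$ with $v_p(p)=1$. For $r\in\mathbb{Q}$, $P\in\mathbb{Z}[z]$ of degree $\le k-2$, let $\phi_f(P,r)=2\pi i\int_\infty^r f(z)P(z)\,dz$; set $\eta_f^{\pm}(P,a,m)=\bigl(\phi_f(P(z),a/m)\pm\phi_f(P(-z),-a/m)\bigr)/\Omega_f^{\pm}$ with normalized periods $\Omega_f^\pm$ (all such values algebraic with $v_p\ge0$, and some value has $v_p=0$), $\eta_f=\eta_f^++\eta_f^-$, $\lambda_f(P,a,m)=\eta_f(P(mz+a),-a,m)$, and $\mu_f(P,a,p^n)=a_p(f)^{-n}\lambda_f(P,a,p^n)$ (extended $\mathbb{Q}_p$-linearly in $P$). The $p$-adic $L$-function $\mu_f$ is the unique locally analytic distribution on $\mathbb{Z}_p^\times$ with $\int_{a+p^n\mathbb{Z}_p}P\,d\mu_f=\mu_f(P,a,p^n)$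 for $\deg P\le k-2$. Write $x=\langle x\rangle\omega(x)$ for $x\in\mathbb{Z}_p^\times$ with $\langle x\rangle\in1+p\mathbb{Z}_p$ and $\omega(x)$ a $(p-1)$-st root of unity (for $p=2$ analogously with the Teichmüller decomposition); $\log_p$ is the $p$-adic logarithm. Define $L_p'(f,k/2)=\frac{d}{ds}\big|_{s=k/2}\int_{\mathbb{Z}_p^\times}\omega(x)^{\frac{k}{2}-1}\langle x\rangle^{s-1}\,d\mu_f(x)$. For $a\in\mathbb{Z}_p^\times$ and a function $g$ analytic near $a$, $\mathrm{TS}_a(g)$ denotes the Taylor expansion of $g$ around $x=a$ truncated to terms of degree at most $k-2$.
   Formalization: The moments of degree at most k-2 do not by themselves determine a locally analytic distribution uniquely; μ_f is taken to satisfy also the standard growth condition v_p(a_p^n ∫_{a+p^n Z_p}(x-a)^j dμ_f) ≥ nj + C for some constant C. *)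

theory Defs
  imports "HOL-Complex_Analysis.Complex_Analysis" "HOL-Computational_Algebra.Computational_Algebra"
begin

section \<open>Cusp forms for \<open>\<Gamma>\<^sub>0(M)\<close>\<close>

text \<open>Modular forms are functions on the complex plane of which only the values on the upper
  half-plane matter.\<close>

definition upper_half_plane :: "complex set" where
  "upper_half_plane = {z. Im z > 0}"

definition SL2Z :: "(int^2^2) set" where
  "SL2Z = {A. det A = 1}"

definition Gamma0 :: "nat \<Rightarrow> (int^2^2) set" where
  "Gamma0 M = {A \<in> SL2Z. int M dvd A$2$1}"

definition slash :: "nat \<Rightarrow> (complex \<Rightarrow> complex) \<Rightarrow> int^2^2 \<Rightarrow> complex \<Rightarrow> complex" where
  "slash k f A z =
     f ((of_int (A$1$1) * z + of_int (A$1$2)) / (of_int (A$2$1) * z + of_int (A$2$2)))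
       / (of_int (A$2$1) * z + of_int (A$2$2)) ^ k"

text \<open>Vanishing at every cusp: all translates under the full modular group tend to \<open>0\<close> as the
  imaginary part tends to infinity, uniformly in the real part.\<close>

definition cusp_forms :: "nat \<Rightarrow> nat \<Rightarrow> (complex \<Rightarrow> complex) set" where
  "cusp_forms k M = {f. f holomorphic_on upper_half_plane \<and>
     (\<forall>A\<in>Gamma0 M. \<forall>z\<in>upper_half_plane. slash k f A z = f z) \<and>
     (\<forall>A\<in>SL2Z. (slash k f A \<longlongrightarrow> 0) (filtercomap Im at_top))}"

definition qcoeff :: "(complex \<Rightarrow> complex) \<Rightarrow> nat \<Rightarrow> complex" where
  "qcoeff f = (THE a. \<forall>z\<in>upper_half_plane.
     (\<lambda>n. a n * exp (2 * of_real pi * \<i> * of_nat n * z)) sums f z)"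

text \<open>The Hecke operator at the prime \<open>l\<close>, acting on weight \<open>k\<close> and level \<open>M\<close> with trivial
  character; it is \<open>T\<^sub>l\<close> if \<open>l\<close> does not divide \<open>M\<close> and \<open>U\<^sub>l\<close> otherwise.\<close>

definition hecke :: "nat \<Rightarrow> nat \<Rightarrow> nat \<Rightarrow> (complex \<Rightarrow> complex) \<Rightarrow> complex \<Rightarrow> complex" where
  "hecke k M l f z =
     (if l dvd M then 0 else of_nat l ^ (k - 1) * f (of_nat l * z))
     + (\<Sum>j<l. f ((z + of_nat j) / of_nat l)) / of_nat l"

definition normalized_eigenform :: "nat \<Rightarrow> nat \<Rightarrow> (complex \<Rightarrow> complex) \<Rightarrow> bool" where
  "normalized_eigenform k M f \<longleftrightarrow> f \<in> cusp_forms k M \<and> qcoeff f 1 = 1 \<and>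
     (\<forall>l. prime l \<longrightarrow> (\<exists>c. \<forall>z\<in>upper_half_plane. hecke k M l f z = c * f z))"

text \<open>The (unnormalized) Petersson product: the integral over \<open>\<Gamma>\<^sub>0(M)\<backslash>\<H>\<close> is written as a sum, over
  the cosets \<open>\<Gamma>\<^sub>0(M)A\<close> in the modular group, of integrals over its standard fundamental domain. The
  integrand does not depend on the representative chosen in each coset.\<close>

definition std_fundamental_domain :: "complex set" where
  "std_fundamental_domain = {z. Im z > 0 \<and> \<bar>Re z\<bar> \<le> 1/2 \<and> norm z \<ge> 1}"

definition Gamma0_cosets :: "nat \<Rightarrow> (int^2^2) set set" where
  "Gamma0_cosets M = (\<lambda>A. (\<lambda>B. B ** A) ` Gamma0 M) ` SL2Z"

definition petersson ::
  "nat \<Rightarrow> nat \<Rightarrow> (complex \<Rightarrow> complex) \<Rightarrow> (complex \<Rightarrow> complex) \<Rightarrow> complex" where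
  "petersson k M f g = (\<Sum>C\<in>Gamma0_cosets M.
     let A = (SOME A. A \<in> C) in
     set_lebesgue_integral lborel std_fundamental_domain
       (\<lambda>z. slash k f A z * cnj (slash k g A z) * of_real (Im z ^ k / (Im z)\<^sup>2)))"

text \<open>New at \<open>p\<close>: orthogonal to the two degeneracy images \<open>g(z)\<close>, \<open>g(pz)\<close> of the forms of
  level \<open>N\<close>. Nothing is required at the primes dividing \<open>N\<close>.\<close>

definition new_at :: "nat \<Rightarrow> nat \<Rightarrow> nat \<Rightarrow> (complex \<Rightarrow> complex) \<Rightarrow> bool" where
  "new_at p k N f \<longleftrightarrow> (\<forall>g\<in>cusp_forms k N.
     petersson k (N * p) f g = 0 \<and> petersson k (N * p) f (\<lambda>z. g (of_nat p * z)) = 0)"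


section \<open>The complex numbers as an algebraic closure of \<open>\<rat>\<^sub>p\<close>\<close>

text \<open>An isomorphism \<open>\<complex> \<simeq> \<rat>\<^sub>p\<close>-bar is used only to transport \<open>v\<^sub>p\<close> (with \<open>v\<^sub>p(0) = \<infinity>\<close>) and \<open>\<rat>\<^sub>p\<close>
  to \<open>\<complex>\<close>, so it is represented by the transported valuation: \<open>\<rat>\<^sub>p\<close> is the closure of \<open>\<rat>\<close>, which has
  to be complete, i.e. a completion of \<open>\<rat>\<close> at \<open>p\<close>, and the algebraically closed field \<open>\<complex>\<close> has to be
  algebraic over it. All \<open>p\<close>-adic objects below live inside \<open>\<complex>\<close>, and their topology is the one
  given by \<open>v\<close>, never the usual one.\<close>

definition Qp :: "(complex \<Rightarrow> ereal) \<Rightarrow> complex set" where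
  "Qp v = {x. \<forall>B::real. \<exists>q\<in>\<rat>. v (x - q) \<ge> ereal B}"

definition Zp :: "(complex \<Rightarrow> ereal) \<Rightarrow> complex set" where
  "Zp v = {x \<in> Qp v. v x \<ge> 0}"

definition Zp_units :: "(complex \<Rightarrow> ereal) \<Rightarrow> complex set" where
  "Zp_units v = {x \<in> Qp v. v x = 0}"

definition vlimit :: "(complex \<Rightarrow> ereal) \<Rightarrow> (nat \<Rightarrow> complex) \<Rightarrow> complex \<Rightarrow> bool" where
  "vlimit v X L \<longleftrightarrow> (\<lambda>n. v (X n - L)) \<longlonglongrightarrow> \<infinity>"

definition vCauchy :: "(complex \<Rightarrow> ereal) \<Rightarrow> (nat \<Rightarrow> complex) \<Rightarrow> bool" where
  "vCauchy v X \<longleftrightarrow> (\<forall>B::real. \<exists>M. \<forall>m\<ge>M. \<forall>n\<ge>M. v (X m - X n) \<ge> ereal B)"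

definition vsums :: "(complex \<Rightarrow> ereal) \<Rightarrow> (nat \<Rightarrow> complex) \<Rightarrow> complex \<Rightarrow> bool" where
  "vsums v c S \<longleftrightarrow> vlimit v (\<lambda>n. \<Sum>i<n. c i) S"

definition is_padic_closure :: "nat \<Rightarrow> (complex \<Rightarrow> ereal) \<Rightarrow> bool" where
  "is_padic_closure p v \<longleftrightarrow>
     (\<forall>x. v x \<noteq> -\<infinity>) \<and> (\<forall>x. v x = \<infinity> \<longleftrightarrow> x = 0) \<and>
     (\<forall>x y. v (x * y) = v x + v y) \<and> (\<forall>x y. v (x + y) \<ge> min (v x) (v y)) \<and>
     v (of_nat p) = 1 \<and>
     (\<forall>X. (\<forall>n. X n \<in> Qp v) \<and> vCauchy v X \<longrightarrow> (\<exists>L\<in>Qp v. vlimit v X L)) \<and>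
     (\<forall>x. \<exists>P. P \<noteq> 0 \<and> (\<forall>i. coeff P i \<in> Qp v) \<and> poly P x = 0)"


section \<open>Periods\<close>

text \<open>The path from \<open>\<i>\<infinity>\<close> to \<open>r\<close> is the vertical half-line \<open>r + \<i>t\<close> with \<open>t\<close> decreasing from \<open>\<infinity>\<close>
  to \<open>0\<close>, whence the minus sign.\<close>

definition period_integral :: "(complex \<Rightarrow> complex) \<Rightarrow> int poly \<Rightarrow> rat \<Rightarrow> complex" where
  "period_integral f P r = 2 * of_real pi * \<i> *
     (- set_lebesgue_integral lborel {0<..}
          (\<lambda>t::real. f (of_rat r + \<i> * of_real t)
                     * poly (map_poly of_int P) (of_rat r + \<i> * of_real t) * \<i>))"

text \<open>The sign \<open>e\<close> is \<open>1\<close> for \<open>\<eta>\<^sup>+\<close> and \<open>-1\<close> for \<open>\<eta>\<^sup>-\<close>.\<close>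

definition eta_sign ::
  "(complex \<Rightarrow> complex) \<Rightarrow> complex \<Rightarrow> complex \<Rightarrow> int poly \<Rightarrow> int \<Rightarrow> nat \<Rightarrow> complex" where
  "eta_sign f e \<Omega> P a m =
     (period_integral f P (of_int a / of_nat m)
      + e * period_integral f (pcompose P [:0, -1:]) (- (of_int a / of_nat m))) / \<Omega>"

definition normalized_period ::
  "(complex \<Rightarrow> ereal) \<Rightarrow> nat \<Rightarrow> (complex \<Rightarrow> complex) \<Rightarrow> complex \<Rightarrow> complex \<Rightarrow> bool" where
  "normalized_period v k f e \<Omega> \<longleftrightarrow>
     (\<forall>P a m. degree P \<le> k - 2 \<and> m \<ge> 1 \<longrightarrow>
        algebraic (eta_sign f e \<Omega> P a m) \<and> v (eta_sign f e \<Omega> P a m) \<ge> 0) \<and>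
     (\<exists>P a m. degree P \<le> k - 2 \<and> m \<ge> 1 \<and> v (eta_sign f e \<Omega> P a m) = 0)"

definition eta ::
  "(complex \<Rightarrow> complex) \<Rightarrow> complex \<Rightarrow> complex \<Rightarrow> int poly \<Rightarrow> int \<Rightarrow> nat \<Rightarrow> complex" where
  "eta f \<Omega>p \<Omega>m P a m = eta_sign f 1 \<Omega>p P a m + eta_sign f (-1) \<Omega>m P a m"

definition lambda_f ::
  "(complex \<Rightarrow> complex) \<Rightarrow> complex \<Rightarrow> complex \<Rightarrow> int poly \<Rightarrow> int \<Rightarrow> nat \<Rightarrow> complex" where
  "lambda_f f \<Omega>p \<Omega>m P a m = eta f \<Omega>p \<Omega>m (pcompose P [:a, int m:]) (- a) m"

definition mu_int :: "nat \<Rightarrow> (complex \<Rightarrow> complex) \<Rightarrow> complex \<Rightarrow> complex \<Rightarrow>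
    int poly \<Rightarrow> int \<Rightarrow> nat \<Rightarrow> complex" where
  "mu_int p f \<Omega>p \<Omega>m P a n = lambda_f f \<Omega>p \<Omega>m P a (p ^ n) / qcoeff f p ^ n"

text \<open>Linear extension to polynomials with coefficients in \<open>\<rat>\<^sub>p\<close>.\<close>

definition mu_poly :: "nat \<Rightarrow> (complex \<Rightarrow> complex) \<Rightarrow> complex \<Rightarrow> complex \<Rightarrow>
    complex poly \<Rightarrow> int \<Rightarrow> nat \<Rightarrow> complex" where
  "mu_poly p f \<Omega>p \<Omega>m P a n =
     (\<Sum>i\<le>degree P. coeff P i * mu_int p f \<Omega>p \<Omega>m (monom 1 i) a n)"


section \<open>Locally analytic functions and distributions on \<open>\<int>\<^sub>p\<^sup>\<times>\<close>\<close>

text \<open>\<open>g\<close> is given on the closed ball \<open>a + p\<^sup>n\<int>\<^sub>p\<close> by the power series with coefficients \<open>c\<close>, which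
  converges on that ball over every extension of \<open>\<rat>\<^sub>p\<close>.\<close>

definition ball_expansion ::
  "(complex \<Rightarrow> ereal) \<Rightarrow> (complex \<Rightarrow> complex) \<Rightarrow> complex \<Rightarrow> nat \<Rightarrow> (nat \<Rightarrow> complex) \<Rightarrow> bool" where
  "ball_expansion v g a n c \<longleftrightarrow> (\<forall>j. c j \<in> Qp v) \<and>
     (\<lambda>j. v (c j) + ereal (real n * real j)) \<longlonglongrightarrow> \<infinity> \<and>
     (\<forall>x\<in>Qp v. v (x - a) \<ge> ereal (real n) \<longrightarrow> vsums v (\<lambda>j. c j * (x - a) ^ j) (g x))"

definition loc_analytic_level :: "(complex \<Rightarrow> ereal) \<Rightarrow> nat \<Rightarrow> (complex \<Rightarrow> complex) set" where
  "loc_analytic_level v n = {g. \<forall>a\<in>Zp_units v. \<exists>c. ball_expansion v g a n c}"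

text \<open>Since \<open>\<int>\<^sub>p\<^sup>\<times>\<close> is compact, the radius may be taken uniform. Values of \<open>g\<close> off \<open>\<int>\<^sub>p\<^sup>\<times>\<close> are
  irrelevant.\<close>

definition loc_analytic :: "(complex \<Rightarrow> ereal) \<Rightarrow> (complex \<Rightarrow> complex) set" where
  "loc_analytic v = (\<Union>n\<in>{1..}. loc_analytic_level v n)"

text \<open>A \<open>\<rat>\<^sub>p\<close>-linear functional that is continuous for the inductive limit topology, i.e. bounded on
  the unit ball of each Banach space of functions analytic on the balls of radius \<open>p\<^sup>-\<^sup>n\<close>. The first
  condition says that only the values on \<open>\<int>\<^sub>p\<^sup>\<times>\<close> matter.\<close>

definition loc_analytic_distribution ::
  "(complex \<Rightarrow> ereal) \<Rightarrow> ((complex \<Rightarrow> complex) \<Rightarrow> complex) \<Rightarrow> bool" where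
  "loc_analytic_distribution v \<mu> \<longleftrightarrow>
     (\<forall>g\<in>loc_analytic v. \<forall>h\<in>loc_analytic v. (\<forall>x\<in>Zp_units v. g x = h x) \<longrightarrow> \<mu> g = \<mu> h) \<and>
     (\<forall>g\<in>loc_analytic v. \<forall>h\<in>loc_analytic v. \<mu> (\<lambda>x. g x + h x) = \<mu> g + \<mu> h) \<and>
     (\<forall>c\<in>Qp v. \<forall>g\<in>loc_analytic v. \<mu> (\<lambda>x. c * g x) = c * \<mu> g) \<and>
     (\<forall>n\<ge>1. \<exists>C::real. \<forall>g\<in>loc_analytic_level v n.
        (\<forall>a\<in>Zp_units v. \<forall>c. ball_expansion v g a n c \<longrightarrow>
           (\<forall>j. v (c j) + ereal (real n * real j) \<ge> 0)) \<longrightarrow> v (\<mu> g) \<ge> ereal C)"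

definition ball_integral :: "(complex \<Rightarrow> ereal) \<Rightarrow> ((complex \<Rightarrow> complex) \<Rightarrow> complex) \<Rightarrow>
    complex \<Rightarrow> nat \<Rightarrow> (complex \<Rightarrow> complex) \<Rightarrow> complex" where
  "ball_integral v \<mu> a n g = \<mu> (\<lambda>x. if v (x - a) \<ge> ereal (real n) then g x else 0)"

text \<open>The moments of degree at most \<open>k - 2\<close> pin down a distribution only
  among those of order at most \<open>v\<^sub>p(a\<^sub>p(f))\<close> (which is less than \<open>k - 1\<close>); the last condition is this
  growth condition of Amice, Velu and Vishik: up to a constant,
  \<open>\<integral> (x - a)\<^sup>j\<close> over \<open>a + p\<^sup>n\<int>\<^sub>p\<close> is divisible by \<open>p\<^sup>n\<^sup>j a\<^sub>p(f)\<^sup>-\<^sup>n\<close>.\<close>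

definition is_padic_L_distribution :: "nat \<Rightarrow> (complex \<Rightarrow> ereal) \<Rightarrow> nat \<Rightarrow> (complex \<Rightarrow> complex) \<Rightarrow>
    complex \<Rightarrow> complex \<Rightarrow> ((complex \<Rightarrow> complex) \<Rightarrow> complex) \<Rightarrow> bool" where
  "is_padic_L_distribution p v k f \<Omega>p \<Omega>m \<mu> \<longleftrightarrow>
     loc_analytic_distribution v \<mu> \<and>
     (\<forall>n\<ge>1. \<forall>a. \<not> int p dvd a \<longrightarrow>
        (\<forall>P. (\<forall>i. coeff P i \<in> Qp v) \<and> degree P \<le> k - 2 \<longrightarrow>
           ball_integral v \<mu> (of_int a) n (poly P) = mu_poly p f \<Omega>p \<Omega>m P a n)) \<and>
     (\<exists>C::real. \<forall>n\<ge>1. \<forall>a\<in>Zp_units v. \<forall>j.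
        v (qcoeff f p ^ n * ball_integral v \<mu> a n (\<lambda>x. (x - a) ^ j))
          \<ge> ereal (real n * real j + C))"


section \<open>The derivative of the \<open>p\<close>-adic \<open>L\<close>-function and its approximations\<close>

text \<open>For \<open>p = 2\<close>, \<open>\<omega>(x)\<close> is \<open>1\<close> or \<open>-1\<close> and \<open>x/\<omega>(x)\<close> lies in \<open>1 + 4\<int>\<^sub>2\<close>.\<close>

definition teichmueller :: "nat \<Rightarrow> (complex \<Rightarrow> ereal) \<Rightarrow> complex \<Rightarrow> complex" where
  "teichmueller p v x = (THE w. w \<in> Qp v \<and> w ^ (if p = 2 then 2 else p - 1) = 1 \<and>
     v (x / w - 1) \<ge> (if p = 2 then 2 else 1))"

definition angle :: "nat \<Rightarrow> (complex \<Rightarrow> ereal) \<Rightarrow> complex \<Rightarrow> complex" where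
  "angle p v x = x / teichmueller p v x"

text \<open>The \<open>p\<close>-adic logarithm, on \<open>1 + p\<int>\<^sub>p\<close>.\<close>

definition padic_log :: "(complex \<Rightarrow> ereal) \<Rightarrow> complex \<Rightarrow> complex" where
  "padic_log v u =
     (THE l. vsums v (\<lambda>i. (-1) ^ i * (u - 1) ^ Suc i / of_nat (Suc i)) l)"

text \<open>The power \<open>u\<^sup>s\<close> for \<open>u \<in> 1 + p\<int>\<^sub>p\<close> and \<open>s \<in> \<int>\<^sub>p\<close>, by the binomial series.\<close>

definition padic_power :: "(complex \<Rightarrow> ereal) \<Rightarrow> complex \<Rightarrow> complex \<Rightarrow> complex" where
  "padic_power v u s = (THE y. vsums v (\<lambda>i. (s gchoose i) * (u - 1) ^ i) y)"

definition has_padic_derivative ::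
  "(complex \<Rightarrow> ereal) \<Rightarrow> (complex \<Rightarrow> complex) \<Rightarrow> complex \<Rightarrow> complex \<Rightarrow> bool" where
  "has_padic_derivative v F s0 D \<longleftrightarrow> (\<forall>B::real. \<exists>d::real. \<forall>s\<in>Zp v.
     s \<noteq> s0 \<and> v (s - s0) \<ge> ereal d \<longrightarrow> v ((F s - F s0) / (s - s0) - D) \<ge> ereal B)"

definition Lp_branch :: "nat \<Rightarrow> (complex \<Rightarrow> ereal) \<Rightarrow> nat \<Rightarrow>
    ((complex \<Rightarrow> complex) \<Rightarrow> complex) \<Rightarrow> complex \<Rightarrow> complex" where
  "Lp_branch p v k \<mu> s =
     \<mu> (\<lambda>x. teichmueller p v x ^ (k div 2 - 1) * padic_power v (angle p v x) (s - 1))"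

definition Lp_deriv :: "nat \<Rightarrow> (complex \<Rightarrow> ereal) \<Rightarrow> nat \<Rightarrow>
    ((complex \<Rightarrow> complex) \<Rightarrow> complex) \<Rightarrow> complex" where
  "Lp_deriv p v k \<mu> = (THE D. has_padic_derivative v (Lp_branch p v k \<mu>) (of_nat (k div 2)) D)"

definition taylor_coeffs ::
  "(complex \<Rightarrow> ereal) \<Rightarrow> (complex \<Rightarrow> complex) \<Rightarrow> complex \<Rightarrow> nat \<Rightarrow> complex" where
  "taylor_coeffs v g a = (THE c. \<exists>n. ball_expansion v g a n c)"

text \<open>The truncated Taylor expansion, as a polynomial in \<open>x\<close> (not in \<open>x - a\<close>).\<close>

definition TS ::
  "(complex \<Rightarrow> ereal) \<Rightarrow> nat \<Rightarrow> complex \<Rightarrow> (complex \<Rightarrow> complex) \<Rightarrow> complex poly" where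
  "TS v k a g = (\<Sum>j\<le>k - 2. smult (taylor_coeffs v g a j) ([:- a, 1:] ^ j))"

definition L_approx :: "nat \<Rightarrow> (complex \<Rightarrow> ereal) \<Rightarrow> nat \<Rightarrow> (complex \<Rightarrow> complex) \<Rightarrow>
    complex \<Rightarrow> complex \<Rightarrow> nat \<Rightarrow> complex" where
  "L_approx p v k f \<Omega>p \<Omega>m n = (\<Sum>a | a \<in> {1..p ^ n - 1} \<and> \<not> p dvd a.
     mu_poly p f \<Omega>p \<Omega>m
       (TS v k (of_nat a) (\<lambda>x. x ^ (k div 2 - 1) * padic_log v (angle p v x))) (int a) n)"

end

theory Submission imports Defs "HOL-Number_Theory.Cong"
begin

text \<open>Since \<open>\<omega>\<^sup>h \<langle>x\<rangle>\<^sup>h = x\<^sup>h\<close> for \<open>h = k/2 - 1\<close>, the derivative \<open>L\<^sub>p'(f, k/2)\<close> is the integral of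
  \<open>x\<^sup>h log\<^sub>p \<langle>x\<rangle>\<close> against \<open>\<mu>\<^sub>f\<close>. Its difference from \<open>L\<^sub>n\<close> is the sum over the residue classes \<open>a\<close> of the
  integrals of the Taylor tails of degree \<open>j \<ge> k - 1\<close>. The Taylor coefficients have valuation at least
  \<open>- \<lfloor>log\<^sub>p j\<rfloor>\<close>, so everything depends on the sharp bound \<open>n j\<close> for the valuation of
  \<open>a\<^sub>p\<^sup>n \<integral> (x - a)\<^sup>j d\<mu>\<^sub>f\<close> over \<open>a + p\<^sup>n \<int>\<^sub>p\<close>, for all \<open>j\<close>; a distribution is only assumed to satisfy such a
  bound up to a constant.

  A form that is new at \<open>p\<close> is orthogonal to its own trace to level \<open>N\<close>, hence has trace zero, and an
  eigenform of trace zero is also an eigenfunction of the Atkin--Lehner matrix \<open>W\<close>, with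
  \<open>a\<^sub>p\<^sup>2 = p\<^sup>k\<^sup>-\<^sup>2\<close>. Moving the path of integration by \<open>W\<close> shows that the periods of \<open>z\<^sup>i\<close> at \<open>b/p\<^sup>n\<close> are
  divisible by \<open>p\<^sup>h\<^sup>-\<^sup>i\<close> for \<open>i \<le> h\<close>. This compensates for the division by \<open>a\<^sub>p\<close>, of valuation \<open>h\<close>, in the
  distribution relation between the radii \<open>p\<^sup>-\<^sup>n\<close> and \<open>p\<^sup>-\<^sup>n\<^sup>-\<^sup>1\<close>, so that the constant can be improved step
  by step until it disappears.\<close>

text \<open>The obstacle is the constant C of the growth condition, which would survive in the final
  estimate. Write I_n for an i-th moment at radius p^(-n). In the distribution relation \<alpha>^n
  I_n is 1/\<alpha> times a combination of terms \<alpha>^(n+1) I_(n+1), so each refinement costs h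
  = v(\<alpha>) and returns i. For i > 2h this is a net gain. For h \<le> i \<le> 2h nothing is
  lost, and integrality of the periods leaves no defect to begin with. Only i < h has a deficit,
  exactly h - i, and this is the divisibility that W supplies. The exponents of the theorem then
  have a simple origin: the tail begins at degree k - 1, the moments give n(k - 1), dividing by
  \<alpha>^n costs n(k/2 - 1), and nk/2 is left. The floor is the largest valuation of a positive
  integer up to k - 1. A second difficulty is that \<mu> is continuous only on functions of a fixed
  level. Differentiation under the integral and summation of Taylor tails therefore need estimates
  of all coefficients, uniform in the centre, instead of pointwise convergence.\<close>

locale padic_closure =
  fixes p :: nat and v :: "complex \<Rightarrow> ereal"
  assumes prime_p: "prime p" and closure: "is_padic_closure p v"
begin

section \<open>Ultrametric calculus with the transported valuation\<close>

lemma v_mult: "v (x * y) = v x + v y"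
  using closure by (auto simp: is_padic_closure_def)

lemma v_eq_infinity_iff: "v x = \<infinity> \<longleftrightarrow> x = 0"
  using closure by (auto simp: is_padic_closure_def)

lemma v_add: "v (x + y) \<ge> min (v x) (v y)"
  using closure by (auto simp: is_padic_closure_def)

lemma v_p: "v (of_nat p) = 1"
  using closure by (auto simp: is_padic_closure_def)

lemma p_gt_1: "p > 1"
  using prime_p by (rule prime_gt_1_nat)

lemma v_0 [simp]: "v 0 = \<infinity>"
  by (simp add: v_eq_infinity_iff)

lemma v_eq_ereal:
  assumes "x \<noteq> 0"
  obtains r where "v x = ereal r"
proof -
  have "v x \<noteq> -\<infinity>" "v x \<noteq> \<infinity>"
    using closure assms by (auto simp: is_padic_closure_def)
  then show ?thesis
    using that by (cases "v x") auto
qed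

lemma v_1 [simp]: "v 1 = 0"
proof -
  obtain r where r: "v 1 = ereal r" by (rule v_eq_ereal[of 1]) auto
  then show ?thesis using v_mult[of 1 1] by (simp add: zero_ereal_def)
qed

lemma v_minus [simp]: "v (- x) = v x"
proof -
  obtain r where r: "v (-1) = ereal r" by (rule v_eq_ereal[of "-1"]) auto
  then have "v (-1) = 0" using v_mult[of "-1" "-1"] by (simp add: zero_ereal_def)
  then show ?thesis using v_mult[of "-1" x] by simp
qed

lemma v_minus_commute: "v (x - y) = v (y - x)"
  using v_minus[of "x - y"] by simp

lemma v_ge_mono: "ereal b \<le> v x \<Longrightarrow> a \<le> b \<Longrightarrow> ereal a \<le> v x"
  by (meson ereal_less_eq(3) order_trans)

lemma v_ge_add: "c \<le> v x \<Longrightarrow> c \<le> v y \<Longrightarrow> c \<le> v (x + y)"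
  using v_add[of x y] by (meson min.boundedI order_trans)

lemma v_ge_diff: "c \<le> v x \<Longrightarrow> c \<le> v y \<Longrightarrow> c \<le> v (x - y)"
  using v_ge_add[of c x "-y"] by simp

lemma v_ge_sum: "(\<And>i. i \<in> A \<Longrightarrow> c \<le> v (f i)) \<Longrightarrow> c \<le> v (\<Sum>i\<in>A. f i)"
  by (induction A rule: infinite_finite_induct) (auto intro: v_ge_add)

lemma v_ge_mult: "ereal a \<le> v x \<Longrightarrow> ereal b \<le> v y \<Longrightarrow> ereal (a + b) \<le> v (x * y)"
  using add_mono[of "ereal a" "v x" "ereal b" "v y"] by (simp add: v_mult)

lemma v_ge_mult_left: "ereal a \<le> v x \<Longrightarrow> 0 \<le> v y \<Longrightarrow> ereal a \<le> v (x * y)"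
  using v_ge_mult[of a x 0 y] by (simp add: zero_ereal_def)

lemma v_ge_mult_right: "0 \<le> v x \<Longrightarrow> ereal a \<le> v y \<Longrightarrow> ereal a \<le> v (x * y)"
  using v_ge_mult_left[of a y x] by (simp add: mult.commute)

lemma v_ge_power: "ereal a \<le> v x \<Longrightarrow> ereal (real n * a) \<le> v (x ^ n)"
proof (induction n)
  case (Suc n)
  then show ?case using v_ge_mult[of a x "real n * a" "x ^ n"] by (simp add: algebra_simps)
qed (simp add: zero_ereal_def)

lemma v_power: "v x = ereal a \<Longrightarrow> v (x ^ n) = ereal (real n * a)"
  by (induction n) (auto simp: v_mult zero_ereal_def algebra_simps)

lemma v_power_0: "v x = 0 \<Longrightarrow> v (x ^ n) = 0"
  using v_power[of x 0 n] by (simp add: zero_ereal_def)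

lemma v_p_power: "v (of_nat p ^ n) = ereal (real n)"
  using v_power[of "of_nat p" 1 n] v_p by (simp add: one_ereal_def)

lemma v_inverse: "v x = ereal a \<Longrightarrow> v (inverse x) = ereal (- a)"
proof -
  assume a: "v x = ereal a"
  then have "x \<noteq> 0" by auto
  then have 1: "v x + v (inverse x) = 0" using v_mult[of x "inverse x"] by simp
  show ?thesis using 1 a by (cases "v (inverse x)") (auto simp: zero_ereal_def)
qed

lemma v_inverse_0: "v x = 0 \<Longrightarrow> v (inverse x) = 0"
  using v_inverse[of x 0] by (simp add: zero_ereal_def)

lemma v_divide: "v x = ereal a \<Longrightarrow> v y = ereal b \<Longrightarrow> v (x / y) = ereal (a - b)"
  using v_inverse[of y b] v_mult[of x "inverse y"] by (simp add: divide_inverse)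

lemma v_ge_divide: "ereal a \<le> v x \<Longrightarrow> v y = ereal b \<Longrightarrow> ereal (a - b) \<le> v (x / y)"
  using v_ge_mult[of a x "-b" "inverse y"] v_inverse[of y b] by (simp add: divide_inverse)

lemma v_divide_unit: "v y = 0 \<Longrightarrow> v (x / y) = v x"
  using v_inverse_0[of y] v_mult[of x "inverse y"] by (simp add: divide_inverse)

lemma v_zero_nonzero: "v x = 0 \<Longrightarrow> x \<noteq> 0"
  by auto

lemma eq_0_if_v_ge:
  assumes "\<And>B. ereal B \<le> v x"
  shows "x = 0"
proof (rule ccontr)
  assume "x \<noteq> 0"
  then obtain r where "v x = ereal r" by (rule v_eq_ereal)
  then show False using assms[of "r + 1"] by simp
qed

text \<open>Isosceles triangles: recovering x as (x + y) - y shows that a larger valuation of the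
  sum would raise that of x.\<close>

lemma v_add_eq: "v x < v y \<Longrightarrow> v (x + y) = v x"
proof -
  assume less: "v x < v y"
  have "v x \<le> v (x + y)" using v_add[of x y] less by (simp add: min_def split: if_splits)
  moreover have "v (x + y) \<le> v x"
    using v_add[of "x + y" "-y"] less by (auto simp: min_def split: if_splits)
  ultimately show ?thesis by simp
qed

lemma v_of_nat_ge: "0 \<le> v (of_nat n)"
  by (induction n) (auto intro: v_ge_add)

lemma v_of_int_ge: "0 \<le> v (of_int a)"
proof (cases a rule: int_cases2)
  case (nonneg n)
  then show ?thesis using v_of_nat_ge[of n] by simp
next
  case (nonpos n)
  then show ?thesis using v_of_nat_ge[of n] by simp
qed

lemma v_of_int_dvd:
  assumes "int (p ^ n) dvd a"
  shows "ereal (real n) \<le> v (of_int a)"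
proof -
  obtain b where b: "a = int (p ^ n) * b" using assms by (auto elim: dvdE)
  have "of_int a = (of_nat p ^ n * of_int b :: complex)" by (simp add: b)
  then show ?thesis
    using v_ge_mult_left[of "real n" "of_nat p ^ n" "of_int b"] v_p_power[of n] v_of_int_ge[of b] by simp
qed

lemma v_pos_mult: "0 < v x \<Longrightarrow> 0 \<le> v y \<Longrightarrow> 0 < v (x * y)"
  unfolding v_mult by (cases "v x"; cases "v y") auto

text \<open>By Bezout 1 = x p + y a; if p and a both had positive valuation, so would 1.\<close>

lemma v_of_int_unit:
  assumes "\<not> int p dvd a"
  shows "v (of_int a) = 0"
proof -
  have "coprime (int p) a"
    using assms prime_p by (simp add: prime_imp_coprime)
  then obtain x y where xy: "x * int p + y * a = 1"
    using bezout_int[of "int p" a] by (auto simp: coprime_iff_gcd_eq_1)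
  have 1: "of_int x * of_nat p + of_int y * of_int a = (1::complex)"
    using arg_cong[OF xy, of "of_int :: int \<Rightarrow> complex"] by simp
  show ?thesis
  proof (rule ccontr)
    assume "v (of_int a) \<noteq> 0"
    then have pos: "0 < v (of_int a)" using v_of_int_ge[of a] by simp
    have "0 < v (of_int y * of_int a)"
      using v_pos_mult[OF pos v_of_int_ge[of y]] by (simp add: mult.commute)
    moreover have "0 < v (of_int x * of_nat p)"
      using v_pos_mult[OF _ v_of_int_ge[of x], of "of_nat p"] v_p by (simp add: mult.commute)
    ultimately show False
      using v_add[of "of_int x * of_nat p" "of_int y * of_int a"] 1 by (simp add: min_def split: if_splits)
  qed
qed

lemma v_of_nat_unit: "\<not> p dvd a \<Longrightarrow> v (of_nat a) = 0"
  using v_of_int_unit[of "int a"] by simp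

lemma v_of_int_ge_1_iff: "1 \<le> v (of_int a) \<longleftrightarrow> int p dvd a"
  using v_of_int_unit[of a] v_of_int_dvd[of 1 a] by (cases "int p dvd a") (auto simp: one_ereal_def)

text \<open>Follows from p^e dividing m, hence p^e \<le> m. The logarithm in the final estimate
  originates here.\<close>

lemma v_of_nat_le_log:
  assumes "m > 0"
  obtains e :: nat where "v (of_nat m) = ereal (real e)" "int e \<le> \<lfloor>ln (real m) / ln (real p)\<rfloor>"
proof -
  define e where "e = multiplicity p m"
  obtain u where u: "m = p ^ e * u" "\<not> p dvd u"
    using multiplicity_decompose'[of m p] assms prime_p not_prime_unit unfolding e_def by blast
  have "v (of_nat m) = ereal (real e)"
    using v_of_nat_unit[OF u(2)] v_p_power[of e] by (simp add: u(1) v_mult)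
  moreover have "int e \<le> \<lfloor>ln (real m) / ln (real p)\<rfloor>"
  proof -
    have "real p ^ e \<le> real m"
      using u assms by (metis dvd_imp_le dvd_triv_left of_nat_le_iff of_nat_power)
    then have "ln (real p ^ e) \<le> ln (real m)"
      using p_gt_1 assms by (subst ln_le_cancel_iff) auto
    then have "real e * ln (real p) \<le> ln (real m)"
      using p_gt_1 by (simp add: ln_realpow)
    then have "real e \<le> ln (real m) / ln (real p)"
      using p_gt_1 by (simp add: pos_le_divide_eq)
    then show ?thesis by (simp add: le_floor_iff)
  qed
  ultimately show ?thesis using that by blast
qed

subsection \<open>The field \<open>\<rat>\<^sub>p\<close>\<close>

lemma Qp_rat: "q \<in> \<rat> \<Longrightarrow> q \<in> Qp v"
  by (auto simp: Qp_def intro!: bexI[of _ q])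

lemma Qp_of_int [simp]: "of_int a \<in> Qp v" and Qp_of_nat [simp]: "of_nat m \<in> Qp v"
  and Qp_0 [simp]: "0 \<in> Qp v" and Qp_1 [simp]: "1 \<in> Qp v"
  by (auto intro: Qp_rat)

lemma Qp_add: "x \<in> Qp v \<Longrightarrow> y \<in> Qp v \<Longrightarrow> x + y \<in> Qp v"
proof -
  assume x: "x \<in> Qp v" and y: "y \<in> Qp v"
  have "\<exists>q\<in>\<rat>. ereal B \<le> v (x + y - q)" for B
  proof -
    obtain q r where qr: "q \<in> \<rat>" "r \<in> \<rat>" "ereal B \<le> v (x - q)" "ereal B \<le> v (y - r)"
      using x y unfolding Qp_def by blast
    have "ereal B \<le> v (x + y - (q + r))"
      using v_ge_add[OF qr(3,4)] by (simp add: algebra_simps)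
    then show ?thesis using qr by (intro bexI[of _ "q + r"]) auto
  qed
  then show ?thesis by (simp add: Qp_def)
qed

lemma Qp_minus: "x \<in> Qp v \<Longrightarrow> - x \<in> Qp v"
proof -
  assume x: "x \<in> Qp v"
  have "\<exists>q\<in>\<rat>. ereal B \<le> v (- x - q)" for B
  proof -
    obtain q where q: "q \<in> \<rat>" "ereal B \<le> v (x - q)" using x unfolding Qp_def by blast
    have "v (- x - (- q)) = v (x - q)" using v_minus_commute[of q x] by simp
    then show ?thesis using q by (intro bexI[of _ "-q"]) auto
  qed
  then show ?thesis by (simp add: Qp_def)
qed

lemma Qp_diff: "x \<in> Qp v \<Longrightarrow> y \<in> Qp v \<Longrightarrow> x - y \<in> Qp v"
  using Qp_add[of x "-y"] Qp_minus[of y] by simp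

lemma v_ge_some: obtains B where "B \<le> 0" "ereal B \<le> v x"
proof (cases "x = 0")
  case True
  then show ?thesis using that[of 0] by simp
next
  case False
  then obtain r where "v x = ereal r" by (rule v_eq_ereal)
  then show ?thesis using that[of "min r 0"] by auto
qed

lemma Qp_mult: "x \<in> Qp v \<Longrightarrow> y \<in> Qp v \<Longrightarrow> x * y \<in> Qp v"
proof -
  assume x: "x \<in> Qp v" and y: "y \<in> Qp v"
  obtain X where X: "X \<le> 0" "ereal X \<le> v x" by (rule v_ge_some)
  obtain Y where Y: "Y \<le> 0" "ereal Y \<le> v y" by (rule v_ge_some)
  have "\<exists>q\<in>\<rat>. ereal B \<le> v (x * y - q)" for B
  proof -
    \<comment> \<open>\<open>B'\<close> covers the loss from multiplying by x or by r. The 0 in the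
      maximum forces v(y - r) \<ge> 0 \<ge> Y, so that r inherits the lower bound Y of y.\<close>
    define B' where "B' = max 0 (max (B - X) (B - Y))"
    obtain q r where qr: "q \<in> \<rat>" "r \<in> \<rat>" "ereal B' \<le> v (x - q)" "ereal B' \<le> v (y - r)"
      using x y unfolding Qp_def by blast
    have "ereal Y \<le> v (y - (y - r))"
      by (rule v_ge_diff) (use Y qr(4) in \<open>auto intro: v_ge_mono simp: B'_def\<close>)
    then have r: "ereal Y \<le> v r" by simp
    have "ereal B \<le> v (x * (y - r))"
      by (rule v_ge_mono[OF v_ge_mult[OF X(2) qr(4)]]) (auto simp: B'_def)
    moreover have "ereal B \<le> v ((x - q) * r)"
      by (rule v_ge_mono[OF v_ge_mult[OF qr(3) r]]) (auto simp: B'_def)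
    ultimately have "ereal B \<le> v (x * (y - r) + (x - q) * r)" by (rule v_ge_add)
    then have "ereal B \<le> v (x * y - q * r)" by (simp add: algebra_simps)
    then show ?thesis using qr by (intro bexI[of _ "q * r"]) auto
  qed
  then show ?thesis by (simp add: Qp_def)
qed

lemma Qp_power: "x \<in> Qp v \<Longrightarrow> x ^ n \<in> Qp v"
  by (induction n) (auto intro: Qp_mult)

lemma Qp_sum: "(\<And>i. i \<in> A \<Longrightarrow> f i \<in> Qp v) \<Longrightarrow> (\<Sum>i\<in>A. f i) \<in> Qp v"
  by (induction A rule: infinite_finite_induct) (auto intro: Qp_add)

lemma Qp_inverse: "x \<in> Qp v \<Longrightarrow> inverse x \<in> Qp v"
proof (cases "x = 0")
  case False
  assume x: "x \<in> Qp v"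
  obtain r where r: "v x = ereal r" using False by (rule v_eq_ereal)
  have "\<exists>q\<in>\<rat>. ereal B \<le> v (inverse x - q)" for B
  proof -
    \<comment> \<open>The entry r + 1 forces v q = v x; the other entry pays for the division by x
      q, of valuation 2r.\<close>
    define B' where "B' = max (r + 1) (B + 2 * r)"
    obtain q where q: "q \<in> \<rat>" "ereal B' \<le> v (x - q)" using x unfolding Qp_def by blast
    have "v x < ereal B'" unfolding r less_ereal.simps B'_def by linarith
    then have "v x < v (q - x)" using q(2) by (simp add: v_minus_commute[of q x])
    then have vq: "v q = ereal r" using v_add_eq[of x "q - x"] r by simp
    have q0: "q \<noteq> 0" using vq by auto
    have "ereal (B' - (r + r)) \<le> v ((q - x) / (x * q))"
      by (rule v_ge_divide) (use q(2) vq r v_minus_commute[of x q] in \<open>auto simp: v_mult\<close>)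
    then have "ereal B \<le> v ((q - x) / (x * q))"
      by (rule v_ge_mono) (auto simp: B'_def)
    also have "(q - x) / (x * q) = inverse x - inverse q"
      using False q0 by (simp add: field_simps)
    finally show ?thesis using q by (intro bexI[of _ "inverse q"]) auto
  qed
  then show ?thesis by (simp add: Qp_def)
qed simp

lemma Qp_divide: "x \<in> Qp v \<Longrightarrow> y \<in> Qp v \<Longrightarrow> x / y \<in> Qp v"
  by (simp add: divide_inverse Qp_mult Qp_inverse)

text \<open>A rational number r/s of nonnegative valuation in lowest terms has s prime to p, so the
  congruence s m = r modulo p^n is solved by a natural number m.\<close>

lemma Zp_approx_nat:
  assumes "x \<in> Zp v"
  obtains m :: nat where "ereal (real n) \<le> v (x - of_nat m)"
proof -
  have x: "x \<in> Qp v" "0 \<le> v x" using assms by (auto simp: Zp_def)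
  obtain q where q: "q \<in> \<rat>" "ereal (real n) \<le> v (x - q)" using x unfolding Qp_def by blast
  have "0 \<le> v (x - q)"
    using q(2) by (rule order_trans[rotated]) (simp add: zero_ereal_def)
  then have vq: "0 \<le> v q" using v_ge_diff[of 0 x "x - q"] x by simp
  obtain r s where rs: "s > 0" "coprime r s" "q = of_int r / of_int s"
    using q(1) by (elim Rats_cases')
  have s: "\<not> int p dvd s"
  proof
    assume s: "int p dvd s"
    have "\<not> int p dvd r"
      using coprime_common_divisor[OF rs(2), of "int p"] s p_gt_1 by auto
    then have "v (of_int r) = 0" by (rule v_of_int_unit)
    moreover have "1 \<le> v (of_int s)" using s by (simp add: v_of_int_ge_1_iff)
    moreover have "v (of_int r) = v q + v (of_int s)" using rs by (simp flip: v_mult)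
    ultimately have "v q + v (of_int s) = 0" by simp
    then show False using vq \<open>1 \<le> v (of_int s)\<close>
      by (cases "v q"; cases "v (of_int s)") (auto simp: zero_ereal_def one_ereal_def)
  qed
  have "coprime s (int (p ^ n))"
    using prime_imp_coprime[of "int p" s] s prime_p by (simp add: coprime_commute)
  then obtain t' where "[s * t' = 1] (mod int (p ^ n))"
    using cong_solve_coprime_int by blast
  then have "[s * t' * r = 1 * r] (mod int (p ^ n))" by (rule cong_scalar_right)
  then obtain t where t: "[s * t = r] (mod int (p ^ n))" by (auto simp: mult.assoc)
  define m where "m = nat (t mod int (p ^ n))"
  have m: "int m = t mod int (p ^ n)"
    using p_gt_1 by (simp add: m_def)
  have "[s * int m = r] (mod int (p ^ n))"
    using t unfolding cong_def m by (simp only: mod_mult_right_eq)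
  then have "ereal (real n) \<le> v (of_int (s * int m - r))"
    by (intro v_of_int_dvd) (simp add: cong_iff_dvd_diff)
  then have "ereal (real n - 0) \<le> v (of_int (s * int m - r) / of_int s)"
    by (rule v_ge_divide) (use v_of_int_unit[OF s] in \<open>simp add: zero_ereal_def\<close>)
  also have "of_int (s * int m - r) / of_int s = of_nat m - q"
    using rs by (simp add: field_simps)
  finally have "ereal (real n) \<le> v (q - of_nat m)"
    using v_minus_commute[of q "of_nat m"] by simp
  from v_ge_add[OF q(2) this] that show ?thesis by simp
qed

lemma Zp_mod_p:
  assumes "x \<in> Zp v"
  obtains t where "t < p" "1 \<le> v (x - of_nat t)"
proof -
  obtain m :: nat where m: "ereal (real 1) \<le> v (x - of_nat m)"
    using assms by (rule Zp_approx_nat)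
  have "1 \<le> v (of_int (int m - int (m mod p)))"
    unfolding v_of_int_ge_1_iff by (simp add: of_nat_mod)
  then have "1 \<le> v (x - of_nat m + of_int (int m - int (m mod p)))"
    using m by (intro v_ge_add) (auto simp: one_ereal_def)
  then show ?thesis using that[of "m mod p"] p_gt_1 by simp
qed

subsection \<open>Convergence\<close>

lemma tendsto_infinity_iff:
  fixes X :: "nat \<Rightarrow> ereal"
  shows "X \<longlonglongrightarrow> \<infinity> \<longleftrightarrow> (\<forall>B::real. \<exists>M. \<forall>n\<ge>M. ereal B \<le> X n)"
proof
  assume "X \<longlonglongrightarrow> \<infinity>"
  then show "\<forall>B::real. \<exists>M. \<forall>n\<ge>M. ereal B \<le> X n"
    unfolding tendsto_PInfty eventually_sequentially by (meson less_imp_le)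
next
  assume *: "\<forall>B::real. \<exists>M. \<forall>n\<ge>M. ereal B \<le> X n"
  show "X \<longlonglongrightarrow> \<infinity>"
    unfolding tendsto_PInfty eventually_sequentially
  proof
    fix r :: real
    obtain M where "\<forall>n\<ge>M. ereal (r + 1) \<le> X n" using * by blast
    moreover have "ereal r < ereal (r + 1)" by simp
    ultimately have "\<forall>n\<ge>M. ereal r < X n" using less_le_trans by blast
    then show "\<exists>M. \<forall>n\<ge>M. ereal r < X n" by blast
  qed
qed

lemma vlimit_iff: "vlimit v X L \<longleftrightarrow> (\<forall>B::real. \<exists>M. \<forall>n\<ge>M. ereal B \<le> v (X n - L))"
  unfolding vlimit_def tendsto_infinity_iff ..

lemma vlimit_unique:
  assumes "vlimit v X L" "vlimit v X L'"
  shows "L = L'"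
proof -
  have "ereal B \<le> v (L' - L)" for B
  proof -
    obtain M where M: "\<forall>n\<ge>M. ereal B \<le> v (X n - L)" using assms(1) unfolding vlimit_iff by blast
    obtain M' where M': "\<forall>n\<ge>M'. ereal B \<le> v (X n - L')" using assms(2) unfolding vlimit_iff by blast
    have "ereal B \<le> v ((X (max M M') - L) - (X (max M M') - L'))"
      by (rule v_ge_diff) (use M M' in auto)
    then show ?thesis by simp
  qed
  then show ?thesis using eq_0_if_v_ge[of "L' - L"] by simp
qed

lemma vlimit_add:
  assumes "vlimit v X L" "vlimit v Y L'"
  shows "vlimit v (\<lambda>n. X n + Y n) (L + L')"
  unfolding vlimit_iff
proof
  fix B :: real
  obtain M where M: "\<forall>n\<ge>M. ereal B \<le> v (X n - L)" using assms(1) unfolding vlimit_iff by blast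
  obtain M' where M': "\<forall>n\<ge>M'. ereal B \<le> v (Y n - L')" using assms(2) unfolding vlimit_iff by blast
  have "ereal B \<le> v ((X n - L) + (Y n - L'))" if "n \<ge> max M M'" for n
    using M M' that by (intro v_ge_add) auto
  then show "\<exists>M. \<forall>n\<ge>M. ereal B \<le> v (X n + Y n - (L + L'))"
    by (intro exI[of _ "max M M'"]) (simp add: algebra_simps)
qed

lemma vlimit_cmult:
  assumes "vlimit v X L"
  shows "vlimit v (\<lambda>n. c * X n) (c * L)"
  unfolding vlimit_iff
proof
  fix B :: real
  obtain C where C: "C \<le> 0" "ereal C \<le> v c" by (rule v_ge_some)
  obtain M where M: "\<forall>n\<ge>M. ereal (B - C) \<le> v (X n - L)" using assms unfolding vlimit_iff by blast
  have "ereal B \<le> v (c * (X n - L))" if "n \<ge> M" for n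
    using v_ge_mult[OF C(2), of "B - C" "X n - L"] M that by simp
  then show "\<exists>M. \<forall>n\<ge>M. ereal B \<le> v (c * X n - c * L)"
    by (auto simp: algebra_simps)
qed

lemma vlimit_diff:
  assumes "vlimit v X L" "vlimit v Y L'"
  shows "vlimit v (\<lambda>n. X n - Y n) (L - L')"
  using vlimit_add[OF assms(1) vlimit_cmult[OF assms(2), of "-1"]] by simp

lemma vlimit_const: "vlimit v (\<lambda>n. c) c"
  by (simp add: vlimit_iff)

lemma vlimit_ge:
  assumes "vlimit v X L" "\<And>n. n \<ge> M \<Longrightarrow> ereal B \<le> v (X n)"
  shows "ereal B \<le> v L"
proof -
  obtain M' where M': "\<forall>n\<ge>M'. ereal B \<le> v (X n - L)" using assms(1) unfolding vlimit_iff by blast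
  have "ereal B \<le> v (X (max M M') - (X (max M M') - L))"
    by (rule v_ge_diff) (use M' assms(2) in auto)
  then show ?thesis by simp
qed

lemma vlimit_mult:
  assumes "vlimit v X L" "vlimit v Y L'"
  shows "vlimit v (\<lambda>n. X n * Y n) (L * L')"
  unfolding vlimit_iff
proof
  fix B :: real
  obtain C where C: "C \<le> 0" "ereal C \<le> v L" by (rule v_ge_some)
  obtain C' where C': "C' \<le> 0" "ereal C' \<le> v L'" by (rule v_ge_some)
  obtain M where M: "\<forall>n\<ge>M. ereal (max 0 (B - C')) \<le> v (X n - L)"
    using assms(1) unfolding vlimit_iff by blast
  obtain M' where M': "\<forall>n\<ge>M'. ereal (max 0 (B - C) + max 0 B) \<le> v (Y n - L')"
    using assms(2) unfolding vlimit_iff by blast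
  have "ereal B \<le> v ((X n - L) * (Y n - L') + ((X n - L) * L' + L * (Y n - L')))"
    if "n \<ge> max M M'" for n
  proof -
    have x: "ereal (max 0 (B - C')) \<le> v (X n - L)"
      and y: "ereal (max 0 (B - C) + max 0 B) \<le> v (Y n - L')" using M M' that by auto
    have 1: "ereal B \<le> v ((X n - L) * (Y n - L'))"
      by (rule v_ge_mono[OF v_ge_mult[OF x y]]) auto
    have 2: "ereal B \<le> v ((X n - L) * L')"
      by (rule v_ge_mono[OF v_ge_mult[OF x C'(2)]]) auto
    have 3: "ereal B \<le> v (L * (Y n - L'))"
      by (rule v_ge_mono[OF v_ge_mult[OF C(2) y]]) auto
    show ?thesis by (rule v_ge_add[OF 1 v_ge_add[OF 2 3]])
  qed
  moreover have "X n * Y n - L * L' = (X n - L) * (Y n - L') + ((X n - L) * L' + L * (Y n - L'))" for n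
    by (simp add: algebra_simps)
  ultimately show "\<exists>M. \<forall>n\<ge>M. ereal B \<le> v (X n * Y n - L * L')"
    by (intro exI[of _ "max M M'"]) simp
qed

lemma Qp_complete:
  assumes "\<And>n. X n \<in> Qp v" "vCauchy v X"
  obtains L where "L \<in> Qp v" "vlimit v X L"
  using closure assms unfolding is_padic_closure_def by blast

text \<open>In an ultrametric the distance of two terms is at most the largest step between them, so
  consecutive differences suffice.\<close>

lemma vCauchy_if_steps:
  assumes "\<And>B::real. \<exists>M. \<forall>n\<ge>M. ereal B \<le> v (X (Suc n) - X n)"
  shows "vCauchy v X"
  unfolding vCauchy_def
proof
  fix B :: real
  obtain M where M: "\<And>n. n \<ge> M \<Longrightarrow> ereal B \<le> v (X (Suc n) - X n)" using assms by blast
  have 1: "ereal B \<le> v (X n - X M)" if "n \<ge> M" for n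
    using that
  proof (induction n rule: dec_induct)
    case (step n)
    then show ?case using v_ge_add[OF step.IH M[OF step.hyps(1)]] by simp
  qed simp
  have "ereal B \<le> v (X m - X n)" if "m \<ge> M" "n \<ge> M" for m n
    using v_ge_diff[OF 1[OF that(1)] 1[OF that(2)]] by simp
  then show "\<exists>M. \<forall>m\<ge>M. \<forall>n\<ge>M. ereal B \<le> v (X m - X n)" by blast
qed

lemma vsums_exists:
  assumes "\<And>i. c i \<in> Qp v" "(\<lambda>i. v (c i)) \<longlonglongrightarrow> \<infinity>"
  obtains S where "S \<in> Qp v" "vsums v c S"
proof -
  have "vCauchy v (\<lambda>n. \<Sum>i<n. c i)"
    using assms(2) by (intro vCauchy_if_steps) (auto simp: tendsto_infinity_iff)
  then show ?thesis
    using Qp_complete[of "\<lambda>n. \<Sum>i<n. c i"] that assms(1) unfolding vsums_def by (auto intro: Qp_sum)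
qed

lemma vsums_unique: "vsums v c S \<Longrightarrow> vsums v c S' \<Longrightarrow> S = S'"
  unfolding vsums_def by (rule vlimit_unique)

lemma vsums_add: "vsums v c S \<Longrightarrow> vsums v d T \<Longrightarrow> vsums v (\<lambda>i. c i + d i) (S + T)"
  unfolding vsums_def by (drule (1) vlimit_add) (simp add: sum.distrib)

lemma vsums_diff: "vsums v c S \<Longrightarrow> vsums v d T \<Longrightarrow> vsums v (\<lambda>i. c i - d i) (S - T)"
  unfolding vsums_def by (drule (1) vlimit_diff) (simp add: sum_subtractf)

lemma vsums_cmult: "vsums v c S \<Longrightarrow> vsums v (\<lambda>i. a * c i) (a * S)"
  unfolding vsums_def by (drule vlimit_cmult[of _ _ a]) (simp add: sum_distrib_left)

lemma vsums_ge: "vsums v c S \<Longrightarrow> (\<And>i. ereal B \<le> v (c i)) \<Longrightarrow> ereal B \<le> v S"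
  unfolding vsums_def by (rule vlimit_ge[where M = 0]) (auto intro: v_ge_sum)

lemma vsums_finite:
  assumes "\<And>i. i \<ge> n \<Longrightarrow> c i = 0"
  shows "vsums v c (\<Sum>i<n. c i)"
proof -
  have "ereal B \<le> v ((\<Sum>i<m. c i) - (\<Sum>i<n. c i))" if "m \<ge> n" for m B
    using sum.mono_neutral_right[of "{..<m}" "{..<n}" c] that assms by auto
  then show ?thesis unfolding vsums_def vlimit_iff by blast
qed

lemma vsums_Suc:
  assumes "vsums v (\<lambda>i. c (Suc i)) S"
  shows "vsums v c (c 0 + S)"
  unfolding vsums_def vlimit_iff
proof
  fix B :: real
  obtain M where M: "\<forall>n\<ge>M. ereal B \<le> v ((\<Sum>i<n. c (Suc i)) - S)"
    using assms unfolding vsums_def vlimit_iff by blast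
  have "ereal B \<le> v ((\<Sum>i<n. c i) - (c 0 + S))" if n: "n \<ge> Suc M" for n
  proof -
    obtain m where m: "n = Suc m" using n Suc_le_D by blast
    have eq: "(\<Sum>i<n. c i) - (c 0 + S) = (\<Sum>i<m. c (Suc i)) - S"
      unfolding m sum.lessThan_Suc_shift by simp
    show ?thesis unfolding eq using M n m by simp
  qed
  then show "\<exists>M. \<forall>n\<ge>M. ereal B \<le> v ((\<Sum>i<n. c i) - (c 0 + S))" by blast
qed

subsection \<open>Expansions on balls\<close>

lemma ereal_le_add_iff: "ereal B \<le> x + ereal r \<longleftrightarrow> ereal (B - r) \<le> x"
  by (cases x) auto

lemma ball_expansion_iff:
  "ball_expansion v g a n c \<longleftrightarrow> (\<forall>j. c j \<in> Qp v) \<and>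
     (\<forall>B::real. \<exists>M. \<forall>j\<ge>M. ereal (B - real n * real j) \<le> v (c j)) \<and>
     (\<forall>x\<in>Qp v. ereal (real n) \<le> v (x - a) \<longrightarrow> vsums v (\<lambda>j. c j * (x - a) ^ j) (g x))"
  unfolding ball_expansion_def tendsto_infinity_iff ereal_le_add_iff ..

lemma ball_expansionI:
  assumes "\<And>j. c j \<in> Qp v"
    and "\<And>B::real. \<exists>M. \<forall>j\<ge>M. ereal (B - real n * real j) \<le> v (c j)"
    and "\<And>x. x \<in> Qp v \<Longrightarrow> ereal (real n) \<le> v (x - a) \<Longrightarrow> vsums v (\<lambda>j. c j * (x - a) ^ j) (g x)"
  shows "ball_expansion v g a n c"
  using assms unfolding ball_expansion_iff by blast

lemma ball_expansion_mono:
  assumes "ball_expansion v g a n c" "n \<le> m"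
  shows "ball_expansion v g a m c"
proof (rule ball_expansionI)
  show "c j \<in> Qp v" for j using assms(1) unfolding ball_expansion_iff by blast
  show "\<exists>M. \<forall>j\<ge>M. ereal (B - real m * real j) \<le> v (c j)" for B
  proof -
    obtain M where M: "\<And>j. j \<ge> M \<Longrightarrow> ereal (B - real n * real j) \<le> v (c j)"
      using assms(1) unfolding ball_expansion_iff by blast
    have "ereal (B - real m * real j) \<le> v (c j)" if "j \<ge> M" for j
      by (rule v_ge_mono[OF M[OF that]]) (use assms(2) in \<open>simp add: mult_right_mono\<close>)
    then show ?thesis by blast
  qed
  show "vsums v (\<lambda>j. c j * (x - a) ^ j) (g x)" if "x \<in> Qp v" "ereal (real m) \<le> v (x - a)" for x
    using assms that v_ge_mono[OF that(2), of "real n"] unfolding ball_expansion_iff by simp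
qed

lemma ball_expansion_cong:
  assumes "ball_expansion v g a n c"
    and "\<And>x. x \<in> Qp v \<Longrightarrow> ereal (real n) \<le> v (x - a) \<Longrightarrow> g' x = g x"
  shows "ball_expansion v g' a n c"
  using assms unfolding ball_expansion_iff by simp

lemma ex_lower_bound_finite:
  obtains B where "B \<le> 0" "\<And>j. j < (M::nat) \<Longrightarrow> ereal B \<le> v (f j)"
proof -
  have "\<exists>B\<le>0. \<forall>j<M. ereal B \<le> v (f j)"
  proof (induction M)
    case (Suc M)
    then obtain B where B: "B \<le> 0" "\<forall>j<M. ereal B \<le> v (f j)" by blast
    obtain C where C: "C \<le> 0" "ereal C \<le> v (f M)" by (rule v_ge_some)
    have "ereal (min B C) \<le> v (f j)" if "j < Suc M" for j
      using that B C v_ge_mono[of B "f j" "min B C"] v_ge_mono[of C "f j" "min B C"]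
      by (cases "j = M") simp_all
    then show ?case using B by (intro exI[of _ "min B C"]) auto
  qed auto
  then show ?thesis using that by blast
qed

lemma ball_expansion_bounded:
  assumes "ball_expansion v g a n c"
  obtains B where "\<And>j. ereal (B - real n * real j) \<le> v (c j)"
proof -
  obtain M where M: "\<And>j. j \<ge> M \<Longrightarrow> ereal (0 - real n * real j) \<le> v (c j)"
    using assms unfolding ball_expansion_iff by blast
  obtain B where B: "B \<le> 0" "\<And>j. j < M \<Longrightarrow> ereal B \<le> v (c j)"
    using ex_lower_bound_finite[of M c] by blast
  have "ereal (B - real n * real j) \<le> v (c j)" for j
  proof (cases "j < M")
    case True
    show ?thesis by (rule v_ge_mono[OF B(2)[OF True]]) simp
  next
    case False
    show ?thesis by (rule v_ge_mono[OF M]) (use False B(1) in auto)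
  qed
  then show ?thesis using that by blast
qed

lemma ball_expansion_add:
  assumes "ball_expansion v g a n c" "ball_expansion v h a n d"
  shows "ball_expansion v (\<lambda>x. g x + h x) a n (\<lambda>j. c j + d j)"
proof (rule ball_expansionI)
  show "c j + d j \<in> Qp v" for j using assms unfolding ball_expansion_iff by (blast intro: Qp_add)
  show "\<exists>M. \<forall>j\<ge>M. ereal (B - real n * real j) \<le> v (c j + d j)" for B
  proof -
    obtain M M' where M: "\<And>j. j \<ge> M \<Longrightarrow> ereal (B - real n * real j) \<le> v (c j)"
      "\<And>j. j \<ge> M' \<Longrightarrow> ereal (B - real n * real j) \<le> v (d j)"
      using assms unfolding ball_expansion_iff by meson
    then have "ereal (B - real n * real j) \<le> v (c j + d j)" if "j \<ge> max M M'" for j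
      using that by (intro v_ge_add) auto
    then show ?thesis by blast
  qed
  show "vsums v (\<lambda>j. (c j + d j) * (x - a) ^ j) (g x + h x)"
    if "x \<in> Qp v" "ereal (real n) \<le> v (x - a)" for x
    using vsums_add[of "\<lambda>j. c j * (x - a) ^ j" "g x" "\<lambda>j. d j * (x - a) ^ j" "h x"] assms that
    unfolding ball_expansion_iff by (simp add: distrib_right)
qed

lemma ball_expansion_cmult:
  assumes "ball_expansion v g a n c" "b \<in> Qp v"
  shows "ball_expansion v (\<lambda>x. b * g x) a n (\<lambda>j. b * c j)"
proof (rule ball_expansionI)
  show "b * c j \<in> Qp v" for j using assms unfolding ball_expansion_iff by (blast intro: Qp_mult)
  show "\<exists>M. \<forall>j\<ge>M. ereal (B - real n * real j) \<le> v (b * c j)" for B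
  proof -
    obtain C where C: "C \<le> 0" "ereal C \<le> v b" by (rule v_ge_some)
    obtain M where M: "\<And>j. j \<ge> M \<Longrightarrow> ereal (B - C - real n * real j) \<le> v (c j)"
      using assms unfolding ball_expansion_iff by blast
    have "ereal (B - real n * real j) \<le> v (b * c j)" if "j \<ge> M" for j
      using v_ge_mult[OF C(2) M[OF that]] by (simp add: algebra_simps)
    then show ?thesis by blast
  qed
  show "vsums v (\<lambda>j. (b * c j) * (x - a) ^ j) (b * g x)"
    if "x \<in> Qp v" "ereal (real n) \<le> v (x - a)" for x
    using vsums_cmult[of "\<lambda>j. c j * (x - a) ^ j" "g x" b] assms that
    unfolding ball_expansion_iff by (simp add: mult.assoc)
qed

lemma ball_expansion_diff:
  assumes "ball_expansion v g a n c" "ball_expansion v h a n d"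
  shows "ball_expansion v (\<lambda>x. g x - h x) a n (\<lambda>j. c j - d j)"
  using ball_expansion_add[OF assms(1) ball_expansion_cmult[OF assms(2), of "-1"]]
    Qp_minus[OF Qp_1] by simp

lemma ball_expansion_0: "ball_expansion v (\<lambda>x. 0) a n (\<lambda>j. 0)"
  using vsums_finite[of 0 "\<lambda>j. 0"] by (intro ball_expansionI) auto

lemma ball_expansion_power:
  "ball_expansion v (\<lambda>x. (x - a) ^ i) a n (\<lambda>j. if j = i then 1 else 0)"
proof (rule ball_expansionI)
  show "\<exists>M. \<forall>j\<ge>M. ereal (B - real n * real j) \<le> v (if j = i then 1 else 0)" for B
    by (intro exI[of _ "Suc i"]) auto
  show "vsums v (\<lambda>j. (if j = i then 1 else 0) * (x - a) ^ j) ((x - a) ^ i)" for x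
  proof -
    have "(\<Sum>j<Suc i. (if j = i then 1 else 0) * (x - a) ^ j) = (x - a) ^ i" by simp
    then show ?thesis using vsums_finite[of "Suc i" "\<lambda>j. (if j = i then 1 else 0) * (x - a) ^ j"] by simp
  qed
qed auto

lemma ball_expansion_sum:
  assumes "\<And>i. i \<in> I \<Longrightarrow> ball_expansion v (g i) a n (c i)"
  shows "ball_expansion v (\<lambda>x. \<Sum>i\<in>I. g i x) a n (\<lambda>j. \<Sum>i\<in>I. c i j)"
  using assms
  by (induction I rule: infinite_finite_induct) (auto intro: ball_expansion_0 ball_expansion_add)

text \<open>Writing x = a + (x - a) turns multiplication by x into a multiple of the coefficient
  sequence plus its shift.\<close>

lemma ball_expansion_mult_id:
  assumes "ball_expansion v g a n c" "a \<in> Qp v"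
  shows "ball_expansion v (\<lambda>x. x * g x) a n (\<lambda>j. a * c j + (if j = 0 then 0 else c (j - 1)))"
proof -
  have c: "c j \<in> Qp v" for j using assms unfolding ball_expansion_iff by blast
  have "ball_expansion v (\<lambda>x. (x - a) * g x) a n (\<lambda>j. if j = 0 then 0 else c (j - 1))"
  proof (rule ball_expansionI)
    show "(if j = 0 then 0 else c (j - 1)) \<in> Qp v" for j using c by auto
    show "\<exists>M. \<forall>j\<ge>M. ereal (B - real n * real j) \<le> v (if j = 0 then 0 else c (j - 1))" for B
    proof -
      obtain M where M: "\<And>j. j \<ge> M \<Longrightarrow> ereal (B - real n * real j) \<le> v (c j)"
        using assms unfolding ball_expansion_iff by blast
      have "ereal (B - real n * real j) \<le> v (c (j - 1))" if "j \<ge> Suc M" for j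
        by (rule v_ge_mono[OF M]) (use that in \<open>auto simp: mult_left_mono\<close>)
      then show ?thesis by (intro exI[of _ "Suc M"]) auto
    qed
    show "vsums v (\<lambda>j. (if j = 0 then 0 else c (j - 1)) * (x - a) ^ j) ((x - a) * g x)"
      if "x \<in> Qp v" "ereal (real n) \<le> v (x - a)" for x
    proof -
      have "vsums v (\<lambda>j. c j * (x - a) ^ j) (g x)"
        using assms(1) that unfolding ball_expansion_iff by blast
      then have "vsums v (\<lambda>j. (x - a) * (c j * (x - a) ^ j)) ((x - a) * g x)" by (rule vsums_cmult)
      then have "vsums v (\<lambda>i. (if Suc i = 0 then 0 else c (Suc i - 1)) * (x - a) ^ Suc i) ((x - a) * g x)"
        by (simp add: mult_ac)
      from vsums_Suc[of "\<lambda>i. (if i = 0 then 0 else c (i - 1)) * (x - a) ^ i", OF this] show ?thesis by simp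
    qed
  qed
  from ball_expansion_add[OF ball_expansion_cmult[OF assms] this] show ?thesis
    by (rule ball_expansion_cong) (simp add: algebra_simps)
qed

text \<open>Uniqueness of power series: if \<open>d i\<close> is the first nonzero coefficient, then
  at a high power y = p^N the i-th term has smaller valuation than all later ones, so the sum cannot
  be 0.\<close>

lemma vsums_powers_0:
  assumes 0: "\<And>y. y \<in> Qp v \<Longrightarrow> ereal (real n) \<le> v y \<Longrightarrow> vsums v (\<lambda>j. d j * y ^ j) 0"
    and B: "\<And>j. ereal (B - real n * real j) \<le> v (d j)"
  shows "d = (\<lambda>j. 0)"
proof (rule ccontr)
  assume "d \<noteq> (\<lambda>j. 0)"
  then have ex: "\<exists>j. d j \<noteq> 0" by auto
  define i where "i = (LEAST j. d j \<noteq> 0)"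
  have i: "d i \<noteq> 0" unfolding i_def by (rule LeastI_ex[OF ex])
  have less: "d j = 0" if "j < i" for j using not_less_Least[of j "\<lambda>j. d j \<noteq> 0"] that unfolding i_def by blast
  obtain r where r: "v (d i) = ereal r" using i by (rule v_eq_ereal)
  \<comment> \<open>For j > i the j-th term has valuation at least B + (N - n)(i + 1);
    \<open>N\<close> is chosen so that this exceeds the valuation r + N i of the i-th term by at
    least 1.\<close>
  define N where "N = n + nat \<lceil>max 0 (r + 1 - B + real n * real i)\<rceil>"
  have N: "N \<ge> n" "real N - real n \<ge> r + 1 - B + real n * real i" "real N - real n \<ge> 0"
    unfolding N_def by linarith+
  define y :: complex where "y = of_nat p ^ N"
  have y: "v y = ereal (real N)" "y \<in> Qp v" unfolding y_def by (auto simp: v_p_power intro: Qp_power)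
  have "vsums v (\<lambda>j. d j * y ^ j) 0" using 0[of y] y N by simp
  moreover have "vsums v (\<lambda>j. if j = i then d j * y ^ j else 0) (d i * y ^ i)"
    using vsums_finite[of "Suc i" "\<lambda>j. if j = i then d j * y ^ j else 0"] by simp
  ultimately have s: "vsums v (\<lambda>j. d j * y ^ j - (if j = i then d j * y ^ j else 0)) (0 - d i * y ^ i)"
    by (rule vsums_diff)
  have "ereal (r + 1 + real N * real i) \<le> v (0 - d i * y ^ i)"
  proof (rule vsums_ge[OF s])
    fix j
    show "ereal (r + 1 + real N * real i) \<le> v (d j * y ^ j - (if j = i then d j * y ^ j else 0))"
    proof (cases "j > i")
      case True
      have yj: "ereal (real j * real N) \<le> v (y ^ j)" using v_power[OF y(1), of j] by simp
      have "(real N - real n) * real (Suc i) \<le> (real N - real n) * real j"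
        using True N by (intro mult_left_mono) auto
      then have "r + 1 + real N * real i \<le> B - real n * real j + real j * real N"
        using N(2) by (simp add: algebra_simps)
      then have "ereal (r + 1 + real N * real i) \<le> v (d j * y ^ j)"
        by (rule v_ge_mono[OF v_ge_mult[OF B yj]])
      then show ?thesis using True by simp
    qed (use less in \<open>auto simp: not_less_iff_gr_or_eq\<close>)
  qed
  moreover have "v (0 - d i * y ^ i) = ereal (r + real N * real i)"
    using v_power[OF y(1), of i] r by (simp add: v_mult)
  ultimately show False by simp
qed

lemma ball_expansion_unique:
  assumes c: "ball_expansion v g a n c" and c': "ball_expansion v g a n' c'" and a: "a \<in> Qp v"
  shows "c = c'"
proof -
  define m where "m = max n n'"
  have "ball_expansion v (\<lambda>x. g x - g x) a m (\<lambda>j. c j - c' j)"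
    using ball_expansion_mono[OF c, of m] ball_expansion_mono[OF c', of m]
    by (intro ball_expansion_diff) (auto simp: m_def)
  then have d: "ball_expansion v (\<lambda>x. 0) a m (\<lambda>j. c j - c' j)" by simp
  obtain B where B: "\<And>j. ereal (B - real m * real j) \<le> v (c j - c' j)"
    using ball_expansion_bounded[OF d] by blast
  have "(\<lambda>j. c j - c' j) = (\<lambda>j. 0)"
  proof (rule vsums_powers_0[OF _ B])
    fix y assume "y \<in> Qp v" "ereal (real m) \<le> v y"
    then show "vsums v (\<lambda>j. (c j - c' j) * y ^ j) 0"
      using d a Qp_add[of a y] unfolding ball_expansion_iff by (auto dest!: bspec[of _ _ "a + y"])
  qed
  then show ?thesis by (auto simp: fun_eq_iff)
qed

text \<open>Every point of an ultrametric ball is a centre. Substituting x - a = b + (x - a') and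
  collecting powers of x - a' keeps the weighted bound, because binomial coefficients are integral
  and b lies within the radius.\<close>

lemma ball_expansion_recenter:
  assumes c: "ball_expansion v g a n c" and a: "a \<in> Qp v" and a': "a' \<in> Qp v"
    and near: "ereal (real n) \<le> v (a' - a)"
    and B: "\<And>j. ereal (B - real n * real j) \<le> v (c j)"
  obtains c' where "ball_expansion v g a' n c'" "\<And>j. ereal (B - real n * real j) \<le> v (c' j)"
proof -
  define b where "b = a' - a"
  have b: "b \<in> Qp v" "ereal (real n) \<le> v b" using a a' near by (auto simp: b_def intro: Qp_diff)
  have cQ: "c i \<in> Qp v" for i using c unfolding ball_expansion_iff by blast
  define t where "t j i = (of_nat (i choose j) * c i * b ^ (i - j))" for j i
  have tQ: "t j i \<in> Qp v" for i j unfolding t_def using cQ b by (intro Qp_mult Qp_power) auto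
  have t_ge: "ereal (R - real n * real j) \<le> v (t j i)" if "ereal (R - real n * real i) \<le> v (c i)" for R i j
  proof (cases "i < j")
    case True
    then show ?thesis by (simp add: t_def binomial_eq_0)
  next
    case False
    have 1: "ereal (0 + (R - real n * real i)) \<le> v (of_nat (i choose j) * c i)"
      by (rule v_ge_mult) (use that v_of_nat_ge in \<open>auto simp flip: zero_ereal_def\<close>)
    have "ereal (0 + (R - real n * real i) + real (i - j) * real n) \<le> v (t j i)"
      unfolding t_def by (rule v_ge_mult[OF 1 v_ge_power[OF b(2)]])
    then show ?thesis using False by (simp add: of_nat_diff algebra_simps)
  qed
  have tail: "\<exists>M. \<forall>i\<ge>M. \<forall>j. ereal (R - real n * real j) \<le> v (t j i)" for R
    using c t_ge unfolding ball_expansion_iff by meson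
  have "\<exists>S. S \<in> Qp v \<and> vsums v (t j) S" for j
  proof -
    have "(\<lambda>i. v (t j i)) \<longlonglongrightarrow> \<infinity>"
      unfolding tendsto_infinity_iff
    proof
      fix R
      obtain M where "\<forall>i\<ge>M. \<forall>j'. ereal (R + real n * real j - real n * real j') \<le> v (t j' i)"
        using tail by blast
      then have "ereal (R + real n * real j - real n * real j) \<le> v (t j i)" if "i \<ge> M" for i
        using that by blast
      then have "\<forall>i\<ge>M. ereal R \<le> v (t j i)" by simp
      then show "\<exists>M. \<forall>i\<ge>M. ereal R \<le> v (t j i)" by blast
    qed
    then show ?thesis using vsums_exists[of "t j"] tQ by blast
  qed
  then have "\<forall>j. \<exists>S. S \<in> Qp v \<and> vsums v (t j) S" by blast
  from choice[OF this] obtain c' where c': "\<And>j. c' j \<in> Qp v" "\<And>j. vsums v (t j) (c' j)" by blast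
  \<comment> \<open>Uniformly in j, replacing the new coefficients by finite partial sums costs no
    more than the tail of the double series. This takes the place of an interchange of two infinite
    summations.\<close>
  have c'_rest: "ereal (R - real n * real j) \<le> v (c' j - (\<Sum>i<I. t j i))"
    if "\<And>i j. i \<ge> I \<Longrightarrow> ereal (R - real n * real j) \<le> v (t j i)" for R I j
  proof -
    have "vsums v (\<lambda>i. if i < I then t j i else 0) (\<Sum>i<I. t j i)"
      using vsums_finite[of I "\<lambda>i. if i < I then t j i else 0"] by simp
    from vsums_ge[OF vsums_diff[OF c'(2) this]] that show ?thesis by auto
  qed
  have "ball_expansion v g a' n c'"
  proof (rule ball_expansionI)
    show "c' j \<in> Qp v" for j by (rule c'(1))
    show "\<exists>M. \<forall>j\<ge>M. ereal (R - real n * real j) \<le> v (c' j)" for R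
    proof -
      obtain M where M: "\<And>i j. i \<ge> M \<Longrightarrow> ereal (R - real n * real j) \<le> v (t j i)"
        using tail by meson
      have "ereal (R - real n * real j) \<le> v (c' j)" if "j \<ge> M" for j
      proof (rule vsums_ge[OF c'(2)])
        fix i
        show "ereal (R - real n * real j) \<le> v (t j i)"
        proof (cases "i < M")
          case True
          then show ?thesis using that by (simp add: t_def binomial_eq_0)
        qed (use M in auto)
      qed
      then show ?thesis by blast
    qed
    show "vsums v (\<lambda>j. c' j * (x - a') ^ j) (g x)" if x: "x \<in> Qp v" "ereal (real n) \<le> v (x - a')" for x
    proof -
      define y where "y = x - a'"
      have xa: "x - a = b + y" by (simp add: b_def y_def)
      have "ereal (real n) \<le> v (x - a)"
        unfolding xa using b x by (intro v_ge_add) (auto simp: y_def)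
      then have s: "vsums v (\<lambda>i. c i * (x - a) ^ i) (g x)"
        using c x unfolding ball_expansion_iff by blast
      \<comment> \<open>Binomial coefficients with j > i vanish, so the triangular sum extends to a
        square, where the two finite sums commute.\<close>
      have partial: "(\<Sum>i<I. c i * (x - a) ^ i) = (\<Sum>j<I. (\<Sum>i<I. t j i) * y ^ j)" for I
      proof -
        have "(\<Sum>i<I. c i * (x - a) ^ i) = (\<Sum>i<I. \<Sum>j<I. t j i * y ^ j)"
        proof (rule sum.cong)
          fix i assume i: "i \<in> {..<I}"
          have "c i * (x - a) ^ i = (\<Sum>j\<le>i. t j i * y ^ j)"
            unfolding xa t_def by (simp add: add.commute[of b y] binomial_ring sum_distrib_left mult_ac)
          also have "\<dots> = (\<Sum>j<I. t j i * y ^ j)"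
            using i by (intro sum.mono_neutral_left) (auto simp: t_def binomial_eq_0)
          finally show "c i * (x - a) ^ i = (\<Sum>j<I. t j i * y ^ j)" .
        qed simp
        also have "\<dots> = (\<Sum>j<I. \<Sum>i<I. t j i * y ^ j)" by (rule sum.swap)
        finally show ?thesis by (simp add: sum_distrib_right)
      qed
      have 1: "vlimit v (\<lambda>I. \<Sum>j<I. (c' j - (\<Sum>i<I. t j i)) * y ^ j) 0"
        unfolding vlimit_iff
      proof
        fix R
        obtain M where M: "\<And>i j. i \<ge> M \<Longrightarrow> ereal (R - real n * real j) \<le> v (t j i)"
          using tail by meson
        have "ereal R \<le> v (\<Sum>j<I. (c' j - (\<Sum>i<I. t j i)) * y ^ j)" if "I \<ge> M" for I
        proof (rule v_ge_sum)
          fix j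
          have 1: "ereal (R - real n * real j) \<le> v (c' j - (\<Sum>i<I. t j i))"
            by (rule c'_rest) (use M that in auto)
          have "ereal (R - real n * real j + real j * real n) \<le> v ((c' j - (\<Sum>i<I. t j i)) * y ^ j)"
            by (rule v_ge_mult[OF 1 v_ge_power]) (use x in \<open>simp add: y_def\<close>)
          then show "ereal R \<le> v ((c' j - (\<Sum>i<I. t j i)) * y ^ j)" by simp
        qed
        then show "\<exists>M. \<forall>I\<ge>M. ereal R \<le> v ((\<Sum>j<I. (c' j - (\<Sum>i<I. t j i)) * y ^ j) - 0)"
          by auto
      qed
      have "vlimit v (\<lambda>I. (\<Sum>j<I. (\<Sum>i<I. t j i) * y ^ j)) (g x)"
        using s unfolding vsums_def partial .
      from vlimit_add[OF this 1] show ?thesis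
        unfolding vsums_def by (simp add: left_diff_distrib sum_subtractf y_def)
    qed
  qed
  moreover have "ereal (B - real n * real j) \<le> v (c' j)" for j
    by (rule vsums_ge[OF c'(2) t_ge[OF B]])
  ultimately show ?thesis using that by blast
qed

lemma Zp_units_near:
  assumes "a \<in> Zp_units v" "x \<in> Qp v" "ereal (real n) \<le> v (x - a)" "n \<ge> 1"
  shows "x \<in> Zp_units v"
proof -
  have "ereal 1 \<le> v (x - a)" by (rule v_ge_mono[OF assms(3)]) (use assms(4) in auto)
  then have "v a < v (x - a)"
    using assms(1) by (cases "v (x - a)") (auto simp: Zp_units_def)
  then have "v (a + (x - a)) = v a" by (rule v_add_eq)
  then show ?thesis using assms by (simp add: Zp_units_def)
qed

text \<open>Two balls of equal radius coincide or are disjoint, so around a' the cut-off function is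
  either g, recentred, or 0.\<close>

lemma restrict_ball_expansion:
  assumes c: "ball_expansion v g a n c" and a: "a \<in> Qp v" and a': "a' \<in> Qp v"
    and B: "\<And>j. ereal (B - real n * real j) \<le> v (c j)"
  obtains c' where
    "ball_expansion v (\<lambda>x. if v (x - a) \<ge> ereal (real n) then g x else 0) a' n c'"
    "\<And>j. ereal (B - real n * real j) \<le> v (c' j)"
proof (cases "ereal (real n) \<le> v (a' - a)")
  case True
  obtain c' where c': "ball_expansion v g a' n c'" "\<And>j. ereal (B - real n * real j) \<le> v (c' j)"
    using ball_expansion_recenter[OF c a a' True B] by blast
  have "ball_expansion v (\<lambda>x. if v (x - a) \<ge> ereal (real n) then g x else 0) a' n c'"
  proof (rule ball_expansion_cong[OF c'(1)])
    fix x assume "ereal (real n) \<le> v (x - a')"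
    from v_ge_add[OF this True] show "(if v (x - a) \<ge> ereal (real n) then g x else 0) = g x" by simp
  qed
  then show ?thesis using c' that by blast
next
  case False
  have "ball_expansion v (\<lambda>x. if v (x - a) \<ge> ereal (real n) then g x else 0) a' n (\<lambda>j. 0)"
  proof (rule ball_expansion_cong[OF ball_expansion_0])
    fix x assume *: "ereal (real n) \<le> v (x - a')"
    have "\<not> ereal (real n) \<le> v (x - a)"
      using v_ge_diff[OF _ *, of "x - a"] False by auto
    then show "(if v (x - a) \<ge> ereal (real n) then g x else 0) = 0" by simp
  qed
  then show ?thesis using that by simp
qed

lemma loc_analytic_levelI:
  "(\<And>a. a \<in> Zp_units v \<Longrightarrow> \<exists>c. ball_expansion v g a n c) \<Longrightarrow> g \<in> loc_analytic_level v n"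
  by (simp add: loc_analytic_level_def)

lemma loc_analytic_level_imp: "g \<in> loc_analytic_level v n \<Longrightarrow> n \<ge> 1 \<Longrightarrow> g \<in> loc_analytic v"
  by (auto simp: loc_analytic_def)

lemma Zp_units_Qp: "a \<in> Zp_units v \<Longrightarrow> a \<in> Qp v"
  by (simp add: Zp_units_def)

subsection \<open>Binomial coefficients\<close>

lemma Qp_prod: "(\<And>i. i \<in> A \<Longrightarrow> f i \<in> Qp v) \<Longrightarrow> (\<Prod>i\<in>A. f i) \<in> Qp v"
  by (induction A rule: infinite_finite_induct) (auto intro: Qp_mult)

lemma Zp_Qp: "s \<in> Zp v \<Longrightarrow> s \<in> Qp v"
  by (simp add: Zp_def)

lemma Zp_of_nat [simp]: "of_nat m \<in> Zp v" and Zp_of_int [simp]: "of_int a \<in> Zp v"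
  and Zp_0 [simp]: "0 \<in> Zp v" and Zp_1 [simp]: "1 \<in> Zp v"
  using v_of_nat_ge v_of_int_ge by (auto simp: Zp_def)

lemma Zp_add: "s \<in> Zp v \<Longrightarrow> t \<in> Zp v \<Longrightarrow> s + t \<in> Zp v"
  by (auto simp: Zp_def intro: Qp_add v_ge_add)

lemma Zp_diff: "s \<in> Zp v \<Longrightarrow> t \<in> Zp v \<Longrightarrow> s - t \<in> Zp v"
  by (auto simp: Zp_def intro: Qp_diff v_ge_diff)

lemma gbinomial_Qp: "s \<in> Qp v \<Longrightarrow> (s gchoose i) \<in> Qp v"
  unfolding gbinomial_prod_rev
  using Qp_of_nat[of "fact i"] by (intro Qp_divide Qp_prod Qp_diff Qp_of_nat) simp_all

text \<open>A real number instead of an \<open>ereal\<close>, so that it can be subtracted and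
  summed in the estimates below.\<close>

definition fact_val :: "nat \<Rightarrow> real" where
  "fact_val i = (SOME r. v (fact i) = ereal r)"

lemma v_fact: "v (fact i) = ereal (fact_val i)"
proof -
  obtain r where "v (fact i) = ereal r" by (rule v_eq_ereal[of "fact i"]) auto
  then show ?thesis unfolding fact_val_def by (rule someI)
qed

lemma fact_val_nonneg: "0 \<le> fact_val i"
  using v_of_nat_ge[of "fact i"] v_fact[of i] by simp

text \<open>The numerators s(s - 1)...(s - i + 1) and t(t - 1)...(t - i + 1) differ by s - t times
  an integral element, by exchanging one factor after the other; dividing by i! costs
  \<open>fact_val i\<close>.\<close>

lemma v_gbinomial_diff:
  assumes s: "s \<in> Zp v" and t: "t \<in> Zp v" and R: "ereal R \<le> v (s - t)"
  shows "ereal (R - fact_val i) \<le> v ((s gchoose i) - (t gchoose i))"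
proof -
  have unit: "0 \<le> v (s - of_nat l)" "0 \<le> v (t - of_nat l)" for l
    using s t v_of_nat_ge[of l] by (auto simp: Zp_def intro: v_ge_diff)
  have tprod: "0 \<le> v (\<Prod>l = 0..<i. t - of_nat l)" for i
  proof (induction i)
    case (Suc i)
    then show ?case using v_ge_mult[of 0 _ 0] unit(2)[of i] by (simp add: zero_ereal_def)
  qed simp
  have "ereal R \<le> v ((\<Prod>l = 0..<i. s - of_nat l) - (\<Prod>l = 0..<i. t - of_nat l))"
  proof (induction i)
    case (Suc i)
    define S T where "S = (\<Prod>l = 0..<i. s - of_nat l)" and "T = (\<Prod>l = 0..<i. t - of_nat l)"
    have 1: "ereal R \<le> v ((S - T) * (s - of_nat i))"
      using v_ge_mult_left[OF Suc.IH unit(1)] by (simp add: S_def T_def)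
    have 2: "ereal R \<le> v (T * (s - t))"
      using v_ge_mult_right[OF tprod[of i] R] by (simp add: T_def)
    have "S * (s - of_nat i) - T * (t - of_nat i) = (S - T) * (s - of_nat i) + T * (s - t)"
      by (simp add: algebra_simps)
    then show ?case using v_ge_add[OF 1 2] by (simp add: S_def T_def)
  qed simp
  from v_ge_divide[OF this v_fact[of i]] show ?thesis
    by (simp add: gbinomial_prod_rev diff_divide_distrib)
qed

text \<open>If a natural number m approximates s up to the valuation of i!, the two binomial
  coefficients differ by an integral element, and that of m is an integer.\<close>

lemma v_gbinomial_ge:
  assumes "s \<in> Zp v"
  shows "0 \<le> v (s gchoose i)"
proof -
  obtain m where m: "ereal (real (nat \<lceil>fact_val i\<rceil>)) \<le> v (s - of_nat m)"
    by (rule Zp_approx_nat[OF assms])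
  have "ereal (fact_val i) \<le> v (s - of_nat m)" by (rule v_ge_mono[OF m]) linarith
  from v_gbinomial_diff[OF assms Zp_of_nat this, of i]
  have 1: "0 \<le> v ((s gchoose i) - (of_nat m gchoose i))" by (simp add: zero_ereal_def)
  have 2: "0 \<le> v (of_nat m gchoose i)"
    using v_of_nat_ge[of "m choose i"] by (simp add: binomial_gbinomial)
  from v_ge_add[OF 1 2] show ?thesis by simp
qed

text \<open>Density of the natural numbers, through which identities for integral powers pass to all
  exponents in Z_p.\<close>

lemma nat_sequence:
  assumes "s \<in> Zp v"
  obtains m :: "nat \<Rightarrow> nat" where "vlimit v (\<lambda>n. of_nat (m n)) s"
proof -
  have "\<forall>n. \<exists>m::nat. ereal (real n) \<le> v (s - of_nat m)" using Zp_approx_nat[OF assms] by blast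
  from choice[OF this] obtain m :: "nat \<Rightarrow> nat" where m: "\<And>n. ereal (real n) \<le> v (s - of_nat (m n))"
    by blast
  have "ereal B \<le> v (of_nat (m n) - s)" if "n \<ge> nat \<lceil>B\<rceil>" for B n
  proof -
    have "ereal B \<le> v (s - of_nat (m n))" by (rule v_ge_mono[OF m[of n]]) (use that in linarith)
    then show ?thesis by (simp add: v_minus_commute)
  qed
  then show ?thesis using that unfolding vlimit_iff by blast
qed

subsection \<open>Powers of one-units\<close>

definition one_units :: "complex set" where
  "one_units = {u \<in> Qp v. 1 \<le> v (u - 1)}"

lemma one_unitsD: "u \<in> one_units \<Longrightarrow> u \<in> Qp v" "u \<in> one_units \<Longrightarrow> ereal 1 \<le> v (u - 1)"
  by (auto simp: one_units_def one_ereal_def)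

lemma v_one_unit: "u \<in> one_units \<Longrightarrow> v u = 0"
  using v_add_eq[of 1 "u - 1"] by (cases "v (u - 1)") (auto simp: one_units_def one_ereal_def)

lemma one_units_1 [simp]: "1 \<in> one_units"
  by (simp add: one_units_def)

lemma one_units_mult:
  assumes "u \<in> one_units" "w \<in> one_units"
  shows "u * w \<in> one_units"
proof -
  have "ereal 1 \<le> v (u * (w - 1))"
    using v_ge_mult_right[of u 1 "w - 1"] v_one_unit[OF assms(1)] one_unitsD(2)[OF assms(2)] by simp
  from v_ge_add[OF this one_unitsD(2)[OF assms(1)]] have "ereal 1 \<le> v (u * w - 1)"
    by (simp add: algebra_simps)
  then show ?thesis using assms by (auto simp: one_units_def one_ereal_def intro: Qp_mult)
qed

lemma one_units_inverse:
  assumes "u \<in> one_units"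
  shows "inverse u \<in> one_units"
proof -
  have u: "u \<noteq> 0" "v (inverse u) = 0"
    using v_one_unit[OF assms] v_inverse_0 v_zero_nonzero by auto
  have "ereal 1 \<le> v ((1 - u) * inverse u)"
    using v_ge_mult_left[of 1 "1 - u" "inverse u"] u one_unitsD(2)[OF assms]
    by (simp add: v_minus_commute[of 1])
  then have "ereal 1 \<le> v (inverse u - 1)" using u by (simp add: field_simps)
  then show ?thesis using assms by (auto simp: one_units_def one_ereal_def intro: Qp_inverse)
qed

lemma one_units_power: "u \<in> one_units \<Longrightarrow> u ^ n \<in> one_units"
  by (induction n) (auto intro: one_units_mult)

lemma padic_power_sums:
  assumes "u \<in> one_units" "s \<in> Zp v"
  shows "vsums v (\<lambda>i. (s gchoose i) * (u - 1) ^ i) (padic_power v u s)"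
    and "padic_power v u s \<in> Qp v"
proof -
  have ge: "ereal (real i) \<le> v ((s gchoose i) * (u - 1) ^ i)" for i
    using v_ge_mult_right[OF v_gbinomial_ge[OF assms(2)] v_ge_power[OF one_unitsD(2)[OF assms(1)]], of i i]
    by simp
  have lim: "(\<lambda>i. v ((s gchoose i) * (u - 1) ^ i)) \<longlonglongrightarrow> \<infinity>"
    unfolding tendsto_infinity_iff
  proof
    fix B
    have "ereal B \<le> v ((s gchoose i) * (u - 1) ^ i)" if "i \<ge> nat \<lceil>B\<rceil>" for i
      by (rule v_ge_mono[OF ge]) (use that in linarith)
    then show "\<exists>M. \<forall>i\<ge>M. ereal B \<le> v ((s gchoose i) * (u - 1) ^ i)" by blast
  qed
  have Q: "(s gchoose i) * (u - 1) ^ i \<in> Qp v" for i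
    using assms by (intro Qp_mult gbinomial_Qp Qp_power Qp_diff) (auto dest: Zp_Qp one_unitsD)
  obtain S where S: "S \<in> Qp v" "vsums v (\<lambda>i. (s gchoose i) * (u - 1) ^ i) S"
    using vsums_exists[OF Q lim] by blast
  then have "padic_power v u s = S"
    unfolding padic_power_def by (blast intro: the_equality vsums_unique)
  then show "vsums v (\<lambda>i. (s gchoose i) * (u - 1) ^ i) (padic_power v u s)"
    and "padic_power v u s \<in> Qp v" using S by auto
qed

lemma padic_power_of_nat:
  assumes "u \<in> one_units"
  shows "padic_power v u (of_nat m) = u ^ m"
proof -
  have "(\<Sum>i<Suc m. (of_nat m gchoose i) * (u - 1) ^ i) = u ^ m"
    using binomial_ring[of "u - 1" 1 m] by (simp add: binomial_gbinomial lessThan_Suc_atMost)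
  moreover have "vsums v (\<lambda>i. (of_nat m gchoose i) * (u - 1) ^ i)
      (\<Sum>i<Suc m. (of_nat m gchoose i) * (u - 1) ^ i)"
    by (rule vsums_finite) (simp flip: binomial_gbinomial add: binomial_eq_0)
  ultimately show ?thesis
    using vsums_unique padic_power_sums(1)[OF assms Zp_of_nat] by metis
qed

text \<open>From index B on, (u - 1)^i alone makes the terms small; the finitely many others are
  continuous in the exponent.\<close>

lemma padic_power_continuous:
  assumes u: "u \<in> one_units" and s: "s \<in> Zp v" "\<And>n. t n \<in> Zp v" and lim: "vlimit v t s"
  shows "vlimit v (\<lambda>n. padic_power v u (t n)) (padic_power v u s)"
  unfolding vlimit_iff
proof
  fix B :: real
  define I where "I = nat \<lceil>B\<rceil>"
  \<comment> \<open>The sum of all \<open>fact_val i\<close> is a common bound for the denominators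
    i! with i < I.\<close>
  define R where "R = B + (\<Sum>i<I. fact_val i)"
  have R: "B \<le> R - fact_val i" if "i < I" for i
    using sum_nonneg_leq_bound[of "{..<I}" fact_val _ i] member_le_sum[of i "{..<I}" fact_val] that fact_val_nonneg
    by (simp add: R_def)
  obtain M where M: "\<forall>n\<ge>M. ereal R \<le> v (t n - s)" using lim unfolding vlimit_iff by blast
  have "ereal B \<le> v (padic_power v u (t n) - padic_power v u s)" if n: "n \<ge> M" for n
  proof (rule vsums_ge[OF vsums_diff[OF padic_power_sums(1)[OF u s(2)] padic_power_sums(1)[OF u s(1)]]])
    fix i
    have pw: "ereal (real i) \<le> v ((u - 1) ^ i)"
      using v_ge_power[OF one_unitsD(2)[OF u], of i] by simp
    have "ereal B \<le> v (((t n gchoose i) - (s gchoose i)) * (u - 1) ^ i)"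
    proof (cases "i < I")
      case True
      have "ereal (R - fact_val i) \<le> v ((t n gchoose i) - (s gchoose i))"
        using M n by (intro v_gbinomial_diff s) auto
      from v_ge_mult[OF this pw] show ?thesis
        by (rule v_ge_mono) (use R[OF True] in simp)
    next
      case False
      have "0 \<le> v ((t n gchoose i) - (s gchoose i))"
        using s by (intro v_ge_diff v_gbinomial_ge)
      from v_ge_mult_right[OF this pw] show ?thesis
        by (rule v_ge_mono) (use False in \<open>simp add: I_def; linarith\<close>)
    qed
    then show "ereal B \<le> v ((t n gchoose i) * (u - 1) ^ i - (s gchoose i) * (u - 1) ^ i)"
      by (simp add: left_diff_distrib)
  qed
  then show "\<exists>M. \<forall>n\<ge>M. ereal B \<le> v (padic_power v u (t n) - padic_power v u s)" by blast
qed

lemma padic_power_mult_base: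
  assumes "u \<in> one_units" "w \<in> one_units" "s \<in> Zp v"
  shows "padic_power v (u * w) s = padic_power v u s * padic_power v w s"
proof -
  obtain m :: "nat \<Rightarrow> nat" where m: "vlimit v (\<lambda>n. of_nat (m n)) s" by (rule nat_sequence[OF assms(3)])
  have lim: "vlimit v (\<lambda>n. x ^ m n) (padic_power v x s)" if "x \<in> one_units" for x
    using padic_power_continuous[OF that assms(3) Zp_of_nat m] padic_power_of_nat[OF that] by simp
  have "vlimit v (\<lambda>n. (u * w) ^ m n) (padic_power v u s * padic_power v w s)"
    using vlimit_mult[OF lim[OF assms(1)] lim[OF assms(2)]] by (simp add: power_mult_distrib)
  then show ?thesis using vlimit_unique lim[OF one_units_mult[OF assms(1,2)]] by blast
qed

lemma padic_power_add_nat: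
  assumes "u \<in> one_units" "s \<in> Zp v"
  shows "padic_power v u (of_nat h + s) = u ^ h * padic_power v u s"
proof -
  obtain m :: "nat \<Rightarrow> nat" where m: "vlimit v (\<lambda>n. of_nat (m n)) s" by (rule nat_sequence[OF assms(2)])
  have m': "vlimit v (\<lambda>n. of_nat (h + m n)) (of_nat h + s)"
    using vlimit_add[OF vlimit_const[of "of_nat h"] m] by simp
  have "vlimit v (\<lambda>n. u ^ (h + m n)) (padic_power v u (of_nat h + s))"
    using padic_power_continuous[OF assms(1) _ Zp_of_nat m'] padic_power_of_nat[OF assms(1)] assms(2)
    by (simp add: Zp_add del: of_nat_add)
  moreover have "vlimit v (\<lambda>n. u ^ h * u ^ m n) (u ^ h * padic_power v u s)"
    using padic_power_continuous[OF assms Zp_of_nat m] padic_power_of_nat[OF assms(1)]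
    by (intro vlimit_cmult) simp
  ultimately show ?thesis using vlimit_unique by (simp add: power_add)
qed

subsection \<open>The logarithm\<close>

text \<open>A crude bound, linear in m: since (u - 1)^m has valuation at least m, half of it is left
  for the convergence of the logarithm series, for p = 2 as well.\<close>

lemma v_of_nat_half:
  assumes "m > 0"
  obtains e where "v (of_nat m) = ereal e" "e \<le> real m / 2"
proof -
  obtain e :: nat where e: "v (of_nat m) = ereal (real e)" "int e \<le> \<lfloor>ln (real m) / ln (real p)\<rfloor>"
    using v_of_nat_le_log[OF assms] by blast
  have "real e \<le> ln (real m) / ln (real p)" using e(2) by (simp add: le_floor_iff)
  then have "real e * ln (real p) \<le> ln (real m)" using p_gt_1 by (simp add: pos_le_divide_eq)
  moreover have "real e * ln 2 \<le> real e * ln (real p)" using p_gt_1 by (intro mult_left_mono) auto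
  ultimately have "ln (2 ^ e) \<le> ln (real m)" by (simp add: ln_realpow)
  then have "2 ^ e \<le> real m" using assms by (subst (asm) ln_le_cancel_iff) auto
  moreover have "2 * real e \<le> 2 ^ e"
  proof -
    have "2 * e \<le> 2 ^ e" for e :: nat
    proof (induction e)
      case (Suc e)
      then show ?case by (cases e) auto
    qed simp
    then have "real (2 * e) \<le> real (2 ^ e)" by (rule of_nat_mono)
    then show ?thesis by simp
  qed
  ultimately have "real e \<le> real m / 2" by linarith
  then show ?thesis using that[of "real e"] e by blast
qed

lemma v_log_coeff: "ereal (- (real (Suc i) / 2)) \<le> v ((-1) ^ i / of_nat (Suc i))"
proof -
  obtain e where e: "v (of_nat (Suc i)) = ereal e" "e \<le> real (Suc i) / 2"
    by (rule v_of_nat_half[of "Suc i"]) auto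
  have "v ((-1) ^ i) = 0" by (rule v_power_0) simp
  then have "ereal (0 - e) \<le> v ((-1) ^ i / of_nat (Suc i))"
    by (intro v_ge_divide e) (simp add: zero_ereal_def)
  then show ?thesis by (rule v_ge_mono) (use e in simp)
qed

lemma padic_log_sums:
  assumes "u \<in> one_units"
  shows "vsums v (\<lambda>i. (-1) ^ i / of_nat (Suc i) * (u - 1) ^ Suc i) (padic_log v u)"
    and "padic_log v u \<in> Qp v" and "0 \<le> v (padic_log v u)"
proof -
  have ge: "ereal (real (Suc i) / 2) \<le> v ((-1) ^ i / of_nat (Suc i) * (u - 1) ^ Suc i)" for i
    by (rule v_ge_mono[OF v_ge_mult[OF v_log_coeff v_ge_power[OF one_unitsD(2)[OF assms]]]])
      (simp add: field_simps)
  have lim: "(\<lambda>i. v ((-1) ^ i / of_nat (Suc i) * (u - 1) ^ Suc i)) \<longlonglongrightarrow> \<infinity>"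
    unfolding tendsto_infinity_iff
  proof
    fix B
    have "ereal B \<le> v ((-1) ^ i / of_nat (Suc i) * (u - 1) ^ Suc i)" if i: "i \<ge> nat \<lceil>2 * B\<rceil>" for i
    proof (rule v_ge_mono[OF ge])
      have "2 * B \<le> real i" using i by linarith
      then show "B \<le> real (Suc i) / 2" by simp
    qed
    then show "\<exists>M. \<forall>i\<ge>M. ereal B \<le> v ((-1) ^ i / of_nat (Suc i) * (u - 1) ^ Suc i)" by blast
  qed
  have Q: "(-1) ^ i / of_nat (Suc i) * (u - 1) ^ Suc i \<in> Qp v" for i
    using assms by (intro Qp_mult Qp_divide Qp_power Qp_diff Qp_minus Qp_1 Qp_of_nat one_unitsD(1))
  obtain S where S: "S \<in> Qp v" "vsums v (\<lambda>i. (-1) ^ i / of_nat (Suc i) * (u - 1) ^ Suc i) S"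
    using vsums_exists[OF Q lim] by blast
  then have "vsums v (\<lambda>i. (-1) ^ i * (u - 1) ^ Suc i / of_nat (Suc i)) S" by simp
  then have "padic_log v u = S"
    unfolding padic_log_def by (blast intro: the_equality vsums_unique)
  then show 1: "vsums v (\<lambda>i. (-1) ^ i / of_nat (Suc i) * (u - 1) ^ Suc i) (padic_log v u)"
    and "padic_log v u \<in> Qp v" using S by auto
  have "ereal 0 \<le> v (padic_log v u)"
    by (rule vsums_ge[OF 1 v_ge_mono[OF ge]]) simp
  then show "0 \<le> v (padic_log v u)" by (simp add: zero_ereal_def)
qed

text \<open>The logarithm is the derivative of \<open>u\<^sup>s\<close> at \<open>s = 0\<close>, coefficient by coefficient; all its
  algebraic properties are deduced from those of integral powers in this way.\<close>

lemma power_log_coeff_bound: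
  obtains d where "d \<ge> 0" "\<And>\<delta> i. \<delta> \<in> Zp v \<Longrightarrow> \<delta> \<noteq> 0 \<Longrightarrow> ereal d \<le> v \<delta> \<Longrightarrow>
     ereal (B - real (Suc i)) \<le> v ((\<delta> gchoose Suc i) / \<delta> - (-1) ^ i / of_nat (Suc i))"
proof -
  \<comment> \<open>From \<open>I\<close> on the denominator costs at most (i + 1)/2, and B is below
    the other half of i + 1.\<close>
  define I where "I = nat \<lceil>2 * B\<rceil>"
  define d where "d = max 0 B + (\<Sum>i<I. fact_val i)"
  have d: "B \<le> d - fact_val i" if "i < I" for i
    using member_le_sum[of i "{..<I}" fact_val] that fact_val_nonneg by (simp add: d_def)
  have "ereal (B - real (Suc i)) \<le> v ((\<delta> gchoose Suc i) / \<delta> - (-1) ^ i / of_nat (Suc i))"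
    if \<delta>: "\<delta> \<in> Zp v" "\<delta> \<noteq> 0" "ereal d \<le> v \<delta>" for \<delta> i
  proof -
    obtain e where e: "v (of_nat (Suc i)) = ereal e" "e \<le> real (Suc i) / 2"
      by (rule v_of_nat_half[of "Suc i"]) auto
    have m1: "((-1::complex) gchoose i) = (-1) ^ i"
      using gbinomial_minus[of 1 i] by (simp flip: binomial_gbinomial add: of_nat_diff)
    \<comment> \<open>Absorption turns the quotient into (\<delta> - 1 choose i)/(i + 1). The
      logarithm coefficient is the value of this expression at \<delta> = 0, so only continuity of a
      binomial coefficient remains.\<close>
    have eq: "(\<delta> gchoose Suc i) / \<delta> - (-1) ^ i / of_nat (Suc i) =
        ((\<delta> - 1 gchoose i) - (-1 gchoose i)) / of_nat (Suc i)"
      unfolding m1 diff_divide_distrib gbinomial_absorption'[of "Suc i" \<delta>, OF zero_less_Suc]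
      using \<delta>(2) by simp
    have Z: "\<delta> - 1 \<in> Zp v" "-1 \<in> Zp v"
      using \<delta> Zp_diff[of \<delta> 1] Zp_diff[of 0 1] by auto
    show ?thesis
    proof (cases "i < I")
      case True
      have "ereal (d - fact_val i) \<le> v ((\<delta> - 1 gchoose i) - (-1 gchoose i))"
        using \<delta>(3) by (intro v_gbinomial_diff Z) simp
      from v_ge_divide[OF this e(1)] show ?thesis
        unfolding eq by (rule v_ge_mono) (use d[OF True] e in simp)
    next
      case False
      have "ereal 0 \<le> v ((\<delta> - 1 gchoose i) - (-1 gchoose i))"
        using v_ge_diff[OF v_gbinomial_ge[OF Z(1)] v_gbinomial_ge[OF Z(2)]] by (simp add: zero_ereal_def)
      from v_ge_divide[OF this e(1)] show ?thesis
        unfolding eq by (rule v_ge_mono) (use e False in \<open>simp add: I_def; linarith\<close>)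
    qed
  qed
  moreover have "d \<ge> 0" unfolding d_def using fact_val_nonneg by (intro add_nonneg_nonneg sum_nonneg) auto
  ultimately show ?thesis using that by blast
qed

text \<open>The coefficient bound loses i + 1 and the power (u - 1)^(i+1) restores it, whence a
  single d serves all u.\<close>

lemma padic_power_log:
  "\<exists>d\<ge>0. \<forall>\<delta>\<in>Zp v. \<forall>u\<in>one_units. \<delta> \<noteq> 0 \<longrightarrow> ereal d \<le> v \<delta> \<longrightarrow>
     ereal B \<le> v ((padic_power v u \<delta> - 1) / \<delta> - padic_log v u)"
proof -
  obtain d where d0: "d \<ge> 0" and d: "\<And>\<delta> i. \<delta> \<in> Zp v \<Longrightarrow> \<delta> \<noteq> 0 \<Longrightarrow> ereal d \<le> v \<delta> \<Longrightarrow>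
     ereal (B - real (Suc i)) \<le> v ((\<delta> gchoose Suc i) / \<delta> - (-1) ^ i / of_nat (Suc i))"
    using power_log_coeff_bound[of B] by blast
  have "ereal B \<le> v ((padic_power v u \<delta> - 1) / \<delta> - padic_log v u)"
    if \<delta>: "\<delta> \<in> Zp v" "\<delta> \<noteq> 0" "ereal d \<le> v \<delta>" and u: "u \<in> one_units" for \<delta> u
  proof -
    have "vsums v (\<lambda>i. (\<delta> gchoose i) * (u - 1) ^ i - (if i = 0 then 1 else 0))
        (padic_power v u \<delta> - 1)"
      using vsums_diff[OF padic_power_sums(1)[OF u \<delta>(1)] vsums_finite[of 1 "\<lambda>i. if i = 0 then 1 else 0"]]
      by simp
    from vsums_cmult[OF this, of "inverse \<delta>"]
    have s1: "vsums v (\<lambda>i. ((\<delta> gchoose i) * (u - 1) ^ i - (if i = 0 then 1 else 0)) / \<delta>)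
        ((padic_power v u \<delta> - 1) / \<delta>)" by (simp add: field_simps)
    have "vsums v (\<lambda>i. (if i = 0 then 0 else (-1) ^ (i - 1) / of_nat i * (u - 1) ^ i)) (padic_log v u)"
      using vsums_Suc[of "\<lambda>i. (if i = 0 then 0 else (-1) ^ (i - 1) / of_nat i * (u - 1) ^ i)"]
        padic_log_sums(1)[OF u] by simp
    from vsums_diff[OF s1 this] show ?thesis
    proof (rule vsums_ge)
      fix i
      show "ereal B \<le> v (((\<delta> gchoose i) * (u - 1) ^ i - (if i = 0 then 1 else 0)) / \<delta> -
          (if i = 0 then 0 else (-1) ^ (i - 1) / of_nat i * (u - 1) ^ i))"
      proof (cases i)
        case (Suc j)
        have "ereal B \<le> v (((\<delta> gchoose Suc j) / \<delta> - (-1) ^ j / of_nat (Suc j)) * (u - 1) ^ Suc j)"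
          by (rule v_ge_mono[OF v_ge_mult[OF d[OF \<delta>] v_ge_power[OF one_unitsD(2)[OF u]]]]) simp
        then show ?thesis unfolding Suc by (simp add: left_diff_distrib)
      qed simp
    qed
  qed
  then show ?thesis using d0 by blast
qed

text \<open>The exponents \<delta> = p^n tend to 0, and there the p-adic power is an ordinary
  power.\<close>

lemma padic_log_limit:
  assumes "u \<in> one_units"
  shows "vlimit v (\<lambda>n. (u ^ p ^ n - 1) / of_nat p ^ n) (padic_log v u)"
  unfolding vlimit_iff
proof
  fix B
  obtain d where d: "\<forall>\<delta>\<in>Zp v. \<forall>u\<in>one_units. \<delta> \<noteq> 0 \<longrightarrow> ereal d \<le> v \<delta> \<longrightarrow>
     ereal B \<le> v ((padic_power v u \<delta> - 1) / \<delta> - padic_log v u)"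
    using padic_power_log by blast
  have "ereal B \<le> v ((u ^ p ^ n - 1) / of_nat p ^ n - padic_log v u)" if "n \<ge> nat \<lceil>d\<rceil>" for n
  proof -
    have "ereal d \<le> v (of_nat (p ^ n))"
      using that by (simp add: v_p_power)
    moreover have "of_nat (p ^ n) \<noteq> (0::complex)" using p_gt_1 by simp
    ultimately have "ereal B \<le> v ((padic_power v u (of_nat (p ^ n)) - 1) / of_nat (p ^ n) - padic_log v u)"
      using bspec[OF bspec[OF d Zp_of_nat] assms] by blast
    then show ?thesis unfolding padic_power_of_nat[OF assms] by simp
  qed
  then show "\<exists>M. \<forall>n\<ge>M. ereal B \<le> v ((u ^ p ^ n - 1) / of_nat p ^ n - padic_log v u)" by blast
qed

text \<open>With q = p^n, X = (x - 1)/q and Y = (y - 1)/q one has (x y - 1)/q = X + Y + q X Y, and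
  the last term tends to 0.\<close>

lemma padic_log_mult:
  assumes u: "u \<in> one_units" and w: "w \<in> one_units"
  shows "padic_log v (u * w) = padic_log v u + padic_log v w"
proof -
  have eq: "q * ((x - 1) / q * ((y - 1) / q)) + ((x - 1) / q + (y - 1) / q) = (x * y - 1) / q"
    if "q \<noteq> 0" for q x y :: complex
    using that by (simp add: field_simps)
  have p0: "of_nat p ^ n \<noteq> (0::complex)" for n using p_gt_1 by simp
  have "vlimit v (\<lambda>n. of_nat p ^ n) 0"
    unfolding vlimit_iff
  proof
    fix B
    have "ereal B \<le> v (of_nat p ^ n - 0)" if "n \<ge> nat \<lceil>B\<rceil>" for n
      using that by (simp add: v_p_power)
    then show "\<exists>M. \<forall>n\<ge>M. ereal B \<le> v (of_nat p ^ n - 0)" by blast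
  qed
  from vlimit_mult[OF this vlimit_mult[OF padic_log_limit[OF u] padic_log_limit[OF w]]]
  have "vlimit v (\<lambda>n. of_nat p ^ n * ((u ^ p ^ n - 1) / of_nat p ^ n * ((w ^ p ^ n - 1) / of_nat p ^ n))) 0"
    by simp
  from vlimit_add[OF this vlimit_add[OF padic_log_limit[OF u] padic_log_limit[OF w]]]
  have "vlimit v (\<lambda>n. ((u * w) ^ p ^ n - 1) / of_nat p ^ n) (padic_log v u + padic_log v w)"
    unfolding eq[OF p0] by (simp add: power_mult_distrib)
  then show ?thesis using vlimit_unique padic_log_limit[OF one_units_mult[OF u w]] by blast
qed

lemma padic_log_root_of_unity:
  assumes u: "u \<in> one_units" and e: "u ^ e = 1" "e > 0"
  shows "padic_log v u = 0"
proof -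
  have 1: "padic_log v 1 = 0" using padic_log_mult[of 1 1] by simp
  have "padic_log v (u ^ n) = of_nat n * padic_log v u" for n
    by (induction n) (auto simp: 1 padic_log_mult[OF u one_units_power[OF u]] algebra_simps)
  from this[of e] show ?thesis using e 1 by simp
qed

subsection \<open>The Teichmueller character\<close>

lemma fermat_dvd: "int p dvd int t ^ p - int t"
proof (induction t)
  case 0
  then show ?case using p_gt_1 by (simp add: power_0_left)
next
  case (Suc t)
  have "(int t + 1) ^ p = (\<Sum>k\<le>p. of_nat (p choose k) * int t ^ k)"
    using binomial_ring[of "int t" 1 p] by simp
  also have "{..p} = insert 0 (insert p {0<..<p})" using p_gt_1 by auto
  also have "(\<Sum>k\<in>insert 0 (insert p {0<..<p}). of_nat (p choose k) * int t ^ k) =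
      1 + int t ^ p + (\<Sum>k\<in>{0<..<p}. of_nat (p choose k) * int t ^ k)"
    using p_gt_1 by simp
  finally have eq: "int (Suc t) ^ p - int (Suc t) =
      (int t ^ p - int t) + (\<Sum>k\<in>{0<..<p}. of_nat (p choose k) * int t ^ k)"
    by (simp add: add.commute)
  have "int p dvd (\<Sum>k\<in>{0<..<p}. of_nat (p choose k) * int t ^ k)"
  proof (intro dvd_sum dvd_mult2)
    fix k assume "k \<in> {0<..<p}"
    then have "p dvd (p choose k)" using prime_p by (intro dvd_choose_prime) auto
    then show "int p dvd int (p choose k)" by simp
  qed
  then show ?case unfolding eq by (rule dvd_add[OF Suc.IH])
qed

lemma v_power_diff:
  assumes "0 \<le> v a" "0 \<le> v b" "ereal r \<le> v (a - b)"
  shows "ereal r \<le> v (a ^ n - b ^ n)"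
proof (induction n)
  case (Suc n)
  have "0 \<le> v (b ^ n)" using v_ge_power[of 0 b n] assms(2) by (simp add: zero_ereal_def)
  have 1: "ereal r \<le> v ((a ^ n - b ^ n) * a)" by (rule v_ge_mult_left[OF Suc.IH assms(1)])
  have 2: "ereal r \<le> v (b ^ n * (a - b))" by (rule v_ge_mult_right) fact+
  have "a ^ Suc n - b ^ Suc n = (a ^ n - b ^ n) * a + b ^ n * (a - b)" by (simp add: algebra_simps)
  then show ?case using v_ge_add[OF 1 2] by simp
qed simp

text \<open>The cofactor of a - b in a^p - b^p is congruent to p b^(p-1) modulo a - b, so it
  contributes at least one more factor p.\<close>

lemma v_power_p_diff:
  assumes "0 \<le> v a" "0 \<le> v b" "ereal r \<le> v (a - b)" "1 \<le> r"
  shows "ereal (r + 1) \<le> v (a ^ p - b ^ p)"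
proof -
  have b: "0 \<le> v (b ^ n)" for n using v_ge_power[of 0 b n] assms(2) by (simp add: zero_ereal_def)
  have "(\<Sum>i<p. b ^ (p - Suc i) * a ^ i) =
      (\<Sum>i<p. b ^ (p - Suc i) * (a ^ i - b ^ i)) + (\<Sum>i<p. b ^ (p - Suc i) * b ^ i)"
    by (simp add: right_diff_distrib sum_subtractf)
  also have "(\<Sum>i<p. b ^ (p - Suc i) * b ^ i) = of_nat p * b ^ (p - 1)"
    by (simp flip: power_add)
  finally have eq: "(\<Sum>i<p. b ^ (p - Suc i) * a ^ i) =
      (\<Sum>i<p. b ^ (p - Suc i) * (a ^ i - b ^ i)) + of_nat p * b ^ (p - 1)" .
  have 1: "ereal 1 \<le> v (\<Sum>i<p. b ^ (p - Suc i) * (a ^ i - b ^ i))"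
    by (intro v_ge_sum v_ge_mult_right b v_ge_mono[OF v_power_diff[OF assms(1-3)]] assms(4))
  have 2: "ereal 1 \<le> v (of_nat p * b ^ (p - 1))"
    using v_ge_mult_left[OF _ b, of 1 "of_nat p" "p - 1"] v_p by (simp add: one_ereal_def)
  have "ereal (r + 1) \<le> v ((a - b) * (\<Sum>i<p. b ^ (p - Suc i) * a ^ i))"
    unfolding eq by (rule v_ge_mult[OF assms(3) v_ge_add[OF 1 2]])
  then show ?thesis by (simp add: power_diff_sumr2)
qed

text \<open>The number of roots of unity in Q_p, which for p = 2 is 2 and not p - 1.\<close>

definition tm_exp :: nat where "tm_exp = (if p = 2 then 2 else p - 1)"

text \<open>For p = 2 the roots 1 and -1 differ by an element of valuation 1, so valuation 2 is
  needed to tell them apart.\<close>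

definition tm_val :: real where "tm_val = (if p = 2 then 2 else 1)"

lemma tm_exp_pos: "tm_exp > 0"
  using p_gt_1 by (simp add: tm_exp_def)

lemma tm_val_bounds: "1 \<le> tm_val" "tm_val \<le> 2"
  by (auto simp: tm_val_def)

lemma teichmueller_eq:
  "teichmueller p v x = (THE w. w \<in> Qp v \<and> w ^ tm_exp = 1 \<and> ereal tm_val \<le> v (x / w - 1))"
proof -
  have "(if p = 2 then 2 else 1) = ereal tm_val"
    by (simp add: tm_val_def one_ereal_def numeral_eq_ereal)
  then show ?thesis unfolding teichmueller_def tm_exp_def by simp
qed

lemma v_root_of_unity:
  assumes "w ^ e = 1" "e > 0"
  shows "v w = 0"
proof -
  have "w \<noteq> 0" using assms by (auto simp: power_0_left)
  then obtain r where r: "v w = ereal r" by (rule v_eq_ereal)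
  then have "real e * r = 0" using v_power[OF r, of e] assms(1) by (simp add: zero_ereal_def)
  then show ?thesis using assms(2) r by (simp add: zero_ereal_def)
qed

text \<open>For odd p the sum 1 + z + ... + z^(p-2) is congruent to the unit p - 1, hence nonzero,
  while its product with z - 1 vanishes.\<close>

lemma root_of_unity_eq_1:
  assumes z: "z ^ tm_exp = 1" and near: "ereal tm_val \<le> v (z - 1)"
  shows "z = 1"
proof (cases "p = 2")
  case True
  have n: "tm_exp = 2" "tm_val = 2" unfolding tm_exp_def tm_val_def using True by auto
  have "z\<^sup>2 = 1" using z unfolding n .
  then have "z = 1 \<or> z = -1" by (simp add: power2_eq_1_iff)
  moreover have "z \<noteq> -1"
  proof
    assume "z = -1"
    then have "ereal 2 \<le> v (- of_nat p)" using near True unfolding n by simp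
    then show False using v_p by (simp only: v_minus) (simp add: one_ereal_def)
  qed
  ultimately show ?thesis by blast
next
  case False
  then have n: "tm_exp = p - 1" "tm_val = 1" unfolding tm_exp_def tm_val_def by auto
  have vz: "v z = 0" by (rule v_root_of_unity[OF z tm_exp_pos])
  have "ereal 1 \<le> v (\<Sum>i<p-1. z ^ i - 1)"
    using v_power_diff[of z 1 1] near vz n by (intro v_ge_sum) simp
  moreover have "v (of_nat (p - 1)) = 0"
  proof (rule v_of_nat_unit)
    show "\<not> p dvd p - 1"
      using p_gt_1 by (auto dest: dvd_imp_le)
  qed
  ultimately have "v (of_nat (p - 1) + (\<Sum>i<p-1. z ^ i - 1)) = 0"
    using v_add_eq[of "of_nat (p - 1)" "\<Sum>i<p-1. z ^ i - 1"]
    by (cases "v (\<Sum>i<p-1. z ^ i - 1)") auto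
  moreover have "of_nat (p - 1) + (\<Sum>i<p-1. z ^ i - 1) = (\<Sum>i<p-1. z ^ i)"
    by (simp add: sum_subtractf)
  ultimately have "(\<Sum>i<p-1. z ^ i) \<noteq> 0" by auto
  moreover have "(z - 1) * (\<Sum>i<p-1. z ^ i) = 0"
    using z n by (simp flip: power_diff_1_eq)
  ultimately show ?thesis by simp
qed

lemma vlimit_power: "vlimit v X L \<Longrightarrow> vlimit v (\<lambda>n. X n ^ e) (L ^ e)"
  by (induction e) (auto intro: vlimit_const vlimit_mult)

lemma vlimit_Suc: "vlimit v X L \<Longrightarrow> vlimit v (\<lambda>n. X (Suc n)) L"
  unfolding vlimit_iff by (meson le_SucI)

text \<open>For odd p the root is the limit of x^(p^n), whose successive terms agree to growing
  precision by Fermat's congruence and \<open>v_power_p_diff\<close>; for p = 2 it is the sign of x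
  modulo 4.\<close>

lemma teichmueller_exists:
  assumes "x \<in> Zp_units v"
  obtains w where "w \<in> Qp v" "w ^ tm_exp = 1" "ereal tm_val \<le> v (x / w - 1)"
proof -
  have x: "x \<in> Qp v" "v x = 0" "x \<in> Zp v" using assms by (auto simp: Zp_units_def Zp_def)
  have near: "ereal tm_val \<le> v (x / w - 1)" if "w ^ tm_exp = 1" "ereal tm_val \<le> v (x - w)" for w
  proof -
    have w: "v w = 0" by (rule v_root_of_unity[OF that(1) tm_exp_pos])
    then have "x / w - 1 = (x - w) / w" using v_zero_nonzero by (simp add: field_simps)
    then show ?thesis using v_divide_unit[OF w, of "x - w"] that(2) by simp
  qed
  show ?thesis
  proof (cases "p = 2")
    case True
    obtain m :: nat where m: "ereal (real 2) \<le> v (x - of_nat m)" by (rule Zp_approx_nat[OF x(3)])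
    have "odd m"
    proof
      assume "even m"
      then have "ereal (real 1) \<le> v (of_int (int m))" using True by (intro v_of_int_dvd) simp
      then have "ereal 1 \<le> v ((x - of_nat m) + of_int (int m))"
        using m by (intro v_ge_add) (auto intro: v_ge_mono)
      then show False using x by (simp add: zero_ereal_def)
    qed
    then have "4 dvd int m - 1 \<or> 4 dvd int m - (- 1)" by presburger
    then obtain w :: int where w: "w = 1 \<or> w = -1" "4 dvd int m - w" by blast
    have n: "tm_exp = 2" "tm_val = 2" unfolding tm_exp_def tm_val_def using True by auto
    have "ereal (real 2) \<le> v (of_int (int m - w))" using w True by (intro v_of_int_dvd) simp
    from v_ge_add[OF m this] have "ereal 2 \<le> v (x - of_int w)" by simp
    moreover have "(of_int w :: complex) ^ tm_exp = 1" using w(1) unfolding n by auto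
    ultimately show ?thesis using that[of "of_int w"] near[of "of_int w"] unfolding n by simp
  next
    case False
    define X where "X n = x ^ p ^ n" for n
    have X0: "v (X n) = 0" for n unfolding X_def using v_power_0[OF x(2)] .
    have base: "ereal 1 \<le> v (x ^ p - x)"
    proof -
      obtain t where t: "t < p" "1 \<le> v (x - of_nat t)" by (rule Zp_mod_p[OF x(3)])
      have 1: "ereal 1 \<le> v (x ^ p - of_nat t ^ p)"
        using t x v_of_nat_ge by (intro v_power_diff) (auto simp: one_ereal_def)
      have "ereal (real 1) \<le> v (of_int (int t ^ p - int t))"
        using fermat_dvd by (intro v_of_int_dvd) simp
      then have 2: "ereal 1 \<le> v (of_nat t ^ p - of_nat t)" by simp
      have 3: "ereal 1 \<le> v (of_nat t - x)" using t by (simp add: v_minus_commute one_ereal_def)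
      from v_ge_add[OF v_ge_add[OF 1 2] 3] show ?thesis by simp
    qed
    have step: "ereal (real n + 1) \<le> v (X (Suc n) - X n)" for n
    proof (induction n)
      case (Suc n)
      have "ereal (real n + 1 + 1) \<le> v (X (Suc n) ^ p - X n ^ p)"
        by (rule v_power_p_diff[OF _ _ Suc.IH]) (auto simp: X0)
      then show ?case by (simp add: X_def mult.commute flip: power_mult)
    qed (use base in \<open>simp add: X_def\<close>)
    have "vCauchy v X"
    proof (rule vCauchy_if_steps)
      fix B
      have "ereal B \<le> v (X (Suc n) - X n)" if "n \<ge> nat \<lceil>B\<rceil>" for n
        by (rule v_ge_mono[OF step]) (use that in linarith)
      then show "\<exists>M. \<forall>n\<ge>M. ereal B \<le> v (X (Suc n) - X n)" by blast
    qed
    then obtain w where w: "w \<in> Qp v" "vlimit v X w"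
      using Qp_complete[of X] x by (auto simp: X_def intro: Qp_power)
    have "vlimit v (\<lambda>n. X n ^ p) (w ^ p)" by (rule vlimit_power[OF w(2)])
    then have "vlimit v (\<lambda>n. X (Suc n)) (w ^ p)" by (simp add: X_def mult.commute flip: power_mult)
    then have wp: "w ^ p = w" using vlimit_Suc[OF w(2)] vlimit_unique by blast
    have Xx: "ereal 1 \<le> v (X n - x)" for n
    proof (induction n)
      case (Suc n)
      have "ereal 1 \<le> v (X (Suc n) - X n)" by (rule v_ge_mono[OF step]) simp
      from v_ge_add[OF this Suc.IH] show ?case by simp
    qed (simp add: X_def)
    have wx: "ereal 1 \<le> v (w - x)"
      by (rule vlimit_ge[OF vlimit_diff[OF w(2) vlimit_const]]) (rule Xx)
    have "w \<noteq> 0"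
    proof
      assume "w = 0"
      then show False using wx x by (simp add: zero_ereal_def)
    qed
    moreover have "w * w ^ (p - 1) = w" using wp p_gt_1 by (simp flip: power_Suc)
    ultimately have "w ^ tm_exp = 1" using False by (simp add: tm_exp_def)
    moreover have "ereal tm_val \<le> v (x - w)"
      using wx False by (simp add: tm_val_def v_minus_commute)
    ultimately show ?thesis using that[of w] w near by blast
  qed
qed

lemma teichmueller_unique:
  assumes "w ^ tm_exp = 1" "ereal tm_val \<le> v (x / w - 1)"
    and "w' ^ tm_exp = 1" "ereal tm_val \<le> v (x / w' - 1)" and x: "v x = 0"
  shows "w = w'"
proof -
  have w: "v w = 0" "v w' = 0"
    using v_root_of_unity[OF _ tm_exp_pos] assms by auto
  have nz: "w \<noteq> 0" "w' \<noteq> 0" "x \<noteq> 0" using w x v_zero_nonzero by auto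
  have "(w / w') ^ tm_exp = 1" using assms by (simp add: power_divide)
  moreover have "ereal tm_val \<le> v (w / w' - 1)"
  proof -
    have "ereal tm_val \<le> v ((x / w' - 1) - (x / w - 1))" by (rule v_ge_diff[OF assms(4,2)])
    moreover have "v (x / w) = 0" using v_divide_unit[OF w(1)] x by simp
    ultimately have "ereal tm_val \<le> v (((x / w' - 1) - (x / w - 1)) / (x / w))"
      by (simp only: v_divide_unit)
    also have "((x / w' - 1) - (x / w - 1)) / (x / w) = w / w' - 1"
      using nz by (simp add: field_simps)
    finally show ?thesis .
  qed
  ultimately have "w / w' = 1" by (rule root_of_unity_eq_1)
  then show ?thesis using nz by simp
qed

lemma teichmueller_props:
  assumes "x \<in> Zp_units v"
  shows "teichmueller p v x \<in> Qp v" "teichmueller p v x ^ tm_exp = 1"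
    "ereal tm_val \<le> v (x / teichmueller p v x - 1)" "v (teichmueller p v x) = 0"
proof -
  obtain w where w: "w \<in> Qp v" "w ^ tm_exp = 1" "ereal tm_val \<le> v (x / w - 1)"
    by (rule teichmueller_exists[OF assms])
  have "teichmueller p v x = w"
    unfolding teichmueller_eq
  proof (rule the_equality)
    show "w \<in> Qp v \<and> w ^ tm_exp = 1 \<and> ereal tm_val \<le> v (x / w - 1)" using w by blast
    show "w' = w" if "w' \<in> Qp v \<and> w' ^ tm_exp = 1 \<and> ereal tm_val \<le> v (x / w' - 1)" for w'
      by (rule teichmueller_unique[of _ x]) (use that w assms in \<open>simp_all add: Zp_units_def\<close>)
  qed
  then show "teichmueller p v x \<in> Qp v" "teichmueller p v x ^ tm_exp = 1"
    "ereal tm_val \<le> v (x / teichmueller p v x - 1)" "v (teichmueller p v x) = 0"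
    using w v_root_of_unity[OF w(2) tm_exp_pos] by auto
qed

text \<open>Closeness 2 covers both values of \<open>tm_val\<close>, which is why the powers are
  expanded on balls of level 2 whatever p is.\<close>

lemma teichmueller_locally_constant:
  assumes a: "a \<in> Zp_units v" and x: "x \<in> Zp_units v" and near: "ereal 2 \<le> v (x - a)"
  shows "teichmueller p v x = teichmueller p v a"
proof (rule teichmueller_unique[of _ x])
  let ?w = "teichmueller p v a"
  note w = teichmueller_props[OF a]
  have "ereal tm_val \<le> v ((x - a) / ?w)"
    using v_ge_mono[OF near tm_val_bounds(2)] v_divide_unit[OF w(4)] by simp
  from v_ge_add[OF this w(3)] show "ereal tm_val \<le> v (x / ?w - 1)"
    by (simp add: diff_divide_distrib)
qed (use teichmueller_props a x in \<open>auto simp: Zp_units_def\<close>)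

lemma angle_one_unit: "x \<in> Zp_units v \<Longrightarrow> angle p v x \<in> one_units"
  using teichmueller_props[of x] v_ge_mono[OF _ tm_val_bounds(1)]
  by (auto simp: angle_def one_units_def one_ereal_def Zp_units_def intro: Qp_divide)

lemma teichmueller_mult_angle: "x \<in> Zp_units v \<Longrightarrow> teichmueller p v x * angle p v x = x"
  using teichmueller_props(4)[of x] v_zero_nonzero by (simp add: angle_def)

lemma divide_one_unit:
  assumes a: "a \<in> Zp_units v" and x: "x \<in> Qp v" "ereal (real n) \<le> v (x - a)" "n \<ge> 1"
  shows "x / a \<in> one_units"
proof -
  have a0: "v a = 0" "a \<noteq> 0" using a v_zero_nonzero by (auto simp: Zp_units_def)
  have "ereal 1 \<le> v ((x - a) / a)"
    unfolding v_divide_unit[OF a0(1)] by (rule v_ge_mono[OF x(2)]) (use x in simp)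
  then show ?thesis
    using a x a0 by (auto simp: one_units_def diff_divide_distrib one_ereal_def Zp_units_def intro: Qp_divide)
qed

text \<open>The quotient of <x> by <a> (x/a) is a root of unity, which the logarithm kills. So the
  logarithm is analytic on balls of level 1 even for p = 2, where the Teichmueller character is not
  constant on them.\<close>

lemma padic_log_angle:
  assumes a: "a \<in> Zp_units v" and x: "x \<in> Qp v" "ereal (real n) \<le> v (x - a)" "n \<ge> 1"
  shows "padic_log v (angle p v x) = padic_log v (angle p v a) + padic_log v (x / a)"
proof -
  have xu: "x \<in> Zp_units v" by (rule Zp_units_near[OF a x])
  define z where "z = angle p v x * (inverse (angle p v a) * inverse (x / a))"
  note xa = divide_one_unit[OF a x]
  note mem = one_units_inverse one_units_mult angle_one_unit[OF a] angle_one_unit[OF xu] xa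
  have z: "z \<in> one_units" unfolding z_def by (intro mem)
  have nz: "x \<noteq> 0" "a \<noteq> 0" "teichmueller p v a \<noteq> 0" "teichmueller p v x \<noteq> 0"
    using a xu teichmueller_props(4) v_zero_nonzero by (auto simp: Zp_units_def)
  have "z = teichmueller p v a / teichmueller p v x"
    unfolding z_def angle_def using nz by (simp add: field_simps)
  then have "z ^ tm_exp = 1"
    using teichmueller_props(2)[OF a] teichmueller_props(2)[OF xu] by (simp add: power_divide)
  then have "padic_log v z = 0" by (rule padic_log_root_of_unity[OF z _ tm_exp_pos])
  moreover have "angle p v x = z * (angle p v a * (x / a))"
    unfolding z_def angle_def using nz by (simp add: field_simps)
  ultimately show ?thesis
    using padic_log_mult[OF z one_units_mult[OF angle_one_unit[OF a] xa]]
      padic_log_mult[OF angle_one_unit[OF a] xa] by simp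
qed

subsection \<open>Expansions of the logarithm and of the powers\<close>

lemma v_zp_unit: "a \<in> Zp_units v \<Longrightarrow> v a = 0"
  by (simp add: Zp_units_def)

text \<open>On the ball x/a - 1 = (x - a)/a, and the remaining summand log <a> is constant. The
  coefficients lose at most j/2, less than the n j granted by the radius.\<close>

lemma ball_expansion_log:
  assumes a: "a \<in> Zp_units v" and n: "n \<ge> 1"
  shows "ball_expansion v (\<lambda>x. padic_log v (angle p v x)) a n
    (\<lambda>j. if j = 0 then padic_log v (angle p v a) else (-1) ^ (j - 1) / of_nat j / a ^ j)"
    (is "ball_expansion v ?g a n ?c")
proof (rule ball_expansionI)
  have aQ: "a \<in> Qp v" and va: "v a = 0" using a by (auto simp: Zp_units_def)
  have a0: "a \<noteq> 0" using va v_zero_nonzero by blast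
  have vp: "v (a ^ j) = 0" for j by (rule v_power_0[OF va])
  show "?c j \<in> Qp v" for j
    using padic_log_sums(2)[OF angle_one_unit[OF a]] Qp_minus[OF Qp_1]
    by (auto intro!: Qp_divide Qp_mult Qp_power aQ)
  have ge: "ereal (- (real j / 2)) \<le> v (?c j)" for j
  proof (cases j)
    case 0
    then show ?thesis using padic_log_sums(3)[OF angle_one_unit[OF a]] by (simp add: zero_ereal_def)
  next
    case (Suc i)
    then show ?thesis using v_log_coeff[of i] by (simp only: v_divide_unit[OF vp] nat.simps diff_Suc_1 if_False)
  qed
  show "\<exists>M. \<forall>j\<ge>M. ereal (B - real n * real j) \<le> v (?c j)" for B
  proof -
    have "ereal (B - real n * real j) \<le> v (?c j)" if j: "j \<ge> nat \<lceil>2 * B\<rceil>" for j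
    proof (rule v_ge_mono[OF ge])
      have "2 * B \<le> real j" using j by linarith
      moreover have "real j \<le> real n * real j" using n mult_right_mono[of 1 "real n" "real j"] by simp
      ultimately show "B - real n * real j \<le> - (real j / 2)" by linarith
    qed
    then show ?thesis by blast
  qed
  show "vsums v (\<lambda>j. ?c j * (x - a) ^ j) (?g x)" if x: "x \<in> Qp v" "ereal (real n) \<le> v (x - a)" for x
  proof -
    have eq: "x / a - 1 = (x - a) / a" using a0 by (simp add: field_simps)
    have "vsums v (\<lambda>i. (-1) ^ i / of_nat (Suc i) * (x / a - 1) ^ Suc i) (padic_log v (x / a))"
      by (rule padic_log_sums(1)[OF divide_one_unit[OF a x n]])
    then have "vsums v (\<lambda>i. ?c (Suc i) * (x - a) ^ Suc i) (padic_log v (x / a))"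
      unfolding eq power_divide by simp
    from vsums_Suc[of "\<lambda>j. ?c j * (x - a) ^ j", OF this] show ?thesis
      by (simp add: padic_log_angle[OF a x n])
  qed
qed

text \<open>Neither multiplication by the unit a nor the shift of indices lowers the weighted bound,
  the radius being at most 1.\<close>

lemma ball_expansion_power_mult:
  assumes c: "ball_expansion v g a n c" and a: "a \<in> Zp_units v"
    and B: "\<And>j. ereal (B - real n * real j) \<le> v (c j)"
  shows "\<exists>c'. ball_expansion v (\<lambda>x. x ^ h * g x) a n c' \<and> (\<forall>j. ereal (B - real n * real j) \<le> v (c' j))"
proof (induction h)
  case 0
  then show ?case using c B by auto
next
  case (Suc h)
  then obtain c' where c': "ball_expansion v (\<lambda>x. x ^ h * g x) a n c'"
    "\<And>j. ereal (B - real n * real j) \<le> v (c' j)" by blast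
  have "ball_expansion v (\<lambda>x. x ^ Suc h * g x) a n (\<lambda>j. a * c' j + (if j = 0 then 0 else c' (j - 1)))"
    using ball_expansion_mult_id[OF c'(1) Zp_units_Qp[OF a]] by (simp add: mult.assoc)
  moreover have "ereal (B - real n * real j) \<le> v (a * c' j + (if j = 0 then 0 else c' (j - 1)))" for j
  proof (rule v_ge_add)
    show "ereal (B - real n * real j) \<le> v (a * c' j)"
      by (rule v_ge_mult_right[OF _ c'(2)]) (simp add: v_zp_unit[OF a])
    show "ereal (B - real n * real j) \<le> v (if j = 0 then 0 else c' (j - 1))"
    proof (cases j)
      case (Suc i)
      have "ereal (B - real n * real j) \<le> v (c' i)"
        by (rule v_ge_mono[OF c'(2)]) (simp add: Suc algebra_simps)
      then show ?thesis using Suc by simp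
    qed simp
  qed
  ultimately show ?case by blast
qed

text \<open>Multiplying by \<open>x\<close> combines adjacent coefficients, so the bound for \<open>j = 1, 2, \<dots>\<close> in the case
  \<open>h = 0\<close> survives for the indices \<open>j > h\<close>.\<close>

lemma ball_expansion_power_log:
  assumes a: "a \<in> Zp_units v" and n: "n \<ge> 1"
  shows "\<exists>c. ball_expansion v (\<lambda>x. x ^ h * padic_log v (angle p v x)) a n c \<and>
    (\<forall>j>h. ereal (- of_int \<lfloor>ln (real j) / ln (real p)\<rfloor>) \<le> v (c j))"
proof (induction h)
  case 0
  let ?c = "\<lambda>j. if j = 0 then padic_log v (angle p v a) else (-1) ^ (j - 1) / of_nat j / a ^ j"
  have "ereal (- of_int \<lfloor>ln (real j) / ln (real p)\<rfloor>) \<le> v (?c j)" if j: "j > 0" for j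
  proof -
    obtain e where e: "v (of_nat j) = ereal (real e)" "int e \<le> \<lfloor>ln (real j) / ln (real p)\<rfloor>"
      by (rule v_of_nat_le_log[OF j])
    have "v ((-1) ^ (j - 1)) = ereal 0" using v_power_0[of "-1" "j - 1"] by (simp add: zero_ereal_def)
    from v_divide[OF this e(1)] have "v ((-1) ^ (j - 1) / of_nat j / a ^ j) = ereal (- real e)"
      unfolding v_divide_unit[OF v_power_0[OF v_zp_unit[OF a]]] by simp
    then have "v (?c j) = ereal (- real e)" using j by simp
    moreover have "- of_int \<lfloor>ln (real j) / ln (real p)\<rfloor> \<le> - real e" using e(2) by linarith
    ultimately show ?thesis by simp
  qed
  then show ?case using ball_expansion_log[OF a n] by (intro exI[of _ ?c]) simp
next
  case (Suc h)
  let ?L = "\<lambda>j. \<lfloor>ln (real j) / ln (real p)\<rfloor>"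
  obtain c where c: "ball_expansion v (\<lambda>x. x ^ h * padic_log v (angle p v x)) a n c"
    "\<And>j. j > h \<Longrightarrow> ereal (- of_int (?L j)) \<le> v (c j)" using Suc.IH by blast
  let ?c = "\<lambda>j. a * c j + (if j = 0 then 0 else c (j - 1))"
  have "ereal (- of_int (?L j)) \<le> v (?c j)" if j: "j > Suc h" for j
  proof (rule v_ge_add)
    show "ereal (- of_int (?L j)) \<le> v (a * c j)"
      using v_zp_unit[OF a] j by (intro v_ge_mult_right c(2)) auto
    have "ln (real (j - 1)) / ln (real p) \<le> ln (real j) / ln (real p)"
      using j p_gt_1 by (intro divide_right_mono) auto
    then have "?L (j - 1) \<le> ?L j" by (rule floor_mono)
    then have "ereal (- of_int (?L j)) \<le> v (c (j - 1))"
      using j by (intro v_ge_mono[OF c(2)]) auto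
    then show "ereal (- of_int (?L j)) \<le> v (if j = 0 then 0 else c (j - 1))" by simp
  qed
  moreover have "ball_expansion v (\<lambda>x. x ^ Suc h * padic_log v (angle p v x)) a n ?c"
    using ball_expansion_mult_id[OF c(1) Zp_units_Qp[OF a]] by (simp add: mult.assoc)
  ultimately show ?case by (intro exI[of _ ?c]) simp
qed

lemma angle_near:
  assumes a: "a \<in> Zp_units v" and x: "x \<in> Qp v" "ereal (real 2) \<le> v (x - a)"
  shows "angle p v x = angle p v a * (x / a)"
proof -
  have xu: "x \<in> Zp_units v" by (rule Zp_units_near[OF a x]) simp
  have "teichmueller p v x = teichmueller p v a"
    using teichmueller_locally_constant[OF a xu] x by simp
  moreover have "a \<noteq> 0" using v_zp_unit[OF a] v_zero_nonzero by blast
  ultimately show ?thesis by (simp add: angle_def)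
qed

lemma v_padic_power: "u \<in> one_units \<Longrightarrow> s \<in> Zp v \<Longrightarrow> 0 \<le> v (padic_power v u s)"
proof -
  assume u: "u \<in> one_units" and s: "s \<in> Zp v"
  have "ereal 0 \<le> v ((s gchoose i) * (u - 1) ^ i)" for i
  proof (rule v_ge_mult_left)
    show "ereal 0 \<le> v (s gchoose i)" using v_gbinomial_ge[OF s] by (simp add: zero_ereal_def)
    show "0 \<le> v ((u - 1) ^ i)"
      using v_ge_mono[OF v_ge_power[OF one_unitsD(2)[OF u]], of 0 i] by (simp add: zero_ereal_def)
  qed
  from vsums_ge[OF padic_power_sums(1)[OF u s] this] show ?thesis by (simp add: zero_ereal_def)
qed

lemma ball_expansion_padic_power:
  assumes a: "a \<in> Zp_units v" and s: "s \<in> Zp v"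
  shows "ball_expansion v (\<lambda>x. padic_power v (angle p v x) s) a 2
    (\<lambda>j. padic_power v (angle p v a) s * (s gchoose j) / a ^ j)" (is "ball_expansion v ?g a 2 ?c")
proof (rule ball_expansionI)
  have aQ: "a \<in> Qp v" and va: "v a = 0" using a by (auto simp: Zp_units_def)
  have a0: "a \<noteq> 0" using va v_zero_nonzero by blast
  note P = padic_power_sums[OF angle_one_unit[OF a] s]
  show "?c j \<in> Qp v" for j
    using P s by (intro Qp_divide Qp_mult Qp_power aQ gbinomial_Qp) (auto dest: Zp_Qp)
  have ge: "ereal 0 \<le> v (?c j)" for j
    unfolding v_divide_unit[OF v_power_0[OF va]]
    using v_padic_power[OF angle_one_unit[OF a] s] v_gbinomial_ge[OF s, of j]
    by (intro v_ge_mult_left) (auto simp: zero_ereal_def)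
  show "\<exists>M. \<forall>j\<ge>M. ereal (B - real 2 * real j) \<le> v (?c j)" for B
  proof -
    have "ereal (B - real 2 * real j) \<le> v (?c j)" if j: "j \<ge> nat \<lceil>B\<rceil>" for j
    proof (rule v_ge_mono[OF ge])
      have "B \<le> real j" using j by linarith
      then show "B - real 2 * real j \<le> 0" by simp
    qed
    then show ?thesis by blast
  qed
  show "vsums v (\<lambda>j. ?c j * (x - a) ^ j) (?g x)" if x: "x \<in> Qp v" "ereal (real 2) \<le> v (x - a)" for x
  proof -
    have eq: "x / a - 1 = (x - a) / a" using a0 by (simp add: field_simps)
    have xa: "x / a \<in> one_units" by (rule divide_one_unit[OF a x]) simp
    from vsums_cmult[OF padic_power_sums(1)[OF xa s], of "padic_power v (angle p v a) s"]
    show ?thesis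
      unfolding angle_near[OF a x] padic_power_mult_base[OF angle_one_unit[OF a] xa s] eq power_divide
      by (simp add: mult_ac)
  qed
qed

text \<open>The difference quotients of <x>^s at s = 0 converge to log <x> in the norm of level 2,
  uniformly over all centres. This is the form of convergence that a distribution respects.\<close>

lemma ball_expansion_difference_quotient:
  "\<exists>d\<ge>0. \<forall>\<delta>\<in>Zp v. \<delta> \<noteq> 0 \<longrightarrow> ereal d \<le> v \<delta> \<longrightarrow> (\<forall>a\<in>Zp_units v. \<exists>c.
     ball_expansion v (\<lambda>x. (padic_power v (angle p v x) \<delta> - 1) / \<delta> - padic_log v (angle p v x)) a 2 c \<and>
     (\<forall>j. ereal (B - real 2 * real j) \<le> v (c j)))"
proof -
  define B' where "B' = max 0 B"
  obtain d1 where d1: "d1 \<ge> 0" "\<And>\<delta> i. \<delta> \<in> Zp v \<Longrightarrow> \<delta> \<noteq> 0 \<Longrightarrow> ereal d1 \<le> v \<delta> \<Longrightarrow>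
     ereal (B' - real (Suc i)) \<le> v ((\<delta> gchoose Suc i) / \<delta> - (-1) ^ i / of_nat (Suc i))"
    using power_log_coeff_bound[of B'] by blast
  obtain d2 where d2: "d2 \<ge> 0" "\<forall>\<delta>\<in>Zp v. \<forall>u\<in>one_units. \<delta> \<noteq> 0 \<longrightarrow> ereal d2 \<le> v \<delta> \<longrightarrow>
     ereal B' \<le> v ((padic_power v u \<delta> - 1) / \<delta> - padic_log v u)"
    using padic_power_log by blast
  define d where "d = max (max d1 d2) B'"
  have "\<exists>c. ball_expansion v (\<lambda>x. (padic_power v (angle p v x) \<delta> - 1) / \<delta> - padic_log v (angle p v x)) a 2 c \<and>
     (\<forall>j. ereal (B - real 2 * real j) \<le> v (c j))"
    if \<delta>: "\<delta> \<in> Zp v" "\<delta> \<noteq> 0" "ereal d \<le> v \<delta>" and a: "a \<in> Zp_units v" for \<delta> a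
  proof -
    define P where "P = padic_power v (angle p v a) \<delta>"
    define L where "L = padic_log v (angle p v a)"
    have vap: "v (a ^ j) = 0" for j by (rule v_power_0[OF v_zp_unit[OF a]])
    note au = angle_one_unit[OF a]
    have vd: "ereal d1 \<le> v \<delta>" "ereal d2 \<le> v \<delta>" "ereal B' \<le> v \<delta>"
      by (rule v_ge_mono[OF \<delta>(3)], simp add: d_def)+
    have B0: "ereal B' \<le> v ((P - 1) / \<delta> - L)"
      using d2(2) \<delta> vd au unfolding P_def L_def by blast
    have "ereal 0 \<le> v ((P - 1) / \<delta> - L)" by (rule v_ge_mono[OF B0]) (simp add: B'_def)
    moreover have "ereal 0 \<le> v L"
      using padic_log_sums(3)[OF au] by (simp add: L_def zero_ereal_def)
    ultimately have "ereal 0 \<le> v ((P - 1) / \<delta> - L + L)" by (rule v_ge_add)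
    \<comment> \<open>(P - 1)/\<delta> is integral, being close to log <a>, so P - 1 is as small as
      \<delta>.\<close>
    from v_ge_mult[OF this vd(3)] have P1: "ereal B' \<le> v (P - 1)" using \<delta>(2) by simp
    have P0: "0 \<le> v P" unfolding P_def by (rule v_padic_power[OF au \<delta>(1)])
    define c where "c j = inverse \<delta> * (P * (\<delta> gchoose j) / a ^ j - (if j = 0 then 1 else 0))
        - (if j = 0 then L else (-1) ^ (j - 1) / of_nat j / a ^ j)" for j
    have "ball_expansion v (\<lambda>x. padic_power v (angle p v x) \<delta> - 1) a 2
        (\<lambda>j. P * (\<delta> gchoose j) / a ^ j - (if j = 0 then 1 else 0))"
      using ball_expansion_diff[OF ball_expansion_padic_power[OF a \<delta>(1)] ball_expansion_power[of a 0 2]]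
      by (simp add: P_def)
    from ball_expansion_diff[OF ball_expansion_cmult[OF this Qp_inverse[OF Zp_Qp[OF \<delta>(1)]]]
        ball_expansion_log[OF a, of 2]]
    have "ball_expansion v (\<lambda>x. inverse \<delta> * (padic_power v (angle p v x) \<delta> - 1) - padic_log v (angle p v x)) a 2 c"
      unfolding c_def L_def by simp
    then have "ball_expansion v (\<lambda>x. (padic_power v (angle p v x) \<delta> - 1) / \<delta> - padic_log v (angle p v x)) a 2 c"
      by (simp add: divide_inverse mult.commute)
    moreover have "ereal (B - real 2 * real j) \<le> v (c j)" for j
    proof (cases j)
      case 0
      have "c 0 = (P - 1) / \<delta> - L" by (simp add: c_def divide_inverse mult.commute)
      then show ?thesis using v_ge_mono[OF B0, of B] 0 by (simp add: B'_def)
    next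
      case (Suc i)
      let ?q = "(\<delta> gchoose Suc i) / \<delta> - (-1) ^ i / of_nat (Suc i)"
      \<comment> \<open>P is close to 1, so the coefficient splits into P times the error of the
        binomial quotient and P - 1 times a logarithm coefficient.\<close>
      have c: "c (Suc i) = (P * ?q + (P - 1) * ((-1) ^ i / of_nat (Suc i))) / a ^ Suc i"
        unfolding c_def using \<delta>(2)
        by (simp add: diff_divide_distrib add_divide_distrib ring_distribs divide_inverse mult_ac)
      have "ereal (B' - real (Suc i)) \<le> v (P * ?q)"
        by (rule v_ge_mult_right[OF P0 d1(2)[OF \<delta>(1,2) vd(1)]])
      then have 1: "ereal (B' - 2 * real (Suc i)) \<le> v (P * ?q)" by (rule v_ge_mono) simp
      have 2: "ereal (B' - 2 * real (Suc i)) \<le> v ((P - 1) * ((-1) ^ i / of_nat (Suc i)))"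
        by (rule v_ge_mono[OF v_ge_mult[OF P1 v_log_coeff]]) (simp add: field_simps)
      have "ereal (B' - 2 * real (Suc i)) \<le> v (c (Suc i))"
        unfolding c v_divide_unit[OF vap] by (rule v_ge_add[OF 1 2])
      then have "ereal (B - 2 * real (Suc i)) \<le> v (c (Suc i))" by (rule v_ge_mono) (simp add: B'_def)
      then show ?thesis using Suc by simp
    qed
    ultimately show ?thesis by blast
  qed
  moreover have "d \<ge> 0" using d1 by (simp add: d_def)
  ultimately show ?thesis by blast
qed

subsection \<open>Distributions\<close>

lemma loc_analytic_level_cong:
  assumes "g \<in> loc_analytic_level v n" "n \<ge> 1" "\<And>x. x \<in> Zp_units v \<Longrightarrow> h x = g x"
  shows "h \<in> loc_analytic_level v n"
proof (rule loc_analytic_levelI)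
  fix a assume a: "a \<in> Zp_units v"
  then obtain c where c: "ball_expansion v g a n c"
    using assms(1) unfolding loc_analytic_level_def by blast
  have "ball_expansion v h a n c"
    by (rule ball_expansion_cong[OF c]) (use assms Zp_units_near[OF a] in auto)
  then show "\<exists>c. ball_expansion v h a n c" by blast
qed

lemma power_with_v:
  obtains q where "q \<in> Qp v" "v q = ereal (of_int m)"
proof (cases "m \<ge> 0")
  case True
  then show ?thesis using that[of "of_nat p ^ nat m"] v_p_power[of "nat m"] by (simp add: Qp_power)
next
  case False
  then show ?thesis
    using that[of "inverse (of_nat p ^ nat (- m))"] v_inverse[OF v_p_power[of "nat (- m)"]]
    by (simp add: Qp_power Qp_inverse del: Qp_of_nat) (simp add: Qp_power Qp_inverse)
qed

lemma distributionD:
  assumes "loc_analytic_distribution v \<mu>"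
  shows distribution_eq: "g \<in> loc_analytic v \<Longrightarrow> h \<in> loc_analytic v \<Longrightarrow>
      (\<And>x. x \<in> Zp_units v \<Longrightarrow> g x = h x) \<Longrightarrow> \<mu> g = \<mu> h"
    and distribution_add: "g \<in> loc_analytic v \<Longrightarrow> h \<in> loc_analytic v \<Longrightarrow>
      \<mu> (\<lambda>x. g x + h x) = \<mu> g + \<mu> h"
    and distribution_scale: "c \<in> Qp v \<Longrightarrow> g \<in> loc_analytic v \<Longrightarrow> \<mu> (\<lambda>x. c * g x) = c * \<mu> g"
proof -
  note * = assms[unfolded loc_analytic_distribution_def]
  show "\<mu> g = \<mu> h" if "g \<in> loc_analytic v" "h \<in> loc_analytic v"
    "\<And>x. x \<in> Zp_units v \<Longrightarrow> g x = h x"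
    by (rule mp[OF bspec[OF bspec[OF conjunct1[OF *] that(1)] that(2)]]) (use that(3) in simp)
  show "\<mu> (\<lambda>x. g x + h x) = \<mu> g + \<mu> h" if "g \<in> loc_analytic v" "h \<in> loc_analytic v"
    by (rule bspec[OF bspec[OF conjunct1[OF conjunct2[OF *]] that(1)] that(2)])
  show "\<mu> (\<lambda>x. c * g x) = c * \<mu> g" if "c \<in> Qp v" "g \<in> loc_analytic v"
    by (rule bspec[OF bspec[OF conjunct1[OF conjunct2[OF conjunct2[OF *]]] that(1)] that(2)])
qed

text \<open>Homogeneous form of continuity: multiplication by a power of p reduces an arbitrary
  bound B to the unit ball of level n.\<close>

lemma distribution_bound:
  assumes \<mu>: "loc_analytic_distribution v \<mu>" and n: "n \<ge> 1"
  shows "\<exists>C. \<forall>g B. (\<forall>a\<in>Zp_units v. \<exists>c. ball_expansion v g a n c \<and>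
     (\<forall>j. ereal (B - real n * real j) \<le> v (c j))) \<longrightarrow> ereal (C + B) \<le> v (\<mu> g)"
proof -
  have "\<forall>n\<ge>1. \<exists>C::real. \<forall>g\<in>loc_analytic_level v n.
        (\<forall>a\<in>Zp_units v. \<forall>c. ball_expansion v g a n c \<longrightarrow>
           (\<forall>j. v (c j) + ereal (real n * real j) \<ge> 0)) \<longrightarrow> v (\<mu> g) \<ge> ereal C"
    using \<mu> unfolding loc_analytic_distribution_def by (elim conjE)
  from mp[OF spec[OF this] n] obtain C where C: "\<forall>g\<in>loc_analytic_level v n.
    (\<forall>a\<in>Zp_units v. \<forall>c. ball_expansion v g a n c \<longrightarrow>
           (\<forall>j. v (c j) + ereal (real n * real j) \<ge> 0)) \<longrightarrow> v (\<mu> g) \<ge> ereal C" ..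
  \<comment> \<open>The 1 is lost because B is real and only integral powers of p are available for
    scaling.\<close>
  have "ereal (C - 1 + B) \<le> v (\<mu> g)"
    if g: "\<forall>a\<in>Zp_units v. \<exists>c. ball_expansion v g a n c \<and> (\<forall>j. ereal (B - real n * real j) \<le> v (c j))" for g B
  proof -
    obtain q where q: "q \<in> Qp v" "v q = ereal (of_int (- \<lfloor>B\<rfloor>))" by (rule power_with_v)
    have exp: "\<exists>c. ball_expansion v (\<lambda>x. q * g x) a n c \<and> (\<forall>j. ereal (0 - real n * real j) \<le> v (c j))"
      if a: "a \<in> Zp_units v" for a
    proof -
      obtain c where c: "ball_expansion v g a n c" "\<And>j. ereal (B - real n * real j) \<le> v (c j)"
        using bspec[OF g a] by blast
      have "ereal (0 - real n * real j) \<le> v (q * c j)" for j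
      proof -
        have "ereal (of_int (- \<lfloor>B\<rfloor>) + (B - real n * real j)) \<le> v (q * c j)"
          by (rule v_ge_mult[OF _ c(2)]) (simp add: q)
        then show ?thesis by (rule v_ge_mono) simp
      qed
      then show ?thesis using ball_expansion_cmult[OF c(1) q(1)] by blast
    qed
    have "ereal C \<le> v (\<mu> (\<lambda>x. q * g x))"
    proof (rule mp[OF bspec[OF C]])
      show "(\<lambda>x. q * g x) \<in> loc_analytic_level v n" using exp by (intro loc_analytic_levelI) blast
      show "\<forall>a\<in>Zp_units v. \<forall>c. ball_expansion v (\<lambda>x. q * g x) a n c \<longrightarrow>
           (\<forall>j. v (c j) + ereal (real n * real j) \<ge> 0)"
      proof (intro ballI allI impI)
        fix a c j
        assume a: "a \<in> Zp_units v" and c: "ball_expansion v (\<lambda>x. q * g x) a n c"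
        obtain c' where c': "ball_expansion v (\<lambda>x. q * g x) a n c'" "\<And>j. ereal (0 - real n * real j) \<le> v (c' j)"
          using exp[OF a] by blast
        have "c = c'" by (rule ball_expansion_unique[OF c c'(1) Zp_units_Qp[OF a]])
        then show "v (c j) + ereal (real n * real j) \<ge> 0"
          using c'(2)[of j] ereal_le_add_iff[of 0 "v (c j)" "real n * real j"] by (simp add: zero_ereal_def)
      qed
    qed
    also have "\<mu> (\<lambda>x. q * g x) = q * \<mu> g"
    proof -
      have "g \<in> loc_analytic v"
        using g n by (intro loc_analytic_level_imp[OF loc_analytic_levelI]) blast+
      then show ?thesis by (rule distribution_scale[OF \<mu> q(1)])
    qed
    finally have "ereal C \<le> ereal (of_int (- \<lfloor>B\<rfloor>)) + v (\<mu> g)" by (simp add: v_mult q)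
    then have "ereal (C + of_int \<lfloor>B\<rfloor>) \<le> v (\<mu> g)" by (cases "v (\<mu> g)") auto
    then show ?thesis by (rule v_ge_mono) linarith
  qed
  then show ?thesis by blast
qed

lemma distribution_diff:
  assumes \<mu>: "loc_analytic_distribution v \<mu>" and g: "g \<in> loc_analytic_level v n" "h \<in> loc_analytic_level v n"
    and n: "n \<ge> 1"
  shows "\<mu> (\<lambda>x. g x - h x) = \<mu> g - \<mu> h"
proof -
  have gh: "g \<in> loc_analytic v" "h \<in> loc_analytic v" using g n loc_analytic_level_imp by blast+
  have "(\<lambda>x. -1 * h x) \<in> loc_analytic_level v n"
    using g(2) ball_expansion_cmult[OF _ Qp_minus[OF Qp_1]] unfolding loc_analytic_level_def by blast
  then have m: "(\<lambda>x. -1 * h x) \<in> loc_analytic v" using n loc_analytic_level_imp by blast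
  have "\<mu> (\<lambda>x. g x + -1 * h x) = \<mu> g + \<mu> (\<lambda>x. -1 * h x)"
    by (rule distribution_add[OF \<mu> gh(1) m])
  also have "\<mu> (\<lambda>x. -1 * h x) = -1 * \<mu> h"
    by (rule distribution_scale[OF \<mu> Qp_minus[OF Qp_1] gh(2)])
  finally show ?thesis by simp
qed

lemma distribution_cmult:
  assumes \<mu>: "loc_analytic_distribution v \<mu>" and g: "g \<in> loc_analytic_level v n" "n \<ge> 1" and c: "c \<in> Qp v"
  shows "\<mu> (\<lambda>x. c * g x) = c * \<mu> g"
  by (rule distribution_scale[OF \<mu> c loc_analytic_level_imp[OF g]])

lemma distribution_cong:
  assumes \<mu>: "loc_analytic_distribution v \<mu>" and g: "g \<in> loc_analytic_level v n" "n \<ge> 1"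
    and eq: "\<And>x. x \<in> Zp_units v \<Longrightarrow> h x = g x"
  shows "\<mu> h = \<mu> g"
proof -
  have "h \<in> loc_analytic_level v n" by (rule loc_analytic_level_cong[OF g eq])
  from loc_analytic_level_imp[OF this g(2)] loc_analytic_level_imp[OF g] show ?thesis
    by (rule distribution_eq[OF \<mu>]) (rule eq)
qed

lemma distribution_sum:
  assumes \<mu>: "loc_analytic_distribution v \<mu>" and n: "n \<ge> 1" and fin: "finite I"
    and g: "\<And>i. i \<in> I \<Longrightarrow> g i \<in> loc_analytic_level v n"
  shows "(\<lambda>x. \<Sum>i\<in>I. g i x) \<in> loc_analytic_level v n \<and> \<mu> (\<lambda>x. \<Sum>i\<in>I. g i x) = (\<Sum>i\<in>I. \<mu> (g i))"
  using fin g
proof (induction I)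
  case empty
  have 0: "(\<lambda>x. 0) \<in> loc_analytic_level v n" using ball_expansion_0 by (intro loc_analytic_levelI) blast
  then show ?case using distribution_cmult[OF \<mu> 0 n Qp_0] by simp
next
  case (insert i I)
  have 1: "g i \<in> loc_analytic_level v n" "(\<lambda>x. \<Sum>i\<in>I. g i x) \<in> loc_analytic_level v n" using insert by auto
  have "(\<lambda>x. g i x + (\<Sum>i\<in>I. g i x)) \<in> loc_analytic_level v n"
    using 1 ball_expansion_add unfolding loc_analytic_level_def by blast
  moreover have "\<mu> (\<lambda>x. g i x + (\<Sum>i\<in>I. g i x)) = \<mu> (g i) + \<mu> (\<lambda>x. \<Sum>i\<in>I. g i x)"
    using 1 loc_analytic_level_imp[OF _ n] by (intro distribution_add[OF \<mu>])
  ultimately show ?case using insert by simp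
qed

subsection \<open>The derivative of the \<open>p\<close>-adic \<open>L\<close>-function\<close>

text \<open>The test points s0 + p^N differ from s0 and come arbitrarily close to it.\<close>

lemma has_padic_derivative_unique:
  assumes "has_padic_derivative v F s0 D" "has_padic_derivative v F s0 D'" "s0 \<in> Zp v"
  shows "D = D'"
proof -
  have "ereal B \<le> v (D' - D)" for B
  proof -
    obtain d where d: "\<forall>s\<in>Zp v. s \<noteq> s0 \<and> ereal d \<le> v (s - s0) \<longrightarrow>
        ereal B \<le> v ((F s - F s0) / (s - s0) - D)"
      using assms(1) unfolding has_padic_derivative_def by blast
    obtain d' where d': "\<forall>s\<in>Zp v. s \<noteq> s0 \<and> ereal d' \<le> v (s - s0) \<longrightarrow>
        ereal B \<le> v ((F s - F s0) / (s - s0) - D')"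
      using assms(2) unfolding has_padic_derivative_def by blast
    define N where "N = nat \<lceil>max d d'\<rceil>"
    define s where "s = s0 + of_nat (p ^ N)"
    have "v (s - s0) = ereal (real N)" by (simp add: s_def v_p_power)
    then have "ereal d \<le> v (s - s0)" "ereal d' \<le> v (s - s0)" by (simp_all add: N_def) linarith+
    moreover have "s \<noteq> s0" "s \<in> Zp v"
      using assms(3) p_gt_1 unfolding s_def by (auto intro: Zp_add simp del: of_nat_power)
    ultimately have "ereal B \<le> v ((F s - F s0) / (s - s0) - D)" "ereal B \<le> v ((F s - F s0) / (s - s0) - D')"
      using d d' by blast+
    from v_ge_diff[OF this] show ?thesis by simp
  qed
  then show ?thesis using eq_0_if_v_ge[of "D' - D"] by simp
qed

text \<open>Differentiation under the integral sign, justified by the boundedness of \<mu> on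
  functions of level 2.\<close>

lemma Lp_deriv_eq:
  assumes \<mu>: "loc_analytic_distribution v \<mu>" and k: "k \<ge> 2"
  shows "Lp_deriv p v k \<mu> = \<mu> (\<lambda>x. x ^ (k div 2 - 1) * padic_log v (angle p v x))"
proof -
  define h where "h = k div 2 - 1"
  define s0 :: complex where "s0 = of_nat (k div 2)"
  have s0: "s0 = of_nat h + 1" using k by (simp add: s0_def h_def of_nat_diff)
  \<comment> \<open>The integrand rewritten in \<delta> = s - s0: as s - 1 = h + \<delta>, a factor
    x^h independent of \<delta> splits off.\<close>
  define G where "G \<delta> x = x ^ h * padic_power v (angle p v x) \<delta>" for \<delta> x
  define g where "g x = x ^ h * padic_log v (angle p v x)" for x
  have G_level: "G \<delta> \<in> loc_analytic_level v 2" if "\<delta> \<in> Zp v" for \<delta>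
  proof (rule loc_analytic_levelI)
    fix a assume a: "a \<in> Zp_units v"
    note e = ball_expansion_padic_power[OF a that]
    obtain B where B: "\<And>j. ereal (B - real 2 * real j) \<le>
      v (padic_power v (angle p v a) \<delta> * (\<delta> gchoose j) / a ^ j)" using ball_expansion_bounded[OF e] by blast
    from ball_expansion_power_mult[OF e a B] show "\<exists>c. ball_expansion v (G \<delta>) a 2 c"
      unfolding G_def by blast
  qed
  have g_level: "g \<in> loc_analytic_level v 2"
    unfolding g_def by (rule loc_analytic_levelI) (use ball_expansion_power_log[of _ 2 h] in auto)
  have F: "Lp_branch p v k \<mu> s = \<mu> (G (s - s0))" if s: "s \<in> Zp v" for s
  proof -
    have \<delta>: "s - s0 \<in> Zp v" using s by (auto simp: s0_def intro: Zp_diff)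
    show ?thesis
      unfolding Lp_branch_def
    proof (rule distribution_cong[OF \<mu> G_level[OF \<delta>]])
      fix x assume x: "x \<in> Zp_units v"
      have "padic_power v (angle p v x) (s - 1) = padic_power v (angle p v x) (of_nat h + (s - s0))"
        by (simp add: s0)
      also have "\<dots> = angle p v x ^ h * padic_power v (angle p v x) (s - s0)"
        by (rule padic_power_add_nat[OF angle_one_unit[OF x] \<delta>])
      finally show "teichmueller p v x ^ (k div 2 - 1) * padic_power v (angle p v x) (s - 1) = G (s - s0) x"
        using teichmueller_mult_angle[OF x]
        by (simp add: G_def h_def flip: mult.assoc power_mult_distrib)
    qed simp
  qed
  have "has_padic_derivative v (Lp_branch p v k \<mu>) s0 (\<mu> g)"
    unfolding has_padic_derivative_def
  proof
    fix B :: real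
    obtain C where C: "\<forall>g B. (\<forall>a\<in>Zp_units v. \<exists>c. ball_expansion v g a 2 c \<and>
     (\<forall>j. ereal (B - real 2 * real j) \<le> v (c j))) \<longrightarrow> ereal (C + B) \<le> v (\<mu> g)"
      using distribution_bound[OF \<mu>, of 2] one_le_numeral by blast
    obtain d where d: "\<forall>\<delta>\<in>Zp v. \<delta> \<noteq> 0 \<longrightarrow> ereal d \<le> v \<delta> \<longrightarrow> (\<forall>a\<in>Zp_units v. \<exists>c.
      ball_expansion v (\<lambda>x. (padic_power v (angle p v x) \<delta> - 1) / \<delta> - padic_log v (angle p v x)) a 2 c \<and>
      (\<forall>j. ereal (B - C - real 2 * real j) \<le> v (c j)))"
      using ball_expansion_difference_quotient[of "B - C"] by blast
    have "ereal B \<le> v ((Lp_branch p v k \<mu> s - Lp_branch p v k \<mu> s0) / (s - s0) - \<mu> g)"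
      if s: "s \<in> Zp v" "s \<noteq> s0" "ereal d \<le> v (s - s0)" for s
    proof -
      define \<delta> where "\<delta> = s - s0"
      have \<delta>: "\<delta> \<in> Zp v" "\<delta> \<noteq> 0" "ereal d \<le> v \<delta>"
        using s by (auto simp: \<delta>_def s0_def intro: Zp_diff)
      have s0Z: "s0 \<in> Zp v" by (simp add: s0_def)
      have iQ: "inverse \<delta> \<in> Qp v" by (rule Qp_inverse[OF Zp_Qp[OF \<delta>(1)]])
      define H where "H x = inverse \<delta> * (G \<delta> x - G 0 x) - g x" for x
      have GG: "(\<lambda>x. G \<delta> x - G 0 x) \<in> loc_analytic_level v 2"
        using G_level[OF \<delta>(1)] G_level[OF Zp_0] ball_expansion_diff unfolding loc_analytic_level_def by blast
      have GG': "(\<lambda>x. inverse \<delta> * (G \<delta> x - G 0 x)) \<in> loc_analytic_level v 2"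
        using GG ball_expansion_cmult[OF _ iQ] unfolding loc_analytic_level_def by blast
      have "\<mu> H = inverse \<delta> * (\<mu> (G \<delta>) - \<mu> (G 0)) - \<mu> g"
        using distribution_diff[OF \<mu> GG' g_level] distribution_cmult[OF \<mu> GG _ iQ]
          distribution_diff[OF \<mu> G_level[OF \<delta>(1)] G_level[OF Zp_0]]
        by (simp add: H_def[abs_def])
      then have "(Lp_branch p v k \<mu> s - Lp_branch p v k \<mu> s0) / (s - s0) - \<mu> g = \<mu> H"
        unfolding F[OF s(1)] F[OF s0Z] \<delta>_def by (simp add: divide_inverse mult.commute)
      moreover have "ereal (C + (B - C)) \<le> v (\<mu> H)"
      proof (rule mp[OF spec[OF spec[OF C]]], rule ballI)
        fix a assume a: "a \<in> Zp_units v"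
        obtain c where c: "ball_expansion v (\<lambda>x. (padic_power v (angle p v x) \<delta> - 1) / \<delta> - padic_log v (angle p v x)) a 2 c"
          "\<And>j. ereal (B - C - real 2 * real j) \<le> v (c j)"
          using d \<delta> a by blast
        obtain c' where c': "ball_expansion v (\<lambda>x. x ^ h * ((padic_power v (angle p v x) \<delta> - 1) / \<delta> - padic_log v (angle p v x))) a 2 c'"
          "\<forall>j. ereal (B - C - real 2 * real j) \<le> v (c' j)"
          using ball_expansion_power_mult[OF c(1) a c(2)] by blast
        have "ball_expansion v H a 2 c'"
        proof (rule ball_expansion_cong[OF c'(1)])
          fix x assume "x \<in> Qp v" "ereal (real 2) \<le> v (x - a)"
          then have "x \<in> Zp_units v" by (rule Zp_units_near[OF a]) simp
          then have "padic_power v (angle p v x) 0 = 1"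
            using padic_power_of_nat[OF angle_one_unit, of x 0] by simp
          then show "H x = x ^ h * ((padic_power v (angle p v x) \<delta> - 1) / \<delta> - padic_log v (angle p v x))"
            by (simp add: H_def G_def g_def divide_inverse algebra_simps)
        qed
        then show "\<exists>c. ball_expansion v H a 2 c \<and> (\<forall>j. ereal (B - C - real 2 * real j) \<le> v (c j))"
          using c'(2) by blast
      qed
      ultimately show ?thesis by simp
    qed
    then show "\<exists>d. \<forall>s\<in>Zp v. s \<noteq> s0 \<and> ereal d \<le> v (s - s0) \<longrightarrow>
      ereal B \<le> v ((Lp_branch p v k \<mu> s - Lp_branch p v k \<mu> s0) / (s - s0) - \<mu> g)" by blast
  qed
  moreover have "s0 \<in> Zp v" by (simp add: s0_def)
  ultimately have "(THE D. has_padic_derivative v (Lp_branch p v k \<mu>) s0 D) = \<mu> g"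
    using has_padic_derivative_unique by (intro the_equality) blast+
  then show ?thesis unfolding Lp_deriv_def s0_def g_def h_def .
qed

subsection \<open>Integrals over balls\<close>

lemma restrict_level:
  assumes "ball_expansion v g a n c" "a \<in> Qp v"
  shows "(\<lambda>x. if v (x - a) \<ge> ereal (real n) then g x else 0) \<in> loc_analytic_level v n"
proof (rule loc_analytic_levelI)
  fix a' assume a': "a' \<in> Zp_units v"
  obtain B where B: "\<And>j. ereal (B - real n * real j) \<le> v (c j)"
    using ball_expansion_bounded[OF assms(1)] by blast
  obtain c' where "ball_expansion v (\<lambda>x. if v (x - a) \<ge> ereal (real n) then g x else 0) a' n c'"
    using restrict_ball_expansion[OF assms Zp_units_Qp[OF a'] B] by blast
  then show "\<exists>c. ball_expansion v (\<lambda>x. if v (x - a) \<ge> ereal (real n) then g x else 0) a' n c" by blast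
qed

lemma ball_integral_sum:
  assumes \<mu>: "loc_analytic_distribution v \<mu>" and n: "n \<ge> 1" and a: "a \<in> Qp v" and fin: "finite I"
    and g: "\<And>i. i \<in> I \<Longrightarrow> ball_expansion v (g i) a n (c i)"
  shows "ball_integral v \<mu> a n (\<lambda>x. \<Sum>i\<in>I. g i x) = (\<Sum>i\<in>I. ball_integral v \<mu> a n (g i))"
proof -
  have "\<mu> (\<lambda>x. \<Sum>i\<in>I. if v (x - a) \<ge> ereal (real n) then g i x else 0) =
      (\<Sum>i\<in>I. \<mu> (\<lambda>x. if v (x - a) \<ge> ereal (real n) then g i x else 0))"
    by (rule conjunct2[OF distribution_sum[OF \<mu> n fin restrict_level[OF g a]]])
  moreover have "(\<lambda>x. \<Sum>i\<in>I. if v (x - a) \<ge> ereal (real n) then g i x else 0) =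
      (\<lambda>x. if v (x - a) \<ge> ereal (real n) then \<Sum>i\<in>I. g i x else 0)"
    by (auto simp: fun_eq_iff)
  ultimately show ?thesis by (simp add: ball_integral_def)
qed

lemma ball_integral_cmult:
  assumes \<mu>: "loc_analytic_distribution v \<mu>" and n: "n \<ge> 1" and a: "a \<in> Qp v" and b: "b \<in> Qp v"
    and g: "ball_expansion v g a n c"
  shows "ball_integral v \<mu> a n (\<lambda>x. b * g x) = b * ball_integral v \<mu> a n g"
proof -
  have "(\<lambda>x. if v (x - a) \<ge> ereal (real n) then b * g x else 0) =
     (\<lambda>x. b * (if v (x - a) \<ge> ereal (real n) then g x else 0))" by (auto simp: fun_eq_iff)
  then show ?thesis
    using distribution_cmult[OF \<mu> restrict_level[OF g a] n b] by (simp add: ball_integral_def)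
qed

lemma ball_integral_diff:
  assumes \<mu>: "loc_analytic_distribution v \<mu>" and n: "n \<ge> 1" and a: "a \<in> Qp v"
    and g: "ball_expansion v g a n c" and h: "ball_expansion v h a n d"
  shows "ball_integral v \<mu> a n (\<lambda>x. g x - h x) = ball_integral v \<mu> a n g - ball_integral v \<mu> a n h"
proof -
  have "(\<lambda>x. if v (x - a) \<ge> ereal (real n) then g x - h x else 0) =
     (\<lambda>x. (if v (x - a) \<ge> ereal (real n) then g x else 0) - (if v (x - a) \<ge> ereal (real n) then h x else 0))"
    by (auto simp: fun_eq_iff)
  then show ?thesis
    using distribution_diff[OF \<mu> restrict_level[OF g a] restrict_level[OF h a] n]
    by (simp add: ball_integral_def)
qed

lemma of_int_unit: "\<not> int p dvd a \<Longrightarrow> of_int a \<in> Zp_units v"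
  by (simp add: Zp_units_def v_of_int_unit)

lemma v_of_int_ge_iff: "ereal (real n) \<le> v (of_int a) \<longleftrightarrow> int (p ^ n) dvd a"
proof
  assume ge: "ereal (real n) \<le> v (of_int a)"
  show "int (p ^ n) dvd a"
  proof (cases "a = 0")
    case False
    define e where "e = multiplicity (int p) a"
    have "\<not> is_unit (int p)" using p_gt_1 by auto
    then obtain u where u: "a = int p ^ e * u" "\<not> int p dvd u"
      using multiplicity_decompose'[of a "int p"] False unfolding e_def by blast
    have "v (of_int a) = ereal (real e)"
      using v_of_int_unit[OF u(2)] v_p_power[of e] by (simp add: u(1) v_mult)
    then have "n \<le> e" using ge by simp
    then show ?thesis using u(1) le_imp_power_dvd[of n e "int p"] by simp
  qed simp
qed (rule v_of_int_dvd)

lemma sum_single: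
  assumes "finite I" "i \<in> I" "\<And>j. j \<in> I \<Longrightarrow> j \<noteq> i \<Longrightarrow> F j = 0"
  shows "(\<Sum>j\<in>I. F j) = F i"
  using sum.mono_neutral_right[of I "{i}" F] assms by auto

text \<open>A point of the ball is a + p^n y with y integral, and the residue t of y modulo p
  singles out one of the p balls of the next level.\<close>

lemma ball_integral_split:
  assumes \<mu>: "loc_analytic_distribution v \<mu>" and n: "n \<ge> 1"
    and g: "\<And>t. t < p \<Longrightarrow> \<exists>c. ball_expansion v g (of_int (a + int (p ^ n * t))) (Suc n) c"
  shows "ball_integral v \<mu> (of_int a) n g =
    (\<Sum>t<p. ball_integral v \<mu> (of_int (a + int (p ^ n * t))) (Suc n) g)"
proof -
  define b :: "nat \<Rightarrow> complex" where "b t = of_int (a + int (p ^ n * t))" for t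
  define G where "G t x = (if v (x - b t) \<ge> ereal (real (Suc n)) then g x else 0)" for t x
  have level: "G t \<in> loc_analytic_level v (Suc n)" if t: "t < p" for t
  proof -
    obtain c where "ball_expansion v g (b t) (Suc n) c" using g[OF t] unfolding b_def by blast
    then show ?thesis unfolding G_def by (rule restrict_level) (unfold b_def, rule Qp_of_int)
  qed
  have sum: "(\<lambda>x. \<Sum>t<p. G t x) \<in> loc_analytic_level v (Suc n) \<and> \<mu> (\<lambda>x. \<Sum>t<p. G t x) = (\<Sum>t<p. \<mu> (G t))"
    by (rule distribution_sum[OF \<mu>]) (use level in auto)
  have near: "ereal (real n) \<le> v (x - of_int a)" if "ereal (real (Suc n)) \<le> v (x - b t)" for x t
  proof -
    have "ereal (real n) \<le> v (of_int (int (p ^ n * t)))" by (rule v_of_int_dvd) simp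
    from v_ge_add[OF v_ge_mono[OF that] this] show ?thesis by (simp add: b_def)
  qed
  have "(if v (x - of_int a) \<ge> ereal (real n) then g x else 0) = (\<Sum>t<p. G t x)"
    if x: "x \<in> Zp_units v" for x
  proof (cases "v (x - of_int a) \<ge> ereal (real n)")
    case True
    define y where "y = (x - of_int a) / of_nat p ^ n"
    have p0: "of_nat p ^ n \<noteq> (0::complex)" using p_gt_1 by simp
    have "ereal (real n - real n) \<le> v y" unfolding y_def by (rule v_ge_divide[OF True v_p_power])
    moreover have "y \<in> Qp v"
      unfolding y_def by (intro Qp_divide Qp_diff Qp_power Qp_of_nat Qp_of_int Zp_units_Qp x)
    ultimately have "y \<in> Zp v" by (simp add: Zp_def zero_ereal_def)
    then obtain t where t: "t < p" "1 \<le> v (y - of_nat t)" by (rule Zp_mod_p)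
    have "ereal (real n + 1) \<le> v (of_nat p ^ n * (y - of_nat t))"
      by (rule v_ge_mult) (use t v_p_power[of n] in \<open>auto simp: one_ereal_def\<close>)
    also have "of_nat p ^ n * (y - of_nat t) = x - b t"
      unfolding y_def b_def using p0 by (simp add: field_simps)
    finally have xt: "ereal (real (Suc n)) \<le> v (x - b t)" by (simp add: add.commute)
    have "G t' x = 0" if t': "t' < p" "t' \<noteq> t" for t'
    proof -
      have "\<not> ereal (real (Suc n)) \<le> v (x - b t')"
      proof
        assume "ereal (real (Suc n)) \<le> v (x - b t')"
        from v_ge_diff[OF this xt] have "ereal (real (Suc n)) \<le> v (b t - b t')" by simp
        also have "b t - b t' = of_int (int (p ^ n) * (int t - int t'))"
          by (simp add: b_def algebra_simps)
        finally have "int (p ^ Suc n) dvd int (p ^ n) * (int t - int t')" by (simp only: v_of_int_ge_iff)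
        then have "int (p ^ n) * int p dvd int (p ^ n) * (int t - int t')" by (simp add: mult.commute)
        then have "int p dvd int t - int t'" using p_gt_1 by simp
        then have "int t = int t'"
          using t t' by (metis mod_eq_dvd_iff mod_pos_pos_trivial of_nat_0_le_iff of_nat_less_iff)
        then show False using t' by simp
      qed
      then show ?thesis by (simp add: G_def)
    qed
    then have "(\<Sum>t<p. G t x) = G t x" using t by (intro sum_single) auto
    then show ?thesis using xt True by (simp add: G_def)
  next
    case False
    have "G t x = 0" for t using near[of x t] False by (auto simp: G_def)
    then show ?thesis using False by simp
  qed
  then have "\<mu> (\<lambda>x. if v (x - of_int a) \<ge> ereal (real n) then g x else 0) = \<mu> (\<lambda>x. \<Sum>t<p. G t x)"
    using sum by (intro distribution_cong[OF \<mu>, of _ "Suc n"]) auto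
  then show ?thesis using sum unfolding ball_integral_def G_def b_def by simp
qed

lemma distribution_total:
  assumes \<mu>: "loc_analytic_distribution v \<mu>" and n: "n \<ge> 1" and g: "g \<in> loc_analytic_level v n"
  shows "\<mu> g = (\<Sum>a | a \<in> {1..p ^ n - 1} \<and> \<not> p dvd a. ball_integral v \<mu> (of_nat a) n g)"
proof -
  let ?I = "{a. a \<in> {1..p ^ n - 1} \<and> \<not> p dvd a}"
  define G where "G a x = (if v (x - of_nat a) \<ge> ereal (real n) then g x else 0)" for a :: nat and x
  have fin: "finite ?I" by simp
  have level: "G a \<in> loc_analytic_level v n" if a: "a \<in> ?I" for a
  proof -
    have "of_nat a \<in> Zp_units v" using a of_int_unit[of "int a"] by simp
    then obtain c where "ball_expansion v g (of_nat a) n c"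
      using g unfolding loc_analytic_level_def by blast
    then show ?thesis unfolding G_def by (rule restrict_level) simp
  qed
  have sum: "(\<lambda>x. \<Sum>a\<in>?I. G a x) \<in> loc_analytic_level v n \<and> \<mu> (\<lambda>x. \<Sum>a\<in>?I. G a x) = (\<Sum>a\<in>?I. \<mu> (G a))"
    by (rule distribution_sum[OF \<mu> n fin level])
  have "g x = (\<Sum>a\<in>?I. G a x)" if x: "x \<in> Zp_units v" for x
  proof -
    have "x \<in> Zp v" using x by (simp add: Zp_def Zp_units_def)
    then obtain m :: nat where m: "ereal (real n) \<le> v (x - of_nat m)" by (rule Zp_approx_nat)
    define a where "a = m mod p ^ n"
    have "ereal (real n) \<le> v (of_int (int m - int a))"
      by (rule v_of_int_dvd) (simp add: a_def of_nat_mod)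
    from v_ge_add[OF m this] have xa: "ereal (real n) \<le> v (x - of_nat a)" by simp
    have pa: "\<not> p dvd a"
    proof
      assume "p dvd a"
      then have "ereal (real 1) \<le> v (of_int (int a))" by (intro v_of_int_dvd) simp
      then have "ereal 1 \<le> v ((x - of_nat a) + of_int (int a))"
        using v_ge_mono[OF xa, of 1] n by (intro v_ge_add) auto
      then show False using x by (simp add: zero_ereal_def Zp_units_def)
    qed
    have "a < p ^ n" using p_gt_1 by (simp add: a_def)
    moreover have "a \<noteq> 0" using pa by (intro notI) simp
    ultimately have a: "a \<in> ?I" using pa by simp
    have "G a' x = 0" if a': "a' \<in> ?I" "a' \<noteq> a" for a'
    proof -
      have "\<not> ereal (real n) \<le> v (x - of_nat a')"
      proof
        assume "ereal (real n) \<le> v (x - of_nat a')"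
        from v_ge_diff[OF this xa] have "ereal (real n) \<le> v (of_int (int a - int a'))" by simp
        then have "int (p ^ n) dvd int a - int a'" by (simp only: v_of_int_ge_iff)
        moreover have "a' < p ^ n" using a' by auto
        ultimately have "int a = int a'"
          using \<open>a < p ^ n\<close> by (metis mod_eq_dvd_iff mod_pos_pos_trivial of_nat_0_le_iff of_nat_less_iff)
        then show False using a' by simp
      qed
      then show ?thesis by (simp add: G_def)
    qed
    then have "(\<Sum>a\<in>?I. G a x) = G a x" using a fin by (intro sum_single) auto
    then show ?thesis using xa by (simp add: G_def)
  qed
  then have "\<mu> g = \<mu> (\<lambda>x. \<Sum>a\<in>?I. G a x)"
    using sum by (intro distribution_cong[OF \<mu>, of _ n] n) auto
  then show ?thesis using sum unfolding ball_integral_def G_def by simp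
qed

subsection \<open>Growth of the moments\<close>

text \<open>The divisibility \<open>p\<^sup>h\<^sup>-\<^sup>i\<close> of the low moments makes the distribution relation lossless: passing from
  radius \<open>p\<^sup>-\<^sup>n\<close> to \<open>p\<^sup>-\<^sup>n\<^sup>-\<^sup>1\<close> gains \<open>p\<^sup>i\<close>, which for \<open>i \<le> h\<close> together with this divisibility makes up for
  the division by \<open>\<alpha>\<close>, while for \<open>i > 2 h\<close> a possible defect \<open>B < 0\<close> improves by \<open>h + 1\<close>.\<close>

lemma moment_bound_step:
  assumes \<mu>: "loc_analytic_distribution v \<mu>" and \<alpha>: "v \<alpha> = ereal (real h)"
    and low: "\<And>n a i. n \<ge> 1 \<Longrightarrow> \<not> int p dvd a \<Longrightarrow> i \<le> 2 * h \<Longrightarrow>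
      ereal (real n * real i + max 0 (real h - real i)) \<le> v (\<alpha> ^ n * ball_integral v \<mu> (of_int a) n (\<lambda>x. (x - of_int a) ^ i))"
    and B: "\<And>n a j. n \<ge> 1 \<Longrightarrow> \<not> int p dvd a \<Longrightarrow>
      ereal (real n * real j + B) \<le> v (\<alpha> ^ n * ball_integral v \<mu> (of_int a) n (\<lambda>x. (x - of_int a) ^ j))"
    and n: "n \<ge> 1" and a: "\<not> int p dvd a"
  shows "ereal (real n * real j + min 0 (B + 1)) \<le> v (\<alpha> ^ n * ball_integral v \<mu> (of_int a) n (\<lambda>x. (x - of_int a) ^ j))"
proof -
  define b where "b t = a + int (p ^ n * t)" for t
  define I where "I t i = ball_integral v \<mu> (of_int (b t)) (Suc n) (\<lambda>x. (x - of_int (b t)) ^ i)" for t i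
  define C :: "nat \<Rightarrow> nat \<Rightarrow> complex" where "C t i = of_nat (j choose i) * of_int (int (p ^ n * t)) ^ (j - i)" for t i
  have CQ: "C t i \<in> Qp v" for t i unfolding C_def by (intro Qp_mult Qp_power Qp_of_nat Qp_of_int)
  have bQ: "of_int (b t) \<in> Qp v" for t by simp
  have pb: "\<not> int p dvd b t" for t
  proof -
    have "int p dvd int (p ^ n * t)" using n by (simp add: dvd_power)
    then show ?thesis using a unfolding b_def by (simp add: dvd_add_left_iff)
  qed
  have expand: "(x - of_int a) ^ j = (\<Sum>i\<le>j. C t i * (x - of_int (b t)) ^ i)" for x t
  proof -
    have "(x - of_int a) ^ j = ((x - of_int (b t)) + of_int (int (p ^ n * t))) ^ j" by (simp add: b_def)
    also have "\<dots> = (\<Sum>i\<le>j. C t i * (x - of_int (b t)) ^ i)"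
      unfolding binomial_ring C_def by (simp add: mult_ac)
    finally show ?thesis .
  qed
  have mono: "ball_expansion v (\<lambda>x. C t i * (x - of_int (b t)) ^ i) (of_int (b t)) (Suc n)
      (\<lambda>l. C t i * (if l = i then 1 else 0))" for t i
    by (rule ball_expansion_cmult[OF ball_expansion_power CQ])
  have ex: "\<exists>c. ball_expansion v (\<lambda>x. (x - of_int a) ^ j) (of_int (b t)) (Suc n) c" for t
    unfolding expand[of _ t] by (rule exI, rule ball_expansion_sum, rule mono)
  have "ball_integral v \<mu> (of_int a) n (\<lambda>x. (x - of_int a) ^ j) =
      (\<Sum>t<p. ball_integral v \<mu> (of_int (b t)) (Suc n) (\<lambda>x. (x - of_int a) ^ j))"
    unfolding b_def by (rule ball_integral_split[OF \<mu> n]) (use ex in \<open>simp add: b_def\<close>)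
  also have "\<dots> = (\<Sum>t<p. \<Sum>i\<le>j. C t i * I t i)"
  proof (rule sum.cong)
    fix t
    have "ball_integral v \<mu> (of_int (b t)) (Suc n) (\<lambda>x. \<Sum>i\<le>j. C t i * (x - of_int (b t)) ^ i) =
        (\<Sum>i\<le>j. ball_integral v \<mu> (of_int (b t)) (Suc n) (\<lambda>x. C t i * (x - of_int (b t)) ^ i))"
      by (rule ball_integral_sum[OF \<mu> _ bQ _ mono]) simp_all
    also have "\<dots> = (\<Sum>i\<le>j. C t i * I t i)"
      unfolding I_def by (intro sum.cong refl ball_integral_cmult[OF \<mu> _ bQ CQ ball_expansion_power]) auto
    finally show "ball_integral v \<mu> (of_int (b t)) (Suc n) (\<lambda>x. (x - of_int a) ^ j) = (\<Sum>i\<le>j. C t i * I t i)"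
      unfolding expand[of _ t] .
  qed simp
  finally have eq: "\<alpha> ^ n * ball_integral v \<mu> (of_int a) n (\<lambda>x. (x - of_int a) ^ j) =
      (\<Sum>t<p. \<Sum>i\<le>j. \<alpha> ^ n * (C t i * I t i))" by (simp add: sum_distrib_left)
  show ?thesis
    unfolding eq
  proof (intro v_ge_sum)
    fix t i assume i: "i \<in> {..j}"
    have \<alpha>0: "\<alpha> \<noteq> 0" using \<alpha> by auto
    \<comment> \<open>The surplus over (n + 1) i known for the finer moments: the periods provide it
      for i \<le> 2h, the current defect B for all other i.\<close>
    define K where "K = (if i \<le> 2 * h then max 0 (real h - real i) else B)"
    have I: "ereal (real (Suc n) * real i + K) \<le> v (\<alpha> ^ Suc n * I t i)"
      unfolding I_def K_def using low[of "Suc n" "b t" i] B[of "Suc n" "b t" i] pb by auto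
    have "ereal (real n) \<le> v (of_int (int (p ^ n * t)))" by (rule v_of_int_dvd) simp
    from v_ge_power[OF this, of "j - i"]
    have C: "ereal (real (j - i) * real n) \<le> v (C t i)"
      unfolding C_def using v_of_nat_ge by (intro v_ge_mult_right) auto
    have "ereal (real (j - i) * real n + (real (Suc n) * real i + K) - real h) \<le> v (C t i * (\<alpha> ^ Suc n * I t i) / \<alpha>)"
      by (rule v_ge_divide[OF v_ge_mult[OF C I] \<alpha>])
    also have "C t i * (\<alpha> ^ Suc n * I t i) / \<alpha> = \<alpha> ^ n * (C t i * I t i)"
      using \<alpha>0 by (simp add: field_simps)
    finally show "ereal (real n * real j + min 0 (B + 1)) \<le> v (\<alpha> ^ n * (C t i * I t i))"
    proof (rule v_ge_mono)
      have "real (j - i) * real n + real (Suc n) * real i = real n * real j + real i"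
        using i by (simp add: of_nat_diff algebra_simps)
      moreover have "min 0 (B + 1) \<le> real i + K - real h"
      proof (cases "i \<le> 2 * h")
        case False
        then have "real i \<ge> 2 * real h + 1" by linarith
        then show ?thesis using False by (simp add: K_def)
      qed (simp add: K_def)
      ultimately show "real n * real j + min 0 (B + 1) \<le>
          real (j - i) * real n + (real (Suc n) * real i + K) - real h" by linarith
    qed
  qed
qed

text \<open>Each application of the step raises a negative defect by 1 and stops at 0; after at
  least -C rounds the constant is gone.\<close>

lemma moment_bound:
  assumes \<mu>: "loc_analytic_distribution v \<mu>" and \<alpha>: "v \<alpha> = ereal (real h)"
    and low: "\<And>n a i. n \<ge> 1 \<Longrightarrow> \<not> int p dvd a \<Longrightarrow> i \<le> 2 * h \<Longrightarrow>
      ereal (real n * real i + max 0 (real h - real i)) \<le> v (\<alpha> ^ n * ball_integral v \<mu> (of_int a) n (\<lambda>x. (x - of_int a) ^ i))"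
    and C: "\<And>n a j. n \<ge> 1 \<Longrightarrow> \<not> int p dvd a \<Longrightarrow>
      ereal (real n * real j + C) \<le> v (\<alpha> ^ n * ball_integral v \<mu> (of_int a) n (\<lambda>x. (x - of_int a) ^ j))"
    and n: "n \<ge> 1" and a: "\<not> int p dvd a"
  shows "ereal (real n * real j) \<le> v (\<alpha> ^ n * ball_integral v \<mu> (of_int a) n (\<lambda>x. (x - of_int a) ^ j))"
proof -
  have "\<forall>n a j. n \<ge> 1 \<longrightarrow> \<not> int p dvd a \<longrightarrow> ereal (real n * real j + min 0 (C + real l)) \<le>
      v (\<alpha> ^ n * ball_integral v \<mu> (of_int a) n (\<lambda>x. (x - of_int a) ^ j))" for l
  proof (induction l)
    case 0
    show ?case
    proof (intro allI impI)
      fix n a j assume "n \<ge> (1::nat)" "\<not> int p dvd a"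
      from C[OF this] show "ereal (real n * real j + min 0 (C + real 0)) \<le>
          v (\<alpha> ^ n * ball_integral v \<mu> (of_int a) n (\<lambda>x. (x - of_int a) ^ j))"
        by (rule v_ge_mono) simp
    qed
  next
    case (Suc l)
    show ?case
    proof (intro allI impI)
      fix n a j assume na: "n \<ge> (1::nat)" "\<not> int p dvd a"
      have "ereal (real n * real j + min 0 (min 0 (C + real l) + 1)) \<le>
          v (\<alpha> ^ n * ball_integral v \<mu> (of_int a) n (\<lambda>x. (x - of_int a) ^ j))"
        by (rule moment_bound_step[OF \<mu> \<alpha> low _ na]) (use Suc.IH in blast)+
      then show "ereal (real n * real j + min 0 (C + real (Suc l))) \<le>
          v (\<alpha> ^ n * ball_integral v \<mu> (of_int a) n (\<lambda>x. (x - of_int a) ^ j))"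
        by (rule v_ge_mono) simp
    qed
  qed
  then have "ereal (real n * real j + min 0 (C + real (nat \<lceil>- C\<rceil>))) \<le>
      v (\<alpha> ^ n * ball_integral v \<mu> (of_int a) n (\<lambda>x. (x - of_int a) ^ j))" using n a by blast
  then show ?thesis by (rule v_ge_mono) linarith
qed

subsection \<open>The error of the approximation\<close>

text \<open>The infinite tail is cut at J. The finite part is estimated by the moments, the
  remainder only by continuity with an uncontrolled constant; this is harmless because the
  coefficients beyond J are as small as desired.\<close>

lemma ball_integral_tail_bound:
  assumes \<mu>: "loc_analytic_distribution v \<mu>" and n: "n \<ge> 1" and a: "a \<in> Qp v"
    and \<alpha>: "v \<alpha> = ereal r"
    and g: "ball_expansion v g a n c"
    and I: "\<And>j. ereal (real n * real j) \<le> v (\<alpha> ^ n * ball_integral v \<mu> a n (\<lambda>x. (x - a) ^ j))"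
    and E: "\<And>j. j \<ge> K \<Longrightarrow> ereal (E - real n * real j) \<le> v (c j)"
  shows "ereal E \<le> v (\<alpha> ^ n * ball_integral v \<mu> a n (\<lambda>x. g x - (\<Sum>j<K. c j * (x - a) ^ j)))"
proof -
  have cQ: "c j \<in> Qp v" for j using g unfolding ball_expansion_iff by blast
  obtain C where C: "\<forall>g B. (\<forall>a\<in>Zp_units v. \<exists>c. ball_expansion v g a n c \<and>
     (\<forall>j. ereal (B - real n * real j) \<le> v (c j))) \<longrightarrow> ereal (C + B) \<le> v (\<mu> g)"
    using distribution_bound[OF \<mu> n] by blast
  \<comment> \<open>Chosen so that C + B together with the n r contributed by \<alpha>^n is exactly
    E.\<close>
  define B where "B = E - C - real n * r"
  obtain M where M: "\<And>j. j \<ge> M \<Longrightarrow> ereal (B - real n * real j) \<le> v (c j)"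
    using g unfolding ball_expansion_iff by blast
  define J where "J = max M K"
  have mono: "ball_expansion v (\<lambda>x. c j * (x - a) ^ j) a n (\<lambda>i. c j * (if i = j then 1 else 0))" for j
    by (rule ball_expansion_cmult[OF ball_expansion_power cQ])
  define R where "R x = g x - (\<Sum>j<J. c j * (x - a) ^ j)" for x
  have R: "ball_expansion v R a n (\<lambda>i. c i - (\<Sum>j<J. c j * (if i = j then 1 else 0)))"
    unfolding R_def by (intro ball_expansion_diff ball_expansion_sum g mono)
  have R_ge: "ereal (B - real n * real i) \<le> v (c i - (\<Sum>j<J. c j * (if i = j then 1 else 0)))" for i
  proof (cases "i < J")
    case True
    then have "(\<Sum>j<J. c j * (if i = j then 1 else 0)) = c i * (if i = i then 1 else 0)"
      by (intro sum_single) auto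
    then show ?thesis by simp
  next
    case False
    then have "(\<Sum>j<J. c j * (if i = j then 1 else 0)) = 0" by (intro sum.neutral) auto
    then show ?thesis using M[of i] False by (simp add: J_def)
  qed
  have "ereal (C + B) \<le> v (ball_integral v \<mu> a n R)"
    unfolding ball_integral_def
  proof (rule mp[OF spec[OF spec[OF C]]], rule ballI)
    fix a' assume a': "a' \<in> Zp_units v"
    show "\<exists>c. ball_expansion v (\<lambda>x. if v (x - a) \<ge> ereal (real n) then R x else 0) a' n c \<and>
        (\<forall>j. ereal (B - real n * real j) \<le> v (c j))"
      using restrict_ball_expansion[OF R a Zp_units_Qp[OF a'] R_ge] by blast
  qed
  moreover have "ereal (real n * r) \<le> v (\<alpha> ^ n)" using v_power[OF \<alpha>, of n] by simp
  ultimately have "ereal (real n * r + (C + B)) \<le> v (\<alpha> ^ n * ball_integral v \<mu> a n R)"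
    by (intro v_ge_mult)
  then have 1: "ereal E \<le> v (\<alpha> ^ n * ball_integral v \<mu> a n R)" by (rule v_ge_mono) (simp add: B_def)
  define S where "S x = (\<Sum>j\<in>{K..<J}. c j * (x - a) ^ j)" for x
  have S: "ball_expansion v S a n (\<lambda>i. \<Sum>j\<in>{K..<J}. c j * (if i = j then 1 else 0))"
    unfolding S_def by (intro ball_expansion_sum mono)
  have "ball_integral v \<mu> a n S = (\<Sum>j\<in>{K..<J}. c j * ball_integral v \<mu> a n (\<lambda>x. (x - a) ^ j))"
    unfolding S_def ball_integral_sum[OF \<mu> n a finite_atLeastLessThan mono]
    by (intro sum.cong refl ball_integral_cmult[OF \<mu> n a cQ ball_expansion_power])
  then have "\<alpha> ^ n * ball_integral v \<mu> a n S =
      (\<Sum>j\<in>{K..<J}. c j * (\<alpha> ^ n * ball_integral v \<mu> a n (\<lambda>x. (x - a) ^ j)))"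
    by (simp add: sum_distrib_left mult_ac)
  also have "ereal E \<le> v \<dots>"
  proof (rule v_ge_sum)
    fix j assume j: "j \<in> {K..<J}"
    have "ereal (E - real n * real j) \<le> v (c j)" by (rule E) (use j in simp)
    from v_ge_mult[OF this I[of j]]
    show "ereal E \<le> v (c j * (\<alpha> ^ n * ball_integral v \<mu> a n (\<lambda>x. (x - a) ^ j)))" by simp
  qed
  finally have 2: "ereal E \<le> v (\<alpha> ^ n * ball_integral v \<mu> a n S)" .
  have "{..<J} = {..<K} \<union> {K..<J}" by (auto simp: J_def)
  then have "(\<Sum>j<J. c j * (x - a) ^ j) = (\<Sum>j<K. c j * (x - a) ^ j) + S x" for x
    unfolding S_def by (simp add: sum.union_disjoint ivl_disj_int)
  then have eq: "g x - (\<Sum>j<K. c j * (x - a) ^ j) = S x - (-1 * R x)" for x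
    by (simp add: R_def)
  have mR: "ball_integral v \<mu> a n (\<lambda>x. -1 * R x) = -1 * ball_integral v \<mu> a n R"
    by (rule ball_integral_cmult[OF \<mu> n a Qp_minus[OF Qp_1] R])
  have "ball_integral v \<mu> a n (\<lambda>x. g x - (\<Sum>j<K. c j * (x - a) ^ j)) =
      ball_integral v \<mu> a n S + ball_integral v \<mu> a n R"
    unfolding eq ball_integral_diff[OF \<mu> n a S ball_expansion_cmult[OF R Qp_minus[OF Qp_1]]] mR by simp
  then show ?thesis using v_ge_add[OF 2 1] by (simp add: distrib_left)
qed

text \<open>Since m + 1 \<le> 2m \<le> p m, one step in m moves the logarithm to base p by at most
  1.\<close>

lemma floor_log_Suc:
  assumes "m \<ge> 1"
  shows "\<lfloor>ln (real (Suc m)) / ln (real p)\<rfloor> \<le> \<lfloor>ln (real m) / ln (real p)\<rfloor> + 1"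
proof -
  have "real (Suc m) \<le> real p * real m"
  proof -
    have "2 * real m \<le> real p * real m" using p_gt_1 by (intro mult_right_mono) auto
    then show ?thesis using assms by linarith
  qed
  then have "ln (real (Suc m)) \<le> ln (real p * real m)" using assms p_gt_1 by (subst ln_le_cancel_iff) auto
  also have "\<dots> = ln (real p) + ln (real m)" using assms p_gt_1 by (simp add: ln_mult)
  finally have "ln (real (Suc m)) / ln (real p) \<le> ln (real m) / ln (real p) + 1"
    using p_gt_1 by (simp add: field_simps)
  then have "\<lfloor>ln (real (Suc m)) / ln (real p)\<rfloor> \<le> \<lfloor>ln (real m) / ln (real p) + 1\<rfloor>" by (rule floor_mono)
  then show ?thesis by simp
qed

lemma floor_log_add:
  assumes "m \<ge> 1"
  shows "\<lfloor>ln (real (m + i)) / ln (real p)\<rfloor> \<le> \<lfloor>ln (real m) / ln (real p)\<rfloor> + int i"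
proof (induction i)
  case (Suc i)
  then show ?case using floor_log_Suc[of "m + i"] assms by simp
qed simp

lemma taylor_coeffs_eq:
  assumes "ball_expansion v g a n c" "a \<in> Qp v"
  shows "taylor_coeffs v g a = c"
  unfolding taylor_coeffs_def
proof (rule the_equality)
  show "\<exists>n. ball_expansion v g a n c" using assms by blast
  show "c' = c" if "\<exists>n. ball_expansion v g a n c'" for c'
    using that ball_expansion_unique assms by blast
qed

lemma Qp_coeff_linear_power:
  assumes "a \<in> Qp v"
  shows "coeff ([:- a, 1:] ^ j) i \<in> Qp v"
proof (induction j arbitrary: i)
  case 0
  then show ?case by simp
next
  case (Suc j)
  have "coeff ([:- a, 1:] ^ Suc j) i = - a * coeff ([:- a, 1:] ^ j) i + (if i = 0 then 0 else coeff ([:- a, 1:] ^ j) (i - 1))"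
    by (cases i) auto
  also have "\<dots> \<in> Qp v" using Suc assms by (auto intro!: Qp_add Qp_mult Qp_minus Qp_diff)
  finally show ?case .
qed

lemma TS_props:
  assumes "ball_expansion v g a n c" "a \<in> Qp v"
  shows "poly (TS v k a g) x = (\<Sum>j<Suc (k - 2). c j * (x - a) ^ j)"
    and "coeff (TS v k a g) i \<in> Qp v" and "degree (TS v k a g) \<le> k - 2"
proof -
  note t = taylor_coeffs_eq[OF assms]
  have cQ: "c j \<in> Qp v" for j using assms unfolding ball_expansion_iff by blast
  show "poly (TS v k a g) x = (\<Sum>j<Suc (k - 2). c j * (x - a) ^ j)"
    unfolding TS_def t lessThan_Suc_atMost by (simp add: poly_sum)
  show "coeff (TS v k a g) i \<in> Qp v"
    unfolding TS_def t coeff_sum using cQ Qp_coeff_linear_power[OF assms(2)] by (auto intro!: Qp_sum Qp_mult)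
  show "degree (TS v k a g) \<le> k - 2"
    unfolding TS_def
  proof (intro degree_sum_le)
    fix j assume j: "j \<in> {..k - 2}"
    have "degree (smult (taylor_coeffs v g a j) ([:- a, 1:] ^ j)) \<le> degree ([:- a, 1:] ^ j)"
      by (rule degree_smult_le)
    also have "\<dots> = j" by (simp add: degree_linear_power)
    finally show "degree (smult (taylor_coeffs v g a j) ([:- a, 1:] ^ j)) \<le> k - 2" using j by simp
  qed simp
qed

text \<open>The modular form enters only through an abstract moment functional \<open>M\<close> and
  the sharp moment bound, so this estimate is purely p-adic.\<close>

theorem approximation_error:
  assumes \<mu>: "loc_analytic_distribution v \<mu>" and k: "k \<ge> 2" "even k" and n: "n \<ge> 1"
    and \<alpha>: "v \<alpha> = ereal (real (k div 2 - 1))"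
    and M: "\<And>n a P. n \<ge> 1 \<Longrightarrow> \<not> int p dvd a \<Longrightarrow> (\<forall>i. coeff P i \<in> Qp v) \<Longrightarrow> degree P \<le> k - 2 \<Longrightarrow>
      ball_integral v \<mu> (of_int a) n (poly P) = M P a n"
    and bound: "\<And>n a j. n \<ge> 1 \<Longrightarrow> \<not> int p dvd a \<Longrightarrow>
      ereal (real n * real j) \<le> v (\<alpha> ^ n * ball_integral v \<mu> (of_int a) n (\<lambda>x. (x - of_int a) ^ j))"
  shows "ereal (real n * real k / 2 - of_int \<lfloor>ln (real k - 1) / ln (real p)\<rfloor>) \<le>
    v (Lp_deriv p v k \<mu> - (\<Sum>a | a \<in> {1..p ^ n - 1} \<and> \<not> p dvd a.
       M (TS v k (of_nat a) (\<lambda>x. x ^ (k div 2 - 1) * padic_log v (angle p v x))) (int a) n))"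
proof -
  define h where "h = k div 2 - 1"
  have kh: "k = 2 * h + 2" using k by (auto simp: h_def elim!: evenE)
  define g where "g x = x ^ h * padic_log v (angle p v x)" for x
  let ?L = "\<lambda>j. \<lfloor>ln (real j) / ln (real p)\<rfloor>"
  let ?I = "{a. a \<in> {1..p ^ n - 1} \<and> \<not> p dvd a}"
  have g_exp: "\<exists>c. ball_expansion v g a n c \<and> (\<forall>j>h. ereal (- of_int (?L j)) \<le> v (c j))"
    if "a \<in> Zp_units v" for a
    unfolding g_def by (rule ball_expansion_power_log[OF that n])
  have g_level: "g \<in> loc_analytic_level v n" using g_exp by (intro loc_analytic_levelI) blast
  \<comment> \<open>The bound before the division by \<alpha>^n, read off at the first degree k - 1
    of the tail.\<close>
  define E where "E = real n * real (k - 1) - of_int (?L (k - 1))"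
  have err: "ereal (E - real n * real h) \<le> v (ball_integral v \<mu> (of_nat a) n g - M (TS v k (of_nat a) g) (int a) n)"
    if a: "a \<in> ?I" for a
  proof -
    have pa: "\<not> int p dvd int a" using a by simp
    have au: "of_nat a \<in> Zp_units v" using of_int_unit[OF pa] by simp
    have aQ: "of_nat a \<in> Qp v" by simp
    obtain c where c: "ball_expansion v g (of_nat a) n c" "\<And>j. j > h \<Longrightarrow> ereal (- of_int (?L j)) \<le> v (c j)"
      using g_exp[OF au] by blast
    have cQ: "c j \<in> Qp v" for j using c(1) unfolding ball_expansion_iff by blast
    have "ereal E \<le> v (\<alpha> ^ n * ball_integral v \<mu> (of_nat a) n (\<lambda>x. g x - (\<Sum>j<Suc (k - 2). c j * (x - of_nat a) ^ j)))"
    proof (rule ball_integral_tail_bound[OF \<mu> n aQ \<alpha> c(1)])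
      show "ereal (real n * real j) \<le> v (\<alpha> ^ n * ball_integral v \<mu> (of_nat a) n (\<lambda>x. (x - of_nat a) ^ j))" for j
        using bound[OF n pa, of j] by simp
      fix j assume j: "Suc (k - 2) \<le> j"
      then have j': "j > h" using kh by simp
      define i where "i = j - (k - 1)"
      have i: "j = (k - 1) + i" using j k by (simp add: i_def)
      \<comment> \<open>Each further degree costs at most 1 in the denominator and gains n \<ge> 1,
        so degree k - 1 is the worst.\<close>
      have "?L j \<le> ?L (k - 1) + int i"
        unfolding i by (rule floor_log_add) (use k in simp)
      moreover have "real i \<le> real n * real i" using n mult_right_mono[of 1 "real n" "real i"] by simp
      moreover have "real n * real j = real n * real (k - 1) + real n * real i"
        unfolding i by (simp add: distrib_left)
      ultimately have "E - real n * real j \<le> - of_int (?L j)" unfolding E_def by linarith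
      then show "ereal (E - real n * real j) \<le> v (c j)" by (rule v_ge_mono[OF c(2)[OF j']])
    qed
    also have "(\<lambda>x. g x - (\<Sum>j<Suc (k - 2). c j * (x - of_nat a) ^ j)) = (\<lambda>x. g x - poly (TS v k (of_nat a) g) x)"
      using TS_props(1)[OF c(1) aQ] by simp
    also have "ball_integral v \<mu> (of_nat a) n \<dots> =
        ball_integral v \<mu> (of_nat a) n g - ball_integral v \<mu> (of_nat a) n (poly (TS v k (of_nat a) g))"
    proof -
      have "ball_expansion v (\<lambda>x. \<Sum>j<Suc (k - 2). c j * (x - of_nat a) ^ j) (of_nat a) n
          (\<lambda>i. \<Sum>j<Suc (k - 2). c j * (if i = j then 1 else 0))"
        by (intro ball_expansion_sum ball_expansion_cmult ball_expansion_power cQ)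
      then have "ball_expansion v (poly (TS v k (of_nat a) g)) (of_nat a) n
          (\<lambda>i. \<Sum>j<Suc (k - 2). c j * (if i = j then 1 else 0))"
        by (rule ball_expansion_cong) (rule TS_props(1)[OF c(1) aQ])
      then show ?thesis by (rule ball_integral_diff[OF \<mu> n aQ c(1)])
    qed
    also have "ball_integral v \<mu> (of_nat a) n (poly (TS v k (of_nat a) g)) = M (TS v k (of_nat a) g) (int a) n"
      using M[OF n pa, of "TS v k (of_nat a) g"] TS_props(2,3)[OF c(1) aQ] by simp
    finally have *: "ereal E \<le> v (\<alpha> ^ n * (ball_integral v \<mu> (of_nat a) n g - M (TS v k (of_nat a) g) (int a) n))" .
    have \<alpha>n: "v (\<alpha> ^ n) = ereal (real n * real h)" using v_power[OF \<alpha>, of n] by (simp add: h_def)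
    have "\<alpha> \<noteq> 0" using \<alpha> by auto
    then have "\<alpha> ^ n \<noteq> 0" by simp
    then show ?thesis using v_ge_divide[OF * \<alpha>n] by simp
  qed
  have "Lp_deriv p v k \<mu> = \<mu> g"
    unfolding Lp_deriv_eq[OF \<mu> k(1)] g_def h_def ..
  also have "\<dots> = (\<Sum>a\<in>?I. ball_integral v \<mu> (of_nat a) n g)"
    by (rule distribution_total[OF \<mu> n g_level])
  finally have "Lp_deriv p v k \<mu> - (\<Sum>a\<in>?I. M (TS v k (of_nat a) g) (int a) n) =
      (\<Sum>a\<in>?I. ball_integral v \<mu> (of_nat a) n g - M (TS v k (of_nat a) g) (int a) n)"
    by (simp add: sum_subtractf)
  moreover have "ereal (E - real n * real h) \<le>
      v (\<Sum>a\<in>?I. ball_integral v \<mu> (of_nat a) n g - M (TS v k (of_nat a) g) (int a) n)"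
    by (rule v_ge_sum[OF err])
  moreover have "E - real n * real h = real n * real k / 2 - of_int \<lfloor>ln (real k - 1) / ln (real p)\<rfloor>"
    unfolding E_def kh by (simp add: of_nat_diff field_simps)
  ultimately show ?thesis unfolding g_def[abs_def] h_def by simp
qed

end

subsection \<open>Integral matrices acting on the upper half-plane\<close>

abbreviation (input) m11 :: "int^2^2 \<Rightarrow> int" where "m11 A \<equiv> A $ 1 $ 1"
abbreviation (input) m12 :: "int^2^2 \<Rightarrow> int" where "m12 A \<equiv> A $ 1 $ 2"
abbreviation (input) m21 :: "int^2^2 \<Rightarrow> int" where "m21 A \<equiv> A $ 2 $ 1"
abbreviation (input) m22 :: "int^2^2 \<Rightarrow> int" where "m22 A \<equiv> A $ 2 $ 2"

definition mat2 :: "int \<Rightarrow> int \<Rightarrow> int \<Rightarrow> int \<Rightarrow> int^2^2" where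
  "mat2 a b c d = vector [vector [a, b], vector [c, d]]"

lemma mat2_nth [simp]:
  "m11 (mat2 a b c d) = a" "m12 (mat2 a b c d) = b"
  "m21 (mat2 a b c d) = c" "m22 (mat2 a b c d) = d"
  by (simp_all add: mat2_def)

lemma mat2_eq_iff: "A = B \<longleftrightarrow> m11 A = m11 B \<and> m12 A = m12 B \<and> m21 A = m21 B \<and> m22 A = m22 B"
  unfolding vec_eq_iff forall_2 by blast

lemma mult_nth:
  fixes A B :: "int^2^2"
  shows "m11 (A ** B) = m11 A * m11 B + m12 A * m21 B" "m12 (A ** B) = m11 A * m12 B + m12 A * m22 B"
    "m21 (A ** B) = m21 A * m11 B + m22 A * m21 B" "m22 (A ** B) = m21 A * m12 B + m22 A * m22 B"
  by (simp_all add: matrix_matrix_mult_def sum_2)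

lemma det_mat2 [simp]: "det (mat2 a b c d) = a * d - b * c"
  by (simp add: det_2)

definition mat_act :: "int^2^2 \<Rightarrow> complex \<Rightarrow> complex" where
  "mat_act A z = (of_int (m11 A) * z + of_int (m12 A)) / (of_int (m21 A) * z + of_int (m22 A))"

definition cocycle :: "int^2^2 \<Rightarrow> complex \<Rightarrow> complex" where
  "cocycle A z = of_int (m21 A) * z + of_int (m22 A)"

lemma slash_eq: "slash k f A z = f (mat_act A z) / cocycle A z ^ k"
  by (simp add: slash_def mat_act_def cocycle_def)

abbreviation uhp :: "complex set" where "uhp \<equiv> upper_half_plane"

lemma uhp_iff: "z \<in> uhp \<longleftrightarrow> Im z > 0"
  by (simp add: upper_half_plane_def)

lemma open_uhp: "open uhp"
  using open_halfspace_Im_gt[of 0] by (simp add: upper_half_plane_def)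

lemma convex_uhp: "convex uhp"
  using convex_halfspace_Im_gt[of 0] by (simp add: upper_half_plane_def)

lemma cocycle_nonzero:
  assumes "det A > 0" "z \<in> uhp"
  shows "cocycle A z \<noteq> 0"
proof
  assume 0: "cocycle A z = 0"
  then have "of_int (m21 A) * Im z = 0" by (simp add: cocycle_def complex_eq_iff)
  then have "m21 A = 0" using assms(2) by (simp add: uhp_iff)
  then show False using 0 assms(1) by (simp add: cocycle_def det_2)
qed

lemma Im_mat_act:
  assumes "det A > 0" "z \<in> uhp"
  shows "Im (mat_act A z) = of_int (det A) * Im z / (cmod (cocycle A z))\<^sup>2"
proof -
  let ?n = "of_int (m11 A) * z + of_int (m12 A)"
  have "mat_act A z = ?n / cocycle A z" by (simp add: mat_act_def cocycle_def)
  also have "\<dots> = ?n * cnj (cocycle A z) / (cocycle A z * cnj (cocycle A z))"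
  proof -
    have "n / c = n * d / (c * d)" if "d \<noteq> 0" for n c d :: complex using that by simp
    moreover have "cnj (cocycle A z) \<noteq> 0" using cocycle_nonzero[OF assms] by simp
    ultimately show ?thesis by blast
  qed
  also have "\<dots> = ?n * cnj (cocycle A z) / of_real ((cmod (cocycle A z))\<^sup>2)"
    by (simp only: complex_norm_square)
  finally have "Im (mat_act A z) = Im (?n * cnj (cocycle A z)) / (cmod (cocycle A z))\<^sup>2"
    by (simp del: of_real_power)
  also have "Im (?n * cnj (cocycle A z)) = of_int (det A) * Im z"
    by (simp add: cocycle_def det_2 algebra_simps)
  finally show ?thesis .
qed

lemma mat_act_uhp:
  assumes "det A > 0" "z \<in> uhp"
  shows "mat_act A z \<in> uhp"
  using assms cocycle_nonzero[OF assms] by (simp add: uhp_iff Im_mat_act)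

lemma cocycle_mult:
  assumes "det B > 0" "z \<in> uhp"
  shows "cocycle (A ** B) z = cocycle A (mat_act B z) * cocycle B z"
proof -
  have "mat_act B z * cocycle B z = of_int (m11 B) * z + of_int (m12 B)"
    using cocycle_nonzero[OF assms] by (simp add: mat_act_def cocycle_def)
  then have "cocycle A (mat_act B z) * cocycle B z =
      of_int (m21 A) * (of_int (m11 B) * z + of_int (m12 B)) + of_int (m22 A) * cocycle B z"
    unfolding cocycle_def[of A] by (simp add: distrib_right mult.assoc)
  then show ?thesis by (simp add: cocycle_def mult_nth algebra_simps)
qed

lemma mat_act_mult:
  assumes "det A > 0" "det B > 0" "z \<in> uhp"
  shows "mat_act (A ** B) z = mat_act A (mat_act B z)"
proof -
  let ?w = "mat_act B z"
  have B: "?w * cocycle B z = of_int (m11 B) * z + of_int (m12 B)" and B0: "cocycle B z \<noteq> 0"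
    using cocycle_nonzero[OF assms(2,3)] by (simp_all add: mat_act_def cocycle_def)
  have "mat_act A ?w = (of_int (m11 A) * ?w + of_int (m12 A)) / cocycle A ?w"
    by (simp add: mat_act_def cocycle_def)
  also have "\<dots> = ((of_int (m11 A) * ?w + of_int (m12 A)) * cocycle B z) / (cocycle A ?w * cocycle B z)"
    using B0 by simp
  also have "(of_int (m11 A) * ?w + of_int (m12 A)) * cocycle B z =
      of_int (m11 A) * (of_int (m11 B) * z + of_int (m12 B)) + of_int (m12 A) * cocycle B z"
    unfolding B[symmetric] by (simp add: algebra_simps)
  also have "\<dots> = of_int (m11 (A ** B)) * z + of_int (m12 (A ** B))"
    by (simp add: cocycle_def mult_nth algebra_simps)
  also have "cocycle A ?w * cocycle B z = cocycle (A ** B) z"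
    by (rule cocycle_mult[OF assms(2,3), symmetric])
  finally show ?thesis by (simp add: mat_act_def cocycle_def)
qed

lemma slash_mult:
  assumes "det A > 0" "det B > 0" "z \<in> uhp"
  shows "slash k (slash k f A) B z = slash k f (A ** B) z"
  using mat_act_mult[OF assms] cocycle_mult[OF assms(2,3), of A]
  by (simp add: slash_eq power_mult_distrib)

lemma slash_cong:
  assumes "\<And>z. z \<in> uhp \<Longrightarrow> f z = g z" "det A > 0" "z \<in> uhp"
  shows "slash k f A z = slash k g A z"
  using assms mat_act_uhp by (simp add: slash_eq)

lemma slash_id: "slash k f (mat 1) z = f z"
  by (simp add: slash_def mat_def)

text \<open>\<open>slash\<close> carries no power of the determinant, so a scalar matrix m acts as
  m^(-k). Factors p^k below come from this convention.\<close>

lemma slash_scaled: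
  assumes "m \<noteq> 0"
  shows "slash k f (mat2 (m * a) (m * b) (m * c) (m * d)) z = slash k f (mat2 a b c d) z / of_int m ^ k"
proof -
  have 1: "of_int (m * x) * z + of_int (m * y) = of_int m * (of_int x * z + of_int y)" for x y
    by (simp add: algebra_simps)
  show ?thesis using assms by (simp add: slash_def 1 power_mult_distrib del: of_int_mult)
qed

lemma holomorphic_mat_act:
  assumes "det A > 0"
  shows "mat_act A holomorphic_on uhp" and "cocycle A holomorphic_on uhp"
proof -
  show 1: "cocycle A holomorphic_on uhp" unfolding cocycle_def by (intro holomorphic_intros)
  show "mat_act A holomorphic_on uhp"
    unfolding mat_act_def using cocycle_nonzero[OF assms]
    by (intro holomorphic_intros) (auto simp: cocycle_def)
qed

lemma holomorphic_slash:
  assumes "f holomorphic_on uhp" "det A > 0"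
  shows "slash k f A holomorphic_on uhp"
proof -
  have "(f \<circ> mat_act A) holomorphic_on uhp"
    by (rule holomorphic_on_compose_gen[OF holomorphic_mat_act(1)[OF assms(2)] assms(1)])
      (use mat_act_uhp[OF assms(2)] in auto)
  then have "(\<lambda>z. (f \<circ> mat_act A) z / cocycle A z ^ k) holomorphic_on uhp"
    by (rule holomorphic_on_divide[OF _ holomorphic_on_power[OF holomorphic_mat_act(2)[OF assms(2)]]])
      (use cocycle_nonzero[OF assms(2)] in simp)
  then show ?thesis by (simp add: slash_eq[abs_def])
qed

lemma DERIV_mat_act:
  assumes "det A > 0" "z \<in> uhp"
  shows "(mat_act A has_field_derivative of_int (det A) / cocycle A z ^ 2) (at z)"
proof -
  have nz: "of_int (m21 A) * z + of_int (m22 A) \<noteq> 0"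
    using cocycle_nonzero[OF assms] by (simp add: cocycle_def)
  show ?thesis
    unfolding mat_act_def cocycle_def using nz
    by (auto intro!: derivative_eq_intros simp: det_2 power2_eq_square field_simps)
qed

text \<open>The vertical line over the pole of A joins the pole to infinity; its image joins
  infinity to a/c = A(infinity), with heights inverted.\<close>

lemma mat_act_vertical:
  assumes "m21 A \<noteq> 0" "t > 0"
  shows "mat_act A (- (of_int (m22 A) / of_int (m21 A)) + \<i> * of_real t) =
    of_int (m11 A) / of_int (m21 A) + \<i> * of_real (of_int (det A) / (of_int (m21 A) ^ 2 * t))"
proof -
  define c :: complex where "c = of_int (m21 A)"
  define T :: complex where "T = of_real t"
  have nz: "c \<noteq> 0" "T \<noteq> 0" using assms by (auto simp: c_def T_def)
  have d: "of_int (det A) = of_int (m11 A) * of_int (m22 A) - of_int (m12 A) * c"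
    by (simp add: det_2 c_def)
  have i2: "\<i> * (\<i> * x) = - x" for x by (simp flip: mult.assoc)
  have den: "c * (- (of_int (m22 A) / c) + \<i> * T) + of_int (m22 A) = \<i> * c * T"
    using nz by (simp add: field_simps)
  have "mat_act A (- (of_int (m22 A) / c) + \<i> * T) =
      (of_int (m11 A) * (- (of_int (m22 A) / c) + \<i> * T) + of_int (m12 A)) / (\<i> * c * T)"
    unfolding mat_act_def c_def[symmetric] den ..
  also have "\<dots> = of_int (m11 A) / c + \<i> * (of_int (det A) / (c ^ 2 * T))"
    unfolding d using nz by (simp add: power2_eq_square field_simps i2)
  finally show ?thesis by (simp add: c_def T_def)
qed

subsection \<open>Groups of matrices and their cosets\<close>

text \<open>A predicate with explicit two-sided inverses, as integral matrices do not form a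
  group.\<close>

definition matrix_subgroup :: "(int^2^2) set \<Rightarrow> bool" where
  "matrix_subgroup H \<longleftrightarrow> H \<subseteq> SL2Z \<and> mat 1 \<in> H \<and> (\<forall>A\<in>H. \<forall>B\<in>H. A ** B \<in> H) \<and>
     (\<forall>A\<in>H. \<exists>B\<in>H. B ** A = mat 1 \<and> A ** B = mat 1)"

lemma SL2Z_iff: "A \<in> SL2Z \<longleftrightarrow> m11 A * m22 A - m12 A * m21 A = 1"
  by (simp add: SL2Z_def det_2)

lemma SL2Z_det: "A \<in> SL2Z \<Longrightarrow> det A > 0"
  by (simp add: SL2Z_def)

lemma Gamma0_SL2Z: "A \<in> Gamma0 M \<Longrightarrow> A \<in> SL2Z"
  by (simp add: Gamma0_def)

lemma mat_1_mat2: "mat 1 = mat2 1 0 0 1"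
  by (simp add: mat2_eq_iff mat_def)

lemma matrix_subgroup_Gamma0: "matrix_subgroup (Gamma0 M)"
proof -
  have inv: "\<exists>B\<in>Gamma0 M. B ** A = mat 1 \<and> A ** B = mat 1" if A: "A \<in> Gamma0 M" for A
  proof -
    have 1: "m11 A * m22 A - m12 A * m21 A = 1" "int M dvd m21 A"
      using A by (auto simp: Gamma0_def SL2Z_iff)
    show ?thesis
      by (rule bexI[of _ "mat2 (m22 A) (- (m12 A)) (- (m21 A)) (m11 A)"])
        (use 1 in \<open>auto simp: Gamma0_def SL2Z_iff mat_1_mat2 mat2_eq_iff mult_nth algebra_simps\<close>)
  qed
  have "A ** B \<in> Gamma0 M" if "A \<in> Gamma0 M" "B \<in> Gamma0 M" for A B
    using that by (auto simp: Gamma0_def SL2Z_def det_mul mult_nth)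
  then show ?thesis
    using inv unfolding matrix_subgroup_def by (auto simp: Gamma0_def SL2Z_iff mat_1_mat2)
qed

lemma Gamma0_1: "Gamma0 1 = SL2Z"
  by (auto simp: Gamma0_def)

lemma matrix_subgroup_SL2Z: "matrix_subgroup SL2Z"
  using matrix_subgroup_Gamma0[of 1] by (simp add: Gamma0_1 del: One_nat_def)

lemma matrix_subgroupD:
  assumes "matrix_subgroup H"
  shows "mat 1 \<in> H" "A \<in> H \<Longrightarrow> A \<in> SL2Z" "A \<in> H \<Longrightarrow> B \<in> H \<Longrightarrow> A ** B \<in> H"
  using assms unfolding matrix_subgroup_def by auto

lemma matrix_subgroup_inv:
  assumes "matrix_subgroup H" "A \<in> H"
  obtains B where "B \<in> H" "B ** A = mat 1" "A ** B = mat 1"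
  using assms unfolding matrix_subgroup_def by blast

definition transversal :: "(int^2^2) set \<Rightarrow> (int^2^2) set \<Rightarrow> (int^2^2) set \<Rightarrow> bool" where
  "transversal H G R \<longleftrightarrow> finite R \<and> R \<subseteq> G \<and> (\<forall>A\<in>G. \<exists>D\<in>R. \<exists>B\<in>H. A = B ** D) \<and>
     (\<forall>D\<in>R. \<forall>D'\<in>R. \<forall>B\<in>H. D' = B ** D \<longrightarrow> D' = D)"

lemma transversalD:
  assumes "transversal H G R"
  shows transversal_finite: "finite R" and transversal_mem: "D \<in> R \<Longrightarrow> D \<in> G"
    and transversal_unique: "D \<in> R \<Longrightarrow> D' \<in> R \<Longrightarrow> B \<in> H \<Longrightarrow> D' = B ** D \<Longrightarrow> D' = D"
proof -
  note * = assms[unfolded transversal_def]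
  show "finite R" using * by (elim conjE)
  show "D \<in> G" if "D \<in> R" using * that by (elim conjE) (rule subsetD)
  show "D' = D" if "D \<in> R" "D' \<in> R" "B \<in> H" "D' = B ** D"
    by (rule mp[OF bspec[OF bspec[OF bspec[OF conjunct2[OF conjunct2[OF conjunct2[OF *]]] that(1)] that(2)] that(3)] that(4)])
qed

lemma transversal_cover:
  assumes "transversal H G R" "A \<in> G"
  obtains D B where "D \<in> R" "B \<in> H" "A = B ** D"
proof -
  have "\<forall>A\<in>G. \<exists>D\<in>R. \<exists>B\<in>H. A = B ** D" using assms(1)[unfolded transversal_def] by (elim conjE)
  from bspec[OF this assms(2)] that show ?thesis by (elim bexE)
qed

text \<open>Converts the shape used in the Petersson product, a sum over cosets with chosen
  representatives, into a sum over any convenient transversal.\<close>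

lemma sum_cosets:
  fixes \<phi> :: "int^2^2 \<Rightarrow> 'a::comm_monoid_add"
  assumes H: "matrix_subgroup H" and R: "transversal H G R"
    and \<phi>: "\<And>B D. B \<in> H \<Longrightarrow> D \<in> G \<Longrightarrow> \<phi> (B ** D) = \<phi> D"
  shows "(\<Sum>C\<in>(\<lambda>A. (\<lambda>B. B ** A) ` H) ` G. \<phi> (SOME A. A \<in> C)) = (\<Sum>D\<in>R. \<phi> D)"
proof -
  define cs where "cs A = (\<lambda>B. B ** A) ` H" for A :: "int^2^2"
  have RG: "D \<in> G" if "D \<in> R" for D by (rule transversal_mem[OF R that])
  have self: "A \<in> cs A" for A
    unfolding cs_def using matrix_subgroupD(1)[OF H] by (auto intro!: image_eqI[of _ _ "mat 1"])
  have cs_eq: "cs (B ** A) = cs A" if B: "B \<in> H" for A B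
  proof -
    obtain B' where B': "B' \<in> H" "B' ** B = mat 1" by (rule matrix_subgroup_inv[OF H B])
    have "C ** (B ** A) \<in> cs A" if "C \<in> H" for C
      unfolding cs_def matrix_mul_assoc using matrix_subgroupD(3)[OF H that B] by blast
    moreover have "C ** A \<in> cs (B ** A)" if "C \<in> H" for C
    proof -
      have "(C ** B') ** (B ** A) = C ** ((B' ** B) ** A)" by (simp only: matrix_mul_assoc)
      then have "C ** A = (C ** B') ** (B ** A)" by (simp only: B'(2) matrix_mul_lid)
      then show ?thesis unfolding cs_def using matrix_subgroupD(3)[OF H that B'(1)] by blast
    qed
    ultimately show ?thesis by (auto simp: cs_def)
  qed
  have "bij_betw cs R (cs ` G)"
    unfolding bij_betw_def
  proof
    show "inj_on cs R"
    proof (rule inj_onI)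
      fix D D' assume D: "D \<in> R" "D' \<in> R" "cs D = cs D'"
      then have "D' \<in> cs D" using self by simp
      then obtain B where "B \<in> H" "D' = B ** D" unfolding cs_def by blast
      then have "D' = D" by (rule transversal_unique[OF R D(1,2)])
      then show "D = D'" ..
    qed
    show "cs ` R = cs ` G"
    proof
      show "cs ` G \<subseteq> cs ` R"
      proof
        fix C assume "C \<in> cs ` G"
        then obtain A where A: "A \<in> G" "C = cs A" by blast
        then obtain D B where "D \<in> R" "B \<in> H" "A = B ** D" using transversal_cover[OF R A(1)] by metis
        then show "C \<in> cs ` R" using A cs_eq by auto
      qed
    qed (use RG in auto)
  qed
  then have "(\<Sum>C\<in>cs ` G. \<phi> (SOME A. A \<in> C)) = (\<Sum>D\<in>R. \<phi> (SOME A. A \<in> cs D))"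
    by (rule sum.reindex_bij_betw[symmetric])
  also have "\<dots> = (\<Sum>D\<in>R. \<phi> D)"
  proof (rule sum.cong)
    fix D assume D: "D \<in> R"
    have "(SOME A. A \<in> cs D) \<in> cs D" using self by (rule someI)
    then obtain B where "B \<in> H" "(SOME A. A \<in> cs D) = B ** D" unfolding cs_def by blast
    then show "\<phi> (SOME A. A \<in> cs D) = \<phi> D" using \<phi> RG[OF D] by simp
  qed simp
  finally show ?thesis unfolding cs_def .
qed

lemma sum_transversal_eq:
  fixes \<phi> :: "int^2^2 \<Rightarrow> 'a::comm_monoid_add"
  assumes H: "matrix_subgroup H" and R: "transversal H G R" "transversal H G R'"
    and \<phi>: "\<And>B D. B \<in> H \<Longrightarrow> D \<in> G \<Longrightarrow> \<phi> (B ** D) = \<phi> D"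
  shows "(\<Sum>D\<in>R. \<phi> D) = (\<Sum>D\<in>R'. \<phi> D)"
  using sum_cosets[OF H R(1) \<phi>] sum_cosets[OF H R(2) \<phi>] by simp

lemma inj_on_mult_right:
  fixes X Y :: "int^2^2"
  assumes "X ** Y = mat 1"
  shows "inj_on (\<lambda>D. D ** X) S"
proof (rule inj_onI)
  fix A B assume "A ** X = B ** X"
  then have "A ** (X ** Y) = B ** (X ** Y)" by (simp add: matrix_mul_assoc)
  then show "A = B" by (simp add: assms)
qed

lemma transversal_mult_right:
  assumes G: "matrix_subgroup G" and R: "transversal H G R" and X: "X \<in> G"
  shows "transversal H G ((\<lambda>D. D ** X) ` R)" and "inj_on (\<lambda>D. D ** X) R"
proof -
  obtain Y where Y: "Y \<in> G" "X ** Y = mat 1" "Y ** X = mat 1" by (rule matrix_subgroup_inv[OF G X])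
  show "inj_on (\<lambda>D. D ** X) R" using Y(2) by (rule inj_on_mult_right)
  have cancel: "(A ** Y) ** X = A" "(A ** X) ** Y = A" for A :: "int^2^2"
    using Y by (simp_all flip: matrix_mul_assoc)
  show "transversal H G ((\<lambda>D. D ** X) ` R)"
    unfolding transversal_def
  proof (intro conjI ballI impI)
    show "finite ((\<lambda>D. D ** X) ` R)" using transversal_finite[OF R] by simp
    show "(\<lambda>D. D ** X) ` R \<subseteq> G"
      using matrix_subgroupD(3)[OF G transversal_mem[OF R] X] by auto
  next
    fix A assume "A \<in> G"
    then have "A ** Y \<in> G" using Y matrix_subgroupD(3)[OF G] by blast
    then obtain D B where DB: "D \<in> R" "B \<in> H" "A ** Y = B ** D" by (rule transversal_cover[OF R])
    then have "A = B ** (D ** X)" by (metis cancel(1) matrix_mul_assoc)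
    then show "\<exists>D\<in>(\<lambda>D. D ** X) ` R. \<exists>B\<in>H. A = B ** D" using DB by blast
  next
    fix E E' B assume E: "E \<in> (\<lambda>D. D ** X) ` R" "E' \<in> (\<lambda>D. D ** X) ` R" and B: "B \<in> H" "E' = B ** E"
    then obtain D D' where D: "D \<in> R" "E = D ** X" "D' \<in> R" "E' = D' ** X" by blast
    then have "D' = B ** D" using B by (metis cancel(2) matrix_mul_assoc)
    then have "D' = D" by (rule transversal_unique[OF R D(1,3) B(1)])
    then show "E' = E" using D by simp
  qed
qed

text \<open>If D' A' = B D A, then A and A' lie in the same coset of G, hence agree; cancelling A
  leaves D and D' in the same coset of H.\<close>

lemma transversal_tower:
  assumes H: "matrix_subgroup H" and G: "matrix_subgroup G" and HG: "H \<subseteq> G"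
    and S: "matrix_subgroup S" and GS: "G \<subseteq> S"
    and R1: "transversal G S R1" and R2: "transversal H G R2"
  shows "transversal H S ((\<lambda>(D, A). D ** A) ` (R2 \<times> R1))" and "inj_on (\<lambda>(D, A). D ** A) (R2 \<times> R1)"
proof -
  have key: "A' = A \<and> D' = D" if D: "D \<in> R2" "D' \<in> R2" "A \<in> R1" "A' \<in> R1" and B: "B \<in> H" "D' ** A' = B ** (D ** A)"
    for A A' D D' B
  proof -
    have DG: "D \<in> G" "D' \<in> G" using D transversal_mem[OF R2] by blast+
    have AS: "A \<in> S" using D transversal_mem[OF R1] by blast
    obtain Y where Y: "Y \<in> G" "Y ** D' = mat 1" "D' ** Y = mat 1" by (rule matrix_subgroup_inv[OF G DG(2)])
    have "A' = Y ** (D' ** A')" using Y by (simp add: matrix_mul_assoc)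
    also have "\<dots> = (Y ** (B ** D)) ** A" unfolding B(2) by (simp add: matrix_mul_assoc)
    finally have 1: "A' = (Y ** (B ** D)) ** A" .
    have "Y ** (B ** D) \<in> G" using Y B HG DG matrix_subgroupD(3)[OF G] by blast
    then have A: "A' = A" using 1 by (rule transversal_unique[OF R1 D(3,4)])
    obtain Z where Z: "Z \<in> S" "Z ** A = mat 1" "A ** Z = mat 1" by (rule matrix_subgroup_inv[OF S AS])
    have "D' = (D' ** A) ** Z" using Z by (simp flip: matrix_mul_assoc)
    also have "\<dots> = (B ** D) ** (A ** Z)" using B(2) unfolding A by (simp add: matrix_mul_assoc)
    finally have "D' = B ** D" using Z by simp
    then show ?thesis using A transversal_unique[OF R2 D(1,2) B(1)] by blast
  qed
  show "inj_on (\<lambda>(D, A). D ** A) (R2 \<times> R1)"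
  proof (rule inj_onI, clarify)
    fix D A D' A' assume *: "D \<in> R2" "A \<in> R1" "D' \<in> R2" "A' \<in> R1" "D ** A = D' ** A'"
    then have "D' ** A' = mat 1 ** (D ** A)" by simp
    from key[OF *(1,3,2,4) matrix_subgroupD(1)[OF H] this] show "D = D' \<and> A = A'" by blast
  qed
  show "transversal H S ((\<lambda>(D, A). D ** A) ` (R2 \<times> R1))"
    unfolding transversal_def
  proof (intro conjI ballI impI)
    show "finite ((\<lambda>(D, A). D ** A) ` (R2 \<times> R1))"
      using transversal_finite[OF R1] transversal_finite[OF R2] by simp
    have "D ** A \<in> S" if "D \<in> R2" "A \<in> R1" for D A
      using matrix_subgroupD(3)[OF S _ transversal_mem[OF R1 that(2)]] transversal_mem[OF R2 that(1)] GS by blast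
    then show "(\<lambda>(D, A). D ** A) ` (R2 \<times> R1) \<subseteq> S" by auto
  next
    fix X assume "X \<in> S"
    then obtain A C where A: "A \<in> R1" "C \<in> G" "X = C ** A" by (rule transversal_cover[OF R1])
    obtain D B where D: "D \<in> R2" "B \<in> H" "C = B ** D" by (rule transversal_cover[OF R2 A(2)])
    have "X = B ** (D ** A)" using A D by (simp add: matrix_mul_assoc)
    then show "\<exists>D\<in>(\<lambda>(D, A). D ** A) ` (R2 \<times> R1). \<exists>B\<in>H. X = B ** D" using A D by force
  next
    fix E E' B assume E: "E \<in> (\<lambda>(D, A). D ** A) ` (R2 \<times> R1)" "E' \<in> (\<lambda>(D, A). D ** A) ` (R2 \<times> R1)"
      and B: "B \<in> H" "E' = B ** E"
    obtain D A where D: "D \<in> R2" "A \<in> R1" "E = D ** A" using E(1) by auto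
    obtain D' A' where D': "D' \<in> R2" "A' \<in> R1" "E' = D' ** A'" using E(2) by auto
    have "A' = A \<and> D' = D" by (rule key[OF D(1) D'(1) D(2) D'(2) B(1)]) (use B(2) D D' in simp)
    then show "E' = E" using D D' by simp
  qed
qed

text \<open>The bottom row modulo M determines the coset: for equal rows the lower left entry of A
  D^(-1) vanishes modulo M. So there are only finitely many cosets.\<close>

lemma ex_transversal_SL2Z:
  assumes "M > 0"
  obtains R where "transversal (Gamma0 M) SL2Z R"
proof -
  define row where "row A = (m21 A mod int M, m22 A mod int M)" for A :: "int^2^2"
  define rep where "rep r = (SOME A. A \<in> SL2Z \<and> row A = r)" for r
  have rep: "rep (row A) \<in> SL2Z \<and> row (rep (row A)) = row A" if "A \<in> SL2Z" for A
    unfolding rep_def by (rule someI[of _ A]) (use that in simp)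
  define C where "C = rep ` row ` SL2Z"
  have "row ` SL2Z \<subseteq> {0..<int M} \<times> {0..<int M}" using assms by (auto simp: row_def)
  then have "finite (row ` SL2Z)" by (rule finite_subset) simp
  then have fin: "finite C" unfolding C_def by (rule finite_imageI)
  have CS: "C \<subseteq> SL2Z" unfolding C_def using rep by auto
  have rel: "\<exists>B\<in>Gamma0 M. A = B ** D" if A: "A \<in> SL2Z" and D: "D \<in> SL2Z" and eq: "row A = row D" for A D
  proof -
    obtain Y where Y: "Y \<in> SL2Z" "Y ** D = mat 1" "D ** Y = mat 1"
      by (rule matrix_subgroup_inv[OF matrix_subgroup_SL2Z D])
    have Yeq: "Y = mat2 (m22 D) (- (m12 D)) (- (m21 D)) (m11 D)"
    proof -
      have "D ** mat2 (m22 D) (- (m12 D)) (- (m21 D)) (m11 D) = mat 1"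
        using D by (simp add: SL2Z_iff mat_1_mat2 mat2_eq_iff mult_nth algebra_simps)
      then have "Y ** (D ** mat2 (m22 D) (- (m12 D)) (- (m21 D)) (m11 D)) = Y ** mat 1" by simp
      then show ?thesis by (simp add: matrix_mul_assoc Y(2))
    qed
    have "int M dvd m21 A - m21 D" "int M dvd m22 A - m22 D"
      using eq by (simp_all add: row_def mod_eq_dvd_iff)
    then have "int M dvd (m21 A - m21 D) * m22 D - (m22 A - m22 D) * m21 D"
      by (rule dvd_diff[OF dvd_mult2 dvd_mult2])
    then have "int M dvd m21 (A ** Y)" unfolding Yeq by (simp add: mult_nth algebra_simps)
    moreover have "A ** Y \<in> SL2Z" by (rule matrix_subgroupD(3)[OF matrix_subgroup_SL2Z A Y(1)])
    moreover have "A = (A ** Y) ** D" using Y(2) by (simp flip: matrix_mul_assoc)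
    ultimately show ?thesis by (auto simp: Gamma0_def)
  qed
  text \<open>A minimal set meeting every coset is a transversal.\<close>
  define P where "P S \<longleftrightarrow> S \<subseteq> C \<and> (\<forall>A\<in>SL2Z. \<exists>D\<in>S. \<exists>B\<in>Gamma0 M. A = B ** D)" for S
  have "P C"
    unfolding P_def
  proof (intro conjI ballI)
    fix A assume A: "A \<in> SL2Z"
    have "\<exists>B\<in>Gamma0 M. A = B ** rep (row A)" using rel[OF A] rep[OF A] by simp
    moreover have "rep (row A) \<in> C" using A by (simp add: C_def)
    ultimately show "\<exists>D\<in>C. \<exists>B\<in>Gamma0 M. A = B ** D" by blast
  qed simp
  define R where "R = arg_min card P"
  have R: "P R" and min: "\<And>S. P S \<Longrightarrow> card R \<le> card S"
    unfolding R_def using arg_min_nat_lemma[of P C card] \<open>P C\<close> by auto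
  have RC: "R \<subseteq> C" using R by (simp add: P_def)
  have "finite R" using RC fin by (rule finite_subset)
  have "D' = D" if D: "D \<in> R" "D' \<in> R" and B: "B \<in> Gamma0 M" "D' = B ** D" for D D' B
  proof (rule ccontr)
    assume ne: "D' \<noteq> D"
    have "P (R - {D'})"
      unfolding P_def
    proof (intro conjI ballI)
      show "R - {D'} \<subseteq> C" using RC by auto
      fix A assume "A \<in> SL2Z"
      then obtain E B' where E: "E \<in> R" "B' \<in> Gamma0 M" "A = B' ** E" using R unfolding P_def by blast
      show "\<exists>D\<in>R - {D'}. \<exists>B\<in>Gamma0 M. A = B ** D"
      proof (cases "E = D'")
        case True
        then have "A = (B' ** B) ** D" using E B by (simp add: matrix_mul_assoc)
        moreover have "B' ** B \<in> Gamma0 M"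
          using E B matrix_subgroupD(3)[OF matrix_subgroup_Gamma0] by blast
        ultimately show ?thesis using D ne by blast
      qed (use E in blast)
    qed
    then have "card R \<le> card (R - {D'})" by (rule min)
    moreover have "card (R - {D'}) < card R" using \<open>finite R\<close> D by (intro card_Diff1_less)
    ultimately show False by simp
  qed
  then have "transversal (Gamma0 M) SL2Z R"
    using R CS \<open>finite R\<close> unfolding transversal_def P_def by (intro conjI) blast+
  then show ?thesis by (rule that)
qed

subsection \<open>Periodic functions and \<open>q\<close>-expansions\<close>

lemma periodic_of_int:
  assumes per: "\<And>z. z \<in> uhp \<Longrightarrow> u (z + of_real M) = (u z :: complex)" and z: "z \<in> uhp"
  shows "u (z + of_int m * of_real M) = u z"
proof -
  have nat: "u (z + of_nat m * of_real M) = u z" if "z \<in> uhp" for m :: nat and z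
    using that
  proof (induction m)
    case (Suc m)
    have "z + of_nat m * of_real M \<in> uhp" using Suc.prems by (simp add: uhp_iff)
    from per[OF this] Suc show ?case by (simp add: algebra_simps)
  qed simp
  show ?thesis
  proof (cases m rule: int_cases2)
    case (nonneg l)
    then show ?thesis using nat[OF z, of l] by simp
  next
    case (nonpos l)
    have "z + of_int m * of_real M \<in> uhp" using z by (simp add: uhp_iff)
    from nat[OF this, of l] show ?thesis using nonpos by simp
  qed
qed

text \<open>u descends to the punctured disc through q = exp(2 pi i z/M), and vanishing at infinity
  makes q = 0 a removable singularity.\<close>

lemma periodic_expansion:
  fixes M :: real
  assumes M: "M > 0" and hol: "u holomorphic_on uhp"
    and per: "\<And>z. z \<in> uhp \<Longrightarrow> u (z + of_real M) = u z"
    and lim: "(u \<longlongrightarrow> 0) (filtercomap Im at_top)"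
  obtains G where "G holomorphic_on ball 0 1" "G 0 = 0"
    "\<And>z. z \<in> uhp \<Longrightarrow> u z = G (exp (2 * of_real pi * \<i> * z / of_real M))"
proof -
  define e where "e z = exp (2 * of_real pi * \<i> * z / of_real M)" for z
  define b where "b q = of_real M * Ln q / (2 * of_real pi * \<i>)" for q
  define G where "G q = (if q = 0 then 0 else u (b q))" for q
  have norm_e: "norm (e z) = exp (- (2 * pi * Im z / M))" for z
    by (simp add: e_def norm_exp_eq_Re)
  have e_uhp: "norm (e z) < 1 \<longleftrightarrow> z \<in> uhp" for z
    using M by (simp add: norm_e uhp_iff zero_less_mult_iff zero_less_divide_iff)
  have eb: "e (b q) = q" if "q \<noteq> 0" for q
    using that M by (simp add: e_def b_def)
  have e_eq: "u z = u w" if "e z = e w" "z \<in> uhp" "w \<in> uhp" for z w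
  proof -
    obtain m :: int where "2 * of_real pi * \<i> * z / of_real M = 2 * of_real pi * \<i> * w / of_real M + of_int (2 * m) * pi * \<i>"
      using \<open>e z = e w\<close> unfolding e_def exp_eq by blast
    moreover have "(2 * of_real pi * \<i> / of_real M) * (z - (w + of_int m * of_real M)) =
        2 * of_real pi * \<i> * z / of_real M - (2 * of_real pi * \<i> * w / of_real M + of_int (2 * m) * pi * \<i>)"
      using M by (simp add: field_simps)
    ultimately have "(2 * of_real pi * \<i> / of_real M) * (z - (w + of_int m * of_real M)) = 0"
      by simp
    then have "z = w + of_int m * of_real M" using M by simp
    then show ?thesis using periodic_of_int[of u M w m] per that(3) by simp
  qed
  have G_eq: "G (e z) = u z" if "z \<in> uhp" for z
  proof -
    have nz: "e z \<noteq> 0" by (simp add: e_def)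
    have "b (e z) \<in> uhp" using eb[OF nz] e_uhp that by metis
    then have "u (b (e z)) = u z" using eb[OF nz] that by (intro e_eq) auto
    then show ?thesis using nz by (simp add: G_def)
  qed
  have "G holomorphic_on ball 0 1"
  proof (rule no_isolated_singularity')
    show "open (ball (0::complex) 1)" "finite {0::complex}" by auto
    have "G analytic_on {q0}" if q0: "q0 \<in> ball 0 1 - {0}" for q0
    proof -
      define S where "S = ball 0 1 \<inter> {q. 0 < Re (q / q0)}"
      \<comment> \<open>A branch of the logarithm near q0: Ln(q/q0) is holomorphic for Re(q/q0) > 0
        wherever q0 lies, whereas the global choice \<open>b\<close> jumps across the cut.\<close>
      define w where "w q = b q0 + of_real M * Ln (q / q0) / (2 * of_real pi * \<i>)" for q
      have ew: "e (w q) = q" if "q \<in> S" for q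
      proof -
        have q: "q / q0 \<noteq> 0" using that by (auto simp: S_def)
        have "2 * of_real pi * \<i> * w q / of_real M = 2 * of_real pi * \<i> * b q0 / of_real M + Ln (q / q0)"
          unfolding w_def using M by (simp add: distrib_left add_divide_distrib)
        then have "e (w q) = e (b q0) * exp (Ln (q / q0))" by (simp only: e_def exp_add)
        then show ?thesis using q q0 eb[of q0] by simp
      qed
      have w_uhp: "w q \<in> uhp" if "q \<in> S" for q
        using ew[OF that] e_uhp[of "w q"] that by (simp add: S_def)
      have "(\<lambda>q. Ln (q / q0)) holomorphic_on S"
        using q0 by (intro holomorphic_intros) (auto simp: S_def complex_nonpos_Reals_iff)
      then have "w holomorphic_on S"
        unfolding w_def
        by (intro holomorphic_on_add holomorphic_on_const holomorphic_on_divide holomorphic_on_mult) auto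
      then have "(u \<circ> w) holomorphic_on S"
        using w_uhp by (intro holomorphic_on_compose_gen[OF _ hol]) auto
      moreover have "(u \<circ> w) q = G q" if "q \<in> S" for q
        using G_eq[OF w_uhp[OF that]] ew[OF that] by simp
      ultimately have "G holomorphic_on S" by (rule holomorphic_transform)
      moreover have "open S"
        unfolding S_def by (intro open_Int open_ball open_Collect_less continuous_intros) (use q0 in auto)
      moreover have "q0 \<in> S" using q0 by (simp add: S_def)
      ultimately show ?thesis by (meson analytic_at)
    qed
    then show "G holomorphic_on (ball 0 1 - {0})"
      using analytic_imp_holomorphic analytic_on_analytic_at by blast
    show "(G \<longlongrightarrow> G z) (at z within ball 0 1)" if "z \<in> {0}" for z
    proof -
      have "(G \<longlongrightarrow> 0) (at 0)"
      proof (rule LIM_I)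
        fix r :: real assume r: "r > 0"
        have "eventually (\<lambda>z. dist (u z) 0 < r) (filtercomap Im at_top)" using lim r by (rule tendstoD)
        then obtain Y where Y: "\<And>z. Im z \<ge> Y \<Longrightarrow> norm (u z) < r"
          unfolding eventually_filtercomap eventually_at_top_linorder by auto
        define s where "s = min 1 (exp (- (2 * pi * Y / M)))"
        have "norm (G q - 0) < r" if q: "q \<noteq> 0" "norm (q - 0) < s" for q
        proof -
          have "norm (e (b q)) < exp (- (2 * pi * Y / M))" using q eb by (simp add: s_def)
          then have "2 * pi * Y / M < 2 * pi * Im (b q) / M" unfolding norm_e by simp
          then have "Y < Im (b q)" using M by (simp add: divide_less_cancel mult_less_cancel_left)
          then show ?thesis using Y[of "b q"] q by (simp add: G_def)
        qed
        moreover have "s > 0" by (simp add: s_def)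
        ultimately show "\<exists>s>0. \<forall>x. x \<noteq> 0 \<and> norm (x - 0) < s \<longrightarrow> norm (G x - 0) < r" by blast
      qed
      then show ?thesis using that by (simp add: G_def tendsto_within_subset[of _ _ _ UNIV])
    qed
  qed
  moreover have "G 0 = 0" by (simp add: G_def)
  ultimately show ?thesis using G_eq that unfolding e_def by metis
qed

text \<open>G vanishes at 0 and has bounded derivative on a smaller closed disc, so |G(q)| \<le> K
  |q|, and |q| is the exponential on the right.\<close>

lemma periodic_decay:
  fixes M y0 :: real
  assumes M: "M > 0" and hol: "u holomorphic_on uhp"
    and per: "\<And>z. z \<in> uhp \<Longrightarrow> u (z + of_real M) = u z"
    and lim: "(u \<longlongrightarrow> 0) (filtercomap Im at_top)" and y0: "y0 > 0"
  shows "\<exists>K\<ge>0. \<forall>z. Im z \<ge> y0 \<longrightarrow> norm (u z) \<le> K * exp (- (2 * pi / M * Im z))"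
proof -
  obtain G where G: "G holomorphic_on ball 0 1" "G 0 = 0"
    "\<And>z. z \<in> uhp \<Longrightarrow> u z = G (exp (2 * of_real pi * \<i> * z / of_real M))"
    using periodic_expansion[OF M hol per lim] by blast
  define \<rho> where "\<rho> = exp (- (2 * pi / M * y0))"
  have \<rho>: "0 < \<rho>" "\<rho> < 1" using M y0 by (auto simp: \<rho>_def)
  have sub: "cball 0 \<rho> \<subseteq> ball (0::complex) 1" using \<rho> by (auto simp: subset_iff)
  have "continuous_on (cball 0 \<rho>) (deriv G)"
    using holomorphic_deriv[OF G(1)] sub holomorphic_on_imp_continuous_on holomorphic_on_subset by blast
  then have "compact (deriv G ` cball 0 \<rho>)" by (intro compact_continuous_image) auto
  then obtain K where K: "\<And>q. q \<in> cball 0 \<rho> \<Longrightarrow> norm (deriv G q) \<le> K"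
    using compact_imp_bounded bounded_iff by (metis imageI)
  have "0 \<le> norm (deriv G 0)" by simp
  also have "\<dots> \<le> K" using \<rho> by (intro K) auto
  finally have K0: "K \<ge> 0" .
  have "norm (u z) \<le> K * exp (- (2 * pi / M * Im z))" if z: "Im z \<ge> y0" for z
  proof -
    define q where "q = exp (2 * of_real pi * \<i> * z / of_real M)"
    have nq: "norm q = exp (- (2 * pi / M * Im z))" by (simp add: q_def norm_exp_eq_Re)
    have "2 * pi / M * y0 \<le> 2 * pi / M * Im z" using z M by (intro mult_left_mono) auto
    then have q: "q \<in> cball 0 \<rho>" by (simp add: nq \<rho>_def)
    have df: "(G has_field_derivative deriv G x) (at x within cball 0 \<rho>)" if "x \<in> cball 0 \<rho>" for x
    proof -
      have "x \<in> ball 0 1" using that sub by blast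
      then show ?thesis
        by (rule has_field_derivative_at_within[OF holomorphic_derivI[OF G(1) open_ball]])
    qed
    have "0 \<in> cball (0::complex) \<rho>" using \<rho> by simp
    from field_differentiable_bound[OF convex_cball df K q this]
    have "norm (G q - G 0) \<le> K * norm (q - 0)" .
    moreover have "z \<in> uhp" using z y0 by (simp add: uhp_iff)
    ultimately show ?thesis using G by (simp add: nq q_def)
  qed
  then show ?thesis using K0 by blast
qed

lemma cusp_formsD:
  assumes "f \<in> cusp_forms k M"
  shows "f holomorphic_on uhp" "A \<in> Gamma0 M \<Longrightarrow> z \<in> uhp \<Longrightarrow> slash k f A z = f z"
    "A \<in> SL2Z \<Longrightarrow> (slash k f A \<longlongrightarrow> 0) (filtercomap Im at_top)"
  using assms by (auto simp: cusp_forms_def)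

text \<open>Conjugation by any A of determinant 1 carries the translation by M into the group of
  level M, so the level is a period at every cusp.\<close>

lemma cusp_form_slash_periodic:
  assumes f: "f \<in> cusp_forms k M" and A: "A \<in> SL2Z" and z: "z \<in> uhp"
  shows "slash k f A (z + of_real (real M)) = slash k f A z"
proof -
  let ?M = "int M"
  define T where "T = mat2 1 ?M 0 1"
  \<comment> \<open>X = A T A^(-1); its lower left entry is -M c^2, with c that of A.\<close>
  define X where "X = mat2 (1 - ?M * m11 A * m21 A) (?M * m11 A ^ 2) (- ?M * m21 A ^ 2) (1 + ?M * m11 A * m21 A)"
  have d: "m11 A * m22 A - m12 A * m21 A = 1" using A by (simp add: SL2Z_iff)
  have XT: "X ** A = A ** T"
  proof -
    have 1: "(1 - ?M * m11 A * m21 A) * m12 A + ?M * m11 A ^ 2 * m22 A = m12 A + ?M * m11 A * (m11 A * m22 A - m12 A * m21 A)"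
      by (simp add: power2_eq_square algebra_simps)
    have 2: "- ?M * m21 A ^ 2 * m12 A + (1 + ?M * m11 A * m21 A) * m22 A = m22 A + ?M * m21 A * (m11 A * m22 A - m12 A * m21 A)"
      by (simp add: power2_eq_square algebra_simps)
    show ?thesis
      unfolding mat2_eq_iff mult_nth X_def T_def mat2_nth 1 2 d
      by (simp add: power2_eq_square algebra_simps)
  qed
  have X: "X \<in> Gamma0 M" by (simp add: Gamma0_def SL2Z_iff X_def power2_eq_square algebra_simps)
  have T: "det T > 0" by (simp add: T_def)
  have "slash k f A z = slash k (slash k f X) A z"
    by (rule slash_cong[OF _ SL2Z_det[OF A] z]) (use cusp_formsD(2)[OF f X] in simp)
  also have "\<dots> = slash k f (X ** A) z"
    by (rule slash_mult[OF SL2Z_det[OF Gamma0_SL2Z[OF X]] SL2Z_det[OF A] z])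
  also have "\<dots> = slash k (slash k f A) T z"
    unfolding XT by (rule slash_mult[OF SL2Z_det[OF A] T z, symmetric])
  finally show ?thesis by (simp add: slash_def[of k "slash k f A"] T_def)
qed

lemma cusp_form_slash_decay:
  assumes f: "f \<in> cusp_forms k M" and M: "M > 0" and A: "A \<in> SL2Z" and y0: "y0 > 0"
  obtains K c where "K \<ge> 0" "c > 0" "\<And>z. Im z \<ge> y0 \<Longrightarrow> norm (slash k f A z) \<le> K * exp (- (c * Im z))"
proof -
  have "\<exists>K\<ge>0. \<forall>z. Im z \<ge> y0 \<longrightarrow> norm (slash k f A z) \<le> K * exp (- (2 * pi / real M * Im z))"
    using cusp_form_slash_periodic[OF f A] cusp_formsD[OF f] A M y0
    by (intro periodic_decay holomorphic_slash SL2Z_det) auto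
  then show ?thesis using that[of _ "2 * pi / real M"] M by auto
qed

lemma exp_index_mult: "exp (2 * of_real pi * \<i> * of_nat n * z) = exp (2 * of_real pi * \<i> * z) ^ n"
  by (simp add: exp_of_nat_mult[symmetric] mult_ac)

text \<open>As a power series in q the difference vanishes on the punctured disc; its lowest
  coefficient is the limit at 0 after division by a power of q. This makes the description in
  \<open>qcoeff\<close> well defined.\<close>

lemma q_expansion_unique:
  assumes a: "\<And>z. z \<in> uhp \<Longrightarrow> (\<lambda>n. a n * exp (2 * of_real pi * \<i> * of_nat n * z)) sums g z"
    and b: "\<And>z. z \<in> uhp \<Longrightarrow> (\<lambda>n. b n * exp (2 * of_real pi * \<i> * of_nat n * z)) sums g z"
  shows "a = b"
proof -
  define d where "d n = a n - b n" for n
  have s: "(\<lambda>n. d n * q ^ n) sums 0" if q: "q \<noteq> 0" "norm q < 1" for q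
  proof -
    define z where "z = Ln q / (2 * of_real pi * \<i>)"
    have e: "exp (2 * of_real pi * \<i> * z) = q" using q by (simp add: z_def)
    have "exp (- (2 * pi * Im z)) < 1" using q(2) unfolding e[symmetric] by (simp add: norm_exp_eq_Re)
    then have "z \<in> uhp" by (simp add: uhp_iff zero_less_mult_iff)
    from sums_diff[OF a[OF this] b[OF this]] show ?thesis
      unfolding exp_index_mult e d_def by (simp add: left_diff_distrib)
  qed
  have "d n = 0" for n
  proof (induction n rule: less_induct)
    case (less m)
    have "((\<lambda>q::complex. 0) \<longlongrightarrow> d (0 + m)) (at 0)"
    proof (rule powser_limit_0_strong[of 1 "\<lambda>n. d (n + m)"])
      fix q :: complex assume q: "q \<noteq> 0" "norm q < 1"
      have "(\<lambda>n. d (n + m) * q ^ (n + m)) sums (0 - (\<Sum>i<m. d i * q ^ i))"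
        by (rule sums_split_initial_segment[OF s[OF q]])
      also have "(\<Sum>i<m. d i * q ^ i) = 0" using less by simp
      finally have "(\<lambda>n. d (n + m) * q ^ (n + m) / q ^ m) sums (0 / q ^ m)"
        by (intro sums_divide) simp
      then show "(\<lambda>n. d (n + m) * q ^ n) sums 0" using q by (simp add: power_add)
    qed simp
    then have "0 = d (0 + m)" by (rule tendsto_unique[OF at_neq_bot tendsto_const])
    then show ?case by simp
  qed
  then show ?thesis by (auto simp: d_def fun_eq_iff)
qed

lemma qcoeff_sums:
  assumes f: "f \<in> cusp_forms k M" and z: "z \<in> uhp"
  shows "(\<lambda>n. qcoeff f n * exp (2 * of_real pi * \<i> * of_nat n * z)) sums f z"
proof -
  define T where "T = mat2 1 1 0 1"
  have T: "T \<in> Gamma0 M" by (simp add: T_def Gamma0_def SL2Z_iff)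
  have per: "f (z + of_real 1) = f z" if "z \<in> uhp" for z
    using cusp_formsD(2)[OF f T that] by (simp add: slash_def T_def)
  have "slash k f (mat 1) = f" by (simp add: slash_id fun_eq_iff)
  then have lim: "(f \<longlongrightarrow> 0) (filtercomap Im at_top)"
    using cusp_formsD(3)[OF f matrix_subgroupD(1)[OF matrix_subgroup_SL2Z]] by simp
  obtain G where G: "G holomorphic_on ball 0 1" "G 0 = 0"
    "\<And>z. z \<in> uhp \<Longrightarrow> f z = G (exp (2 * of_real pi * \<i> * z / of_real 1))"
    using periodic_expansion[OF zero_less_one cusp_formsD(1)[OF f] per lim] by blast
  define a where "a n = (deriv ^^ n) G 0 / fact n" for n
  have a: "(\<lambda>n. a n * exp (2 * of_real pi * \<i> * of_nat n * z)) sums f z" if z: "z \<in> uhp" for z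
  proof -
    have "exp (2 * of_real pi * \<i> * z) \<in> ball 0 1"
      using z by (simp add: norm_exp_eq_Re uhp_iff)
    from holomorphic_power_series[OF G(1) this] show ?thesis
      unfolding exp_index_mult a_def using G(3)[OF z] by simp
  qed
  have "qcoeff f = a"
    unfolding qcoeff_def
    by (rule the_equality) (use a q_expansion_unique[of _ f a] in \<open>blast+\<close>)
  then show ?thesis using a[OF z] by simp
qed

text \<open>Averaging over the p shifts is a sum over p-th roots of unity, which removes the
  coefficients of index prime to p. What remains is a(p m), compared with c a(m) at m = 1.\<close>

lemma qcoeff_hecke_eigenvalue:
  assumes f: "f \<in> cusp_forms k M" and p: "p > 0" "p dvd M"
    and c: "\<And>z. z \<in> uhp \<Longrightarrow> hecke k M p f z = c * f z"
  shows "qcoeff f p = c * qcoeff f 1"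
proof -
  let ?a = "qcoeff f"
  let ?e = "\<lambda>z. exp (2 * of_real pi * \<i> * z)"
  have roots: "(\<Sum>j<p. ?e (of_nat n / of_nat p) ^ j) = (if p dvd n then of_nat p else 0)" for n
  proof (cases "p dvd n")
    case True
    then obtain m where "n = p * m" by (auto elim: dvdE)
    then have "?e (of_nat n / of_nat p) = ?e 1 ^ m" using p exp_index_mult[of m 1] by simp
    then show ?thesis using True by simp
  next
    case False
    have ne: "?e (of_nat n / of_nat p) \<noteq> 1"
    proof
      assume "?e (of_nat n / of_nat p) = 1"
      then obtain l :: int where "2 * pi * (real n / real p) = of_int (2 * l) * pi"
        unfolding exp_eq_1 by auto
      then have "real n = of_int l * real p" using p by (simp add: field_simps)
      then have "int n = l * int p" by (metis of_int_eq_iff of_int_mult of_int_of_nat_eq)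
      then show False using False by (metis dvd_triv_right int_dvd_int_iff)
    qed
    have "?e (of_nat n / of_nat p) ^ p = exp (2 * of_real pi * \<i> * of_nat p * (of_nat n / of_nat p))"
      by (rule exp_index_mult[symmetric])
    also have "\<dots> = exp (2 * of_real pi * \<i> * of_nat n * 1)" using p by (simp add: mult_ac)
    also have "\<dots> = ?e 1 ^ n" by (rule exp_index_mult)
    finally have "?e (of_nat n / of_nat p) ^ p = 1" by simp
    then show ?thesis using ne False by (simp add: sum_gp_strict)
  qed
  have "(\<lambda>m. ?a (p * m) * exp (2 * of_real pi * \<i> * of_nat m * z)) sums (c * f z)" if z: "z \<in> uhp" for z
  proof -
    have zj: "(z + of_nat j) / of_nat p \<in> uhp" for j
      using z p by (simp add: uhp_iff)
    have "(\<lambda>n. (\<Sum>j<p. ?a n * exp (2 * of_real pi * \<i> * of_nat n * ((z + of_nat j) / of_nat p))) / of_nat p)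
        sums ((\<Sum>j<p. f ((z + of_nat j) / of_nat p)) / of_nat p)"
      by (intro sums_divide sums_sum qcoeff_sums[OF f] zj)
    also have "(\<Sum>j<p. f ((z + of_nat j) / of_nat p)) / of_nat p = c * f z"
      using c[OF z] p by (simp add: hecke_def)
    also have "(\<lambda>n. (\<Sum>j<p. ?a n * exp (2 * of_real pi * \<i> * of_nat n * ((z + of_nat j) / of_nat p))) / of_nat p) =
        (\<lambda>n. if p dvd n then ?a n * exp (2 * of_real pi * \<i> * (of_nat n / of_nat p) * z) else 0)"
    proof
      fix n
      have 1: "exp (2 * of_real pi * \<i> * of_nat n * ((z + of_nat j) / of_nat p)) =
          exp (2 * of_real pi * \<i> * (of_nat n / of_nat p) * z) * ?e (of_nat n / of_nat p) ^ j" for j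
        unfolding exp_index_mult[symmetric] exp_add[symmetric]
        by (rule arg_cong[of _ _ exp]) (simp add: add_divide_distrib ring_distribs mult_ac)
      have "(\<Sum>j<p. ?a n * exp (2 * of_real pi * \<i> * of_nat n * ((z + of_nat j) / of_nat p))) =
          ?a n * exp (2 * of_real pi * \<i> * (of_nat n / of_nat p) * z) * (\<Sum>j<p. ?e (of_nat n / of_nat p) ^ j)"
        unfolding 1 by (simp add: sum_distrib_left mult_ac)
      then show "(\<Sum>j<p. ?a n * exp (2 * of_real pi * \<i> * of_nat n * ((z + of_nat j) / of_nat p))) / of_nat p =
          (if p dvd n then ?a n * exp (2 * of_real pi * \<i> * (of_nat n / of_nat p) * z) else 0)"
        unfolding roots using p by simp
    qed
    finally have "(\<lambda>n. if p dvd n then ?a n * exp (2 * of_real pi * \<i> * (of_nat n / of_nat p) * z) else 0) sums (c * f z)" .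
    then have "(\<lambda>m. if p dvd p * m then ?a (p * m) * exp (2 * of_real pi * \<i> * (of_nat (p * m) / of_nat p) * z) else 0)
        sums (c * f z)"
      using p by (subst sums_mono_reindex[of "\<lambda>m. p * m"]) (auto simp: strict_mono_def elim!: dvdE)
    then show ?thesis using p by simp
  qed
  moreover have "(\<lambda>m. c * ?a m * exp (2 * of_real pi * \<i> * of_nat m * z)) sums (c * f z)" if z: "z \<in> uhp" for z
    using sums_mult[OF qcoeff_sums[OF f z], of c] by (simp add: mult.assoc)
  ultimately have "(\<lambda>m. ?a (p * m)) = (\<lambda>m. c * ?a m)" by (rule q_expansion_unique[of _ "\<lambda>z. c * f z"])
  then show ?thesis by (metis mult.right_neutral)
qed

subsection \<open>The trace to lower level\<close>

text \<open>For a transversal R of H in G this is the trace from H to G.\<close>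

definition slash_sum :: "(int^2^2) set \<Rightarrow> nat \<Rightarrow> (complex \<Rightarrow> complex) \<Rightarrow> complex \<Rightarrow> complex" where
  "slash_sum R k u z = (\<Sum>D\<in>R. slash k u D z)"

definition slash_invariant :: "(int^2^2) set \<Rightarrow> nat \<Rightarrow> (complex \<Rightarrow> complex) \<Rightarrow> bool" where
  "slash_invariant H k u \<longleftrightarrow> (\<forall>A\<in>H. \<forall>z\<in>uhp. slash k u A z = u z)"

lemma slash_slash_sum:
  assumes "R \<subseteq> SL2Z" "A \<in> SL2Z" "z \<in> uhp"
  shows "slash k (slash_sum R k u) A z = (\<Sum>D\<in>R. slash k u (D ** A) z)"
proof -
  have "slash k (slash_sum R k u) A z = (\<Sum>D\<in>R. slash k (slash k u D) A z)"
    by (simp add: slash_eq[of k "slash_sum R k u"] slash_eq[of k "slash k u D" for D] slash_sum_def sum_divide_distrib)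
  also have "\<dots> = (\<Sum>D\<in>R. slash k u (D ** A) z)"
    using assms by (intro sum.cong refl slash_mult SL2Z_det) auto
  finally show ?thesis .
qed

lemma slash_invariant_mult:
  assumes u: "slash_invariant H k u" and H: "H \<subseteq> SL2Z" and B: "B \<in> H" and D: "det D > 0" and z: "z \<in> uhp"
  shows "slash k u (B ** D) z = slash k u D z"
proof -
  have "slash k u (B ** D) z = slash k (slash k u B) D z"
    using B H by (intro slash_mult[symmetric] D z SL2Z_det) auto
  also have "\<dots> = slash k u D z"
    by (rule slash_cong[OF _ D z]) (use u B in \<open>auto simp: slash_invariant_def\<close>)
  finally show ?thesis .
qed

text \<open>Right multiplication by an element of G permutes the cosets, and by invariance of u the
  summands depend on the cosets only.\<close>

lemma slash_sum_invariant:
  assumes H: "matrix_subgroup H" and G: "matrix_subgroup G" and HG: "H \<subseteq> G"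
    and R: "transversal H G R" and u: "slash_invariant H k u"
  shows "slash_invariant G k (slash_sum R k u)"
  unfolding slash_invariant_def
proof (intro ballI)
  fix A z assume A: "A \<in> G" and z: "z \<in> uhp"
  have GS: "G \<subseteq> SL2Z" using matrix_subgroupD(2)[OF G] by blast
  have "slash k (slash_sum R k u) A z = (\<Sum>D\<in>R. slash k u (D ** A) z)"
    using slash_slash_sum[OF _ _ z] transversal_mem[OF R] GS A by blast
  also have "\<dots> = (\<Sum>D\<in>(\<lambda>D. D ** A) ` R. slash k u D z)"
    using transversal_mult_right(2)[OF G R A] by (simp add: sum.reindex)
  also have "\<dots> = (\<Sum>D\<in>R. slash k u D z)"
  proof (rule sum_transversal_eq[OF H transversal_mult_right(1)[OF G R A] R])
    show "slash k u (B ** D) z = slash k u D z" if "B \<in> H" "D \<in> G" for B D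
      by (rule slash_invariant_mult[OF u _ that(1) SL2Z_det z]) (use HG GS that in auto)
  qed
  finally show "slash k (slash_sum R k u) A z = slash_sum R k u z" by (simp add: slash_sum_def)
qed

lemma Gamma0_mono: "M dvd L \<Longrightarrow> Gamma0 L \<subseteq> Gamma0 M"
  by (auto simp: Gamma0_def dest: dvd_trans[of "int M" "int L"])

lemma slash_sum_cusp_form:
  assumes level: "M dvd L" and R: "transversal (Gamma0 L) (Gamma0 M) R" and f: "f \<in> cusp_forms k L"
  shows "slash_sum R k f \<in> cusp_forms k M"
proof -
  have RS: "R \<subseteq> SL2Z" using transversal_mem[OF R] Gamma0_SL2Z by blast
  have inv: "slash_invariant (Gamma0 L) k f"
    using cusp_formsD(2)[OF f] by (simp add: slash_invariant_def)
  have "slash_sum R k f holomorphic_on uhp"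
    unfolding slash_sum_def[abs_def] using RS
    by (intro holomorphic_on_sum holomorphic_slash cusp_formsD(1)[OF f] SL2Z_det) auto
  moreover have "slash_invariant (Gamma0 M) k (slash_sum R k f)"
    by (rule slash_sum_invariant[OF matrix_subgroup_Gamma0 matrix_subgroup_Gamma0 Gamma0_mono[OF level] R inv])
  moreover have "(slash k (slash_sum R k f) A \<longlongrightarrow> 0) (filtercomap Im at_top)" if A: "A \<in> SL2Z" for A
  proof -
    have "((\<lambda>z. \<Sum>D\<in>R. slash k f (D ** A) z) \<longlongrightarrow> (\<Sum>D\<in>R. 0)) (filtercomap Im at_top)"
    proof (intro tendsto_sum)
      fix D assume "D \<in> R"
      then have "D ** A \<in> SL2Z" using RS A matrix_subgroupD(3)[OF matrix_subgroup_SL2Z] by blast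
      then show "(slash k f (D ** A) \<longlongrightarrow> 0) (filtercomap Im at_top)" by (rule cusp_formsD(3)[OF f])
    qed
    moreover have "eventually (\<lambda>z. (\<Sum>D\<in>R. slash k f (D ** A) z) = slash k (slash_sum R k f) A z) (filtercomap Im at_top)"
    proof -
      have "eventually (\<lambda>z. Im z > 0) (filtercomap Im at_top)"
        using eventually_gt_at_top[of "0::real"] eventually_filtercomapI by blast
      then show ?thesis
        by (rule eventually_mono) (simp add: slash_slash_sum[OF RS A] uhp_iff)
    qed
    ultimately show ?thesis by (simp add: tendsto_cong)
  qed
  ultimately show ?thesis by (auto simp: cusp_forms_def slash_invariant_def)
qed

subsection \<open>Forms of level divisible exactly once by a prime\<close>

text \<open>The entries \<open>x, y, s, w\<close> of an Atkin--Lehner matrix \<open>W = (p x, y; N p s, p w)\<close> of determinant \<open>p\<close>,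
  and the cosets of \<open>\<Gamma>\<^sub>0(N p)\<close> in \<open>\<Gamma>\<^sub>0(N)\<close>: the \<open>j\<close>-th nontrivial one is \<open>W (1, j; 0, p) / p\<close>.\<close>

locale atkin_lehner =
  fixes N p k :: nat and x y s w :: int
  assumes N: "N \<ge> 1" and prime_p: "prime p" and pN: "\<not> p dvd N" and k: "k \<ge> 2"
    and det_W: "int p * x * w - int N * s * y = 1"
begin

definition W :: "int^2^2" where
  "W = mat2 (int p * x) y (int N * int p * s) (int p * w)"

definition coset_rep :: "nat \<Rightarrow> int^2^2" where
  "coset_rep j = mat2 x (x * int j + y) (int N * s) (int N * s * int j + int p * w)"

definition reps :: "(int^2^2) set" where
  "reps = insert (mat 1) (coset_rep ` {..<p})"

abbreviation "H \<equiv> Gamma0 (N * p)"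
abbreviation "G \<equiv> Gamma0 N"

lemma p_gt_1: "p > 1"
  using prime_p by (rule prime_gt_1_nat)

lemma prime_int_p: "prime (int p)"
  using prime_p by simp

lemma p_not_dvd_N: "\<not> int p dvd int N"
  using pN by simp

lemma p_not_dvd_s: "\<not> int p dvd s"
proof
  assume "int p dvd s"
  then have "int p dvd int p * x * w - int N * s * y" by (intro dvd_diff) (simp_all add: dvd_mult dvd_mult2)
  then show False using det_W p_gt_1 by simp
qed

lemma det_W_pos: "det W > 0" and det_W_eq: "det W = int p"
proof -
  have "det W = int p * (int p * x * w - int N * s * y)" by (simp add: W_def algebra_simps)
  then show "det W = int p" by (simp add: det_W)
  then show "det W > 0" using p_gt_1 by simp
qed

lemma det_coset_rep: "det (coset_rep j) = 1"
proof -
  have "det (coset_rep j) = int p * x * w - int N * s * y" by (simp add: coset_rep_def algebra_simps)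
  then show ?thesis by (simp add: det_W)
qed

lemma coset_rep_G: "coset_rep j \<in> G"
  using det_coset_rep[of j] by (simp add: Gamma0_def SL2Z_def) (simp add: coset_rep_def)

lemma H_iff: "A \<in> H \<longleftrightarrow> A \<in> SL2Z \<and> int N * int p dvd m21 A"
  by (simp add: Gamma0_def)

lemma HG: "H \<subseteq> G"
  by (rule Gamma0_mono) simp

lemma coset_rep_inverse:
  "coset_rep j ** mat2 (int N * s * int j + int p * w) (- (x * int j + y)) (- (int N * s)) x = mat 1"
  "mat2 (int N * s * int j + int p * w) (- (x * int j + y)) (- (int N * s)) x ** coset_rep j = mat 1"
  using det_coset_rep[of j]
  by (simp_all add: mat2_eq_iff mat_1_mat2 mult_nth coset_rep_def algebra_simps)

lemma quotient_coset_rep: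
  assumes "A = B ** coset_rep j"
  shows "m21 B = m21 A * (int N * s * int j + int p * w) - m22 A * (int N * s)"
proof -
  let ?Y = "mat2 (int N * s * int j + int p * w) (- (x * int j + y)) (- (int N * s)) x"
  have "A ** ?Y = B ** (coset_rep j ** ?Y)" unfolding assms by (simp only: matrix_mul_assoc)
  then have "B = A ** ?Y" by (simp only: coset_rep_inverse matrix_mul_rid)
  then show ?thesis by (simp add: mult_nth)
qed

text \<open>Let (N c, d) be the bottom row. If p divides c the matrix is already in H; otherwise N c
  is invertible modulo p, and the coset is that of the j with c N j = d modulo p.\<close>

lemma transversal_reps: "transversal H G reps"
  unfolding transversal_def
proof (intro conjI ballI impI)
  show "finite reps" by (simp add: reps_def)
  show "reps \<subseteq> G"
    using coset_rep_G matrix_subgroupD(1)[OF matrix_subgroup_Gamma0] by (auto simp: reps_def)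
next
  fix A assume A: "A \<in> G"
  then obtain c where c: "m21 A = int N * c" by (auto simp: Gamma0_def elim: dvdE)
  show "\<exists>D\<in>reps. \<exists>B\<in>H. A = B ** D"
  proof (cases "int p dvd c")
    case True
    then have "A \<in> H" using A c by (simp add: H_iff Gamma0_SL2Z mult_dvd_mono)
    then have "\<exists>B\<in>H. A = B ** mat 1" by (intro bexI[of _ A]) auto
    then show ?thesis by (simp add: reps_def)
  next
    case False
    have "\<not> int p dvd c * int N"
      using False p_not_dvd_N prime_int_p by (simp add: prime_dvd_mult_iff)
    then have "coprime (int p) (c * int N)" by (rule prime_imp_coprime[OF prime_int_p])
    then have "coprime (c * int N) (int p)" by (subst coprime_commute)
    then obtain t where "[c * int N * t = 1] (mod int p)" using cong_solve_coprime_int by blast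
    then have "[c * int N * t * m22 A = 1 * m22 A] (mod int p)" by (rule cong_scalar_right)
    then have t: "[c * int N * (t * m22 A) = m22 A] (mod int p)" by (simp add: mult.assoc)
    define j where "j = nat ((t * m22 A) mod int p)"
    have j: "int j = (t * m22 A) mod int p" "j < p" using p_gt_1 by (auto simp: j_def nat_less_iff)
    have "[c * int N * int j = m22 A] (mod int p)"
      using t unfolding j cong_def by (simp only: mod_mult_right_eq)
    then have dvd: "int p dvd c * int N * int j - m22 A" by (simp add: cong_iff_dvd_diff)
    let ?Y = "mat2 (int N * s * int j + int p * w) (- (x * int j + y)) (- (int N * s)) x"
    define B where "B = A ** ?Y"
    have AB: "A = B ** coset_rep j"
      unfolding B_def by (simp only: matrix_mul_assoc[symmetric] coset_rep_inverse matrix_mul_rid)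
    have "m21 B = int N * (s * (c * int N * int j - m22 A) + int p * (w * c))"
      unfolding quotient_coset_rep[OF AB] c by (simp add: algebra_simps)
    moreover have "int p dvd s * (c * int N * int j - m22 A) + int p * (w * c)"
      by (rule dvd_add[OF dvd_mult[OF dvd] dvd_triv_left])
    ultimately have "int N * int p dvd m21 B" by (simp only: mult_dvd_mono dvd_refl)
    moreover have "B \<in> SL2Z"
    proof -
      have "det ?Y = 1" using det_coset_rep[of j] by (simp add: coset_rep_def algebra_simps)
      then show ?thesis using A by (simp add: B_def SL2Z_def Gamma0_def det_mul)
    qed
    ultimately have "B \<in> H" by (simp add: H_iff)
    then show ?thesis using AB j by (auto simp: reps_def)
  qed
next
  fix D D' B assume D: "D \<in> reps" "D' \<in> reps" and B: "B \<in> H" "D' = B ** D"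
  have Ndvd: "int N * int p dvd int N * a \<longleftrightarrow> int p dvd a" for a using N by simp
  show "D' = D"
  proof (cases "D = mat 1")
    case True
    then have "int N * int p dvd m21 D'" using B by (simp add: H_iff)
    then have "D' \<notin> coset_rep ` {..<p}" using p_not_dvd_s N by (auto simp: coset_rep_def)
    then show ?thesis using D True by (simp add: reps_def)
  next
    case False
    then obtain j where j: "j < p" "D = coset_rep j" using D by (auto simp: reps_def)
    have m: "m21 B = m21 D' * (int N * s * int j + int p * w) - m22 D' * (int N * s)"
      using B j by (intro quotient_coset_rep) simp
    show ?thesis
    proof (cases "D' = mat 1")
      case True
      then have "m21 B = int N * (- s)" unfolding m by (simp add: mat_1_mat2)
      then have "int p dvd s" using B(1) Ndvd[of "- s"] by (simp only: H_iff) simp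
      then show ?thesis using p_not_dvd_s by simp
    next
      case False
      then obtain i where i: "i < p" "D' = coset_rep i" using D by (auto simp: reps_def)
      have "m21 B = int N * (int N * (s * s * (int j - int i)))"
        unfolding m i by (simp add: coset_rep_def algebra_simps)
      then have "int p dvd int N * (s * s * (int j - int i))" using B(1) Ndvd by (simp only: H_iff)
      then have "int p dvd int j - int i"
        using p_not_dvd_N p_not_dvd_s prime_int_p by (simp add: prime_dvd_mult_iff)
      then have "int j = int i"
        using i j by (metis mod_eq_dvd_iff mod_pos_pos_trivial of_nat_0_le_iff of_nat_less_iff)
      then show ?thesis using i j by simp
    qed
  qed
qed

lemma slash_sum_reps:
  "slash_sum reps k u z = u z + (\<Sum>j<p. slash k u (coset_rep j) z)"
proof -
  have inj: "inj_on coset_rep {..<p}"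
  proof (rule inj_onI)
    fix i j assume "coset_rep i = coset_rep j"
    then have "int N * s * int i = int N * s * int j" by (simp add: coset_rep_def mat2_eq_iff)
    moreover have "s \<noteq> 0" using p_not_dvd_s by auto
    ultimately show "i = j" using N by simp
  qed
  have "mat 1 \<notin> coset_rep ` {..<p}"
    using p_not_dvd_s N by (auto simp: coset_rep_def mat_1_mat2 mat2_eq_iff)
  then show ?thesis
    unfolding slash_sum_def reps_def using inj by (simp add: sum.reindex slash_id)
qed

definition Up :: "(complex \<Rightarrow> complex) \<Rightarrow> complex \<Rightarrow> complex" where
  "Up u z = (\<Sum>j<p. u ((z + of_nat j) / of_nat p)) / of_nat p"

text \<open>W (1, j; 0, p) is p times \<open>coset_rep j\<close>; the resulting p^k cancels the
  cocycle of (1, j; 0, p), so the nontrivial cosets add up to p U_p(u|W).\<close>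

lemma slash_sum_reps_Up:
  assumes z: "z \<in> uhp"
  shows "slash_sum reps k u z = u z + of_nat p * Up (slash k u W) z"
proof -
  have "slash k u (coset_rep j) z = slash k u W ((z + of_nat j) / of_nat p)" for j
  proof -
    define V where "V = mat2 1 (int j) 0 (int p)"
    have V: "det V > 0" using p_gt_1 by (simp add: V_def)
    have WV: "W ** V = mat2 (int p * x) (int p * (x * int j + y)) (int p * (int N * s)) (int p * (int N * s * int j + int p * w))"
      by (simp add: mat2_eq_iff mult_nth W_def V_def algebra_simps)
    have "slash k u (coset_rep j) z = of_nat p ^ k * slash k u (W ** V) z"
      unfolding WV coset_rep_def using p_gt_1 by (simp add: slash_scaled)
    also have "slash k u (W ** V) z = slash k (slash k u W) V z"
      by (rule slash_mult[OF det_W_pos V z, symmetric])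
    also have "\<dots> = slash k u W ((z + of_nat j) / of_nat p) / of_nat p ^ k"
      by (simp add: slash_def[of k "slash k u W"] V_def)
    finally show ?thesis using p_gt_1 by simp
  qed
  then show ?thesis using p_gt_1 by (simp add: slash_sum_reps Up_def)
qed

text \<open>W normalizes H.\<close>

lemma slash_W_invariant:
  assumes u: "slash_invariant H k u"
  shows "slash_invariant H k (slash k u W)"
  unfolding slash_invariant_def
proof (intro ballI)
  fix B z assume B: "B \<in> H" and z: "z \<in> uhp"
  have "int N * int p dvd m21 B" using B by (simp add: H_iff)
  then obtain c where c: "m21 B = int N * int p * c" by (auto elim: dvdE)
  \<comment> \<open>The entries of W B W^(-1) with the denominator p of W^(-1) divided out, so that
    they are visibly integral.\<close>
  define B' where "B' = mat2 ((int p * x * m11 B + y * (int N * int p * c)) * w - (int p * x * m12 B + y * m22 B) * (int N * s))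
     (- (x * m11 B + y * (int N * c)) * y + (int p * x * m12 B + y * m22 B) * x)
     (int N * int p * (s * m11 B * w + int p * w * w * c - int N * s * s * m12 B - w * m22 B * s))
     (- (int N * s * m11 B + w * (int N * int p * c)) * y + (int N * int p * s * m12 B + int p * w * m22 B) * x)"
  have eq: "W ** B = B' ** W"
    unfolding mat2_eq_iff mult_nth W_def B'_def mat2_nth c using det_W by (intro conjI; algebra)
  have detB: "det B = 1" using B by (simp add: H_iff SL2Z_def)
  have "det (B' ** W) = det (W ** B)" by (simp only: eq)
  then have "det B' * int p = int p" by (simp add: det_mul det_W_eq detB)
  then have detB': "det B' = 1" using p_gt_1 by simp
  have "m21 B' = int N * int p * (s * m11 B * w + int p * w * w * c - int N * s * s * m12 B - w * m22 B * s)"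
    by (simp only: B'_def mat2_nth)
  then have B': "B' \<in> H" using detB' by (simp only: H_iff SL2Z_def) simp
  have "slash k (slash k u W) B z = slash k u (W ** B) z"
    by (rule slash_mult[OF det_W_pos _ z]) (simp add: detB)
  also have "\<dots> = slash k u W z"
    unfolding eq by (rule slash_invariant_mult[OF u _ B' det_W_pos z]) (use Gamma0_SL2Z in blast)
  finally show "slash k (slash k u W) B z = slash k u W z" .
qed

text \<open>W^2 is p times an element of H, and the scalar p acts as p^(-k).\<close>

lemma slash_W_W:
  assumes u: "slash_invariant H k u" and z: "z \<in> uhp"
  shows "slash k (slash k u W) W z = u z / of_nat p ^ k"
proof -
  let ?a = "int p * x * x + int N * s * y" and ?b = "y * (x + w)"
  let ?c = "int N * int p * (s * (x + w))" and ?d = "int N * s * y + int p * w * w"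
  have WW: "W ** W = mat2 (int p * ?a) (int p * ?b) (int p * ?c) (int p * ?d)"
    by (simp add: mat2_eq_iff mult_nth W_def algebra_simps)
  have "?a * ?d - ?b * ?c = (int p * x * w - int N * s * y)^2" by (simp add: power2_eq_square algebra_simps)
  then have "mat2 ?a ?b ?c ?d \<in> H" by (simp add: H_iff SL2Z_iff det_W)
  then have "slash k u (mat2 ?a ?b ?c ?d) z = u z" using u z unfolding slash_invariant_def by blast
  then show ?thesis
    unfolding slash_mult[OF det_W_pos det_W_pos z] WW using p_gt_1 by (simp add: slash_scaled)
qed

text \<open>For a \<open>U\<^sub>p\<close>-eigenform \<open>f\<close> of trace zero put \<open>g = f|W\<close>. Then the trace of \<open>g\<close> is
  \<open>g + p\<^sup>1\<^sup>-\<^sup>k a f\<close>, of which the trace is itself (as that of \<open>f\<close> vanishes) and also \<open>p + 1\<close> times itself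
  (as it has level \<open>N\<close>). So it vanishes, i.e. \<open>f\<close> is an eigenfunction of \<open>W\<close>.\<close>

lemma trace_zero_eigenform:
  assumes f: "slash_invariant H k f" and tr: "\<And>z. z \<in> uhp \<Longrightarrow> slash_sum reps k f z = 0"
    and U: "\<And>z. z \<in> uhp \<Longrightarrow> Up f z = a * f z" and z: "z \<in> uhp"
  shows "slash k f W z = - (of_nat p * a / of_nat p ^ k) * f z"
proof -
  let ?g = "slash k f W"
  have g: "slash_invariant H k ?g" by (rule slash_W_invariant[OF f])
  have tr_g: "slash_sum reps k ?g z = ?g z + of_nat p * a / of_nat p ^ k * f z" if z: "z \<in> uhp" for z
  proof -
    have "Up (slash k ?g W) z = (\<Sum>j<p. f ((z + of_nat j) / of_nat p) / of_nat p ^ k) / of_nat p"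
      unfolding Up_def
    proof (intro arg_cong2[of _ _ _ _ "(/)"] sum.cong refl)
      fix j
      have "(z + of_nat j) / of_nat p \<in> uhp" using z p_gt_1 by (simp add: uhp_iff)
      then show "slash k ?g W ((z + of_nat j) / of_nat p) = f ((z + of_nat j) / of_nat p) / of_nat p ^ k"
        by (rule slash_W_W[OF f])
    qed
    also have "\<dots> = Up f z / of_nat p ^ k" by (simp add: Up_def sum_divide_distrib mult.commute)
    finally show ?thesis using slash_sum_reps_Up[OF z, of ?g] U[OF z] by simp
  qed
  have inv: "slash_invariant G k (slash_sum reps k ?g)"
    by (rule slash_sum_invariant[OF matrix_subgroup_Gamma0 matrix_subgroup_Gamma0 HG transversal_reps g])
  have "slash_sum reps k (slash_sum reps k ?g) z = (\<Sum>D\<in>reps. slash_sum reps k ?g z)"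
    unfolding slash_sum_def[of reps k "slash_sum reps k ?g"]
  proof (rule sum.cong)
    fix D assume "D \<in> reps"
    then have "D \<in> G" using transversal_mem[OF transversal_reps] by blast
    then show "slash k (slash_sum reps k ?g) D z = slash_sum reps k ?g z"
      using inv z unfolding slash_invariant_def by blast
  qed simp
  then have 1: "slash_sum reps k (slash_sum reps k ?g) z = of_nat (card reps) * slash_sum reps k ?g z" by simp
  have "slash_sum reps k (slash_sum reps k ?g) z =
      (\<Sum>D\<in>reps. slash k ?g D z + of_nat p * a / of_nat p ^ k * slash k f D z)"
    unfolding slash_sum_def[of reps k "slash_sum reps k ?g"]
  proof (rule sum.cong)
    fix D assume "D \<in> reps"
    then have "det D > 0" using transversal_mem[OF transversal_reps] Gamma0_SL2Z SL2Z_det by blast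
    then have "mat_act D z \<in> uhp" using z by (intro mat_act_uhp)
    then show "slash k (slash_sum reps k ?g) D z = slash k ?g D z + of_nat p * a / of_nat p ^ k * slash k f D z"
      unfolding slash_eq[of k "slash_sum reps k ?g"] slash_eq[of k ?g] slash_eq[of k f D] tr_g[OF \<open>mat_act D z \<in> uhp\<close>]
      by (simp add: add_divide_distrib)
  qed simp
  also have "\<dots> = slash_sum reps k ?g z + of_nat p * a / of_nat p ^ k * slash_sum reps k f z"
    by (simp add: sum.distrib sum_distrib_left slash_sum_def)
  finally have "of_nat (card reps) * slash_sum reps k ?g z = slash_sum reps k ?g z"
    using 1 tr[OF z] by simp
  \<comment> \<open>There are p + 1 cosets; that the number differs from 1 is what forces the trace
    to vanish.\<close>
  moreover have "card reps \<ge> 2"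
  proof -
    have "coset_rep 0 \<noteq> mat 1" using p_not_dvd_s N by (auto simp: coset_rep_def mat_1_mat2 mat2_eq_iff)
    then have "card {mat 1, coset_rep 0} = 2" by simp
    moreover have "{mat 1, coset_rep 0} \<subseteq> reps" using p_gt_1 by (auto simp: reps_def)
    moreover have "finite reps" by (rule transversal_finite[OF transversal_reps])
    ultimately show ?thesis by (metis card_mono)
  qed
  ultimately have "slash_sum reps k ?g z = 0"
  proof -
    assume *: "of_nat (card reps) * slash_sum reps k ?g z = slash_sum reps k ?g z" "card reps \<ge> 2"
    have "(of_nat (card reps) - 1) * slash_sum reps k ?g z = 0" using *(1) by (simp add: algebra_simps)
    moreover have "of_nat (card reps) - 1 \<noteq> (0::complex)"
    proof
      assume "of_nat (card reps) - 1 = (0::complex)"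
      then have "(of_nat (card reps) :: complex) = of_nat 1" by simp
      then have "card reps = 1" by (simp only: of_nat_eq_iff)
      then show False using *(2) by simp
    qed
    ultimately show ?thesis by simp
  qed
  then have "?g z + of_nat p * a / of_nat p ^ k * f z = 0" unfolding tr_g[OF z] .
  then show ?thesis by (simp add: eq_neg_iff_add_eq_0)
qed

text \<open>W^2 acts as p^(-k), so the eigenvalue -p^(1-k) a of W has square p^(-k).\<close>

lemma trace_zero_eigenvalue:
  assumes f: "slash_invariant H k f" and tr: "\<And>z. z \<in> uhp \<Longrightarrow> slash_sum reps k f z = 0"
    and U: "\<And>z. z \<in> uhp \<Longrightarrow> Up f z = a * f z" and z: "z \<in> uhp" "f z \<noteq> 0"
  shows "a\<^sup>2 = of_nat p ^ (k - 2)"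
proof -
  let ?e = "- (of_nat p * a / of_nat p ^ k)"
  have eig: "slash k f W z = ?e * f z" if "z \<in> uhp" for z
    by (rule trace_zero_eigenform[OF f _ _ that]) (rule tr U, assumption)+
  have "f z / of_nat p ^ k = slash k (slash k f W) W z" by (rule slash_W_W[OF f z(1), symmetric])
  also have "\<dots> = ?e * slash k f W z"
    using eig[OF mat_act_uhp[OF det_W_pos z(1)]] by (simp add: slash_eq[of k "slash k f W"] slash_eq[of k f W z])
  also have "\<dots> = ?e * (?e * f z)" unfolding eig[OF z(1)] ..
  finally have "1 / of_nat p ^ k * f z = ?e * ?e * f z" by (simp add: mult.assoc)
  then have "1 / of_nat p ^ k = ?e * ?e" using z(2) by (simp only: mult_cancel_right simp_thms)
  then have "1 / of_nat p ^ k = of_nat p ^ 2 * a\<^sup>2 / (of_nat p ^ k * of_nat p ^ k)"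
    by (simp add: power2_eq_square mult_ac)
  then have "of_nat p ^ k = of_nat p ^ 2 * a\<^sup>2" using p_gt_1 by (simp add: field_simps)
  moreover have "(of_nat p :: complex) ^ k = of_nat p ^ 2 * of_nat p ^ (k - 2)"
    using power_add[of "of_nat p :: complex" 2 "k - 2"] by (simp only: le_add_diff_inverse[OF k])
  ultimately show ?thesis using p_gt_1 by simp
qed

end

subsection \<open>The Petersson product and the trace\<close>

lemma power_le_exp:
  fixes c :: real
  assumes "c > 0"
  obtains C where "C \<ge> 0" "\<And>t. t \<ge> 0 \<Longrightarrow> t ^ m \<le> C * exp (c * t)"
proof -
  \<comment> \<open>\<open>Suc m\<close> in place of m avoids a division by 0 and still gives m b
    \<le> c.\<close>
  define b where "b = c / real (Suc m)"
  have b: "b > 0" using assms by (simp add: b_def)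
  have "t ^ m \<le> (1 / b) ^ m * exp (c * t)" if t: "t \<ge> 0" for t
  proof -
    have "b * t \<le> exp (b * t)" using exp_ge_add_one_self[of "b * t"] by linarith
    then have "t \<le> 1 / b * exp (b * t)" using b by (simp add: field_simps)
    then have "t ^ m \<le> (1 / b * exp (b * t)) ^ m" using t by (rule power_mono)
    also have "\<dots> = (1 / b) ^ m * exp (real m * (b * t))" by (simp only: power_mult_distrib exp_of_nat_mult)
    also have "\<dots> \<le> (1 / b) ^ m * exp (c * t)"
    proof -
      have "real m * b \<le> c" using assms by (simp add: b_def field_simps)
      then have "real m * (b * t) \<le> c * t" using t by (simp add: mult_right_mono flip: mult.assoc)
      then show ?thesis using b by (intro mult_left_mono) auto
    qed
    finally show ?thesis .
  qed
  then show ?thesis using that[of "(1 / b) ^ m"] b by simp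
qed

text \<open>The integrand is a product over the two real coordinates: an indicator in Re z and an
  exponential in Im z.\<close>

lemma strip_integrable:
  assumes c: "c > 0"
  shows "set_integrable lborel {z. \<bar>Re z\<bar> \<le> 1/2 \<and> Im z \<ge> 1/2} (\<lambda>z. exp (- (c * Im z)))"
proof -
  let ?T = "{z. \<bar>Re z\<bar> \<le> 1/2 \<and> Im z \<ge> 1/2}"
  define F :: "complex \<Rightarrow> real \<Rightarrow> ennreal" where
    "F b t = (if b = 1 then indicator {-1/2..1/2} t else ennreal (exp (- (c * t))) * indicator {1/2..} t)" for b t
  have T: "?T \<in> sets borel"
  proof -
    have "closed {z. \<bar>Re z\<bar> \<le> 1/2 \<and> Im z \<ge> 1/2}"
      by (intro closed_Collect_conj closed_Collect_le continuous_intros)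
    then show ?thesis by simp
  qed
  have "(\<integral>\<^sup>+z. ennreal (norm (indicator ?T z *\<^sub>R exp (- (c * Im z)))) \<partial>lborel) =
      (\<integral>\<^sup>+z. (\<Prod>b\<in>Basis. F b (z \<bullet> b)) \<partial>lborel)"
    by (intro nn_integral_cong)
      (auto simp: Basis_complex_def F_def complex_eq_iff indicator_def)
  also have "\<dots> = (\<Prod>b\<in>Basis. \<integral>\<^sup>+t. F b t \<partial>lborel)"
  proof (rule nn_integral_lborel_prod)
    show "F b \<in> borel_measurable borel" for b unfolding F_def[abs_def] by (cases "b = 1") simp_all
  qed simp
  also have "\<dots> < \<infinity>"
  proof -
    have 1: "(\<integral>\<^sup>+t. F 1 t \<partial>lborel) = 1" by (simp add: F_def)
    have "(\<integral>\<^sup>+t. ennreal (exp (- (c * t))) * indicator {1/2..} t \<partial>lborel) = ennreal (0 - (- exp (- (c * (1/2))) / c))"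
    proof (rule nn_integral_FTC_atLeast[of _ _ "\<lambda>t. - exp (- (c * t)) / c"])
      show "((\<lambda>t. - exp (- (c * t)) / c) has_real_derivative exp (- (c * t))) (at t)" for t
        using c by (auto intro!: derivative_eq_intros)
      have "filterlim (\<lambda>t. c * t) at_top at_top"
        using c by (intro filterlim_tendsto_pos_mult_at_top[OF tendsto_const _ filterlim_ident])
      then have "((\<lambda>t. exp (- (c * t))) \<longlongrightarrow> 0) at_top"
        by (intro filterlim_compose[OF exp_at_bot] filterlim_compose[OF filterlim_uminus_at_bot_at_top])
      then show "((\<lambda>t. - exp (- (c * t)) / c) \<longlongrightarrow> 0) at_top"
        using tendsto_divide[OF tendsto_minus tendsto_const[of c], of "\<lambda>t. exp (- (c * t))" 0] c by simp
    qed auto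
    then have "(\<integral>\<^sup>+t. F \<i> t \<partial>lborel) < \<infinity>" by (simp add: F_def complex_eq_iff)
    then show ?thesis using 1 by (simp add: Basis_complex_def)
  qed
  finally have "(\<integral>\<^sup>+z. ennreal (norm (indicator ?T z *\<^sub>R exp (- (c * Im z)))) \<partial>lborel) < \<infinity>" .
  moreover have "(\<lambda>z. indicator ?T z *\<^sub>R exp (- (c * Im z))) \<in> borel_measurable lborel"
    using T by (intro borel_measurable_scaleR borel_measurable_indicator borel_measurable_exp) auto
  ultimately show ?thesis unfolding set_integrable_def by (intro integrableI_bounded)
qed

abbreviation (input) "domF \<equiv> std_fundamental_domain"

text \<open>The conditions even give (Im z)^2 \<ge> 3/4; the rational bound 1/2 serves all
  estimates.\<close>

lemma domF_D: "z \<in> domF \<Longrightarrow> \<bar>Re z\<bar> \<le> 1/2 \<and> Im z \<ge> 1/2"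
proof -
  assume z: "z \<in> domF"
  then have 1: "\<bar>Re z\<bar> \<le> 1/2" "Im z > 0" "norm z \<ge> 1" by (auto simp: std_fundamental_domain_def)
  have "(Re z)\<^sup>2 \<le> (1/2)\<^sup>2" using 1(1) by (intro power2_le_iff_abs_le[THEN iffD2]) auto
  moreover have "(norm z)\<^sup>2 \<ge> 1" using 1(3) by (simp add: one_le_power)
  ultimately have "(1/2)\<^sup>2 \<le> (Im z)\<^sup>2" unfolding cmod_power2 by (simp add: power2_eq_square)
  then have "1/2 \<le> Im z" by (rule power2_le_imp_le) (use 1(2) in simp)
  then show ?thesis using 1 by simp
qed

lemma domF_uhp: "domF \<subseteq> uhp"
  by (auto simp: std_fundamental_domain_def uhp_iff)

lemma domF_borel: "domF \<in> sets borel"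
proof -
  have "domF = {z. Im z > 0} \<inter> ({z. \<bar>Re z\<bar> \<le> 1/2} \<inter> {z. 1 \<le> norm z})"
    by (auto simp: std_fundamental_domain_def)
  moreover have "open {z. Im z > 0}" by (rule open_halfspace_Im_gt)
  moreover have "closed ({z. \<bar>Re z\<bar> \<le> 1/2} \<inter> {z::complex. 1 \<le> norm z})"
    by (intro closed_Int closed_Collect_le continuous_intros)
  ultimately show ?thesis using sets.Int[OF borel_open borel_closed] by metis
qed

definition petersson_integrand ::
  "nat \<Rightarrow> (complex \<Rightarrow> complex) \<Rightarrow> int^2^2 \<Rightarrow> (complex \<Rightarrow> complex) \<Rightarrow> int^2^2 \<Rightarrow> complex \<Rightarrow> complex" where
  "petersson_integrand k f A g B z =
     slash k f A z * cnj (slash k g B z) * of_real (Im z ^ k / (Im z)\<^sup>2)"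

text \<open>The decay of f absorbs the growing factor (Im z)^k, and that of g remains as an
  integrable majorant on the strip.\<close>

lemma petersson_integrable:
  assumes f: "f \<in> cusp_forms k M" "M > 0" "A \<in> SL2Z" and g: "g \<in> cusp_forms k L" "L > 0" "B \<in> SL2Z"
  shows "set_integrable lborel domF (petersson_integrand k f A g B)"
proof -
  obtain K1 c1 where 1: "K1 \<ge> 0" "c1 > 0" "\<And>z. Im z \<ge> 1/2 \<Longrightarrow> norm (slash k f A z) \<le> K1 * exp (- (c1 * Im z))"
    using cusp_form_slash_decay[OF f, of "1/2"] by auto
  obtain K2 c2 where 2: "K2 \<ge> 0" "c2 > 0" "\<And>z. Im z \<ge> 1/2 \<Longrightarrow> norm (slash k g B z) \<le> K2 * exp (- (c2 * Im z))"
    using cusp_form_slash_decay[OF g, of "1/2"] by auto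
  obtain C where C: "C \<ge> 0" "\<And>t. t \<ge> 0 \<Longrightarrow> t ^ k \<le> C * exp (c1 * t)"
    using power_le_exp[OF 1(2), of k] by metis
  let ?T = "{z. \<bar>Re z\<bar> \<le> 1/2 \<and> Im z \<ge> 1/2}"
  have "set_integrable lborel ?T (\<lambda>z. K1 * K2 * (4 * C) * exp (- (c2 * Im z)))"
    by (rule set_integrable_mult_right) (use strip_integrable[OF 2(2)] in simp)
  then have T: "set_integrable lborel domF (\<lambda>z. K1 * K2 * (4 * C) * exp (- (c2 * Im z)))"
    by (rule set_integrable_subset) (use domF_borel domF_D in auto)
  show ?thesis
  proof (rule set_integrable_bound[OF T])
    have "continuous_on domF (slash k f A)" "continuous_on domF (slash k g B)"
      using holomorphic_on_imp_continuous_on[OF holomorphic_slash[OF cusp_formsD(1)[OF f(1)] SL2Z_det[OF f(3)]]]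
        holomorphic_on_imp_continuous_on[OF holomorphic_slash[OF cusp_formsD(1)[OF g(1)] SL2Z_det[OF g(3)]]]
        continuous_on_subset[OF _ domF_uhp] by blast+
    moreover have "continuous_on domF (\<lambda>z. Im z ^ k / (Im z)\<^sup>2)"
      using domF_D by (intro continuous_intros) force
    ultimately have "continuous_on domF (petersson_integrand k f A g B)"
      unfolding petersson_integrand_def[abs_def] by (intro continuous_on_mult continuous_on_cnj continuous_on_of_real)
    then show "set_borel_measurable lborel domF (petersson_integrand k f A g B)"
      unfolding set_borel_measurable_def
      using borel_measurable_continuous_on_indicator[OF domF_borel] by simp
    show "AE z in lborel. z \<in> domF \<longrightarrow>
        norm (petersson_integrand k f A g B z) \<le> norm (K1 * K2 * (4 * C) * exp (- (c2 * Im z)))"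
    proof (rule AE_I2, rule impI)
      fix z assume "z \<in> domF"
      then have y: "Im z \<ge> 1/2" using domF_D by blast
      have "Im z ^ k / (Im z)\<^sup>2 \<le> C * exp (c1 * Im z) / (1/2)\<^sup>2"
        using y C by (intro frac_le power_mono C(2)) auto
      \<comment> \<open>The 4 bounds (Im z)^(-2), as Im z \<ge> 1/2.\<close>
      then have w: "Im z ^ k / (Im z)\<^sup>2 \<le> 4 * C * exp (c1 * Im z)" by (simp add: power2_eq_square)
      have "norm (petersson_integrand k f A g B z) =
          norm (slash k f A z) * norm (slash k g B z) * (Im z ^ k / (Im z)\<^sup>2)"
        using y by (simp add: petersson_integrand_def norm_mult norm_divide norm_power del: of_real_divide of_real_power)
      also have "\<dots> \<le> (K1 * exp (- (c1 * Im z))) * (K2 * exp (- (c2 * Im z))) * (4 * C * exp (c1 * Im z))"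
        using 1 2 y by (intro mult_mono w) auto
      also have "\<dots> = K1 * K2 * (4 * C) * exp (- (c2 * Im z)) * (exp (- (c1 * Im z)) * exp (c1 * Im z))"
        by (simp add: mult_ac)
      also have "exp (- (c1 * Im z)) * exp (c1 * Im z) = 1" by (simp flip: exp_add)
      finally show "norm (petersson_integrand k f A g B z) \<le> norm (K1 * K2 * (4 * C) * exp (- (c2 * Im z)))"
        using 1 2 C by simp
    qed
  qed
qed

text \<open>Adjointness of trace and inclusion: the cosets of level L are summed in two stages, and
  as g is invariant under the larger group, the inner sum falls on f alone.\<close>

lemma petersson_eq_trace:
  assumes M: "M > 0" and L: "M dvd L" "L > 0"
    and f: "f \<in> cusp_forms k L" and g: "g \<in> cusp_forms k M"
    and R1: "transversal (Gamma0 M) SL2Z R1" and R2: "transversal (Gamma0 L) (Gamma0 M) R2"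
  shows "petersson k L f g =
    (\<Sum>A\<in>R1. set_lebesgue_integral lborel domF (petersson_integrand k (slash_sum R2 k f) A g A))"
proof -
  have GH: "Gamma0 L \<subseteq> Gamma0 M" by (rule Gamma0_mono[OF L(1)])
  have GS: "Gamma0 M \<subseteq> SL2Z" "Gamma0 L \<subseteq> SL2Z" using Gamma0_SL2Z by blast+
  define \<phi> where "\<phi> A = set_lebesgue_integral lborel domF (petersson_integrand k f A g A)" for A
  have inv_f: "slash_invariant (Gamma0 L) k f" using cusp_formsD(2)[OF f] by (simp add: slash_invariant_def)
  have inv_g: "slash_invariant (Gamma0 M) k g" using cusp_formsD(2)[OF g] by (simp add: slash_invariant_def)
  have \<phi>: "\<phi> (B ** D) = \<phi> D" if B: "B \<in> Gamma0 L" and D: "D \<in> SL2Z" for B D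
    unfolding \<phi>_def
  proof (rule set_lebesgue_integral_cong, use domF_borel in simp, intro allI impI)
    fix z assume "z \<in> domF"
    then have z: "z \<in> uhp" using domF_uhp by blast
    have "slash k f (B ** D) z = slash k f D z"
      by (rule slash_invariant_mult[OF inv_f GS(2) B SL2Z_det[OF D] z])
    moreover have "slash k g (B ** D) z = slash k g D z"
      using B GH by (intro slash_invariant_mult[OF inv_g GS(1) _ SL2Z_det[OF D] z]) auto
    ultimately show "petersson_integrand k f (B ** D) g (B ** D) z = petersson_integrand k f D g D z"
      by (simp add: petersson_integrand_def)
  qed
  note tower = transversal_tower[OF matrix_subgroup_Gamma0 matrix_subgroup_Gamma0 GH matrix_subgroup_SL2Z GS(1) R1 R2]
  have "petersson k L f g = (\<Sum>C\<in>Gamma0_cosets L. \<phi> (SOME A. A \<in> C))"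
    unfolding petersson_def \<phi>_def petersson_integrand_def[abs_def] Let_def ..
  also have "\<dots> = (\<Sum>D\<in>(\<lambda>(D, A). D ** A) ` (R2 \<times> R1). \<phi> D)"
    unfolding Gamma0_cosets_def
    by (rule sum_cosets[OF matrix_subgroup_Gamma0 tower(1) \<phi>])
  also have "\<dots> = (\<Sum>(D, A)\<in>R2 \<times> R1. \<phi> (D ** A))"
    using tower(2) by (simp add: sum.reindex case_prod_unfold)
  also have "\<dots> = (\<Sum>A\<in>R1. \<Sum>D\<in>R2. \<phi> (D ** A))"
    by (simp add: sum.cartesian_product[symmetric] sum.swap[of _ R2])
  also have "\<dots> = (\<Sum>A\<in>R1. set_lebesgue_integral lborel domF (petersson_integrand k (slash_sum R2 k f) A g A))"
  proof (rule sum.cong)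
    fix A assume "A \<in> R1"
    then have A: "A \<in> SL2Z" by (rule transversal_mem[OF R1])
    have DA: "D ** A \<in> SL2Z" if "D \<in> R2" for D
      using transversal_mem[OF R2 that] GS A matrix_subgroupD(3)[OF matrix_subgroup_SL2Z] by blast
    have R2S: "R2 \<subseteq> SL2Z" using transversal_mem[OF R2] GS by blast
    have "(\<Sum>D\<in>R2. \<phi> (D ** A)) =
        (\<Sum>D\<in>R2. set_lebesgue_integral lborel domF (petersson_integrand k f (D ** A) g A))"
    proof (rule sum.cong)
      fix D assume D: "D \<in> R2"
      show "\<phi> (D ** A) = set_lebesgue_integral lborel domF (petersson_integrand k f (D ** A) g A)"
        unfolding \<phi>_def
      proof (rule set_lebesgue_integral_cong, use domF_borel in simp, intro allI impI)
        fix z assume "z \<in> domF"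
        then have z: "z \<in> uhp" using domF_uhp by blast
        have "slash k g (D ** A) z = slash k g A z"
          by (rule slash_invariant_mult[OF inv_g GS(1) transversal_mem[OF R2 D] SL2Z_det[OF A] z])
        then show "petersson_integrand k f (D ** A) g (D ** A) z = petersson_integrand k f (D ** A) g A z"
          by (simp add: petersson_integrand_def)
      qed
    qed simp
    also have "\<dots> = set_lebesgue_integral lborel domF (\<lambda>z. \<Sum>D\<in>R2. petersson_integrand k f (D ** A) g A z)"
    proof -
      have "set_integrable lborel domF (petersson_integrand k f (D ** A) g A)" if "D \<in> R2" for D
        by (rule petersson_integrable[OF f L(2) DA[OF that] g M A])
      then show ?thesis
        unfolding set_lebesgue_integral_def set_integrable_def scaleR_sum_right
        by (rule Bochner_Integration.integral_sum[symmetric])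
    qed
    also have "\<dots> = set_lebesgue_integral lborel domF (petersson_integrand k (slash_sum R2 k f) A g A)"
    proof (rule set_lebesgue_integral_cong, use domF_borel in simp, intro allI impI)
      fix z assume "z \<in> domF"
      then have z: "z \<in> uhp" using domF_uhp by blast
      show "(\<Sum>D\<in>R2. petersson_integrand k f (D ** A) g A z) = petersson_integrand k (slash_sum R2 k f) A g A z"
        unfolding petersson_integrand_def slash_slash_sum[OF R2S A z] by (simp only: sum_distrib_right)
    qed
    finally show "(\<Sum>D\<in>R2. \<phi> (D ** A)) =
        set_lebesgue_integral lborel domF (petersson_integrand k (slash_sum R2 k f) A g A)" .
  qed simp
  finally show ?thesis .
qed

text \<open>The integrands are nonnegative, so each vanishes almost everywhere. By continuity g|A is
  then 0 on an open part of the domain, by the identity theorem on the half-plane, and A can be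
  undone.\<close>

lemma petersson_self_zero:
  assumes M: "M > 0" and g: "g \<in> cusp_forms k M" and R1: "transversal (Gamma0 M) SL2Z R1"
    and 0: "(\<Sum>A\<in>R1. set_lebesgue_integral lborel domF (petersson_integrand k g A g A)) = 0"
    and z: "z \<in> uhp"
  shows "g z = 0"
proof -
  define q where "q A z = (norm (slash k g A z))\<^sup>2 * (Im z ^ k / (Im z)\<^sup>2)" for A z
  have q_eq: "petersson_integrand k g A g A z = of_real (q A z)" for A z
    unfolding petersson_integrand_def q_def of_real_mult complex_norm_square ..
  have q_nonneg: "indicator domF z *\<^sub>R q A z \<ge> 0" for A z
    using domF_D[of z] by (auto simp: q_def indicator_def)
  have int: "set_lebesgue_integral lborel domF (petersson_integrand k g A g A) =
      of_real (set_lebesgue_integral lborel domF (q A))" for A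
  proof -
    have "(\<lambda>z. indicator domF z *\<^sub>R petersson_integrand k g A g A z) =
        (\<lambda>z. complex_of_real (indicator domF z *\<^sub>R q A z))"
      by (simp add: fun_eq_iff q_eq scaleR_conv_of_real)
    then show ?thesis unfolding set_lebesgue_integral_def by (simp only: integral_complex_of_real)
  qed
  have sum0: "(\<Sum>A\<in>R1. set_lebesgue_integral lborel domF (q A)) = 0"
    using 0 unfolding int by (simp flip: of_real_sum)
  have nn: "0 \<le> set_lebesgue_integral lborel domF (q A)" for A
    unfolding set_lebesgue_integral_def by (intro integral_nonneg_AE AE_I2 q_nonneg)
  have zero: "set_lebesgue_integral lborel domF (q A) = 0" if "A \<in> R1" for A
    by (rule sum_nonneg_0[OF transversal_finite[OF R1] nn sum0 that])
  obtain A where A: "A \<in> R1"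
    using transversal_cover[OF R1 matrix_subgroupD(1)[OF matrix_subgroup_SL2Z]] by metis
  have AS: "A \<in> SL2Z" by (rule transversal_mem[OF R1 A])
  have "set_integrable lborel domF (q A)"
  proof -
    have "integrable lborel (\<lambda>z. complex_of_real (indicator domF z *\<^sub>R q A z))"
      using petersson_integrable[OF g M AS g M AS]
      unfolding set_integrable_def q_eq by (simp add: scaleR_conv_of_real)
    then show ?thesis unfolding set_integrable_def by (simp only: complex_of_real_integrable_eq)
  qed
  then have ae: "AE z in lborel. indicator domF z *\<^sub>R q A z = 0"
    using zero[OF A] q_nonneg unfolding set_integrable_def set_lebesgue_integral_def
    by (subst (asm) integral_nonneg_eq_0_iff_AE) auto
  have hol: "slash k g A holomorphic_on uhp"
    by (rule holomorphic_slash[OF cusp_formsD(1)[OF g] SL2Z_det[OF AS]])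
  \<comment> \<open>A convenient open part of the fundamental domain: above height 1 the condition
    |z| \<ge> 1 is automatic.\<close>
  define V where "V = {z. \<bar>Re z\<bar> < 1/2 \<and> Im z > 1}"
  have V: "open V" unfolding V_def by (intro open_Collect_conj open_Collect_less continuous_intros)
  have V_dom: "z \<in> domF" if "z \<in> V" for z
  proof -
    have "1 \<le> norm z" using that abs_Im_le_cmod[of z] by (simp add: V_def)
    then show ?thesis using that by (simp add: V_def std_fundamental_domain_def)
  qed
  have V_uhp: "V \<subseteq> uhp" by (auto simp: V_def uhp_iff)
  define X where "X = {z \<in> V. slash k g A z \<in> - {0}}"
  have "open X"
  proof -
    have "continuous_on V (slash k g A)"
      using holomorphic_on_imp_continuous_on[OF hol] V_uhp continuous_on_subset by blast
    then have "open (slash k g A -` (- {0}) \<inter> V)"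
      using V continuous_on_open_vimage by blast
    moreover have "slash k g A -` (- {0}) \<inter> V = X" by (auto simp: X_def)
    ultimately show ?thesis by simp
  qed
  have "AE z in lborel. z \<notin> X"
    using ae
  proof eventually_elim
    fix z assume *: "indicator domF z *\<^sub>R q A z = 0"
    show "z \<notin> X"
    proof
      assume "z \<in> X"
      then show False using * V_dom[of z] by (auto simp: X_def V_def q_def)
    qed
  qed
  then have "X \<in> null_sets lborel"
    using \<open>open X\<close> by (subst (asm) AE_iff_null_sets[symmetric]) auto
  then have "negligible X"
    unfolding negligible_iff_null_sets by (rule null_sets_completionI)
  then have "X = {}" using open_not_negligible[OF \<open>open X\<close>] by blast
  then have Vz: "slash k g A z = 0" if "z \<in> V" for z using that by (auto simp: X_def)
  have "Complex 0 2 \<in> V" by (simp add: V_def)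
  then have "V \<noteq> {}" by blast
  have all: "slash k g A z = 0" if "z \<in> uhp" for z
    by (rule analytic_continuation_open[OF V open_uhp \<open>V \<noteq> {}\<close> convex_connected[OF convex_uhp] V_uhp hol, of "\<lambda>_. 0"])
      (use Vz that in auto)
  obtain B where B: "B \<in> SL2Z" "A ** B = mat 1"
    by (rule matrix_subgroup_inv[OF matrix_subgroup_SL2Z AS])
  have "g z = slash k g (A ** B) z" by (simp add: B slash_id)
  also have "\<dots> = slash k (slash k g A) B z"
    by (rule slash_mult[OF SL2Z_det[OF AS] SL2Z_det[OF B(1)] z, symmetric])
  also have "\<dots> = 0"
    using all[OF mat_act_uhp[OF SL2Z_det[OF B(1)] z]] by (simp add: slash_eq[of k "slash k g A"])
  finally show ?thesis .
qed

lemma new_form_trace_zero: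
  assumes M: "M > 0" and L: "M dvd L" "L > 0" and f: "f \<in> cusp_forms k L"
    and R2: "transversal (Gamma0 L) (Gamma0 M) R2"
    and new: "\<And>g. g \<in> cusp_forms k M \<Longrightarrow> petersson k L f g = 0" and z: "z \<in> uhp"
  shows "slash_sum R2 k f z = 0"
proof -
  obtain R1 where R1: "transversal (Gamma0 M) SL2Z R1" by (rule ex_transversal_SL2Z[OF M])
  have g: "slash_sum R2 k f \<in> cusp_forms k M" by (rule slash_sum_cusp_form[OF L(1) R2 f])
  show ?thesis
    by (rule petersson_self_zero[OF M g R1 _ z])
      (use new[OF g] petersson_eq_trace[OF M L f g R1 R2] in simp)
qed

subsection \<open>Line integrals of cusp forms\<close>

lemma exp_integrable_Ioi:
  assumes "c > (0::real)"
  shows "set_integrable lborel {0<..} (\<lambda>t. exp (- (c * t)))"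
proof -
  have "(\<integral>\<^sup>+t. ennreal (exp (- (c * t))) * indicator {0..} t \<partial>lborel) = ennreal (0 - (- exp (- (c * 0)) / c))"
  proof (rule nn_integral_FTC_atLeast[of _ _ "\<lambda>t. - exp (- (c * t)) / c"])
    show "((\<lambda>t. - exp (- (c * t)) / c) has_real_derivative exp (- (c * t))) (at t)" for t
      using assms by (auto intro!: derivative_eq_intros)
    have "filterlim (\<lambda>t. c * t) at_top at_top"
      using assms by (intro filterlim_tendsto_pos_mult_at_top[OF tendsto_const _ filterlim_ident])
    then have "((\<lambda>t. exp (- (c * t))) \<longlongrightarrow> 0) at_top"
      by (intro filterlim_compose[OF exp_at_bot] filterlim_compose[OF filterlim_uminus_at_bot_at_top])
    then show "((\<lambda>t. - exp (- (c * t)) / c) \<longlongrightarrow> 0) at_top"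
      using tendsto_divide[OF tendsto_minus tendsto_const[of c], of "\<lambda>t. exp (- (c * t))" 0] assms by simp
  qed auto
  also have "(\<integral>\<^sup>+t. ennreal (exp (- (c * t))) * indicator {0..} t \<partial>lborel) =
      (\<integral>\<^sup>+t. ennreal (norm (indicator {0..} t *\<^sub>R exp (- (c * t)))) \<partial>lborel)"
    by (intro nn_integral_cong) (auto simp: indicator_def)
  finally have "(\<integral>\<^sup>+t. ennreal (norm (indicator {0..} t *\<^sub>R exp (- (c * t)))) \<partial>lborel) < \<infinity>" by simp
  moreover have "(\<lambda>t. indicator {0..} t *\<^sub>R exp (- (c * t))) \<in> borel_measurable lborel" by simp
  ultimately have "set_integrable lborel {0..} (\<lambda>t. exp (- (c * t)))"
    unfolding set_integrable_def by (intro integrableI_bounded)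
  then show ?thesis by (rule set_integrable_subset) auto
qed

lemma exp_bounded_integrable:
  fixes h :: "real \<Rightarrow> complex"
  assumes "continuous_on {a<..} h" "c > 0" "a \<ge> 0" "\<And>t. t > a \<Longrightarrow> norm (h t) \<le> K * exp (- (c * t))"
  shows "set_integrable lborel {a<..} h"
proof (rule set_integrable_bound)
  show "set_integrable lborel {a<..} (\<lambda>t. K * exp (- (c * t)))"
    using set_integrable_subset[OF exp_integrable_Ioi[OF assms(2)], of "{a<..}"] assms(3) by auto
  show "set_borel_measurable lborel {a<..} h"
    unfolding set_borel_measurable_def using borel_measurable_continuous_on_indicator[OF _ assms(1)] by simp
  show "AE t in lborel. t \<in> {a<..} \<longrightarrow> norm (h t) \<le> norm (K * exp (- (c * t)))"
    using assms(4) order_trans[OF _ abs_ge_self] by (intro AE_I2) (auto simp: real_norm_def)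
qed

text \<open>Induction along Horner's scheme: each step spends half of c on the factor z and leaves
  the other half for the remaining polynomial.\<close>

lemma poly_exp_bound:
  fixes Q :: "complex poly"
  assumes "c > 0"
  shows "\<exists>K\<ge>0. \<forall>z. \<bar>Re z\<bar> \<le> X \<longrightarrow> Im z \<ge> 0 \<longrightarrow> norm (poly Q z) \<le> K * exp (c * Im z)"
  using assms
proof (induction Q arbitrary: c)
  case 0
  then show ?case by (intro exI[of _ 0]) simp
next
  case (pCons a Q)
  obtain K where K: "K \<ge> 0" "\<forall>z. \<bar>Re z\<bar> \<le> X \<longrightarrow> Im z \<ge> 0 \<longrightarrow> norm (poly Q z) \<le> K * exp (c / 2 * Im z)"
    using pCons.IH[of "c / 2"] pCons.prems by auto
  have c2: "c / 2 > 0" using pCons.prems by simp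
  obtain C where C: "C \<ge> 0" "\<And>t. t \<ge> 0 \<Longrightarrow> t ^ 1 \<le> C * exp (c / 2 * t)"
    using power_le_exp[OF c2, of 1] by metis
  have "norm (poly (pCons a Q) z) \<le> (norm a + (\<bar>X\<bar> + C) * K) * exp (c * Im z)"
    if z: "\<bar>Re z\<bar> \<le> X" "Im z \<ge> 0" for z
  proof -
    let ?e = "exp (c / 2 * Im z)"
    have e1: "1 \<le> ?e" using z c2 by simp
    have ee: "?e * ?e = exp (c * Im z)" by (simp flip: exp_add)
    have "norm z \<le> \<bar>Re z\<bar> + \<bar>Im z\<bar>" by (rule cmod_le)
    also have "\<dots> \<le> \<bar>X\<bar> * ?e + C * ?e"
    proof (rule add_mono)
      have "\<bar>Re z\<bar> \<le> \<bar>X\<bar> * 1" using z by simp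
      also have "\<dots> \<le> \<bar>X\<bar> * ?e" using e1 by (intro mult_left_mono) auto
      finally show "\<bar>Re z\<bar> \<le> \<bar>X\<bar> * ?e" .
      show "\<bar>Im z\<bar> \<le> C * ?e" using C(2)[of "Im z"] z by simp
    qed
    finally have nz: "norm z \<le> (\<bar>X\<bar> + C) * ?e" by (simp add: distrib_right)
    have "norm (poly (pCons a Q) z) \<le> norm a + norm z * norm (poly Q z)"
      using norm_triangle_ineq[of a "z * poly Q z"] by (simp add: norm_mult)
    also have "\<dots> \<le> norm a * (?e * ?e) + ((\<bar>X\<bar> + C) * ?e) * (K * ?e)"
    proof (rule add_mono)
      have "1 \<le> ?e * ?e" using mult_mono[OF e1 e1] by simp
      then show "norm a \<le> norm a * (?e * ?e)" using mult_left_mono[of 1 "?e * ?e" "norm a"] by simp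
      show "norm z * norm (poly Q z) \<le> ((\<bar>X\<bar> + C) * ?e) * (K * ?e)"
        using nz K z C by (intro mult_mono) auto
    qed
    also have "\<dots> = (norm a + (\<bar>X\<bar> + C) * K) * (?e * ?e)" by (simp add: algebra_simps)
    finally show ?thesis unfolding ee .
  qed
  moreover have "norm a + (\<bar>X\<bar> + C) * K \<ge> 0" using K C by simp
  ultimately show ?case by blast
qed

text \<open>Integrability gives a limit of the primitive up the imaginary axis; on high horizontal
  segments the integrand is exponentially small, so every vertical line has the same limit. Infinity
  thus is a common endpoint of all vertical paths.\<close>

lemma vertical_limit:
  fixes \<Phi> g :: "complex \<Rightarrow> complex"
  assumes \<Phi>: "\<And>w. w \<in> uhp \<Longrightarrow> (\<Phi> has_field_derivative g w) (at w)"
    and g: "g holomorphic_on uhp"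
    and bound: "\<And>X. \<exists>K c. c > 0 \<and> (\<forall>w. \<bar>Re w\<bar> \<le> X \<longrightarrow> Im w \<ge> 1 \<longrightarrow> norm (g w) \<le> K * exp (- (c * Im w)))"
  shows "\<exists>l. \<forall>x. ((\<lambda>t. \<Phi> (Complex x t)) \<longlongrightarrow> l) at_top"
proof -
  have contg: "continuous_on uhp g" using g by (rule holomorphic_on_imp_continuous_on)
  have Cx: "Complex x t = of_real x + \<i> * of_real t" for x t by (simp add: complex_eq_iff)
  have "\<exists>l. ((\<lambda>t. \<Phi> (Complex 0 t)) \<longlongrightarrow> l) at_top"
  proof -
    let ?h = "\<lambda>t. g (Complex 0 t) * \<i>"
    obtain K c where K: "c > 0" "\<And>w. \<bar>Re w\<bar> \<le> 0 \<Longrightarrow> Im w \<ge> 1 \<Longrightarrow> norm (g w) \<le> K * exp (- (c * Im w))"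
      using bound[of 0] by blast
    have cont: "continuous_on {0<..} ?h"
    proof (intro continuous_on_mult continuous_on_const continuous_on_compose2[OF contg])
      show "continuous_on {0<..} (Complex 0)" unfolding Cx by (intro continuous_intros)
      show "Complex 0 ` {0<..} \<subseteq> uhp" by (auto simp: uhp_iff)
    qed
    have int: "set_integrable lborel {1<..} ?h"
    proof (rule exp_bounded_integrable[OF _ K(1)])
      show "continuous_on {1<..} ?h" by (rule continuous_on_subset[OF cont]) auto
      show "norm (?h t) \<le> K * exp (- (c * t))" if "t > 1" for t
        using K(2)[of "Complex 0 t"] that by (simp add: norm_mult)
    qed simp
    have int': "set_integrable lborel {2..} ?h"
      by (rule set_integrable_subset[OF int]) auto
    have "((\<lambda>b. LINT t:{2..b}|lborel. ?h t) \<longlongrightarrow> (LINT t:{2..}|lborel. ?h t)) at_top"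
      by (rule tendsto_set_lebesgue_integral_at_top[OF _ int']) simp
    moreover have "eventually (\<lambda>b. (LINT t:{2..b}|lborel. ?h t) = \<Phi> (Complex 0 b) - \<Phi> (Complex 0 2)) at_top"
      using eventually_ge_at_top[of "2::real"]
    proof eventually_elim
      fix b :: real assume b: "b \<ge> 2"
      have d: "((\<lambda>t. \<Phi> (Complex 0 t)) has_vector_derivative ?h t) (at t within {2..b})" if t: "t \<ge> 2" for t
      proof -
        have v: "((\<lambda>t. \<i> * of_real t) has_vector_derivative \<i>) (at t within {2..b})"
          by (auto intro!: derivative_eq_intros)
        have "Complex 0 t \<in> uhp" using t by (simp add: uhp_iff)
        then have D: "(\<Phi> has_field_derivative g (Complex 0 t)) (at (\<i> * of_real t))"
          using \<Phi>[of "Complex 0 t"] by (simp add: Cx)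
        have "((\<Phi> \<circ> (\<lambda>t. \<i> * of_real t)) has_vector_derivative (\<i> * g (Complex 0 t))) (at t within {2..b})"
          by (rule field_vector_diff_chain_within[OF v has_field_derivative_at_within[OF D]])
        then show ?thesis by (simp add: o_def Cx mult.commute)
      qed
      have "continuous_on {2..b} ?h" by (rule continuous_on_subset[OF cont]) auto
      from integral_FTC_atLeastAtMost[OF b d this]
      show "(LINT t:{2..b}|lborel. ?h t) = \<Phi> (Complex 0 b) - \<Phi> (Complex 0 2)"
        unfolding set_lebesgue_integral_def by simp
    qed
    ultimately have "((\<lambda>b. \<Phi> (Complex 0 b) - \<Phi> (Complex 0 2)) \<longlongrightarrow> (LINT t:{2..}|lborel. ?h t)) at_top"
      by (rule Lim_transform_eventually)
    from tendsto_add[OF this tendsto_const[of "\<Phi> (Complex 0 2)"]] show ?thesis by auto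
  qed
  then obtain l where l: "((\<lambda>t. \<Phi> (Complex 0 t)) \<longlongrightarrow> l) at_top" by blast
  have "((\<lambda>t. \<Phi> (Complex x t)) \<longlongrightarrow> l) at_top" for x
  proof -
    obtain K c where K: "c > 0" "\<And>w. \<bar>Re w\<bar> \<le> \<bar>x\<bar> \<Longrightarrow> Im w \<ge> 1 \<Longrightarrow> norm (g w) \<le> K * exp (- (c * Im w))"
      using bound[of "\<bar>x\<bar>"] by blast
    have "((\<lambda>t. \<Phi> (Complex x t) - \<Phi> (Complex 0 t)) \<longlongrightarrow> 0) at_top"
    proof (rule Lim_null_comparison)
      show "eventually (\<lambda>t. norm (\<Phi> (Complex x t) - \<Phi> (Complex 0 t)) \<le> K * exp (- (c * t)) * \<bar>x\<bar>) at_top"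
        using eventually_ge_at_top[of "1::real"]
      proof eventually_elim
        fix t :: real assume t: "t \<ge> 1"
        define S where "S = {w. Im w = t} \<inter> ({w. Re w \<le> \<bar>x\<bar>} \<inter> {w. Re w \<ge> - \<bar>x\<bar>})"
        have S: "w \<in> uhp" "\<bar>Re w\<bar> \<le> \<bar>x\<bar>" "Im w = t" if "w \<in> S" for w
          using that t by (auto simp: S_def uhp_iff)
        have "convex S"
          unfolding S_def by (intro convex_Int convex_halfspace_Re_le convex_halfspace_Re_ge)
            (use convex_hyperplane[of "\<i>" t] in simp)
        then have "norm (\<Phi> (Complex x t) - \<Phi> (Complex 0 t)) \<le> K * exp (- (c * t)) * norm (Complex x t - Complex 0 t)"
        proof (rule field_differentiable_bound)
          show "(\<Phi> has_field_derivative g w) (at w within S)" if "w \<in> S" for w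
            using \<Phi>[OF S(1)[OF that]] by (rule has_field_derivative_at_within)
          show "norm (g w) \<le> K * exp (- (c * t))" if "w \<in> S" for w
            using K(2)[of w] S[OF that] t by simp
        qed (auto simp: S_def)
        also have "Complex x t - Complex 0 t = of_real x" by (simp add: complex_eq_iff)
        finally show "norm (\<Phi> (Complex x t) - \<Phi> (Complex 0 t)) \<le> K * exp (- (c * t)) * \<bar>x\<bar>" by simp
      qed
      have "filterlim (\<lambda>t. c * t) at_top at_top"
        using K by (intro filterlim_tendsto_pos_mult_at_top[OF tendsto_const _ filterlim_ident])
      then have "((\<lambda>t. exp (- (c * t))) \<longlongrightarrow> 0) at_top"
        by (intro filterlim_compose[OF exp_at_bot] filterlim_compose[OF filterlim_uminus_at_bot_at_top])
      then show "((\<lambda>t. K * exp (- (c * t)) * \<bar>x\<bar>) \<longlongrightarrow> 0) at_top"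
        by (intro tendsto_mult_left_zero tendsto_mult_right_zero)
    qed
    from tendsto_add[OF this l] show ?thesis by simp
  qed
  then show ?thesis by blast
qed

lemma poly_holomorphic: "(\<lambda>w. poly Q w) holomorphic_on S"
  unfolding holomorphic_on_def field_differentiable_def
  using poly_DERIV has_field_derivative_at_within by blast

lemma vertical_limit_poly:
  fixes Q :: "complex poly"
  assumes \<Phi>: "\<And>w. w \<in> uhp \<Longrightarrow> (\<Phi> has_field_derivative u w * poly Q w) (at w)"
    and u: "u holomorphic_on uhp" and c: "c > 0"
    and bound: "\<And>w. Im w \<ge> 1 \<Longrightarrow> norm (u w) \<le> K * exp (- (c * Im w))"
  shows "\<exists>l. \<forall>x. ((\<lambda>t. \<Phi> (Complex x t)) \<longlongrightarrow> l) at_top"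
proof (rule vertical_limit[OF \<Phi>])
  show "(\<lambda>w. u w * poly Q w) holomorphic_on uhp"
    using u by (intro holomorphic_on_mult poly_holomorphic)
  fix X :: real
  obtain C where C: "C \<ge> 0" "\<forall>z. \<bar>Re z\<bar> \<le> X \<longrightarrow> Im z \<ge> 0 \<longrightarrow> norm (poly Q z) \<le> C * exp (c / 2 * Im z)"
    using poly_exp_bound[of "c / 2" X Q] c by auto
  have "norm (u w * poly Q w) \<le> K * C * exp (- (c / 2 * Im w))" if w: "\<bar>Re w\<bar> \<le> X" "Im w \<ge> 1" for w
  proof -
    have K: "0 \<le> K * exp (- (c * Im w))" using bound[OF w(2)] norm_ge_zero order_trans by blast
    have "norm (u w * poly Q w) \<le> (K * exp (- (c * Im w))) * (C * exp (c / 2 * Im w))"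
      unfolding norm_mult using bound[OF w(2)] C(2) w K by (intro mult_mono) auto
    also have "\<dots> = K * C * (exp (- (c * Im w)) * exp (c / 2 * Im w))" by simp
    also have "exp (- (c * Im w)) * exp (c / 2 * Im w) = exp (- (c / 2 * Im w))" by (simp flip: exp_add)
    finally show ?thesis .
  qed
  moreover have "c / 2 > 0" using c by simp
  ultimately show "\<exists>K c. c > 0 \<and> (\<forall>w. \<bar>Re w\<bar> \<le> X \<longrightarrow> Im w \<ge> 1 \<longrightarrow> norm (u w * poly Q w) \<le> K * exp (- (c * Im w)))"
    by blast
qed

definition vline :: "rat \<Rightarrow> real \<Rightarrow> complex" where
  "vline r t = of_rat r + \<i> * of_real t"

lemma Im_vline [simp]: "Im (vline r t) = t" and Re_vline [simp]: "Re (vline r t) = of_rat r"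
proof -
  have "(of_rat r :: complex) = of_real (of_rat r)"
  proof (cases r)
    case (Fract a b)
    then show ?thesis by (simp add: of_rat_rat)
  qed
  then show "Im (vline r t) = t" "Re (vline r t) = of_rat r" by (simp_all add: vline_def)
qed

lemma vline_uhp: "t > 0 \<Longrightarrow> vline r t \<in> uhp"
  by (simp add: uhp_iff)

lemma vline_Complex: "vline r t = Complex (of_rat r) t"
  by (simp add: complex_eq_iff)

lemma cusp_matrix:
  fixes A C :: int
  assumes "coprime A C"
  obtains B D where "A * D - B * C = 1"
proof -
  obtain u v where "u * A + v * C = gcd A C" using bezout_int by blast
  then have "A * u - (- v) * C = 1" using assms by (simp add: algebra_simps coprime_iff_gcd_eq_1)
  then show ?thesis by (rule that)
qed

lemma mat_act_line:
  assumes det: "det X > 0" and C: "m21 X \<noteq> 0"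
    and s: "of_rat s = (- (of_int (m22 X) / of_int (m21 X)) :: complex)" and t: "t > 0"
  shows "mat_act X (vline s t) = Complex (Re (of_int (m11 X) / of_int (m21 X))) (of_int (det X) / ((of_int (m21 X))\<^sup>2 * t))"
proof -
  have "mat_act X (vline s t) =
      of_int (m11 X) / of_int (m21 X) + \<i> * of_real (of_int (det X) / (of_int (m21 X) ^ 2 * t))"
    unfolding vline_def s by (rule mat_act_vertical) (use C t in auto)
  then show ?thesis by (simp add: complex_eq_iff)
qed

lemma filterlim_const_divide_at_top:
  assumes "(a::real) > 0" "b > 0"
  shows "filterlim (\<lambda>t. a / (b * t)) at_top (at_right 0)"
proof -
  have "filterlim (\<lambda>t. a / b * inverse t) at_top (at_right 0)"
    using assms by (intro filterlim_tendsto_pos_mult_at_top[OF tendsto_const _ filterlim_inverse_at_top_right]) auto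
  then show ?thesis by (simp add: field_simps)
qed

text \<open>For t > 1 this is decay at infinity. For t \<le> 1 a matrix X with X(infinity) = r = A/C
  moves the point to height 1/(C^2 t), and the decay of f|X there outweighs the k-th power of the
  cocycle; boundedness is enough on this range.\<close>

lemma cusp_form_line_bound:
  assumes f: "f \<in> cusp_forms k M" and M: "M > 0"
  shows "\<exists>K c. c > 0 \<and> (\<forall>t>0. norm (f (vline r t)) \<le> K * exp (- (c * t)))"
proof -
  have I: "mat 1 \<in> SL2Z" using matrix_subgroupD(1)[OF matrix_subgroup_SL2Z] .
  obtain K0 c0 where 0: "K0 \<ge> 0" "c0 > 0" "\<And>z. Im z \<ge> 1 \<Longrightarrow> norm (slash k f (mat 1) z) \<le> K0 * exp (- (c0 * Im z))"
    using cusp_form_slash_decay[OF f M I, of 1] by auto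
  obtain A C where AC: "quotient_of r = (A, C)" by fastforce
  have C: "C > 0" "coprime A C" "r = of_int A / of_int C"
    using quotient_of_denom_pos[OF AC] quotient_of_coprime[OF AC] quotient_of_div[OF AC] by auto
  have rr: "(of_rat r :: complex) = of_int A / of_int C" using C(3) by (simp add: of_rat_divide)
  obtain B D where BD: "A * D - B * C = 1" by (rule cusp_matrix[OF C(2)])
  define X where "X = mat2 A B C D"
  have X: "X \<in> SL2Z" using BD by (simp add: X_def SL2Z_iff)
  have dX: "det X = 1" using X by (simp add: SL2Z_def)
  define Y where "Y = mat2 D (- B) (- C) A"
  have dY: "det Y = 1" using BD by (simp add: Y_def algebra_simps)
  have XY: "X ** Y = mat 1" using BD by (simp add: X_def Y_def mat2_eq_iff mat_1_mat2 mult_nth algebra_simps)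
  obtain K1 c1 where 1: "K1 \<ge> 0" "c1 > 0"
    "\<And>z. Im z \<ge> 1 / (real_of_int C)\<^sup>2 \<Longrightarrow> norm (slash k f X z) \<le> K1 * exp (- (c1 * Im z))"
    using cusp_form_slash_decay[OF f M X, of "1 / (real_of_int C)\<^sup>2"] C by auto
  obtain K2 where K2: "K2 \<ge> 0" "\<And>t. t \<ge> 0 \<Longrightarrow> t ^ k \<le> K2 * exp (c1 * t)"
    using power_le_exp[OF 1(2), of k] by metis
  define K3 where "K3 = K1 * K2 * real_of_int C ^ k"
  have K3: "K3 \<ge> 0" using 1 K2 C by (simp add: K3_def)
  have small: "norm (f (vline r t)) \<le> K3" if t: "0 < t" "t \<le> 1" for t
  proof -
    have v: "vline r t \<in> uhp" using t by (simp add: vline_uhp)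
    define y where "y = mat_act Y (vline r t)"
    have y_uhp: "y \<in> uhp" unfolding y_def by (rule mat_act_uhp) (use dY v in auto)
    have Xy: "mat_act X y = vline r t"
      unfolding y_def using mat_act_mult[of X Y "vline r t"] v by (simp add: dX dY XY) (simp add: mat_act_def mat_def)
    have cY: "cocycle Y (vline r t) = - of_int C * (\<i> * of_real t)"
      using C(1) by (simp add: cocycle_def Y_def vline_def rr field_simps)
    have "cocycle (X ** Y) (vline r t) = cocycle X y * cocycle Y (vline r t)"
      unfolding y_def by (rule cocycle_mult) (use dY v in auto)
    then have "cocycle X y * cocycle Y (vline r t) = 1" by (simp add: XY cocycle_def mat_def)
    then have "norm (cocycle X y) * norm (cocycle Y (vline r t)) = 1" by (metis norm_mult norm_one)
    then have cX: "norm (cocycle X y) = 1 / (real_of_int C * t)"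
      unfolding cY using C t by (simp add: norm_mult field_simps)
    have ncY: "norm (cocycle Y (vline r t)) = real_of_int C * t"
      unfolding cY using C(1) t by (simp add: norm_mult)
    have "Im y = of_int (det Y) * Im (vline r t) / (norm (cocycle Y (vline r t)))\<^sup>2"
      unfolding y_def by (rule Im_mat_act) (use dY v in auto)
    also have "\<dots> = 1 / ((real_of_int C)\<^sup>2 * t)"
      unfolding ncY dY using C(1) t by (simp add: power2_eq_square)
    finally have Imy: "Im y = 1 / ((real_of_int C)\<^sup>2 * t)" .
    have "1 / (real_of_int C)\<^sup>2 \<le> Im y" unfolding Imy using C t by (intro divide_left_mono) auto
    then have s: "norm (slash k f X y) \<le> K1 * exp (- (c1 * Im y))" by (rule 1(3))
    have "f (vline r t) = slash k f X y * cocycle X y ^ k"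
      unfolding slash_eq Xy using cocycle_nonzero[of X y] y_uhp dX by simp
    then have "norm (f (vline r t)) = norm (slash k f X y) * norm (cocycle X y) ^ k"
      by (simp add: norm_mult norm_power)
    also have "norm (cocycle X y) = real_of_int C * Im y"
      unfolding cX Imy using C t by (simp add: power2_eq_square)
    also have "norm (slash k f X y) * (real_of_int C * Im y) ^ k =
        norm (slash k f X y) * (Im y ^ k * real_of_int C ^ k)" by (simp add: power_mult_distrib mult_ac)
    also have "\<dots> \<le> (K1 * exp (- (c1 * Im y))) * ((K2 * exp (c1 * Im y)) * real_of_int C ^ k)"
      using s 1 K2 C y_uhp by (intro mult_mono K2(2)) (auto simp: uhp_iff)
    also have "\<dots> = K3 * (exp (- (c1 * Im y)) * exp (c1 * Im y))" by (simp add: K3_def)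
    also have "exp (- (c1 * Im y)) * exp (c1 * Im y) = 1" by (simp flip: exp_add)
    finally show ?thesis by simp
  qed
  have "norm (f (vline r t)) \<le> (K0 + K3 * exp c0) * exp (- (c0 * t))" if t: "t > 0" for t
  proof (cases "t \<le> 1")
    case True
    have "c0 * t \<le> c0" using True 0 by simp
    then have "1 \<le> exp c0 * exp (- (c0 * t))" by (simp flip: exp_add)
    then have "K3 * 1 \<le> K3 * (exp c0 * exp (- (c0 * t)))" using K3 by (rule mult_left_mono)
    moreover have "0 \<le> K0 * exp (- (c0 * t))" using 0 by simp
    ultimately show ?thesis using small[OF t True] by (simp add: algebra_simps)
  next
    case False
    then have "norm (f (vline r t)) \<le> K0 * exp (- (c0 * t))"
      using 0(3)[of "vline r t"] by (simp add: slash_id)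
    moreover have "0 \<le> K3 * exp c0 * exp (- (c0 * t))" using K3 by simp
    ultimately show ?thesis by (simp add: algebra_simps)
  qed
  then show ?thesis using 0(2) by blast
qed

lemma line_integrable:
  assumes f: "f \<in> cusp_forms k M" and M: "M > 0"
  shows "set_integrable lborel {0<..} (\<lambda>t. f (vline r t) * poly Q (vline r t) * \<i>)"
    and "continuous_on {0<..} (\<lambda>t. f (vline r t) * poly Q (vline r t) * \<i>)"
proof -
  obtain K c where K: "c > 0" "\<And>t. t > 0 \<Longrightarrow> norm (f (vline r t)) \<le> K * exp (- (c * t))"
    using cusp_form_line_bound[OF f M, of r] by blast
  obtain C where C: "C \<ge> 0" "\<forall>z. \<bar>Re z\<bar> \<le> \<bar>of_rat r\<bar> \<longrightarrow> Im z \<ge> 0 \<longrightarrow> norm (poly Q z) \<le> C * exp (c / 2 * Im z)"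
    using poly_exp_bound[of "c / 2" "\<bar>of_rat r\<bar>" Q] K by auto
  have "continuous_on {0<..} (\<lambda>t. f (vline r t))"
  proof (rule continuous_on_compose2[OF holomorphic_on_imp_continuous_on[OF cusp_formsD(1)[OF f]]])
    show "continuous_on {0<..} (vline r)" unfolding vline_def by (intro continuous_intros)
  qed (auto simp: vline_uhp)
  then show cont: "continuous_on {0<..} (\<lambda>t. f (vline r t) * poly Q (vline r t) * \<i>)"
    by (intro continuous_on_mult continuous_on_const continuous_on_poly) (auto simp: vline_def intro!: continuous_intros)
  show "set_integrable lborel {0<..} (\<lambda>t. f (vline r t) * poly Q (vline r t) * \<i>)"
  proof (rule exp_bounded_integrable[OF cont])
    show "c / 2 > 0" using K by simp
    fix t :: real assume t: "t > 0"
    have K0: "0 \<le> K * exp (- (c * t))" using K(2)[OF t] norm_ge_zero order_trans by blast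
    have "norm (f (vline r t) * poly Q (vline r t) * \<i>) \<le> (K * exp (- (c * t))) * (C * exp (c / 2 * t))"
      unfolding norm_mult using K(2)[OF t] C(2)[rule_format, of "vline r t"] K0 t by (simp add: mult_mono)
    also have "\<dots> = K * C * (exp (- (c * t)) * exp (c / 2 * t))" by simp
    also have "exp (- (c * t)) * exp (c / 2 * t) = exp (- (c / 2 * t))" by (simp flip: exp_add)
    finally show "norm (f (vline r t) * poly Q (vline r t) * \<i>) \<le> K * C * exp (- (c / 2 * t))" .
  qed simp
qed

definition line_integral :: "(complex \<Rightarrow> complex) \<Rightarrow> complex poly \<Rightarrow> rat \<Rightarrow> complex" where
  "line_integral f Q r = set_lebesgue_integral lborel {0<..} (\<lambda>t. f (vline r t) * poly Q (vline r t) * \<i>)"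

lemma line_integral_FTC:
  assumes f: "f \<in> cusp_forms k M" and M: "M > 0"
    and F: "\<And>z. z \<in> uhp \<Longrightarrow> (F has_field_derivative f z * poly Q z) (at z)"
    and A: "((\<lambda>t. F (vline r t)) \<longlongrightarrow> A) (at_right 0)" and B: "((\<lambda>t. F (vline r t)) \<longlongrightarrow> B) at_top"
  shows "line_integral f Q r = B - A"
proof -
  let ?h = "\<lambda>t. f (vline r t) * poly Q (vline r t) * \<i>"
  have "(LBINT t=0..\<infinity>. ?h t) = B - A"
  proof (rule interval_integral_FTC_integrable)
    show "((\<lambda>t. F (vline r t)) has_vector_derivative ?h t) (at t)" if "0 < ereal t" for t
    proof -
      have "((\<lambda>t. vline r t) has_vector_derivative \<i>) (at t)"
        unfolding vline_def by (auto intro!: derivative_eq_intros)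
      from field_vector_diff_chain_at[OF this F[OF vline_uhp]] that
      show ?thesis by (simp add: o_def mult_ac)
    qed
    show "isCont ?h t" if "0 < ereal t" for t
      using line_integrable(2)[OF f M, of r Q] that by (auto simp: continuous_on_eq_continuous_at)
    show "set_integrable lborel (einterval 0 \<infinity>) ?h"
      using line_integrable(1)[OF f M, of r Q] by (simp add: zero_ereal_def)
    show "(((\<lambda>t. F (vline r t)) \<circ> real_of_ereal) \<longlongrightarrow> A) (at_right 0)"
      using A by (simp add: zero_ereal_def ereal_tendsto_simps)
    show "(((\<lambda>t. F (vline r t)) \<circ> real_of_ereal) \<longlongrightarrow> B) (at_left \<infinity>)"
      using B by (simp add: ereal_tendsto_simps)
  qed simp
  then show ?thesis
    by (simp add: interval_lebesgue_integral_def line_integral_def zero_ereal_def)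
qed

lemma line_integral_sum:
  assumes f: "f \<in> cusp_forms k M" and M: "M > 0"
    and eq: "\<And>z. (\<Sum>i\<in>I. c i * poly (Q i) z) = poly R z"
  shows "(\<Sum>i\<in>I. c i * line_integral f (Q i) r) = line_integral f R r"
proof -
  have "line_integral f R r =
      set_lebesgue_integral lborel {0<..} (\<lambda>t. \<Sum>i\<in>I. c i * (f (vline r t) * poly (Q i) (vline r t) * \<i>))"
    unfolding line_integral_def eq[symmetric] by (simp add: sum_distrib_left sum_distrib_right mult_ac)
  also have "\<dots> = (\<Sum>i\<in>I. set_lebesgue_integral lborel {0<..} (\<lambda>t. c i * (f (vline r t) * poly (Q i) (vline r t) * \<i>)))"
  proof -
    have "set_integrable lborel {0<..} (\<lambda>t. c i * (f (vline r t) * poly (Q i) (vline r t) * \<i>))" for i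
      by (rule set_integrable_mult_right) (use line_integrable(1)[OF f M] in simp)
    then show ?thesis
      unfolding set_lebesgue_integral_def set_integrable_def scaleR_sum_right
      by (rule Bochner_Integration.integral_sum)
  qed
  also have "\<dots> = (\<Sum>i\<in>I. c i * line_integral f (Q i) r)"
    unfolding line_integral_def by simp
  finally show ?thesis ..
qed

text \<open>Applied to the cocycle in weight k: one factor clears the denominator of the i-th power
  of the image point, one that of the derivative, and the rest stays as a polynomial.\<close>

lemma power_split:
  fixes x :: "'a::monoid_mult"
  assumes "i + 2 \<le> k"
  shows "x ^ k = x ^ (k - 2 - i) * x ^ i * x ^ 2"
proof -
  have "k = k - 2 - i + i + 2" using assms by simp
  then have "x ^ k = x ^ (k - 2 - i + i + 2)" by (rule arg_cong)
  then show ?thesis by (simp only: power_add)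
qed

text \<open>F composed with X is a primitive of f|X times a polynomial, so F has one limit at the
  cusp X(infinity) along the images of all vertical lines.\<close>

lemma cusp_limit:
  assumes f: "f \<in> cusp_forms k M" and M: "M > 0" and i: "i + 2 \<le> k" and X: "X \<in> SL2Z"
    and F: "\<And>z. z \<in> uhp \<Longrightarrow> (F has_field_derivative f z * poly (monom 1 i) z) (at z)"
  obtains l where "\<And>a. ((\<lambda>t. F (mat_act X (Complex a t))) \<longlongrightarrow> l) at_top"
proof -
  have dX: "det X > 0" "det X = 1" using X by (auto simp: SL2Z_def)
  obtain K c where "K \<ge> 0" and K: "c > 0" "\<And>z. Im z \<ge> 1 \<Longrightarrow> norm (slash k f X z) \<le> K * exp (- (c * Im z))"
    using cusp_form_slash_decay[OF f M X, of 1] by auto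
  define Q :: "complex poly" where
    "Q = [:of_int (m12 X), of_int (m11 X):] ^ i * [:of_int (m22 X), of_int (m21 X):] ^ (k - 2 - i)"
  have "\<exists>l. \<forall>a. ((\<lambda>t. (F \<circ> mat_act X) (Complex a t)) \<longlongrightarrow> l) at_top"
  proof (rule vertical_limit_poly[OF _ holomorphic_slash[OF cusp_formsD(1)[OF f] dX(1)] K])
    fix z assume z: "z \<in> uhp"
    let ?J = "cocycle X z" and ?n = "of_int (m11 X) * z + of_int (m12 X)"
    have J: "?J \<noteq> 0" by (rule cocycle_nonzero[OF dX(1) z])
    have act: "mat_act X z = ?n / ?J" by (simp add: mat_act_def cocycle_def)
    have Q: "poly Q z = ?n ^ i * ?J ^ (k - 2 - i)"
      by (simp add: Q_def cocycle_def algebra_simps)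
    have "?J ^ k = ?J ^ (k - 2 - i) * ?J ^ i * ?J ^ 2"
      by (rule power_split[OF i])
    then have eq: "f (mat_act X z) * poly (monom 1 i) (mat_act X z) * (of_int (det X) / ?J ^ 2) = slash k f X z * poly Q z"
      unfolding slash_eq Q poly_monom using J by (simp add: dX act power_divide)
    have "((F \<circ> mat_act X) has_field_derivative f (mat_act X z) * poly (monom 1 i) (mat_act X z) * (of_int (det X) / ?J ^ 2)) (at z)"
      by (rule DERIV_chain[OF F[OF mat_act_uhp[OF dX(1) z]] DERIV_mat_act[OF dX(1) z]])
    then show "((F \<circ> mat_act X) has_field_derivative slash k f X z * poly Q z) (at z)" unfolding eq .
  qed
  then show ?thesis using that by auto
qed

lemma filterlim_vertical_limit:
  assumes "\<And>a. ((\<lambda>t. G (Complex a t)) \<longlongrightarrow> l) at_top" and "b > 0" "c > 0"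
    and eq: "\<And>t. t > 0 \<Longrightarrow> H t = G (Complex a (b / (c * t)))"
  shows "(H \<longlongrightarrow> l) (at_right (0::real))"
proof -
  have "((\<lambda>t. G (Complex a (b / (c * t)))) \<longlongrightarrow> l) (at_right 0)"
    by (rule filterlim_compose[OF assms(1) filterlim_const_divide_at_top[OF assms(2,3)]])
  moreover have "eventually (\<lambda>t. G (Complex a (b / (c * t))) = H t) (at_right 0)"
    using eventually_at_right_less by (rule eventually_mono) (simp add: eq)
  ultimately show ?thesis by (rule Lim_transform_eventually)
qed

context atkin_lehner
begin

text \<open>The weight k - 2 action of W on z^i, with the factor p of the cocycle p (N s z + w)
  taken out.\<close>

definition W_poly :: "nat \<Rightarrow> complex poly" where
  "W_poly i = [:of_int w, of_int (int N * s):] ^ (k - 2 - i) * [:of_int y, of_int (int p * x):] ^ i"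

text \<open>For a primitive F of f z^i, F(W z)/\<kappa> is a primitive of f times
  \<open>W_poly i\<close>. The path between r and infinity becomes one between W^(-1)(r) and
  W^(-1)(infinity) = -w/(N s), broken at infinity into two vertical lines. The constant collects the
  eigenvalue, p^(k-2-i) from the cocycle and p from the determinant; the condition \<open>ne\<close>
  says that W^(-1)(r) is finite.\<close>

lemma line_integral_W:
  assumes f: "f \<in> cusp_forms k (N * p)" and \<epsilon>: "\<And>z. z \<in> uhp \<Longrightarrow> slash k f W z = \<epsilon> * f z"
    and i: "i \<le> k - 2" and AC: "coprime A C" "C > 0" and ne: "C * x \<noteq> A * (int N * s)"
    and \<epsilon>0: "\<epsilon> \<noteq> 0"
  shows "line_integral f (monom 1 i) (of_int A / of_int C) = \<epsilon> * of_nat p ^ (k - 1 - i) *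
    (line_integral f (W_poly i) (of_int (C * y - A * int p * w) / of_int (int p * (A * int N * s - C * x)))
      - line_integral f (W_poly i) (of_int (- w) / of_int (int N * s)))"
proof -
  have Np: "N * p > 0" using N p_gt_1 by simp
  have ik: "i + 2 \<le> k" using i k by simp
  have s0: "s \<noteq> 0" using p_not_dvd_s by auto
  obtain B D where BD: "A * D - B * C = 1" by (rule cusp_matrix[OF AC(1)])
  define X where "X = mat2 A B C D"
  define Y where "Y = mat2 D (- B) (- C) A"
  have X: "X \<in> SL2Z" using BD by (simp add: X_def SL2Z_iff)
  have dX: "det X = 1" "det X > 0" using X by (auto simp: SL2Z_def)
  have dY: "det Y = 1" using BD by (simp add: Y_def algebra_simps)
  have XY: "X ** Y = mat 1" using BD by (simp add: X_def Y_def mat2_eq_iff mat_1_mat2 mult_nth algebra_simps)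
  \<comment> \<open>X^(-1) W sends W^(-1)(r) to infinity: its pole is the first new endpoint, and
    the limit there can be computed through X.\<close>
  define R where "R = Y ** W"
  have dR: "det R = int p" "det R > 0" using p_gt_1 by (simp_all add: R_def det_mul dY det_W_eq)
  have R21: "m21 R = int p * (A * int N * s - C * x)" and R22: "m22 R = - (C * y - A * int p * w)"
    by (simp_all add: R_def Y_def W_def mult_nth algebra_simps)
  have XR: "X ** R = W" unfolding R_def by (simp add: matrix_mul_assoc XY)
  have R21': "m21 R \<noteq> 0" unfolding R21 mult.assoc using ne p_gt_1 by simp
  define r :: rat where "r = of_int A / of_int C"
  define s1 :: rat where "s1 = of_int (C * y - A * int p * w) / of_int (int p * (A * int N * s - C * x))"
  define s2 :: rat where "s2 = of_int (- w) / of_int (int N * s)"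
  have s1: "of_rat s1 = (- (of_int (m22 R) / of_int (m21 R)) :: complex)"
    unfolding s1_def R21 R22 of_rat_divide of_rat_of_int_eq
    by (simp only: of_int_minus minus_divide_left minus_minus)
  have s2: "of_rat s2 = (- (of_int (m22 W) / of_int (m21 W)) :: complex)"
    unfolding s2_def of_rat_divide of_rat_of_int_eq using p_gt_1 by (simp add: W_def)
  have r: "of_rat r = (- (of_int (m22 Y) / of_int (m21 Y)) :: complex)"
    unfolding r_def of_rat_divide of_rat_of_int_eq by (simp add: Y_def)
  have "(\<lambda>z. f z * poly (monom 1 i) z) holomorphic_on uhp"
    by (intro holomorphic_on_mult cusp_formsD(1)[OF f] poly_holomorphic)
  then obtain F where F': "\<And>z. z \<in> uhp \<Longrightarrow> (F has_field_derivative f z * poly (monom 1 i) z) (at z within uhp)"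
    using holomorphic_convex_primitive'[OF convex_uhp open_uhp] by blast
  have F: "(F has_field_derivative f z * poly (monom 1 i) z) (at z)" if "z \<in> uhp" for z
    using F'[OF that] at_within_open[OF that open_uhp] by simp
  obtain l0 where "\<And>a. ((\<lambda>t. F (mat_act (mat 1) (Complex a t))) \<longlongrightarrow> l0) at_top"
    using cusp_limit[OF f Np ik matrix_subgroupD(1)[OF matrix_subgroup_SL2Z] F] by blast
  then have l0: "((\<lambda>t. F (Complex a t)) \<longlongrightarrow> l0) at_top" for a by (simp add: mat_act_def mat_def)
  obtain lX where lX: "\<And>a. ((\<lambda>t. F (mat_act X (Complex a t))) \<longlongrightarrow> lX) at_top"
    using cusp_limit[OF f Np ik X F] by blast
  \<comment> \<open>Going down to r is the image under X of going up a vertical line.\<close>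
  have lim0_r: "((\<lambda>t. F (vline r t)) \<longlongrightarrow> lX) (at_right 0)"
  proof (rule filterlim_vertical_limit[OF lX])
    fix t :: real assume t: "t > 0"
    have v: "vline r t \<in> uhp" by (rule vline_uhp[OF t])
    have "vline r t = mat_act X (mat_act Y (vline r t))"
      using mat_act_mult[of X Y "vline r t"] v dX dY by (simp add: XY) (simp add: mat_act_def mat_def)
    also have "mat_act Y (vline r t) =
        Complex (Re (of_int (m11 Y) / of_int (m21 Y))) (of_int (det Y) / ((of_int (m21 Y))\<^sup>2 * t))"
      by (rule mat_act_line[OF _ _ r t]) (use dY AC in \<open>auto simp: Y_def\<close>)
    finally show "F (vline r t) = F (mat_act X (Complex (Re (of_int (m11 Y) / of_int (m21 Y))) (of_int (det Y) / ((of_int (m21 Y))\<^sup>2 * t))))"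
      by simp
  qed (use dY AC in \<open>auto simp: Y_def\<close>)
  have lim1_r: "((\<lambda>t. F (vline r t)) \<longlongrightarrow> l0) at_top" unfolding vline_Complex by (rule l0)
  have int_r: "line_integral f (monom 1 i) r = l0 - lX"
    by (rule line_integral_FTC[OF f Np _ lim0_r lim1_r]) (rule F)
  define \<kappa> where "\<kappa> = \<epsilon> * of_nat p ^ (k - 1 - i)"
  have \<kappa>0: "\<kappa> \<noteq> 0" using \<epsilon>0 p_gt_1 by (simp add: \<kappa>_def)
  define \<Phi> where "\<Phi> z = F (mat_act W z) / \<kappa>" for z
  have \<Phi>: "(\<Phi> has_field_derivative f z * poly (W_poly i) z) (at z)" if z: "z \<in> uhp" for z
  proof -
    let ?J = "cocycle W z" and ?n = "of_int y + z * of_int (int p * x)" and ?d = "of_int w + z * of_int (int N * s)"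
    have J: "?J \<noteq> 0" by (rule cocycle_nonzero[OF det_W_pos z])
    have Jd: "?J = of_nat p * ?d" by (simp add: cocycle_def W_def algebra_simps)
    have act: "mat_act W z = ?n / ?J" by (simp add: mat_act_def cocycle_def W_def algebra_simps)
    have act_i: "mat_act W z ^ i = ?n ^ i / ?J ^ i" by (simp only: act power_divide)
    have fW: "f (mat_act W z) = \<epsilon> * f z * ?J ^ k"
      using \<epsilon>[OF z] J by (simp add: slash_eq field_simps)
    have Jk: "?J ^ k = ?J ^ (k - 2 - i) * ?J ^ i * ?J ^ 2"
      by (rule power_split[OF ik])
    have pk: "(of_nat p :: complex) ^ (k - 1 - i) = of_nat p * of_nat p ^ (k - 2 - i)"
    proof -
      have "k - 1 - i = Suc (k - 2 - i)" using ik by simp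
      then show ?thesis by simp
    qed
    have "f (mat_act W z) * poly (monom 1 i) (mat_act W z) * (of_int (det W) / ?J ^ 2) =
        \<epsilon> * f z * (?J ^ (k - 2 - i) * ?n ^ i) * of_nat p"
      unfolding fW Jk poly_monom act_i det_W_eq using J by simp
    also have "?J ^ (k - 2 - i) = of_nat p ^ (k - 2 - i) * ?d ^ (k - 2 - i)" unfolding Jd power_mult_distrib ..
    also have "\<epsilon> * f z * (of_nat p ^ (k - 2 - i) * ?d ^ (k - 2 - i) * ?n ^ i) * of_nat p = \<kappa> * (f z * poly (W_poly i) z)"
      unfolding \<kappa>_def pk W_poly_def by (simp add: mult_ac)
    finally have eq: "f (mat_act W z) * poly (monom 1 i) (mat_act W z) * (of_int (det W) / ?J ^ 2) = \<kappa> * (f z * poly (W_poly i) z)" .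
    have "((F \<circ> mat_act W) has_field_derivative f (mat_act W z) * poly (monom 1 i) (mat_act W z) * (of_int (det W) / ?J ^ 2)) (at z)"
      by (rule DERIV_chain[OF F[OF mat_act_uhp[OF det_W_pos z]] DERIV_mat_act[OF det_W_pos z]])
    from DERIV_cdivide[OF this, of \<kappa>] show ?thesis
      unfolding eq \<Phi>_def o_def using \<kappa>0 by simp
  qed
  obtain l\<Phi> where l\<Phi>: "\<And>a. ((\<lambda>t. \<Phi> (Complex a t)) \<longlongrightarrow> l\<Phi>) at_top"
  proof -
    have I: "mat 1 \<in> SL2Z" by (rule matrix_subgroupD(1)[OF matrix_subgroup_SL2Z])
    obtain K c where "K \<ge> 0" and K: "c > 0" "\<And>z. Im z \<ge> 1 \<Longrightarrow> norm (f z) \<le> K * exp (- (c * Im z))"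
      using cusp_form_slash_decay[OF f Np I, of 1] by (auto simp: slash_id)
    from vertical_limit_poly[OF \<Phi> cusp_formsD(1)[OF f] K] that show ?thesis by blast
  qed
  have lim0_s1: "((\<lambda>t. \<Phi> (vline s1 t)) \<longlongrightarrow> lX / \<kappa>) (at_right 0)"
  proof (rule filterlim_vertical_limit[of "\<lambda>z. F (mat_act X z) / \<kappa>"])
    show "((\<lambda>t. F (mat_act X (Complex a t)) / \<kappa>) \<longlongrightarrow> lX / \<kappa>) at_top" for a
      by (intro tendsto_divide lX tendsto_const \<kappa>0)
    fix t :: real assume t: "t > 0"
    have v: "vline s1 t \<in> uhp" by (rule vline_uhp[OF t])
    have "mat_act W (vline s1 t) = mat_act X (mat_act R (vline s1 t))"
      using mat_act_mult[OF dX(2) dR(2) v] by (simp add: XR)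
    also have "mat_act R (vline s1 t) =
        Complex (Re (of_int (m11 R) / of_int (m21 R))) (of_int (det R) / ((of_int (m21 R))\<^sup>2 * t))"
      by (rule mat_act_line[OF dR(2) R21' s1 t])
    finally show "\<Phi> (vline s1 t) = F (mat_act X (Complex (Re (of_int (m11 R) / of_int (m21 R))) (of_int (det R) / ((of_int (m21 R))\<^sup>2 * t)))) / \<kappa>"
      by (simp add: \<Phi>_def)
  qed (use dR R21' in auto)
  have lim1_s1: "((\<lambda>t. \<Phi> (vline s1 t)) \<longlongrightarrow> l\<Phi>) at_top" unfolding vline_Complex by (rule l\<Phi>)
  have int_s1: "line_integral f (W_poly i) s1 = l\<Phi> - lX / \<kappa>"
    by (rule line_integral_FTC[OF f Np _ lim0_s1 lim1_s1]) (rule \<Phi>)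
  have W21: "m21 W \<noteq> 0" using s0 N p_gt_1 by (simp add: W_def)
  have lim0_s2: "((\<lambda>t. \<Phi> (vline s2 t)) \<longlongrightarrow> l0 / \<kappa>) (at_right 0)"
  proof (rule filterlim_vertical_limit[of "\<lambda>z. F z / \<kappa>"])
    show "((\<lambda>t. F (Complex a t) / \<kappa>) \<longlongrightarrow> l0 / \<kappa>) at_top" for a
      by (intro tendsto_divide l0 tendsto_const \<kappa>0)
    fix t :: real assume t: "t > 0"
    show "\<Phi> (vline s2 t) = F (Complex (Re (of_int (m11 W) / of_int (m21 W))) (of_int (det W) / ((of_int (m21 W))\<^sup>2 * t))) / \<kappa>"
      unfolding \<Phi>_def mat_act_line[OF det_W_pos W21 s2 t] ..
  qed (use det_W_pos W21 in auto)
  have lim1_s2: "((\<lambda>t. \<Phi> (vline s2 t)) \<longlongrightarrow> l\<Phi>) at_top" unfolding vline_Complex by (rule l\<Phi>)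
  have int_s2: "line_integral f (W_poly i) s2 = l\<Phi> - l0 / \<kappa>"
    by (rule line_integral_FTC[OF f Np _ lim0_s2 lim1_s2]) (rule \<Phi>)
  have "\<kappa> * (line_integral f (W_poly i) s1 - line_integral f (W_poly i) s2) = l0 - lX"
    unfolding int_s1 int_s2 using \<kappa>0 by (simp add: algebra_simps)
  then show ?thesis using int_r by (simp add: r_def s1_def s2_def \<kappa>_def)
qed

end

subsection \<open>Normalized periods of integral polynomials\<close>

abbreviation (input) of_int_poly :: "int poly \<Rightarrow> complex poly" where
  "of_int_poly P \<equiv> map_poly of_int P"

lemma of_int_poly_pCons: "of_int_poly (pCons a P) = pCons (of_int a) (of_int_poly P)"
  by (simp add: map_poly_pCons)

lemma of_int_poly_add: "of_int_poly (P + Q) = of_int_poly P + of_int_poly Q"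
  by (rule poly_eqI) (simp add: coeff_map_poly)

lemma of_int_poly_smult: "of_int_poly (smult a P) = smult (of_int a) (of_int_poly P)"
  by (rule poly_eqI) (simp add: coeff_map_poly)

lemma of_int_poly_mult: "of_int_poly (P * Q) = of_int_poly P * of_int_poly Q"
proof (induction P)
  case (pCons a P)
  then show ?case
    by (simp add: of_int_poly_add of_int_poly_smult of_int_poly_pCons del: map_poly_pCons)
qed simp

lemma of_int_poly_power: "of_int_poly (P ^ n) = of_int_poly P ^ n"
  by (induction n) (simp_all add: of_int_poly_mult map_poly_1)

lemma of_int_poly_pcompose: "of_int_poly (pcompose P Q) = pcompose (of_int_poly P) (of_int_poly Q)"
proof (induction P)
  case (pCons a P)
  then show ?case
    by (simp add: pcompose_pCons of_int_poly_add of_int_poly_mult of_int_poly_pCons del: map_poly_pCons)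
qed simp

lemma of_int_poly_monom: "of_int_poly (monom 1 i) = monom 1 i"
  by (simp add: map_poly_monom)

lemma period_integral_eq:
  "period_integral f P r = - (2 * of_real pi * \<i>) * line_integral f (of_int_poly P) r"
  by (simp add: period_integral_def line_integral_def vline_def)

lemma period_integral_sum:
  assumes f: "f \<in> cusp_forms k M" "M > 0"
    and eq: "\<And>z. (\<Sum>i\<in>I. c i * poly (of_int_poly (P i)) z) = d * poly (of_int_poly R) z"
  shows "(\<Sum>i\<in>I. c i * period_integral f (P i) r) = d * period_integral f R r"
proof -
  have "(\<Sum>i\<in>I. c i * line_integral f (of_int_poly (P i)) r) = line_integral f (smult d (of_int_poly R)) r"
    by (rule line_integral_sum[OF f]) (simp add: eq)
  moreover have "(\<Sum>i\<in>{()}. d * line_integral f (of_int_poly R) r) = line_integral f (smult d (of_int_poly R)) r"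
    by (rule line_integral_sum[OF f]) simp_all
  ultimately have *: "(\<Sum>i\<in>I. c i * line_integral f (of_int_poly (P i)) r) = d * line_integral f (of_int_poly R) r"
    by simp
  have "(\<Sum>i\<in>I. c i * (- (2 * of_real pi * \<i>) * line_integral f (of_int_poly (P i)) r)) =
      (\<Sum>i\<in>I. - (2 * of_real pi * \<i>) * (c i * line_integral f (of_int_poly (P i)) r))"
    by (intro sum.cong refl mult.left_commute)
  also have "\<dots> = - (2 * of_real pi * \<i>) * (d * line_integral f (of_int_poly R) r)"
    unfolding sum_distrib_left[symmetric] * ..
  also have "\<dots> = d * (- (2 * of_real pi * \<i>) * line_integral f (of_int_poly R) r)"
    by (rule mult.left_commute)
  finally show ?thesis unfolding period_integral_eq .
qed

lemma eta_sign_sum: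
  assumes f: "f \<in> cusp_forms k M" "M > 0"
    and eq: "\<And>z. (\<Sum>i\<in>I. c i * poly (of_int_poly (P i)) z) = d * poly (of_int_poly R) z"
  shows "(\<Sum>i\<in>I. c i * eta_sign f e \<Omega> (P i) a m) = d * eta_sign f e \<Omega> R a m"
proof -
  have 1: "(\<Sum>i\<in>I. c i * period_integral f (P i) r) = d * period_integral f R r" for r
    by (rule period_integral_sum[OF f eq])
  have 2: "(\<Sum>i\<in>I. c i * period_integral f (pcompose (P i) [:0, -1:]) r) = d * period_integral f (pcompose R [:0, -1:]) r" for r
    by (rule period_integral_sum[OF f]) (simp add: of_int_poly_pcompose of_int_poly_pCons poly_pcompose eq del: map_poly_pCons)
  have "(\<Sum>i\<in>I. c i * eta_sign f e \<Omega> (P i) a m) =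
      ((\<Sum>i\<in>I. c i * period_integral f (P i) (of_int a / of_nat m)) +
       e * (\<Sum>i\<in>I. c i * period_integral f (pcompose (P i) [:0, -1:]) (- (of_int a / of_nat m)))) / \<Omega>"
    by (simp add: eta_sign_def sum_divide_distrib sum_distrib_left sum.distrib[symmetric] algebra_simps add_divide_distrib)
  also have "\<dots> = d * eta_sign f e \<Omega> R a m"
    unfolding 1 2 by (simp add: eta_sign_def algebra_simps)
  finally show ?thesis .
qed

lemma rat_fraction:
  obtains b :: int and m :: nat where "m \<ge> 1" "(s :: rat) = of_int b / of_nat m"
proof -
  obtain A C where AC: "quotient_of s = (A, C)" by fastforce
  have C: "C > 0" "s = of_int A / of_int C"
    using quotient_of_denom_pos[OF AC] quotient_of_div[OF AC] by auto
  show ?thesis by (rule that[of "nat C" A]) (use C in auto)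
qed

context atkin_lehner
begin

text \<open>The normalized periods pair a/m with -a/m and P(z) with P(-z); on the second half the
  role of W is played by its conjugate under z -> -z.\<close>

lemma conjugate: "atkin_lehner N p k x (- y) (- s) w"
  using N prime_p pN k det_W by unfold_locales auto

text \<open>Kept over the integers because normalized periods are integral for integral
  polynomials.\<close>

definition W_int_poly :: "nat \<Rightarrow> int poly" where
  "W_int_poly i = [:w, int N * s:] ^ (k - 2 - i) * [:y, int p * x:] ^ i"

lemma of_int_W_int_poly: "of_int_poly (W_int_poly i) = W_poly i"
  by (simp add: W_int_poly_def W_poly_def of_int_poly_mult of_int_poly_power of_int_poly_pCons)

lemma degree_W_int_poly:
  assumes "i \<le> k - 2"
  shows "degree (W_int_poly i) \<le> k - 2"
proof -
  have lin: "degree ([:a, b:] ^ n) \<le> n" for a b :: int and n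
  proof -
    have "degree ([:a, b:] ^ n) \<le> degree [:a, b:] * n" by (rule degree_power_le)
    also have "\<dots> \<le> 1 * n" by (intro mult_right_mono) auto
    finally show ?thesis by simp
  qed
  have "degree (W_int_poly i) \<le> (k - 2 - i) + i"
    unfolding W_int_poly_def by (rule order_trans[OF degree_mult_le add_mono[OF lin lin]])
  then show ?thesis using assms by simp
qed

text \<open>Displacing the path at a/p^n by W and that at -a/p^n by its conjugate produces opposite
  endpoints and the same constant, so the halves recombine to normalized periods. Nothing more about
  the new endpoints is recorded, since normalized periods are integral at all rational
  numbers.\<close>

lemma eta_sign_W:
  assumes f: "f \<in> cusp_forms k (N * p)" and tr: "\<And>z. z \<in> uhp \<Longrightarrow> slash_sum reps k f z = 0"
    and tr': "\<And>z. z \<in> uhp \<Longrightarrow> slash_sum (atkin_lehner.reps N p x (- y) (- s) w) k f z = 0"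
    and U: "\<And>z. z \<in> uhp \<Longrightarrow> Up f z = \<alpha> * f z" and \<alpha>0: "\<alpha> \<noteq> 0"
    and i: "i \<le> k - 2" and a: "\<not> int p dvd a" and n: "n \<ge> 1"
  obtains b1 b2 :: int and m1 m2 :: nat where "m1 \<ge> 1" "m2 \<ge> 1"
    "eta_sign f e \<Omega> (monom 1 i) a (p ^ n) = - (of_nat p * \<alpha> / of_nat p ^ k) * of_nat p ^ (k - 1 - i) *
      (eta_sign f e \<Omega> (W_int_poly i) b1 m1 - eta_sign f e \<Omega> (W_int_poly i) b2 m2)"
proof -
  interpret c: atkin_lehner N p k x "- y" "- s" w by (rule conjugate)
  have Np: "N * p > 0" using N p_gt_1 by simp
  have inv: "slash_invariant H k f" using cusp_formsD(2)[OF f] by (simp add: slash_invariant_def)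
  let ?\<epsilon> = "- (of_nat p * \<alpha> / of_nat p ^ k)"
  have \<epsilon>0: "?\<epsilon> \<noteq> 0" using \<alpha>0 p_gt_1 by simp
  have W: "slash k f W z = ?\<epsilon> * f z" if "z \<in> uhp" for z
    by (rule trace_zero_eigenform[OF inv _ _ that]) (rule tr U, assumption)+
  have cW: "slash k f c.W z = ?\<epsilon> * f z" if "z \<in> uhp" for z
    by (rule c.trace_zero_eigenform[OF inv _ _ that]) (rule tr' U, assumption)+
  define C where "C = int (p ^ n)"
  have C: "C > 0" using p_gt_1 by (simp add: C_def)
  have pC: "int p dvd C" unfolding C_def using n by (simp add: dvd_power)
  have cop: "coprime a C" "coprime (- a) C"
    using prime_imp_coprime[OF prime_int_p a] by (simp_all add: C_def coprime_commute)
  \<comment> \<open>As p divides C but not a N s, the preimage of a/p^n under W is not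
    infinity.\<close>
  have ne: "C * x \<noteq> a * (int N * s)"
  proof
    assume "C * x = a * (int N * s)"
    then have "int p dvd a * (int N * s)" using pC by (metis dvd_mult2)
    then show False using a p_not_dvd_N p_not_dvd_s prime_int_p by (simp add: prime_dvd_mult_iff)
  qed
  have ne': "C * x \<noteq> - a * (int N * - s)" using ne by simp
  define s1 :: rat where "s1 = of_int (C * y - a * int p * w) / of_int (int p * (a * int N * s - C * x))"
  define s2 :: rat where "s2 = of_int (- w) / of_int (int N * s)"
  let ?\<kappa> = "?\<epsilon> * of_nat p ^ (k - 1 - i)"
  have r: "(of_int a / of_nat (p ^ n) :: rat) = of_int a / of_int C" by (simp add: C_def)
  have plus: "line_integral f (monom 1 i) (of_int a / of_nat (p ^ n)) =
      ?\<kappa> * (line_integral f (W_poly i) s1 - line_integral f (W_poly i) s2)"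
    unfolding r s1_def s2_def by (rule line_integral_W[OF f W i cop(1) C ne \<epsilon>0])
  have cs1: "of_int (C * (- y) - (- a) * int p * w) / of_int (int p * ((- a) * int N * (- s) - C * x)) = - s1"
    unfolding s1_def by (simp add: minus_divide_left)
  have cs2: "of_int (- w) / of_int (int N * (- s)) = - s2"
    unfolding s2_def by simp
  have "line_integral f (monom 1 i) (of_int (- a) / of_int C) =
      ?\<kappa> * (line_integral f (c.W_poly i) (of_int (C * (- y) - (- a) * int p * w) / of_int (int p * ((- a) * int N * (- s) - C * x)))
        - line_integral f (c.W_poly i) (of_int (- w) / of_int (int N * (- s))))"
    by (rule c.line_integral_W[OF f cW i cop(2) C ne' \<epsilon>0])
  then have minus: "line_integral f (monom 1 i) (- (of_int a / of_nat (p ^ n))) =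
      ?\<kappa> * (line_integral f (c.W_poly i) (- s1) - line_integral f (c.W_poly i) (- s2))"
    unfolding cs1 cs2 r by (simp only: of_int_minus minus_divide_left)
  \<comment> \<open>The substitution z -> -z contributes the same sign (-1)^i before and after the
    displacement, so it drops out of the relation.\<close>
  have sgn: "line_integral f (of_int_poly (pcompose (monom 1 i) [:0, -1:])) t = (-1) ^ i * line_integral f (monom 1 i) t" for t
  proof -
    have "(-1) ^ i * poly (monom 1 i) z = poly (of_int_poly (pcompose (monom 1 i) [:0, -1:])) z" for z :: complex
    proof -
      have "poly (of_int_poly (pcompose (monom 1 i) [:0, -1:])) z = (- z) ^ i"
        by (simp add: of_int_poly_pcompose of_int_poly_monom of_int_poly_pCons poly_pcompose poly_monom)
      also have "\<dots> = (-1) ^ i * z ^ i" by (rule power_minus)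
      finally show ?thesis by (simp only: poly_monom mult_1)
    qed
    then show ?thesis
      using line_integral_sum[OF f Np, where I = "{()}" and c = "\<lambda>_. (-1) ^ i" and Q = "\<lambda>_. monom 1 i" and R = "of_int_poly (pcompose (monom 1 i) [:0, -1:])" and r = t]
      by simp
  qed
  have sgnW: "line_integral f (of_int_poly (pcompose (W_int_poly i) [:0, -1:])) t = (-1) ^ i * line_integral f (c.W_poly i) t" for t
  proof -
    have "(-1) ^ i * poly (c.W_poly i) z = poly (of_int_poly (pcompose (W_int_poly i) [:0, -1:])) z" for z
    proof -
      have "poly (of_int_poly (pcompose (W_int_poly i) [:0, -1:])) z =
          (of_int w + (- z) * of_int (int N * s)) ^ (k - 2 - i) * (of_int y + (- z) * of_int (int p * x)) ^ i"
        unfolding of_int_poly_pcompose of_int_W_int_poly poly_pcompose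
        by (simp add: W_poly_def of_int_poly_pCons)
      also have "of_int y + (- z) * of_int (int p * x) = - (of_int (- y) + z * of_int (int p * x))" by simp
      also have "(- (of_int (- y) + z * of_int (int p * x))) ^ i = (-1) ^ i * (of_int (- y) + z * of_int (int p * x)) ^ i"
        by (rule power_minus)
      finally show ?thesis by (simp add: c.W_poly_def mult_ac)
    qed
    then show ?thesis
      using line_integral_sum[OF f Np, where I = "{()}" and c = "\<lambda>_. (-1) ^ i" and Q = "\<lambda>_. c.W_poly i" and R = "of_int_poly (pcompose (W_int_poly i) [:0, -1:])" and r = t]
      by simp
  qed
  obtain b1 m1 where 1: "m1 \<ge> 1" "s1 = of_int b1 / of_nat m1" by (rule rat_fraction)
  obtain b2 m2 where 2: "m2 \<ge> 1" "s2 = of_int b2 / of_nat m2" by (rule rat_fraction)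
  have "eta_sign f e \<Omega> (monom 1 i) a (p ^ n) =
      ?\<kappa> * (eta_sign f e \<Omega> (W_int_poly i) b1 m1 - eta_sign f e \<Omega> (W_int_poly i) b2 m2)"
    unfolding eta_sign_def period_integral_eq sgn sgnW of_int_poly_monom of_int_W_int_poly plus minus 1(2)[symmetric] 2(2)[symmetric]
    by (simp add: diff_divide_distrib add_divide_distrib algebra_simps)
  then show ?thesis using that 1(1) 2(1) by blast
qed

end

text \<open>Evaluating (x - a)^i at p^n z + a leaves p^(n i) z^i, so all terms of the linear
  extension collapse to one normalized period at -a/p^n.\<close>

lemma mu_poly_power:
  assumes f: "f \<in> cusp_forms k M" "M > 0"
  shows "mu_poly p f \<Omega>p \<Omega>m ([:- of_int a, 1:] ^ i) a n =
    of_nat p ^ (n * i) * eta f \<Omega>p \<Omega>m (monom 1 i) (- a) (p ^ n) / qcoeff f p ^ n"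
proof -
  let ?P = "[:- of_int a, 1:] ^ i :: complex poly"
  let ?Q = "\<lambda>l. pcompose (monom 1 l) [:a, int (p ^ n):]"
  have "(\<Sum>l\<le>degree ?P. coeff ?P l * poly (of_int_poly (?Q l)) z) = of_nat p ^ (n * i) * poly (of_int_poly (monom 1 i)) z" for z
  proof -
    have "(\<Sum>l\<le>degree ?P. coeff ?P l * poly (of_int_poly (?Q l)) z) =
        (\<Sum>l\<le>degree ?P. coeff ?P l * (of_int a + z * of_nat p ^ n) ^ l)"
      by (simp add: of_int_poly_pcompose of_int_poly_monom of_int_poly_pCons poly_pcompose poly_monom)
    also have "\<dots> = poly ?P (of_int a + z * of_nat p ^ n)" by (rule poly_altdef[symmetric])
    also have "\<dots> = (z * of_nat p ^ n) ^ i" by simp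
    finally show ?thesis by (simp add: of_int_poly_monom poly_monom power_mult_distrib mult.commute flip: power_mult)
  qed
  from eta_sign_sum[OF f this]
  have "(\<Sum>l\<le>degree ?P. coeff ?P l * eta_sign f e \<Omega> (?Q l) b m) =
      of_nat p ^ (n * i) * eta_sign f e \<Omega> (monom 1 i) b m" for e \<Omega> b m by simp
  note this[of 1 \<Omega>p "- a" "p ^ n"] this[of "-1" \<Omega>m "- a" "p ^ n"]
  moreover have "mu_poly p f \<Omega>p \<Omega>m ?P a n =
      ((\<Sum>l\<le>degree ?P. coeff ?P l * eta_sign f 1 \<Omega>p (?Q l) (- a) (p ^ n)) +
       (\<Sum>l\<le>degree ?P. coeff ?P l * eta_sign f (-1) \<Omega>m (?Q l) (- a) (p ^ n))) / qcoeff f p ^ n"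
    unfolding mu_poly_def mu_int_def lambda_f_def eta_def
    by (simp add: sum_divide_distrib distrib_left add_divide_distrib flip: sum.distrib)
  ultimately show ?thesis by (simp add: eta_def distrib_left)
qed

text \<open>Different summands may involve the same polynomial and endpoint; their coefficients are
  added over the fibres of \<open>key\<close>, so that the result is indexed by a set of
  pairs.\<close>

lemma sum_by_key:
  fixes \<alpha> \<beta> :: "'x \<Rightarrow> complex" and \<phi> :: "'a \<Rightarrow> 'b \<Rightarrow> complex"
  assumes "finite X"
  shows "(\<Sum>x\<in>X. (\<alpha> x / A + \<beta> x / B) / C * \<phi> (fst (key x)) (snd (key x))) =
    (\<Sum>(P, r)\<in>key ` X. ((\<Sum>x\<in>{x \<in> X. key x = (P, r)}. \<alpha> x) / A + (\<Sum>x\<in>{x \<in> X. key x = (P, r)}. \<beta> x) / B) / C * \<phi> P r)"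
proof -
  have "(\<Sum>x\<in>X. (\<alpha> x / A + \<beta> x / B) / C * \<phi> (fst (key x)) (snd (key x))) =
    (\<Sum>q\<in>key ` X. \<Sum>x\<in>{x \<in> X. key x = q}. (\<alpha> x / A + \<beta> x / B) / C * \<phi> (fst (key x)) (snd (key x)))"
    by (rule sum.image_gen[OF assms])
  also have "\<dots> = (\<Sum>q\<in>key ` X. ((\<Sum>x\<in>{x \<in> X. key x = q}. \<alpha> x) / A + (\<Sum>x\<in>{x \<in> X. key x = q}. \<beta> x) / B) / C * \<phi> (fst q) (snd q))"
  proof (rule sum.cong)
    fix q
    have "(\<Sum>x\<in>{x \<in> X. key x = q}. (\<alpha> x / A + \<beta> x / B) / C * \<phi> (fst (key x)) (snd (key x))) =
        (\<Sum>x\<in>{x \<in> X. key x = q}. (\<alpha> x / A + \<beta> x / B) / C * \<phi> (fst q) (snd q))"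
      by (rule sum.cong) auto
    then show "(\<Sum>x\<in>{x \<in> X. key x = q}. (\<alpha> x / A + \<beta> x / B) / C * \<phi> (fst (key x)) (snd (key x))) =
        ((\<Sum>x\<in>{x \<in> X. key x = q}. \<alpha> x) / A + (\<Sum>x\<in>{x \<in> X. key x = q}. \<beta> x) / B) / C * \<phi> (fst q) (snd q)"
      by (simp add: sum_distrib_right sum_divide_distrib sum.distrib add_divide_distrib distrib_right)
  qed simp
  finally show ?thesis by (simp add: case_prod_unfold)
qed

text \<open>The coefficients come from the truncated Taylor expansions and hence lie in Q_p;
  everything transcendental sits in the periods.\<close>

lemma L_approx_periods:
  assumes v: "padic_closure p v"
  shows "\<exists>(I :: (int poly \<times> rat) set) c c'.
            finite I \<and>
            (\<forall>(P, r)\<in>I. degree P \<le> k - 2 \<and> c (P, r) \<in> Qp v \<and> c' (P, r) \<in> Qp v) \<and>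
            L_approx p v k f \<Omega>p \<Omega>m n =
              (\<Sum>(P, r)\<in>I. (c (P, r) / \<Omega>p + c' (P, r) / \<Omega>m) / qcoeff f p ^ n
                            * period_integral f P r)"
proof -
  interpret padic_closure p v by (rule v)
  define T where "T a = TS v k (of_nat a) (\<lambda>x. x ^ (k div 2 - 1) * padic_log v (angle p v x))" for a
  define J where "J = {a. a \<in> {1..p ^ n - 1} \<and> \<not> p dvd a}"
  define Q where "Q a l = pcompose (monom 1 l) [:int a, int (p ^ n):]" for a l
  define R :: "nat \<Rightarrow> rat" where "R a = of_int (- int a) / of_nat (p ^ n)" for a
  have T: "coeff (T a) i \<in> Qp v" "degree (T a) \<le> k - 2" if a: "a \<in> J" for a i
  proof -
    have au: "of_nat a \<in> Zp_units v" using of_int_unit[of "int a"] a by (simp add: J_def)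
    obtain c where "ball_expansion v (\<lambda>x. x ^ (k div 2 - 1) * padic_log v (angle p v x)) (of_nat a) 1 c"
      using ball_expansion_power_log[OF au, of 1 "k div 2 - 1"] by auto
    from TS_props(2,3)[OF this Qp_of_nat] show "coeff (T a) i \<in> Qp v" "degree (T a) \<le> k - 2"
      unfolding T_def by auto
  qed
  define X where "X = J \<times> {..k - 2} \<times> (UNIV :: bool set)"
  have finX: "finite X" by (simp add: X_def J_def)
  \<comment> \<open>b distinguishes the two integrals in \<open>eta_sign\<close>, that of P at
    -a/p^n and that of P(-z) at a/p^n; the second has a sign in the minus part, recorded in
    \<open>\<beta>\<close>.\<close>
  define key where "key x = (case x of (a, l, b) \<Rightarrow>
    if b then (Q a l, R a) else (pcompose (Q a l) [:0, -1:], - R a))" for x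
  define \<alpha> where "\<alpha> x = (case x of (a, l, b :: bool) \<Rightarrow> coeff (T a) l)" for x
  define \<beta> where "\<beta> x = (case x of (a, l, b) \<Rightarrow> (if b then 1 else - 1) * coeff (T a) l)" for x
  have degQ: "degree (fst (key x)) \<le> k - 2" if "x \<in> X" for x
  proof -
    obtain a l b where x: "x = (a, l, b)" by (cases x)
    with that have l: "l \<le> k - 2" by (simp add: X_def)
    have "degree (Q a l) \<le> degree (monom (1::int) l) * degree [:int a, int (p ^ n):]"
      unfolding Q_def by (rule degree_pcompose_le)
    also have "\<dots> \<le> l * 1" by (intro mult_mono degree_monom_le) auto
    finally have 1: "degree (Q a l) \<le> l" by simp
    have "degree (pcompose (Q a l) [:0, -1:]) \<le> degree (Q a l) * degree [:0, -1 :: int:]"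
      by (rule degree_pcompose_le)
    then have "degree (pcompose (Q a l) [:0, -1:]) \<le> degree (Q a l)" by simp
    then show ?thesis using 1 x l by (auto simp: key_def)
  qed
  have "L_approx p v k f \<Omega>p \<Omega>m n = (\<Sum>a\<in>J. mu_poly p f \<Omega>p \<Omega>m (T a) (int a) n)"
    by (simp add: L_approx_def J_def T_def)
  also have "\<dots> = (\<Sum>a\<in>J. \<Sum>l\<le>k - 2. \<Sum>b\<in>(UNIV :: bool set).
      (\<alpha> (a, l, b) / \<Omega>p + \<beta> (a, l, b) / \<Omega>m) / qcoeff f p ^ n *
        period_integral f (fst (key (a, l, b))) (snd (key (a, l, b))))"
  proof (rule sum.cong)
    fix a assume a: "a \<in> J"
    have "mu_poly p f \<Omega>p \<Omega>m (T a) (int a) n = (\<Sum>l\<le>k - 2. coeff (T a) l * mu_int p f \<Omega>p \<Omega>m (monom 1 l) (int a) n)"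
      unfolding mu_poly_def using T(2)[OF a]
      by (intro sum.mono_neutral_left) (auto intro: coeff_eq_0)
    also have "\<dots> = (\<Sum>l\<le>k - 2. \<Sum>b\<in>(UNIV :: bool set).
      (\<alpha> (a, l, b) / \<Omega>p + \<beta> (a, l, b) / \<Omega>m) / qcoeff f p ^ n *
        period_integral f (fst (key (a, l, b))) (snd (key (a, l, b))))"
    proof (rule sum.cong)
      fix l
      have r: "of_int (- int a) / of_nat (p ^ n) = R a" by (simp add: R_def)
      show "coeff (T a) l * mu_int p f \<Omega>p \<Omega>m (monom 1 l) (int a) n = (\<Sum>b\<in>(UNIV :: bool set).
        (\<alpha> (a, l, b) / \<Omega>p + \<beta> (a, l, b) / \<Omega>m) / qcoeff f p ^ n *
        period_integral f (fst (key (a, l, b))) (snd (key (a, l, b))))"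
        unfolding mu_int_def lambda_f_def eta_def eta_sign_def r Q_def[symmetric]
        by (simp add: UNIV_bool \<alpha>_def \<beta>_def key_def add_divide_distrib diff_divide_distrib ring_distribs)
    qed simp
    finally show "mu_poly p f \<Omega>p \<Omega>m (T a) (int a) n = (\<Sum>l\<le>k - 2. \<Sum>b\<in>(UNIV :: bool set).
      (\<alpha> (a, l, b) / \<Omega>p + \<beta> (a, l, b) / \<Omega>m) / qcoeff f p ^ n *
        period_integral f (fst (key (a, l, b))) (snd (key (a, l, b))))" .
  qed simp
  also have "\<dots> = (\<Sum>x\<in>X. (\<alpha> x / \<Omega>p + \<beta> x / \<Omega>m) / qcoeff f p ^ n * period_integral f (fst (key x)) (snd (key x)))"
    unfolding X_def sum.cartesian_product by (simp add: case_prod_unfold)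
  also have "\<dots> = (\<Sum>(P, r)\<in>key ` X. ((\<Sum>x\<in>{x \<in> X. key x = (P, r)}. \<alpha> x) / \<Omega>p +
      (\<Sum>x\<in>{x \<in> X. key x = (P, r)}. \<beta> x) / \<Omega>m) / qcoeff f p ^ n * period_integral f P r)"
    by (rule sum_by_key[OF finX])
  finally have eq: "L_approx p v k f \<Omega>p \<Omega>m n = (\<Sum>(P, r)\<in>key ` X.
      ((\<Sum>x\<in>{x \<in> X. key x = (P, r)}. \<alpha> x) / \<Omega>p + (\<Sum>x\<in>{x \<in> X. key x = (P, r)}. \<beta> x) / \<Omega>m)
        / qcoeff f p ^ n * period_integral f P r)" .
  have "\<alpha> x \<in> Qp v" "\<beta> x \<in> Qp v" if "x \<in> X" for x
    using that by (auto simp: X_def \<alpha>_def \<beta>_def intro!: Qp_minus T(1))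
  then have Q: "(\<Sum>x\<in>{x \<in> X. key x = q}. \<alpha> x) \<in> Qp v" "(\<Sum>x\<in>{x \<in> X. key x = q}. \<beta> x) \<in> Qp v" for q
    by (auto intro!: Qp_sum)
  show ?thesis
  proof (intro exI conjI)
    show "finite (key ` X)" using finX by simp
    show "\<forall>(P, r)\<in>key ` X. degree P \<le> k - 2 \<and>
        (\<lambda>q. \<Sum>x\<in>{x \<in> X. key x = q}. \<alpha> x) (P, r) \<in> Qp v \<and> (\<lambda>q. \<Sum>x\<in>{x \<in> X. key x = q}. \<beta> x) (P, r) \<in> Qp v"
    proof (rule ballI)
      fix q assume "q \<in> key ` X"
      then have "degree (fst q) \<le> k - 2" using degQ by auto
      then show "case q of (P, r) \<Rightarrow> degree P \<le> k - 2 \<and>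
        (\<lambda>q. \<Sum>x\<in>{x \<in> X. key x = q}. \<alpha> x) (P, r) \<in> Qp v \<and> (\<lambda>q. \<Sum>x\<in>{x \<in> X. key x = q}. \<beta> x) (P, r) \<in> Qp v"
        using Q by (simp add: case_prod_unfold)
    qed
  qed (rule eq)
qed

lemma hecke_Up:
  assumes "atkin_lehner N p k x y s w"
  shows "hecke k (N * p) p f z = atkin_lehner.Up p f z"
  unfolding hecke_def atkin_lehner.Up_def[OF assms] by simp

theorem theorem3p1:
  fixes N p k n :: nat
    and v :: "complex \<Rightarrow> ereal"
    and f :: "complex \<Rightarrow> complex"
    and \<Omega>p \<Omega>m :: complex
    and \<mu> :: "(complex \<Rightarrow> complex) \<Rightarrow> complex"
  assumes "N \<ge> 1" and "prime p" and "\<not> p dvd N"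
    and "k \<ge> 2" and "even k"
    and "f \<in> cusp_forms k (N * p)"
    and "normalized_eigenform k (N * p) f"
    and "new_at p k N f"
    and "is_padic_closure p v"
    and "normalized_period v k f 1 \<Omega>p"
    and "normalized_period v k f (-1) \<Omega>m"
    and "is_padic_L_distribution p v k f \<Omega>p \<Omega>m \<mu>"
    and "n \<ge> 1"
  shows "(\<exists>(I :: (int poly \<times> rat) set) c c'.
            finite I \<and>
            (\<forall>(P, r)\<in>I. degree P \<le> k - 2 \<and> c (P, r) \<in> Qp v \<and> c' (P, r) \<in> Qp v) \<and>
            L_approx p v k f \<Omega>p \<Omega>m n =
              (\<Sum>(P, r)\<in>I. (c (P, r) / \<Omega>p + c' (P, r) / \<Omega>m) / qcoeff f p ^ n
                            * period_integral f P r)) \<and>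
         v (Lp_deriv p v k \<mu> - L_approx p v k f \<Omega>p \<Omega>m n)
           \<ge> ereal (real n * real k / 2 - of_int \<lfloor>ln (real k - 1) / ln (real p)\<rfloor>)"
proof
  have closure: "padic_closure p v" using assms(2,9) by unfold_locales
  show "\<exists>(I :: (int poly \<times> rat) set) c c'.
            finite I \<and>
            (\<forall>(P, r)\<in>I. degree P \<le> k - 2 \<and> c (P, r) \<in> Qp v \<and> c' (P, r) \<in> Qp v) \<and>
            L_approx p v k f \<Omega>p \<Omega>m n =
              (\<Sum>(P, r)\<in>I. (c (P, r) / \<Omega>p + c' (P, r) / \<Omega>m) / qcoeff f p ^ n
                            * period_integral f P r)"
    by (rule L_approx_periods[OF closure])
  interpret padic_closure p v by (rule closure)
  define h where "h = k div 2 - 1"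
  have kh: "k = 2 * h + 2" using assms(4,5) by (auto simp: h_def elim!: evenE)
  define \<alpha> where "\<alpha> = qcoeff f p"
  note f = assms(6)
  have Np: "N * p > 0" using assms(1) p_gt_1 by simp
  have "coprime (int p) (int N)" using prime_imp_coprime[of "int p" "int N"] assms(2,3) by simp
  then obtain x y' where "x * int p + y' * int N = 1"
    using bezout_int[of "int p" "int N"] by (auto simp: coprime_iff_gcd_eq_1)
  \<comment> \<open>With s = w = 1 and y = -y' the determinant condition on W is the Bezout
    relation.\<close>
  then have AL: "atkin_lehner N p k x (- y') 1 1"
    using assms(1-4) by unfold_locales (auto simp: algebra_simps)
  interpret A: atkin_lehner N p k x "- y'" 1 1 by (rule AL)
  interpret A': atkin_lehner N p k x "- (- y')" "- 1" 1 by (rule A.conjugate)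
  have inv: "slash_invariant A.H k f" using cusp_formsD(2)[OF f] by (simp add: slash_invariant_def)
  obtain c where c: "\<And>z. z \<in> uhp \<Longrightarrow> hecke k (N * p) p f z = c * f z"
    using assms(2,7) unfolding normalized_eigenform_def by blast
  have q1: "qcoeff f 1 = 1" using assms(7) unfolding normalized_eigenform_def by blast
  have "\<alpha> = c"
    using qcoeff_hecke_eigenvalue[OF f _ _ c] p_gt_1 q1 by (simp add: \<alpha>_def)
  then have U: "A.Up f z = \<alpha> * f z" if "z \<in> uhp" for z
    using c[OF that] hecke_Up[OF AL, of f z] by simp
  have new: "petersson k (N * p) f g = 0" if "g \<in> cusp_forms k N" for g
    using assms(8) that unfolding new_at_def by blast
  have N0: "N > 0" using assms(1) by simp
  have tr: "slash_sum A.reps k f z = 0" if "z \<in> uhp" for z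
    by (rule new_form_trace_zero[OF N0 dvd_triv_left Np f A.transversal_reps new that])
  have tr': "slash_sum A'.reps k f z = 0" if "z \<in> uhp" for z
    by (rule new_form_trace_zero[OF N0 dvd_triv_left Np f A'.transversal_reps new that])
  \<comment> \<open>The eigenvalue can be determined only where f does not vanish; such a point
    exists because the first coefficient is 1.\<close>
  obtain z0 where z0: "z0 \<in> uhp" "f z0 \<noteq> 0"
  proof (rule ccontr)
    assume "\<not> thesis"
    then have f0: "f z = 0" if "z \<in> uhp" for z using that \<open>\<And>z0. z0 \<in> uhp \<Longrightarrow> f z0 \<noteq> 0 \<Longrightarrow> thesis\<close> by blast
    have "qcoeff f = (\<lambda>_. 0)"
      by (rule q_expansion_unique[of _ f]) (use qcoeff_sums[OF f] f0 in auto)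
    then show False using q1 by simp
  qed
  have \<alpha>2: "\<alpha>\<^sup>2 = of_nat p ^ (k - 2)"
    by (rule A.trace_zero_eigenvalue[OF inv _ _ z0]) (rule tr U, assumption)+
  have \<alpha>0: "\<alpha> \<noteq> 0"
  proof
    assume "\<alpha> = 0"
    then have "of_nat p ^ (k - 2) = (0::complex)" using \<alpha>2 by simp
    then show False using p_gt_1 by simp
  qed
  have v\<alpha>: "v \<alpha> = ereal (real h)"
  proof -
    obtain r where r: "v \<alpha> = ereal r" using \<alpha>0 by (rule v_eq_ereal)
    have "ereal (real 2 * r) = ereal (real (k - 2))"
      using v_power[OF r, of 2] v_p_power[of "k - 2"] \<alpha>2 by simp
    then show ?thesis using r kh by simp
  qed
  have period_ge: "0 \<le> v (eta_sign f e \<Omega> P a m)"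
    if "normalized_period v k f e \<Omega>" "degree P \<le> k - 2" "m \<ge> 1" for e \<Omega> P a m
    using that unfolding normalized_period_def by blast
  have period_low: "ereal (max 0 (real h - real i)) \<le> v (eta_sign f e \<Omega> (monom 1 i) a (p ^ m))"
    if per: "normalized_period v k f e \<Omega>" and i: "i \<le> k - 2" and a: "\<not> int p dvd a" and m: "m \<ge> 1" for e \<Omega> i a m
  proof -
    have "p ^ m \<ge> 1" using p_gt_1 by simp
    then have 0: "0 \<le> v (eta_sign f e \<Omega> (monom 1 i) a (p ^ m))"
      using i by (intro period_ge[OF per] order_trans[OF degree_monom_le])
    obtain b1 b2 m1 m2 where b: "m1 \<ge> 1" "m2 \<ge> 1"
      "eta_sign f e \<Omega> (monom 1 i) a (p ^ m) = - (of_nat p * \<alpha> / of_nat p ^ k) * of_nat p ^ (k - 1 - i) *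
        (eta_sign f e \<Omega> (A.W_int_poly i) b1 m1 - eta_sign f e \<Omega> (A.W_int_poly i) b2 m2)"
      by (rule A.eta_sign_W[OF f _ _ _ \<alpha>0 i a m]) (rule tr tr' U, assumption)+
    \<comment> \<open>Valuation of the displacement factor: 1 + h - k from the eigenvalue of W and k
      - 1 - i from the substitution add up to h - i.\<close>
    have "v (of_nat p * \<alpha>) = ereal (1 + real h)"
      using v_p v\<alpha> by (simp add: v_mult one_ereal_def)
    from v_divide[OF this v_p_power[of k]]
    have "v (- (of_nat p * \<alpha> / of_nat p ^ k)) = ereal (1 + real h - real k)" by simp
    then have "v (- (of_nat p * \<alpha> / of_nat p ^ k) * of_nat p ^ (k - 1 - i)) = ereal (1 + real h - real k + real (k - 1 - i))"
      by (simp only: v_mult v_p_power plus_ereal.simps)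
    also have "1 + real h - real k + real (k - 1 - i) = real h - real i" using i kh by simp
    finally have 1: "ereal (real h - real i) \<le> v (- (of_nat p * \<alpha> / of_nat p ^ k) * of_nat p ^ (k - 1 - i))" by simp
    have "0 \<le> v (eta_sign f e \<Omega> (A.W_int_poly i) b1 m1 - eta_sign f e \<Omega> (A.W_int_poly i) b2 m2)"
      by (intro v_ge_diff period_ge[OF per A.degree_W_int_poly[OF i]] b)
    from v_ge_mult_left[OF 1 this] have "ereal (real h - real i) \<le> v (eta_sign f e \<Omega> (monom 1 i) a (p ^ m))"
      unfolding b(3) .
    then show ?thesis using 0 by (auto simp: max_def zero_ereal_def)
  qed
  have dist: "loc_analytic_distribution v \<mu>"
    using assms(12) unfolding is_padic_L_distribution_def by (elim conjE)
  have mom: "ball_integral v \<mu> (of_int a) m (poly P) = mu_poly p f \<Omega>p \<Omega>m P a m"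
    if "m \<ge> 1" "\<not> int p dvd a" "\<forall>i. coeff P i \<in> Qp v" "degree P \<le> k - 2" for m a P
  proof -
    have "\<forall>n\<ge>1. \<forall>a. \<not> int p dvd a \<longrightarrow>
        (\<forall>P. (\<forall>i. coeff P i \<in> Qp v) \<and> degree P \<le> k - 2 \<longrightarrow>
           ball_integral v \<mu> (of_int a) n (poly P) = mu_poly p f \<Omega>p \<Omega>m P a n)"
      using assms(12) unfolding is_padic_L_distribution_def by (elim conjE)
    then show ?thesis using that by blast
  qed
  have low: "ereal (real m * real i + max 0 (real h - real i)) \<le>
      v (\<alpha> ^ m * ball_integral v \<mu> (of_int a) m (\<lambda>x. (x - of_int a) ^ i))"
    if m: "m \<ge> 1" and a: "\<not> int p dvd a" and i: "i \<le> 2 * h" for m a i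
  proof -
    have ik: "i \<le> k - 2" using i kh by simp
    have deg: "degree ([:- of_int a, 1:] ^ i :: complex poly) \<le> k - 2"
      using ik by (simp add: degree_linear_power)
    have coe: "\<forall>l. coeff ([:- of_int a, 1:] ^ i :: complex poly) l \<in> Qp v"
      by (intro allI Qp_coeff_linear_power Qp_of_int)
    have "(\<lambda>x::complex. (x - of_int a) ^ i) = poly ([:- of_int a, 1:] ^ i)" by (simp add: fun_eq_iff)
    then have "ball_integral v \<mu> (of_int a) m (\<lambda>x. (x - of_int a) ^ i) = mu_poly p f \<Omega>p \<Omega>m ([:- of_int a, 1:] ^ i) a m"
      using mom[OF m a coe deg] by simp
    also have "\<alpha> ^ m * \<dots> = of_nat p ^ (m * i) * eta f \<Omega>p \<Omega>m (monom 1 i) (- a) (p ^ m)"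
      unfolding mu_poly_power[OF f Np] using \<alpha>0 by (simp add: \<alpha>_def)
    finally have eq: "\<alpha> ^ m * ball_integral v \<mu> (of_int a) m (\<lambda>x. (x - of_int a) ^ i) =
      of_nat p ^ (m * i) * eta f \<Omega>p \<Omega>m (monom 1 i) (- a) (p ^ m)" .
    have a': "\<not> int p dvd - a" using a by simp
    have "ereal (max 0 (real h - real i)) \<le> v (eta f \<Omega>p \<Omega>m (monom 1 i) (- a) (p ^ m))"
      unfolding eta_def by (intro v_ge_add period_low[OF assms(10) ik a' m] period_low[OF assms(11) ik a' m])
    moreover have "ereal (real m * real i) \<le> v (of_nat p ^ (m * i))" by (simp add: v_p_power)
    ultimately show ?thesis unfolding eq by (intro v_ge_mult)
  qed
  have "\<exists>C::real. \<forall>n\<ge>1. \<forall>a\<in>Zp_units v. \<forall>j.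
        v (qcoeff f p ^ n * ball_integral v \<mu> a n (\<lambda>x. (x - a) ^ j)) \<ge> ereal (real n * real j + C)"
    using assms(12) unfolding is_padic_L_distribution_def by (elim conjE)
  then obtain C where C: "\<forall>n\<ge>1. \<forall>a\<in>Zp_units v. \<forall>j.
        v (\<alpha> ^ n * ball_integral v \<mu> a n (\<lambda>x. (x - a) ^ j)) \<ge> ereal (real n * real j + C)"
    unfolding \<alpha>_def by blast
  have bound: "ereal (real m * real j) \<le> v (\<alpha> ^ m * ball_integral v \<mu> (of_int a) m (\<lambda>x. (x - of_int a) ^ j))"
    if m: "m \<ge> 1" and a: "\<not> int p dvd a" for m a j
  proof (rule moment_bound[OF dist v\<alpha> low _ m a])
    show "ereal (real m * real j + C) \<le> v (\<alpha> ^ m * ball_integral v \<mu> (of_int a) m (\<lambda>x. (x - of_int a) ^ j))"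
      if "m \<ge> 1" "\<not> int p dvd a" for m a j
      using C of_int_unit[OF that(2)] that(1) by blast
  qed
  show "v (Lp_deriv p v k \<mu> - L_approx p v k f \<Omega>p \<Omega>m n)
      \<ge> ereal (real n * real k / 2 - of_int \<lfloor>ln (real k - 1) / ln (real p)\<rfloor>)"
    unfolding L_approx_def
    by (rule approximation_error[OF dist assms(4,5,13), of \<alpha> "mu_poly p f \<Omega>p \<Omega>m"])
      (use v\<alpha> mom bound in \<open>simp_all add: h_def\<close>)
qed

end
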